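(* Let $n,m\ge0$ be integers and let $f_n\in\hat L^2(\mathbb R_+^n)$, $g_m\in\hat L^2(\mathbb R_+^m)$ satisfy $\int_{2k}^{2k+2}f_n(t,* )\,dt=0$ and $\int_{2k}^{2k+2}g_m(t,* )\,dt=0$ for all $k\in\mathbb N$ (no condition when the function has no variables). Assume that $f_n\star^i_kg_m\in L^2(\mathbb R_+^{m+n-k-i})$ for all $0\le i\le k\le m\wedge n$. Then $$I_n(f_n)\,I_m(g_m)=\sum_{k=0}^{m\wedge n}k!\binom mk\binom nk\sum_{i=0}^k\binom ki\,I_{m+n-k-i}\big(f_n\,\widetilde\star^i_k\,g_m\big).$$
   Context: $\mathbb N=\{0,1,2,\ldots\}$, $\mathbb R_+=[0,\infty)$. $(U_k)_{k\in\mathbb N}$ is an i.i.d. sequence uniformly distributed on $[-1,1]$. $\Delta_n:=\bigcup [2k_1,2k_1+2]\times\cdots\times[2k_n,2k_n+2]$, the union being over pairwise distinct $k_1,\ldots,k_n\in\mathbb N$; $\hat L^2(\mathbb R_+^n)$ is the space of symmetric square-integrable functions on $\mathbb R_+^n$ vanishing outside $\Delta_n$; $*$ stands for the remaining variables. Multiple stochastic integrals. For $f_n\in\hat L^2(\mathbb R_+^n)$ (integrable, then extended by continuity using $\mathbb E[I_n(f_n)^2]\le n!\|f_n\|^2_{L^2(\mathbb R_+^n,(dx/2)^{\otimes n})}$), $$I_n(f_n):=\sum_{r=0}^n\frac{(-1)^{n-r}}{2^{n-r}}\binom nr\sum_{k_1,\ldots,k_r\ge0\text{ distinct}}\int_{\mathbb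 R_+^{n-r}}f_n(2k_1+1+U_{k_1},\ldots,2k_r+1+U_{k_r},y_1,\ldots,y_{n-r})\,dy_1\cdots dy_{n-r},$$ with $I_0(c)=c$ for constants $c$. For a symmetric $h\in L^2(\mathbb R_+^p)$ not vanishing outside $\Delta_p$, $I_p(h)$ means $I_p(\mathbf 1_{\Delta_p}h)$. For $0\le i\le k\le n\wedge m$, $$f_n\star^i_kg_m(\gamma_1,\ldots,\gamma_{k-i},t_1,\ldots,t_{n-k},s_1,\ldots,s_{m-k}):=\frac1{2^i}\int_{\mathbb R_+^i}f_n(z_1,\ldots,z_i,\gamma_1,\ldots,\gamma_{k-i},t_1,\ldots,t_{n-k})\,g_m(z_1,\ldots,z_i,\gamma_1,\ldots,\gamma_{k-i},s_1,\ldots,s_{m-k})\,dz_1\cdots dz_i,$$ and $f_n\,\widetilde\star^i_k\,g_m$ is the symmetrization of $f_n\star^i_kg_m$ in its $m+n-k-i$ variables (average over all permutations of the variables). *)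

theory Defs
  imports "HOL-Probability.Probability" "HOL-Combinatorics.Permutations"
begin

text \<open>
  Points of \<open>\<real>\<^sub>+\<^sup>n\<close> are extensional functions on \<open>{..<n}\<close>; \<open>\<real>\<^sub>+\<^sup>0\<close> is the single point
  \<open>\<lambda>_. undefined\<close> with mass 1, so functions of no variable are constants.
\<close>

definition Rp :: "nat \<Rightarrow> (nat \<Rightarrow> real) measure" where
  "Rp n = PiM {..<n} (\<lambda>_. restrict_space lborel {0..})"

definition tcat :: "nat \<Rightarrow> (nat \<Rightarrow> real) \<Rightarrow> nat \<Rightarrow> (nat \<Rightarrow> real) \<Rightarrow> (nat \<Rightarrow> real)" where
  "tcat p x q y = (\<lambda>j\<in>{..<p + q}. if j < p then x j else y (j - p))"

definition tslice :: "nat \<Rightarrow> nat \<Rightarrow> (nat \<Rightarrow> real) \<Rightarrow> (nat \<Rightarrow> real)" where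
  "tslice a q x = (\<lambda>j\<in>{..<q}. x (a + j))"

definition Delta :: "nat \<Rightarrow> (nat \<Rightarrow> real) set" where
  "Delta n = {x \<in> space (Rp n). \<exists>k :: nat \<Rightarrow> nat. inj_on k {..<n} \<and>
      (\<forall>j<n. x j \<in> {2 * real (k j) .. 2 * real (k j) + 2})}"

text \<open>
  Functions represent their \<open>L\<^sup>2\<close> classes, hence symmetry and vanishing outside \<open>\<Delta>\<^sub>n\<close> are
  required almost everywhere.
\<close>

definition sq_integrable :: "nat \<Rightarrow> ((nat \<Rightarrow> real) \<Rightarrow> real) \<Rightarrow> bool" where
  "sq_integrable n f \<longleftrightarrow> f \<in> borel_measurable (Rp n) \<and> integrable (Rp n) (\<lambda>x. (f x)\<^sup>2)"

definition L2_hat :: "nat \<Rightarrow> ((nat \<Rightarrow> real) \<Rightarrow> real) set" where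
  "L2_hat n = {f. sq_integrable n f \<and>
      (\<forall>\<sigma>. \<sigma> permutes {..<n} \<longrightarrow> (AE x in Rp n. f (x \<circ> \<sigma>) = f x)) \<and>
      (AE x in Rp n. x \<notin> Delta n \<longrightarrow> f x = 0)}"

definition distinct_tuples :: "nat \<Rightarrow> (nat \<Rightarrow> nat) set" where
  "distinct_tuples r = {k \<in> {..<r} \<rightarrow>\<^sub>E UNIV. inj_on k {..<r}}"

text \<open>The defining formula of the multiple stochastic integral, for integrable \<open>f\<close>.\<close>

definition stoch_int_L1 ::
  "(nat \<Rightarrow> 'a \<Rightarrow> real) \<Rightarrow> nat \<Rightarrow> ((nat \<Rightarrow> real) \<Rightarrow> real) \<Rightarrow> 'a \<Rightarrow> real" where
  "stoch_int_L1 U n f \<omega> =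
     (\<Sum>r\<le>n. (-1) ^ (n - r) / 2 ^ (n - r) * real (n choose r) *
        (\<Sum>\<^sub>\<infinity>k\<in>distinct_tuples r.
           (\<integral>y. f (tcat r (\<lambda>j. 2 * real (k j) + 1 + U (k j) \<omega>) (n - r) y) \<partial>Rp (n - r))))"

text \<open>
  Its extension by continuity: the \<open>L\<^sup>2(M)\<close> limit of the integrals of any integrable elements of
  \<open>L2_hat n\<close> converging to \<open>f\<close> in \<open>L\<^sup>2\<close>. The limit, and hence the integral, is determined up to
  almost sure equality. The norms for \<open>dx\<close> and \<open>dx/2\<close> differ by a constant factor, so they define
  the same convergence.
\<close>

definition is_stoch_int ::
  "'a measure \<Rightarrow> (nat \<Rightarrow> 'a \<Rightarrow> real) \<Rightarrow> nat \<Rightarrow> ((nat \<Rightarrow> real) \<Rightarrow> real) \<Rightarrow> ('a \<Rightarrow> real) \<Rightarrow> bool" where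
  "is_stoch_int M U n f X \<longleftrightarrow>
     X \<in> borel_measurable M \<and> integrable M (\<lambda>\<omega>. (X \<omega>)\<^sup>2) \<and>
     (\<forall>h :: nat \<Rightarrow> (nat \<Rightarrow> real) \<Rightarrow> real.
        (\<forall>j. h j \<in> L2_hat n \<and> integrable (Rp n) (h j)) \<longrightarrow>
        ((\<lambda>j. \<integral>\<^sup>+x. ennreal ((h j x - f x)\<^sup>2) \<partial>Rp n) \<longlonglongrightarrow> 0) \<longrightarrow>
        ((\<lambda>j. \<integral>\<^sup>+\<omega>. ennreal ((stoch_int_L1 U n (h j) \<omega> - X \<omega>)\<^sup>2) \<partial>M) \<longlonglongrightarrow> 0))"

definition stoch_int ::
  "'a measure \<Rightarrow> (nat \<Rightarrow> 'a \<Rightarrow> real) \<Rightarrow> nat \<Rightarrow> ((nat \<Rightarrow> real) \<Rightarrow> real) \<Rightarrow> 'a \<Rightarrow> real" where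
  "stoch_int M U n f = (SOME X. is_stoch_int M U n f X)"

text \<open>
  \<open>contraction n m i k f g\<close> is \<open>f \<star>\<^sup>i\<^sub>k g\<close>; the \<open>m + n - k - i\<close> variables of the result are ordered
  as \<open>\<gamma>\<close> (\<open>k - i\<close> of them), \<open>t\<close> (\<open>n - k\<close>), \<open>s\<close> (\<open>m - k\<close>). Used for \<open>i \<le> k \<le> min m n\<close>.
\<close>

definition contraction :: "nat \<Rightarrow> nat \<Rightarrow> nat \<Rightarrow> nat \<Rightarrow>
    ((nat \<Rightarrow> real) \<Rightarrow> real) \<Rightarrow> ((nat \<Rightarrow> real) \<Rightarrow> real) \<Rightarrow> (nat \<Rightarrow> real) \<Rightarrow> real" where
  "contraction n m i k f g x =
     (let \<gamma> = tslice 0 (k - i) x;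
          t = tslice (k - i) (n - k) x;
          s = tslice ((k - i) + (n - k)) (m - k) x
      in 1 / 2 ^ i *
         (\<integral>z. f (tcat i z (n - i) (tcat (k - i) \<gamma> (n - k) t)) *
              g (tcat i z (m - i) (tcat (k - i) \<gamma> (m - k) s)) \<partial>Rp i))"

definition symmetrization :: "nat \<Rightarrow> ((nat \<Rightarrow> real) \<Rightarrow> real) \<Rightarrow> (nat \<Rightarrow> real) \<Rightarrow> real" where
  "symmetrization p h x = (\<Sum>\<sigma> | \<sigma> permutes {..<p}. h (x \<circ> \<sigma>)) / fact p"

text \<open>The condition \<open>\<integral>\<^bsub>[2k,2k+2]\<^esub> f(t,*) dt = 0\<close> for all \<open>k\<close> and almost all \<open>*\<close>.\<close>

definition cell_centered :: "nat \<Rightarrow> ((nat \<Rightarrow> real) \<Rightarrow> real) \<Rightarrow> bool" where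
  "cell_centered n f \<longleftrightarrow> (n \<ge> 1 \<longrightarrow>
     (\<forall>k :: nat. AE y in Rp (n - 1).
        (LBINT t:{2 * real k .. 2 * real k + 2}. f (tcat 1 (\<lambda>_. t) (n - 1) y)) = 0))"

end

theory Submission
  imports Defs
begin

text \<open>
  Put \<open>X\<^sub>k = 2k + 1 + U\<^sub>k\<close>, so that \<open>X\<^sub>k\<close> is uniform on the \<open>k\<close>-th cell, and truncate \<open>I\<^sub>n(f)\<close> to the
  first \<open>N\<close> cells. For a centred \<open>f\<close> the truncation is the sum of \<open>f(X\<^bsub>k\<^esub>)\<close> over tuples \<open>k\<close> of distinct
  indices below \<open>N\<close>. The truncated difference of the two sides of the formula is tested against
  bounded functions of finitely many coordinates, and by the Hoeffding decomposition only against
  those \<open>\<phi>\<close> that depend on the coordinates in a finite set \<open>A\<close> and are centred in each of them. Then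
  \<open>E[f(X\<^bsub>k\<^esub>) g(X\<^bsub>l\<^esub>) \<phi>]\<close> depends on the images \<open>K\<close>, \<open>L\<close> of \<open>k\<close>, \<open>l\<close> only, and it vanishes unless \<open>A\<close> contains the
  symmetric difference of \<open>K\<close> and \<open>L\<close> and is contained in their union. Testing a multiple integral
  against \<open>\<phi>\<close> picks out the tuples with image exactly \<open>A\<close>, so both sides become multiples of one sum
  over \<open>(K, L)\<close>, and the multiplicities agree.

  The contractions involve all cells, not the first \<open>N\<close>, but the truncation error tends to \<open>0\<close> weakly.
  The difference of the two sides is an \<open>L\<^sup>1\<close> limit of functions of finitely many coordinates that tend
  to \<open>0\<close> weakly, hence it vanishes. In this way the contractions of truncations of \<open>f\<close> and \<open>g\<close> need
  not converge in \<open>L\<^sup>2\<close>; square integrability of \<open>f \<star>\<^sup>i\<^sub>k g\<close> is used only to define its integral.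
\<close>

section \<open>Cells and the law of the coordinates\<close>

text \<open>Why so many of these expectations vanish: an index that occurs in only one of the tuple
  \<open>k\<close>, the tuple \<open>l\<close> and the set \<open>A\<close> sits in a single factor,
  and that factor is centred in this coordinate. So every index is shared by at least two of the
  three. Only images matter because \<open>f\<close> and \<open>g\<close> are symmetric. Let
  \<open>q\<close> be the size of the intersection of \<open>K\<close> and \<open>L\<close>. A
  common index either lies in \<open>A\<close> and becomes a variable \<gamma> of a contraction, or
  it does not and is integrated out as one of the \<open>i\<close> variables \<open>z\<close>. Hence
  \<open>(K, L, A)\<close> selects exactly one term \<open>(q, i)\<close> of the double sum. The
  left side meets it \<open>n! m!\<close> times, once for all orderings of \<open>K\<close> and
  \<open>L\<close>; the right side meets it \<open>(q-i)! (n-q)! (m-q)! i!\<close> times, the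
  orderings of the blocks \<gamma>, \<open>t\<close>, \<open>s\<close>, \<open>z\<close>. The
  quotient is the coefficient \<open>q! C(m,q) C(n,q) C(q,i)\<close>. The factor
  \<open>1/2^i\<close> turns Lebesgue measure on the cells into the uniform law. Listing a common
  index only once is also what keeps the tuples on the right free of repetitions, in accordance with
  the restriction to \<Delta>.\<close>

abbreviation Rpos :: "real measure" where "Rpos \<equiv> restrict_space lborel {0..}"

definition cell :: "nat \<Rightarrow> real set" where "cell k = {2 * real k ..< 2 * real k + 2}"

text \<open>The underlying space is the cell itself. Hence every point of \<open>space Q\<close>,
  not just almost every one, has its \<open>k\<close>-th coordinate in cell \<open>k\<close>, and
  pointwise arguments need no exceptional set.\<close>

definition Qc :: "nat \<Rightarrow> real measure" where
  "Qc k = density (restrict_space lborel (cell k)) (\<lambda>_. ennreal (1/2))"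

text \<open>\<open>Q\<close> is the law of \<open>(2k + 1 + U\<^sub>k)\<^sub>k\<close>; half-open cells make the index of a coordinate a function of
  its value.\<close>

definition Q :: "(nat \<Rightarrow> real) measure" where "Q = PiM UNIV Qc"

text \<open>The arguments \<open>X_(k 0), ..., X_(k (p-1))\<close> of an integrand, packed as an
  extensional point of \<open>Rp p\<close>.\<close>

definition pick :: "nat \<Rightarrow> (nat \<Rightarrow> nat) \<Rightarrow> (nat \<Rightarrow> real) \<Rightarrow> nat \<Rightarrow> real" where
  "pick p k x = (\<lambda>j\<in>{..<p}. x (k j))"

text \<open>Coordinates from \<open>p\<close> on are left free, so \<open>blk r k\<close> also makes
  sense inside \<open>Rp (r + q)\<close>, where only the first \<open>r\<close> arguments are pinned
  to cells.\<close>

definition blk :: "nat \<Rightarrow> (nat \<Rightarrow> nat) \<Rightarrow> (nat \<Rightarrow> real) set" where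
  "blk p k = {v. \<forall>j<p. v j \<in> cell (k j)}"

lemma cell_measurable [measurable, simp]: "cell k \<in> sets borel"
  by (simp add: cell_def)

lemma cell_nonneg: "t \<in> cell k \<Longrightarrow> 0 \<le> t"
  by (auto simp: cell_def)

lemma in_cell_iff: "0 \<le> t \<Longrightarrow> t \<in> cell k \<longleftrightarrow> k = nat \<lfloor>t / 2\<rfloor>"
proof -
  assume "0 \<le> t"
  have "t \<in> cell k \<longleftrightarrow> of_int (int k) \<le> t / 2 \<and> t / 2 < of_int (int k) + 1"
    by (auto simp: cell_def field_simps)
  also have "\<dots> \<longleftrightarrow> \<lfloor>t / 2\<rfloor> = int k"
    by (metis floor_eq_iff)
  also have "\<dots> \<longleftrightarrow> k = nat \<lfloor>t / 2\<rfloor>"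
    using \<open>0 \<le> t\<close> by auto
  finally show ?thesis .
qed

lemma cell_unique: "t \<in> cell k \<Longrightarrow> t \<in> cell l \<Longrightarrow> k = l"
  using in_cell_iff[OF cell_nonneg, of t k] in_cell_iff[OF cell_nonneg, of t k l] by simp

lemma sets_Qc [measurable_cong]: "sets (Qc k) = sets (restrict_space borel (cell k))"
  by (simp add: Qc_def sets_restrict_space)

lemma space_Qc [simp]: "space (Qc k) = cell k"
  by (simp add: Qc_def space_restrict_space)

lemma nn_integral_Qc:
  assumes [measurable]: "F \<in> borel_measurable borel"
  shows "(\<integral>\<^sup>+t. F t \<partial>Qc k) = (\<integral>\<^sup>+t. ennreal (1/2) * indicator (cell k) t * F t \<partial>lborel)"
proof -
  have [measurable]: "F \<in> borel_measurable (restrict_space lborel (cell k))"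
    by (intro measurable_restrict_space1) simp
  have "(\<integral>\<^sup>+t. F t \<partial>Qc k) = (\<integral>\<^sup>+t. ennreal (1/2) * F t \<partial>restrict_space lborel (cell k))"
    by (simp add: Qc_def nn_integral_density)
  also have "\<dots> = (\<integral>\<^sup>+t. ennreal (1/2) * F t * indicator (cell k) t \<partial>lborel)"
    by (subst nn_integral_restrict_space) auto
  finally show ?thesis by (simp add: mult_ac)
qed

lemma emeasure_Qc:
  assumes "A \<in> sets borel"
  shows "emeasure (Qc k) (A \<inter> cell k) = ennreal (1/2) * emeasure lborel (cell k \<inter> A)"
proof -
  have "A \<inter> cell k \<in> sets (Qc k)"
    using assms by (auto simp: sets_Qc sets_restrict_space)
  then have "emeasure (Qc k) (A \<inter> cell k) = (\<integral>\<^sup>+t. indicator (A \<inter> cell k) t \<partial>Qc k)"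
    by simp
  also have "\<dots> = (\<integral>\<^sup>+t. ennreal (1/2) * indicator (cell k) t * indicator (A \<inter> cell k) t \<partial>lborel)"
    using assms by (subst nn_integral_Qc) auto
  also have "\<dots> = (\<integral>\<^sup>+t. ennreal (1/2) * indicator (cell k \<inter> A) t \<partial>lborel)"
    by (intro nn_integral_cong) (auto split: split_indicator)
  also have "\<dots> = ennreal (1/2) * emeasure lborel (cell k \<inter> A)"
    using assms by (subst nn_integral_cmult_indicator) auto
  finally show ?thesis .
qed

lemma prob_space_Qc: "prob_space (Qc k)"
proof (rule prob_spaceI)
  show "emeasure (Qc k) (space (Qc k)) = 1"
    using emeasure_Qc[of UNIV k]
    by (simp add: cell_def ennreal_mult[symmetric] flip: ennreal_numeral del: ennreal_half)
qed

interpretation Qc: prob_space "Qc k" for k by (rule prob_space_Qc)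
interpretation PQ: product_prob_space Qc UNIV ..
interpretation Q: prob_space Q unfolding Q_def by (rule PQ.prob_space_axioms)

lemma space_Q: "space Q = {x. \<forall>k. x k \<in> cell k}"
  by (auto simp: Q_def space_PiM PiE_def)

lemma sets_Q [measurable_cong]: "sets Q = sets (PiM UNIV Qc)"
  by (simp add: Q_def)

lemma sets_Rpos [simp, measurable_cong]: "sets Rpos = sets (restrict_space borel {0..})"
  by (simp add: sets_restrict_space)

lemma component_Rpos [measurable]: "(\<lambda>x. x k) \<in> measurable Q Rpos"
proof -
  have "(\<lambda>t. t) \<in> measurable (Qc k) (restrict_space borel {0..})"
    using cell_nonneg by (intro measurable_restrict_space2) (auto intro: measurable_restrict_space1 simp: measurable_cong_sets[OF sets_Qc refl])
  then have "(\<lambda>t. t) \<in> measurable (Qc k) Rpos"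
    by (simp add: measurable_cong_sets[OF refl sets_Rpos])
  moreover have "(\<lambda>x. x k) \<in> measurable Q (Qc k)"
    unfolding Q_def by simp
  ultimately show ?thesis by (rule measurable_compose[rotated])
qed

lemma sigma_finite_Rpos: "sigma_finite_measure Rpos"
  by (intro sigma_finite_measure_restrict_space) (auto intro: sigma_finite_lborel)

interpretation Rpos: sigma_finite_measure Rpos by (rule sigma_finite_Rpos)
interpretation PR: product_sigma_finite "\<lambda>_::nat. Rpos" ..

lemma sigma_finite_Rp: "sigma_finite_measure (Rp n)"
proof -
  interpret finite_product_sigma_finite "\<lambda>_. Rpos" "{..<n}" by standard simp
  show ?thesis unfolding Rp_def by (rule sigma_finite_measure_axioms)
qed
interpretation Rp: sigma_finite_measure "Rp n" for n by (rule sigma_finite_Rp)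

lemma space_Rp: "space (Rp n) = {..<n} \<rightarrow>\<^sub>E {0..}"
  by (auto simp: Rp_def space_PiM space_restrict_space)

lemma sets_Rp: "sets (Rp n) = sets (PiM {..<n} (\<lambda>_. Rpos))"
  by (simp add: Rp_def)

lemma Rp_component [measurable]: "j < n \<Longrightarrow> (\<lambda>x. x j) \<in> measurable (Rp n) Rpos"
  unfolding Rp_def by (rule measurable_component_singleton) simp

lemma Rp_component_borel [measurable]: "j < n \<Longrightarrow> (\<lambda>x. x j) \<in> borel_measurable (Rp n)"
proof -
  assume "j < n"
  have "(\<lambda>t. t) \<in> measurable Rpos borel"
    by (simp add: measurable_restrict_space1)
  from measurable_compose[OF Rp_component[OF \<open>j < n\<close>] this] show ?thesis by simp
qed

lemma measurable_Rp [measurable (raw)]: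
  "(\<And>j. j < n \<Longrightarrow> (\<lambda>x. g x j) \<in> measurable M Rpos) \<Longrightarrow> (\<lambda>x. \<lambda>j\<in>{..<n}. g x j) \<in> measurable M (Rp n)"
  unfolding Rp_def by (rule measurable_restrict) auto

lemma pick_measurable [measurable]: "pick p k \<in> measurable Q (Rp p)"
  unfolding pick_def by measurable

section \<open>Concatenation, permutation and evaluation of arguments\<close>

lemma tcat_measurable [measurable]:
  "(\<lambda>(u,y). tcat r u q y) \<in> measurable (Rp r \<Otimes>\<^sub>M Rp q) (Rp (r + q))"
proof -
  have "(\<lambda>x. if j < r then fst x j else snd x (j - r)) \<in> measurable (Rp r \<Otimes>\<^sub>M Rp q) Rpos" if "j < r + q" for j
    using that by (cases "j < r") (auto intro!: measurable_compose[OF measurable_fst Rp_component] measurable_compose[OF measurable_snd Rp_component])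
  then show ?thesis
    unfolding tcat_def case_prod_beta by (intro measurable_Rp)
qed

lemma tcat_measurable' [measurable (raw)]:
  "f \<in> measurable M (Rp r) \<Longrightarrow> g \<in> measurable M (Rp q) \<Longrightarrow> (\<lambda>x. tcat r (f x) q (g x)) \<in> measurable M (Rp (r + q))"
  using measurable_compose[OF measurable_Pair tcat_measurable] by auto

lemma blk_indicator_measurable [measurable]:
  assumes "r \<le> p"
  shows "(indicator (blk r k) :: _ \<Rightarrow> ennreal) \<in> borel_measurable (Rp p)"
    and "(indicator (blk r k) :: _ \<Rightarrow> real) \<in> borel_measurable (Rp p)"
proof -
  have "Measurable.pred (Rp p) (\<lambda>v. \<forall>j\<in>{..<r}. v j \<in> cell (k j))"
    using assms by (intro pred_intros_finite) (auto intro!: pred_sets1[OF _ Rp_component_borel] simp: pred_def)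
  moreover have "blk r k \<inter> space (Rp p) = {v\<in>space (Rp p). \<forall>j\<in>{..<r}. v j \<in> cell (k j)}"
    by (auto simp: blk_def)
  ultimately have b: "blk r k \<inter> space (Rp p) \<in> sets (Rp p)" by (simp add: pred_def)
  show "(indicator (blk r k) :: _ \<Rightarrow> ennreal) \<in> borel_measurable (Rp p)"
    by (subst measurable_cong[where g="indicator (blk r k \<inter> space (Rp p))"])
      (use b in \<open>auto intro!: borel_measurable_indicator split: split_indicator\<close>)
  show "(indicator (blk r k) :: _ \<Rightarrow> real) \<in> borel_measurable (Rp p)"
    by (subst measurable_cong[where g="indicator (blk r k \<inter> space (Rp p))"])
      (use b in \<open>auto intro!: borel_measurable_indicator split: split_indicator\<close>)
qed

lemma box_sets_Rp: "(\<And>j. j < p \<Longrightarrow> A j \<in> sets Rpos) \<Longrightarrow> Pi\<^sub>E {..<p} A \<in> sets (Rp p)"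
  unfolding Rp_def by (rule sets_PiM_I_finite) auto

text \<open>Fubini for arguments written as one extensional function. A product measure is
  determined by its values on boxes, and a box in \<open>r + q\<close> variables pulls back to a
  product of two boxes.\<close>

lemma law_tcat: "distr (Rp r \<Otimes>\<^sub>M Rp q) (Rp (r + q)) (\<lambda>(u,y). tcat r u q y) = Rp (r + q)"
proof -
  have "distr (Rp r \<Otimes>\<^sub>M Rp q) (Rp (r + q)) (\<lambda>(u,y). tcat r u q y) = PiM {..<r+q} (\<lambda>_. Rpos)"
  proof (rule PR.PiM_eqI)
    fix A assume A: "\<And>i. i \<in> {..<r+q} \<Longrightarrow> A i \<in> sets Rpos"
    have sub: "A i \<subseteq> {0..}" if "i < r + q" for i
      using A[of i] that sets.sets_into_space[of "A i" Rpos] by (auto simp: space_restrict_space)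
    have *: "(\<lambda>(u,y). tcat r u q y) -` Pi\<^sub>E {..<r+q} A \<inter> space (Rp r \<Otimes>\<^sub>M Rp q) =
        Pi\<^sub>E {..<r} A \<times> Pi\<^sub>E {..<q} (\<lambda>j. A (r + j))" (is "?L = ?R")
    proof (intro set_eqI)
      fix z :: "(nat \<Rightarrow> real) \<times> (nat \<Rightarrow> real)"
      obtain u y where z: "z = (u,y)" by (cases z)
      have 1: "(\<forall>j<r+q. tcat r u q y j \<in> A j) \<longleftrightarrow> (\<forall>j<r. u j \<in> A j) \<and> (\<forall>j<q. y j \<in> A (r + j))"
        apply (intro iffI conjI allI impI)
        subgoal for j by (drule spec[of _ j]) (simp add: tcat_def)
        subgoal for j by (drule spec[of _ "r + j"]) (simp add: tcat_def)
        subgoal for j by (cases "j < r") (auto simp: tcat_def dest: spec[of _ "j - r"])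
        done
      have 2: "tcat r u q y \<in> extensional {..<r+q}"
        by (simp add: tcat_def)
      have 3: "u \<in> {..<r} \<rightarrow>\<^sub>E {0..}" if "\<forall>j<r. u j \<in> A j" "u \<in> extensional {..<r}"
        unfolding PiE_iff using that sub[OF trans_less_add1] by blast
      have 4: "y \<in> {..<q} \<rightarrow>\<^sub>E {0..}" if "\<forall>j<q. y j \<in> A (r + j)" "y \<in> extensional {..<q}"
        unfolding PiE_iff using that sub[OF nat_add_left_cancel_less[THEN iffD2]] by blast
      have "z \<in> ?L \<longleftrightarrow> (\<forall>j<r+q. tcat r u q y j \<in> A j) \<and> u \<in> {..<r} \<rightarrow>\<^sub>E {0..} \<and> y \<in> {..<q} \<rightarrow>\<^sub>E {0..}"
        using 2 by (auto simp: z space_pair_measure space_Rp PiE_iff)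
      also have "\<dots> \<longleftrightarrow> z \<in> ?R"
        unfolding 1 z using 3 4 by (auto simp: PiE_iff)
      finally show "z \<in> ?L \<longleftrightarrow> z \<in> ?R" .
    qed
    have "emeasure (distr (Rp r \<Otimes>\<^sub>M Rp q) (Rp (r + q)) (\<lambda>(u,y). tcat r u q y)) (Pi\<^sub>E {..<r+q} A)
      = emeasure (Rp r \<Otimes>\<^sub>M Rp q) (Pi\<^sub>E {..<r} A \<times> Pi\<^sub>E {..<q} (\<lambda>j. A (r + j)))"
      using A by (subst emeasure_distr) (auto intro!: box_sets_Rp simp: *)
    also have "\<dots> = emeasure (Rp r) (Pi\<^sub>E {..<r} A) * emeasure (Rp q) (Pi\<^sub>E {..<q} (\<lambda>j. A (r + j)))"
      using A by (intro Rp.emeasure_pair_measure_Times box_sets_Rp) auto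
    also have "emeasure (Rp r) (Pi\<^sub>E {..<r} A) = (\<Prod>j<r. emeasure Rpos (A j))"
      unfolding Rp_def using A by (intro PR.emeasure_PiM) auto
    also have "emeasure (Rp q) (Pi\<^sub>E {..<q} (\<lambda>j. A (r + j))) = (\<Prod>j<q. emeasure Rpos (A (r + j)))"
      unfolding Rp_def using A by (intro PR.emeasure_PiM) auto
    also have "(\<Prod>j<r. emeasure Rpos (A j)) * (\<Prod>j<q. emeasure Rpos (A (r + j))) = (\<Prod>j<r+q. emeasure Rpos (A j))"
      by (induction q) (simp_all add: mult.assoc[symmetric])
    finally show "emeasure (distr (Rp r \<Otimes>\<^sub>M Rp q) (Rp (r + q)) (\<lambda>(u,y). tcat r u q y)) (Pi\<^sub>E {..<r+q} A)
      = (\<Prod>j<r+q. emeasure Rpos (A j))" .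
  qed (auto simp: sets_Rp)
  then show ?thesis by (simp add: Rp_def)
qed

lemma permute_measurable:
  assumes s: "\<sigma> permutes {..<p}"
  shows "(\<lambda>x. x \<circ> \<sigma>) \<in> measurable (Rp p) (Rp p)"
proof -
  have meq: "x \<circ> \<sigma> = (\<lambda>j\<in>{..<p}. x (\<sigma> j))" if "x \<in> space (Rp p)" for x
    using that permutes_not_in[OF s] by (auto simp: space_Rp PiE_iff extensional_def fun_eq_iff)
  show "(\<lambda>x. x \<circ> \<sigma>) \<in> measurable (Rp p) (Rp p)"
    using permutes_in_image[OF s] by (subst measurable_cong[OF meq]) (auto intro!: measurable_Rp Rp_component)
qed

text \<open>A permutation maps boxes to boxes with permuted sides, and the product of the side
  lengths does not depend on their order.\<close>

lemma law_permute:
  assumes s: "\<sigma> permutes {..<p}"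
  shows "distr (Rp p) (Rp p) (\<lambda>x. x \<circ> \<sigma>) = Rp p"
proof -
  have meq: "x \<circ> \<sigma> = (\<lambda>j\<in>{..<p}. x (\<sigma> j))" if "x \<in> space (Rp p)" for x
    using that permutes_not_in[OF s] by (auto simp: space_Rp PiE_iff extensional_def fun_eq_iff)
  note m = permute_measurable[OF s]
  have "distr (Rp p) (Rp p) (\<lambda>x. x \<circ> \<sigma>) = PiM {..<p} (\<lambda>_. Rpos)"
  proof (rule PR.PiM_eqI)
    fix A assume A: "\<And>i. i \<in> {..<p} \<Longrightarrow> A i \<in> sets Rpos"
    have sub: "A i \<subseteq> {0..}" if "i < p" for i
      using A[of i] that sets.sets_into_space[of "A i" Rpos] by (auto simp: space_restrict_space)
    have inv: "inv \<sigma> j < p \<longleftrightarrow> j < p" for j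
      using permutes_in_image[OF permutes_inv[OF s], of j] by simp
    have sg: "\<sigma> j < p \<longleftrightarrow> j < p" for j
      using permutes_in_image[OF s, of j] by simp
    have all: "(\<forall>j<p. x (\<sigma> j) \<in> A j) \<longleftrightarrow> (\<forall>j<p. x j \<in> A (inv \<sigma> j))" for x :: "nat \<Rightarrow> real"
    proof (intro iffI allI impI)
      fix j assume h: "\<forall>j<p. x (\<sigma> j) \<in> A j" "j < p"
      then show "x j \<in> A (inv \<sigma> j)"
        using spec[OF h(1), of "inv \<sigma> j"] inv[of j] permutes_inverses(1)[OF s, of j] by simp
    next
      fix j assume h: "\<forall>j<p. x j \<in> A (inv \<sigma> j)" "j < p"
      then show "x (\<sigma> j) \<in> A j"
        using spec[OF h(1), of "\<sigma> j"] sg[of j] permutes_inverses(2)[OF s, of j] by simp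
    qed
    have "(\<lambda>x. x \<circ> \<sigma>) -` Pi\<^sub>E {..<p} A \<inter> space (Rp p) = Pi\<^sub>E {..<p} (\<lambda>j. A (inv \<sigma> j))"
      (is "?L = ?R")
    proof (intro set_eqI)
      fix x
      have ext: "x \<in> space (Rp p) \<Longrightarrow> x \<circ> \<sigma> \<in> extensional {..<p}"
        by (subst meq) auto
      have "x \<in> ?L \<longleftrightarrow> (\<forall>j<p. x (\<sigma> j) \<in> A j) \<and> x \<in> space (Rp p)"
        using ext by (auto simp: PiE_iff)
      also have "\<dots> \<longleftrightarrow> (\<forall>j<p. x j \<in> A (inv \<sigma> j)) \<and> x \<in> space (Rp p)"
        unfolding all ..
      also have "\<dots> \<longleftrightarrow> x \<in> ?R"
      proof -
        have "x j \<in> {0..}" if "\<forall>j<p. x j \<in> A (inv \<sigma> j)" "j < p" for j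
          using sub[of "inv \<sigma> j"] inv[of j] that by blast
        then show ?thesis by (auto simp: space_Rp PiE_iff)
      qed
      finally show "x \<in> ?L \<longleftrightarrow> x \<in> ?R" .
    qed
    then have "emeasure (distr (Rp p) (Rp p) (\<lambda>x. x \<circ> \<sigma>)) (Pi\<^sub>E {..<p} A) = emeasure (Rp p) (Pi\<^sub>E {..<p} (\<lambda>j. A (inv \<sigma> j)))"
      using A by (subst emeasure_distr) (auto intro!: box_sets_Rp m)
    also have "\<dots> = (\<Prod>j<p. emeasure Rpos (A (inv \<sigma> j)))"
      unfolding Rp_def using A inv by (subst PR.emeasure_PiM) auto
    also have "\<dots> = (\<Prod>j<p. emeasure Rpos (A j))"
      using prod.permute[OF permutes_inv[OF s], of "\<lambda>j. emeasure Rpos (A j)"] by (simp add: comp_def)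
    finally show "emeasure (distr (Rp p) (Rp p) (\<lambda>x. x \<circ> \<sigma>)) (Pi\<^sub>E {..<p} A) = (\<Prod>j<p. emeasure Rpos (A j))" .
  qed (auto simp: sets_Rp)
  then show ?thesis by (simp add: Rp_def)
qed

text \<open>Injectivity makes the selected coordinates independent; each has density 1/2 on its
  cell, which multiplies to \<open>1/2^p\<close> on the block. Both measures are identified with the
  product of the one-dimensional laws \<open>?M j\<close>.\<close>

lemma law_pick:
  assumes k: "inj_on k {..<p}"
  shows "distr Q (Rp p) (pick p k) = density (Rp p) (\<lambda>v. ennreal (1/2^p) * indicator (blk p k) v)"
proof -
  let ?M = "\<lambda>j. density Rpos (\<lambda>t. ennreal (1/2) * indicator (cell (k j)) t)"
  have cm: "cell (k j) \<in> sets Rpos" for j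
    using cell_nonneg by (auto simp: sets_restrict_space intro!: image_eqI[of _ _ "cell (k j)"])
  have em: "emeasure (?M j) A = ennreal (1/2) * emeasure lborel (cell (k j) \<inter> A)" if "A \<in> sets Rpos" for j A
  proof -
    have A: "A \<in> sets borel" "A \<subseteq> {0..}" using that
      by (auto simp: sets_restrict_space_iff)
    have "emeasure (?M j) A = (\<integral>\<^sup>+t. ennreal (1/2) * indicator (cell (k j) \<inter> A) t \<partial>Rpos)"
      using that cm by (subst emeasure_density) (auto intro!: nn_integral_cong split: split_indicator)
    also have "\<dots> = ennreal (1/2) * emeasure Rpos (cell (k j) \<inter> A)"
      using that cm by (subst nn_integral_cmult_indicator) auto
    also have "emeasure Rpos (cell (k j) \<inter> A) = emeasure lborel (cell (k j) \<inter> A)"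
      using A by (subst emeasure_restrict_space) auto
    finally show ?thesis .
  qed
  have "prob_space (?M j)" for j
  proof (rule prob_spaceI)
    have "emeasure (?M j) {0..} = ennreal (1/2) * emeasure lborel (cell (k j) \<inter> {0..})"
      by (rule em) (simp add: sets_restrict_space_iff)
    also have "cell (k j) \<inter> {0..} = cell (k j)" using cell_nonneg by auto
    also have "ennreal (1/2) * emeasure lborel (cell (k j)) = 1"
      by (simp add: cell_def ennreal_mult[symmetric] flip: ennreal_numeral del: ennreal_half)
    finally show "emeasure (?M j) (space (?M j)) = 1" by (simp add: space_restrict_space)
  qed
  then interpret M: product_sigma_finite ?M
    by (simp add: product_sigma_finite_def prob_space_imp_sigma_finite)
  have sM: "sets (PiM {..<p} ?M) = sets (Rp p)"
    unfolding Rp_def by (intro sets_PiM_cong) auto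
  have 1: "distr Q (Rp p) (pick p k) = PiM {..<p} ?M"
  proof (rule M.PiM_eqI)
    fix A assume "\<And>i. i \<in> {..<p} \<Longrightarrow> A i \<in> sets (?M i)"
    then have A: "i < p \<Longrightarrow> A i \<in> sets Rpos" for i by simp
    have A': "A i \<in> sets borel" if "i < p" for i using A[OF that]
      by (auto simp: sets_restrict_space_iff)
    \<comment> \<open>The side of the box seen from the index \<open>l = k j\<close>. Intersecting
      with the cell makes it measurable for \<open>Qc l\<close>, whose space is the cell.\<close>
    define B where "B l = A (the_inv_into {..<p} k l) \<inter> cell l" for l
    have Bk: "B (k j) = A j \<inter> cell (k j)" if "j < p" for j
      unfolding B_def using that k by (subst the_inv_into_f_f) auto
    have "pick p k -` Pi\<^sub>E {..<p} A \<inter> space Q = prod_emb UNIV Qc (k ` {..<p}) (Pi\<^sub>E (k ` {..<p}) B)"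
      using Bk by (auto simp: prod_emb_def space_Q PiE_iff pick_def)
    then have "emeasure (distr Q (Rp p) (pick p k)) (Pi\<^sub>E {..<p} A) = emeasure Q (prod_emb UNIV Qc (k ` {..<p}) (Pi\<^sub>E (k ` {..<p}) B))"
      using A by (subst emeasure_distr) (auto intro!: box_sets_Rp)
    also have "\<dots> = (\<Prod>l\<in>k ` {..<p}. emeasure (Qc l) (B l))"
      unfolding Q_def using A' Bk by (subst PQ.emeasure_PiM_emb) (auto simp: sets_Qc sets_restrict_space)
    also have "\<dots> = (\<Prod>j<p. emeasure (Qc (k j)) (A j \<inter> cell (k j)))"
      using k Bk by (subst prod.reindex) auto
    also have "\<dots> = (\<Prod>j<p. emeasure (?M j) (A j))"
      using A A' by (intro prod.cong) (auto simp: em emeasure_Qc simp del: ennreal_half)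
    finally show "emeasure (distr Q (Rp p) (pick p k)) (Pi\<^sub>E {..<p} A) = (\<Prod>j<p. emeasure (?M j) (A j))" .
  qed (simp_all only: sM sets_distr finite_lessThan)
  have 2: "density (Rp p) (\<lambda>v. ennreal (1/2^p) * indicator (blk p k) v) = PiM {..<p} ?M"
  proof (rule M.PiM_eqI)
    fix A assume "\<And>i. i \<in> {..<p} \<Longrightarrow> A i \<in> sets (?M i)"
    then have A: "i < p \<Longrightarrow> A i \<in> sets Rpos" for i by simp
    have ind: "ennreal (1/2^p) * indicator (blk p k) v * indicator (Pi\<^sub>E {..<p} A) v =
       (\<Prod>j<p. ennreal (1/2) * indicator (cell (k j)) (v j) * indicator (A j) (v j))" if v: "v \<in> space (Rp p)" for v
    proof (cases "v \<in> blk p k \<and> v \<in> Pi\<^sub>E {..<p} A")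
      case True
      then have "(\<Prod>j<p. ennreal (1/2) * indicator (cell (k j)) (v j) * indicator (A j) (v j)) = (\<Prod>j<p. ennreal (1/2))"
        by (intro prod.cong) (auto simp: blk_def PiE_iff)
      also have "\<dots> = ennreal (1/2^p)"
        by (simp add: ennreal_power power_one_over[symmetric] del: ennreal_half)
      finally show ?thesis using True by simp
    next
      case False
      then obtain j where "j < p" "v j \<notin> cell (k j) \<or> v j \<notin> A j"
        using v by (auto simp: blk_def PiE_iff space_Rp)
      then have "(\<Prod>j<p. ennreal (1/2) * indicator (cell (k j)) (v j) * indicator (A j) (v j)) = 0"
        by (intro prod_zero) (auto intro!: bexI[of _ j])
      then show ?thesis using False by (auto split: split_indicator)
    qed
    have "emeasure (density (Rp p) (\<lambda>v. ennreal (1/2^p) * indicator (blk p k) v)) (Pi\<^sub>E {..<p} A)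
      = (\<integral>\<^sup>+v. (\<Prod>j<p. ennreal (1/2) * indicator (cell (k j)) (v j) * indicator (A j) (v j)) \<partial>Rp p)"
      using A by (subst emeasure_density) (auto intro!: nn_integral_cong box_sets_Rp simp: ind)
    also have "\<dots> = (\<Prod>j<p. \<integral>\<^sup>+t. ennreal (1/2) * indicator (cell (k j)) t * indicator (A j) t \<partial>Rpos)"
      unfolding Rp_def using A cm
      by (intro PR.product_nn_integral_prod) auto
    also have "\<dots> = (\<Prod>j<p. emeasure (?M j) (A j))"
      using A cm by (intro prod.cong refl) (subst emeasure_density, auto)
    finally show "emeasure (density (Rp p) (\<lambda>v. ennreal (1/2^p) * indicator (blk p k) v)) (Pi\<^sub>E {..<p} A) = (\<Prod>j<p. emeasure (?M j) (A j))" .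
  qed (simp_all only: sM sets_density finite_lessThan)
  show ?thesis using 1 2 by simp
qed

section \<open>Resampling a set of coordinates from an independent copy\<close>

definition mix :: "nat set \<Rightarrow> (nat \<Rightarrow> real) \<Rightarrow> (nat \<Rightarrow> real) \<Rightarrow> nat \<Rightarrow> real" where
  "mix B x y = (\<lambda>k. if k \<in> B then y k else x k)"

lemma mix_in_space: "x \<in> space Q \<Longrightarrow> y \<in> space Q \<Longrightarrow> mix B x y \<in> space Q"
  by (auto simp: space_Q mix_def)

lemma mix_measurable [measurable]: "(\<lambda>(x,y). mix B x y) \<in> measurable (Q \<Otimes>\<^sub>M Q) Q"
proof -
  have "(\<lambda>z. if k \<in> B then snd z k else fst z k) \<in> measurable (Q \<Otimes>\<^sub>M Q) (Qc k)" for k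
    unfolding Q_def by (cases "k \<in> B") auto
  then show ?thesis
    unfolding mix_def case_prod_beta
    by (subst (3) Q_def) (intro measurable_PiM_single', auto simp: Q_def space_pair_measure space_PiM PiE_iff)
qed

lemma mix_measurable' [measurable (raw)]:
  "f \<in> measurable M Q \<Longrightarrow> g \<in> measurable M Q \<Longrightarrow> (\<lambda>x. mix B (f x) (g x)) \<in> measurable M Q"
  using measurable_compose[OF measurable_Pair mix_measurable] by auto

interpretation QQ: pair_prob_space Q Q ..

text \<open>The coordinates are independent, so replacing those in \<open>B\<close> by the
  coordinates of an independent second point does not change the law. Integrating over the second
  point is conditional expectation given the coordinates outside \<open>B\<close>.\<close>

lemma law_mix: "distr (Q \<Otimes>\<^sub>M Q) Q (\<lambda>(x,y). mix B x y) = Q"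
proof (rule measure_eqI_PiM_infinite[where I=UNIV and M=Qc])
  show "finite_measure (distr (Q \<Otimes>\<^sub>M Q) Q (\<lambda>(x,y). mix B x y))"
    by (intro prob_space.finite_measure QQ.prob_space_distr mix_measurable)
  fix A J assume J: "finite J" "J \<subseteq> UNIV" and A: "\<And>i. i \<in> J \<Longrightarrow> A i \<in> sets (Qc i)"
  have S: "prob_emb \<in> sets Q" if "prob_emb = prod_emb UNIV Qc K (Pi\<^sub>E K A)" "K \<subseteq> J" for prob_emb K
    unfolding Q_def that using that(2) J A by (auto intro!: sets_PiM_I finite_subset[OF that(2)])
  have sub: "A i \<subseteq> cell i" if "i \<in> J" for i
    using sets.sets_into_space[OF A[OF that]] by simp
  have "(\<lambda>(x,y). mix B x y) -` prod_emb UNIV Qc J (Pi\<^sub>E J A) \<inter> space (Q \<Otimes>\<^sub>M Q)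
     = prod_emb UNIV Qc (J - B) (Pi\<^sub>E (J - B) A) \<times> prod_emb UNIV Qc (J \<inter> B) (Pi\<^sub>E (J \<inter> B) A)" (is "?L = ?R")
  proof (intro set_eqI)
    fix z :: "(nat \<Rightarrow> real) \<times> (nat \<Rightarrow> real)"
    obtain x y where z: "z = (x,y)" by (cases z)
    have "z \<in> ?L \<longleftrightarrow> x \<in> space Q \<and> y \<in> space Q \<and> (\<forall>j\<in>J. mix B x y j \<in> A j)"
      using mix_in_space[of x y B] by (auto simp: z prod_emb_def space_pair_measure restrict_PiE_iff Q_def space_PiM)
    also have "\<dots> \<longleftrightarrow> x \<in> space Q \<and> y \<in> space Q \<and> (\<forall>j\<in>J-B. x j \<in> A j) \<and> (\<forall>j\<in>J\<inter>B. y j \<in> A j)"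
      by (auto simp: mix_def)
    also have "\<dots> \<longleftrightarrow> z \<in> ?R"
      by (auto simp: z prod_emb_def restrict_PiE_iff Q_def space_PiM)
    finally show "z \<in> ?L \<longleftrightarrow> z \<in> ?R" .
  qed
  then have "emeasure (distr (Q \<Otimes>\<^sub>M Q) Q (\<lambda>(x,y). mix B x y)) (prod_emb UNIV Qc J (Pi\<^sub>E J A)) =
      emeasure (Q \<Otimes>\<^sub>M Q) (prod_emb UNIV Qc (J - B) (Pi\<^sub>E (J - B) A) \<times> prod_emb UNIV Qc (J \<inter> B) (Pi\<^sub>E (J \<inter> B) A))"
    by (subst emeasure_distr) (auto intro!: S)
  also have "\<dots> = emeasure Q (prod_emb UNIV Qc (J - B) (Pi\<^sub>E (J - B) A)) * emeasure Q (prod_emb UNIV Qc (J \<inter> B) (Pi\<^sub>E (J \<inter> B) A))"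
    by (intro Q.emeasure_pair_measure_Times) (auto intro!: S)
  also have "\<dots> = (\<Prod>j\<in>J-B. emeasure (Qc j) (A j)) * (\<Prod>j\<in>J\<inter>B. emeasure (Qc j) (A j))"
    unfolding Q_def using J A by (subst (1 2) PQ.emeasure_PiM_emb) auto
  also have "\<dots> = (\<Prod>j\<in>J. emeasure (Qc j) (A j))"
    using prod.Int_Diff[OF J(1), of "\<lambda>j. emeasure (Qc j) (A j)" B] by (simp add: mult.commute)
  also have "\<dots> = emeasure Q (prod_emb UNIV Qc J (Pi\<^sub>E J A))"
    unfolding Q_def using J A by (subst PQ.emeasure_PiM_emb) auto
  finally show "emeasure (distr (Q \<Otimes>\<^sub>M Q) Q (\<lambda>(x,y). mix B x y)) (prod_emb UNIV Qc J (Pi\<^sub>E J A)) = emeasure Q (prod_emb UNIV Qc J (Pi\<^sub>E J A))" .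
qed (auto simp: Q_def)

text \<open>The tower property: average over the resampled coordinates first.\<close>

lemma integral_mix:
  fixes \<psi> :: "(nat \<Rightarrow> real) \<Rightarrow> real"
  assumes "integrable Q \<psi>"
  shows "(\<integral>x. \<psi> x \<partial>Q) = (\<integral>x. (\<integral>y. \<psi> (mix B x y) \<partial>Q) \<partial>Q)"
    and "integrable Q (\<lambda>x. \<integral>y. \<psi> (mix B x y) \<partial>Q)"
proof -
  have i: "integrable (Q \<Otimes>\<^sub>M Q) (\<lambda>(x,y). \<psi> (mix B x y))"
    using integrable_distr_eq[OF mix_measurable, of \<psi> B, unfolded law_mix] assms
    by (simp add: case_prod_beta')
  have "(\<integral>x. \<psi> x \<partial>Q) = (\<integral>x. \<psi> x \<partial>distr (Q \<Otimes>\<^sub>M Q) Q (\<lambda>(x,y). mix B x y))"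
    by (simp add: law_mix)
  also have "\<dots> = (\<integral>z. \<psi> (mix B (fst z) (snd z)) \<partial>(Q \<Otimes>\<^sub>M Q))"
    using assms by (subst integral_distr) (auto simp: case_prod_beta)
  also have "\<dots> = (\<integral>x. (\<integral>y. \<psi> (mix B x y) \<partial>Q) \<partial>Q)"
    using QQ.integral_fst'[OF i] by (simp add: case_prod_beta')
  finally show "(\<integral>x. \<psi> x \<partial>Q) = (\<integral>x. (\<integral>y. \<psi> (mix B x y) \<partial>Q) \<partial>Q)" .
  show "integrable Q (\<lambda>x. \<integral>y. \<psi> (mix B x y) \<partial>Q)"
    using QQ.integrable_fst'[OF i] by (simp add: case_prod_beta)
qed

section \<open>Hoeffding decomposition\<close>

text \<open>Stated pointwise instead of through a generated sigma-algebra, so that dependence can be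
  checked by comparing values. Only points of \<open>space Q\<close> are compared.\<close>

definition dep :: "nat set \<Rightarrow> ((nat \<Rightarrow> real) \<Rightarrow> real) \<Rightarrow> bool" where
  "dep A \<phi> \<longleftrightarrow> (\<forall>x\<in>space Q. \<forall>y\<in>space Q. (\<forall>j\<in>A. x j = y j) \<longrightarrow> \<phi> x = \<phi> y)"

text \<open>The test functions. Boundedness makes products with integrable functions integrable, and
  it survives \<open>cexp\<close>.\<close>

definition bmeas :: "((nat \<Rightarrow> real) \<Rightarrow> real) \<Rightarrow> bool" where
  "bmeas \<phi> \<longleftrightarrow> \<phi> \<in> borel_measurable Q \<and> (\<exists>c. \<forall>x\<in>space Q. \<bar>\<phi> x\<bar> \<le> c)"

text \<open>\<open>cexp j\<close> integrates out the \<open>j\<close>-th coordinate only, since \<open>mix {j} x y\<close> agrees with \<open>x\<close> elsewhere.\<close>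

definition cexp :: "nat \<Rightarrow> ((nat \<Rightarrow> real) \<Rightarrow> real) \<Rightarrow> (nat \<Rightarrow> real) \<Rightarrow> real" where
  "cexp j \<phi> x = (\<integral>y. \<phi> (mix {j} x y) \<partial>Q)"

definition centered_on :: "nat set \<Rightarrow> ((nat \<Rightarrow> real) \<Rightarrow> real) \<Rightarrow> bool" where
  "centered_on A \<phi> \<longleftrightarrow> (\<forall>j\<in>A. \<forall>x\<in>space Q. cexp j \<phi> x = 0)"

text \<open>The components of a Hoeffding decomposition: \<open>\<phi>\<close> sees only coordinates
  in \<open>A\<close> and averages to zero over each of them. For empty \<open>A\<close> these are
  the constants.\<close>

definition pure :: "nat set \<Rightarrow> ((nat \<Rightarrow> real) \<Rightarrow> real) \<Rightarrow> bool" where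
  "pure A \<phi> \<longleftrightarrow> bmeas \<phi> \<and> dep A \<phi> \<and> centered_on A \<phi>"

lemma depD: "dep A \<phi> \<Longrightarrow> x \<in> space Q \<Longrightarrow> y \<in> space Q \<Longrightarrow> (\<And>j. j \<in> A \<Longrightarrow> x j = y j) \<Longrightarrow> \<phi> x = \<phi> y"
  unfolding dep_def by blast

lemma dep_mono: "dep A \<phi> \<Longrightarrow> A \<subseteq> B \<Longrightarrow> dep B \<phi>"
  unfolding dep_def by blast

lemma dep_mix: "dep A \<phi> \<Longrightarrow> j \<notin> A \<Longrightarrow> x \<in> space Q \<Longrightarrow> y \<in> space Q \<Longrightarrow> \<phi> (mix {j} x y) = \<phi> x"
  by (rule depD[of A \<phi>], assumption, rule mix_in_space) (auto simp: mix_def)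

lemma dep_mult: "dep A \<phi> \<Longrightarrow> dep B \<psi> \<Longrightarrow> dep (A \<union> B) (\<lambda>x. \<phi> x * \<psi> x)"
  by (intro dep_def[THEN iffD2] ballI impI arg_cong2[where f="(*)"]) (erule (2) depD; blast)+

lemma dep_diff: "dep A \<phi> \<Longrightarrow> dep A \<psi> \<Longrightarrow> dep A (\<lambda>x. \<phi> x - \<psi> x)"
  by (intro dep_def[THEN iffD2] ballI impI arg_cong2[where f="(-)"]) (erule (2) depD; blast)+

lemma bmeas_measurable [measurable_dest]: "bmeas \<phi> \<Longrightarrow> \<phi> \<in> borel_measurable Q"
  by (simp add: bmeas_def)

lemma bmeasE:
  assumes "bmeas \<phi>"
  obtains c where "\<And>x. x \<in> space Q \<Longrightarrow> \<bar>\<phi> x\<bar> \<le> c"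
proof -
  from assms obtain c where "\<forall>x\<in>space Q. \<bar>\<phi> x\<bar> \<le> c"
    unfolding bmeas_def by (elim conjE exE)
  then show thesis by (intro that) blast
qed

lemma bmeasI:
  "\<phi> \<in> borel_measurable Q \<Longrightarrow> (\<And>x. x \<in> space Q \<Longrightarrow> \<bar>\<phi> x\<bar> \<le> c) \<Longrightarrow> bmeas \<phi>"
  unfolding bmeas_def by (intro conjI exI[of _ c] ballI)

lemma bmeas_integrable_mult:
  assumes "bmeas \<phi>" "integrable Q \<psi>" shows "integrable Q (\<lambda>x. \<psi> x * \<phi> x)"
proof -
  obtain c where c: "\<And>x. x \<in> space Q \<Longrightarrow> \<bar>\<phi> x\<bar> \<le> c"
    using bmeasE[OF assms(1)] by blast
  have [measurable]: "\<phi> \<in> borel_measurable Q" "\<psi> \<in> borel_measurable Q"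
    using bmeas_measurable[OF assms(1)] assms(2) by auto
  show ?thesis
  proof (rule Bochner_Integration.integrable_bound)
    show "integrable Q (\<lambda>x. c * \<psi> x)" using assms by simp
    have "norm (\<psi> x * \<phi> x) \<le> norm (c * \<psi> x)" if "x \<in> space Q" for x
    proof -
      have "\<bar>\<psi> x\<bar> * \<bar>\<phi> x\<bar> \<le> \<bar>\<psi> x\<bar> * \<bar>c\<bar>"
        using c[OF that] by (intro mult_left_mono) auto
      then show ?thesis by (simp add: abs_mult mult.commute)
    qed
    then show "AE x in Q. norm (\<psi> x * \<phi> x) \<le> norm (c * \<psi> x)" by auto
  qed simp
qed

lemma bmeas_integrable: "bmeas \<phi> \<Longrightarrow> integrable Q \<phi>"
  using bmeas_integrable_mult[of \<phi> "\<lambda>_. 1"] by simp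

lemma bmeas_mult: assumes "bmeas \<phi>" "bmeas \<psi>" shows "bmeas (\<lambda>x. \<phi> x * \<psi> x)"
proof -
  obtain c where c: "\<And>x. x \<in> space Q \<Longrightarrow> \<bar>\<phi> x\<bar> \<le> c"
    using bmeasE[OF assms(1)] by blast
  obtain d where d: "\<And>x. x \<in> space Q \<Longrightarrow> \<bar>\<psi> x\<bar> \<le> d"
    using bmeasE[OF assms(2)] by blast
  have "\<bar>\<phi> x * \<psi> x\<bar> \<le> c * d" if "x \<in> space Q" for x
    unfolding abs_mult using c[OF that] d[OF that] by (intro mult_mono) auto
  moreover have "(\<lambda>x. \<phi> x * \<psi> x) \<in> borel_measurable Q"
    using assms by (intro borel_measurable_times bmeas_measurable)
  ultimately show ?thesis by (intro bmeasI)
qed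

lemma bmeas_diff: assumes "bmeas \<phi>" "bmeas \<psi>" shows "bmeas (\<lambda>x. \<phi> x - \<psi> x)"
proof -
  obtain c where c: "\<And>x. x \<in> space Q \<Longrightarrow> \<bar>\<phi> x\<bar> \<le> c"
    using bmeasE[OF assms(1)] by blast
  obtain d where d: "\<And>x. x \<in> space Q \<Longrightarrow> \<bar>\<psi> x\<bar> \<le> d"
    using bmeasE[OF assms(2)] by blast
  have "\<bar>\<phi> x - \<psi> x\<bar> \<le> c + d" if "x \<in> space Q" for x
    using c[OF that] d[OF that] by linarith
  moreover have "(\<lambda>x. \<phi> x - \<psi> x) \<in> borel_measurable Q"
    using assms by (intro borel_measurable_diff bmeas_measurable)
  ultimately show ?thesis by (intro bmeasI)
qed

lemma bmeas_mix: assumes "bmeas \<phi>" "x \<in> space Q" shows "bmeas (\<lambda>y. \<phi> (mix B x y))"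
proof -
  obtain c where c: "\<And>x. x \<in> space Q \<Longrightarrow> \<bar>\<phi> x\<bar> \<le> c"
    using bmeasE[OF assms(1)] by blast
  have [measurable]: "\<phi> \<in> borel_measurable Q" using assms(1) by (rule bmeas_measurable)
  have "(\<lambda>y. \<phi> (mix B x y)) \<in> borel_measurable Q" using assms(2) by measurable
  moreover have "\<bar>\<phi> (mix B x y)\<bar> \<le> c" if "y \<in> space Q" for y
    using c mix_in_space[OF assms(2) that] .
  ultimately show ?thesis by (intro bmeasI)
qed

lemma bmeas_cexp: assumes "bmeas \<phi>" shows "bmeas (cexp j \<phi>)"
proof -
  obtain c where c: "\<And>x. x \<in> space Q \<Longrightarrow> \<bar>\<phi> x\<bar> \<le> c"
    using bmeasE[OF assms(1)] by blast
  have [measurable]: "\<phi> \<in> borel_measurable Q" using assms(1) by (rule bmeas_measurable)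
  have "\<bar>cexp j \<phi> x\<bar> \<le> c" if x: "x \<in> space Q" for x
  proof -
    have "\<bar>cexp j \<phi> x\<bar> \<le> (\<integral>y. \<bar>\<phi> (mix {j} x y)\<bar> \<partial>Q)"
      unfolding cexp_def by (rule integral_abs_bound)
    also have "\<dots> \<le> (\<integral>y. c \<partial>Q)"
      using c mix_in_space[OF x] bmeas_mix[OF assms x, of "{j}"]
      by (intro integral_mono) (auto intro!: bmeas_integrable integrable_abs)
    finally show ?thesis by (simp add: Q.prob_space)
  qed
  moreover have "cexp j \<phi> \<in> borel_measurable Q"
    unfolding cexp_def by measurable
  ultimately show ?thesis by (intro bmeasI)
qed

lemma dep_cexp: assumes "dep A \<phi>" shows "dep (A - {j}) (cexp j \<phi>)"
  unfolding dep_def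
proof (intro ballI impI)
  fix x y assume xy: "x \<in> space Q" "y \<in> space Q" "\<forall>i\<in>A - {j}. x i = y i"
  have "\<phi> (mix {j} x z) = \<phi> (mix {j} y z)" if "z \<in> space Q" for z
    using depD[OF assms mix_in_space[OF xy(1) that] mix_in_space[OF xy(2) that], of "{j}" "{j}"] xy(3)
    by (auto simp: mix_def)
  then show "cexp j \<phi> x = cexp j \<phi> y"
    unfolding cexp_def by (intro Bochner_Integration.integral_cong) auto
qed

lemma cexp_diff:
  assumes "bmeas \<phi>" "bmeas \<psi>" "x \<in> space Q"
  shows "cexp j (\<lambda>x. \<phi> x - \<psi> x) x = cexp j \<phi> x - cexp j \<psi> x"
  unfolding cexp_def
  by (rule Bochner_Integration.integral_diff[OF bmeas_integrable[OF bmeas_mix[OF assms(1,3)]] bmeas_integrable[OF bmeas_mix[OF assms(2,3)]]])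

lemma cexp_cexp_same:
  assumes "bmeas \<phi>" "x \<in> space Q"
  shows "cexp j (cexp j \<phi>) x = cexp j \<phi> x"
proof -
  have "mix {j} (mix {j} x y) z = mix {j} x z" for y z by (auto simp: mix_def)
  then show ?thesis by (simp add: cexp_def Q.prob_space)
qed

lemma cexp_commute:
  assumes "bmeas \<phi>" "x \<in> space Q"
  shows "cexp i (cexp j \<phi>) x = cexp j (cexp i \<phi>) x"
proof (cases "i = j")
  case False
  have [measurable]: "\<phi> \<in> borel_measurable Q" using assms(1) by (rule bmeas_measurable)
  obtain c where c: "\<And>x. x \<in> space Q \<Longrightarrow> \<bar>\<phi> x\<bar> \<le> c"
    using bmeasE[OF assms(1)] by blast
  have eq: "mix {j} (mix {i} x y) z = mix {i} (mix {j} x z) y" for y z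
    using False by (auto simp: mix_def)
  have "integrable (Q \<Otimes>\<^sub>M Q) (\<lambda>(y, z). \<phi> (mix {j} (mix {i} x y) z))"
  proof (rule QQ.P.integrable_const_bound[where B=c])
    show "AE z in Q \<Otimes>\<^sub>M Q. norm (case z of (y, z) \<Rightarrow> \<phi> (mix {j} (mix {i} x y) z)) \<le> c"
      by (intro AE_I2) (auto simp: space_pair_measure intro!: c mix_in_space assms)
  qed (use assms in measurable)
  then show ?thesis
    unfolding cexp_def using QQ.Fubini_integral[of "\<lambda>y z. \<phi> (mix {j} (mix {i} x y) z)"]
    by (simp add: eq)
qed simp

text \<open>Averages over different coordinates commute, so averaging over one more coordinate keeps
  the centring already achieved; the peeling below relies on this.\<close>

lemma centered_on_cexp:
  assumes "bmeas \<phi>" "centered_on A \<phi>"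
  shows "centered_on A (cexp j \<phi>)"
  unfolding centered_on_def
proof (intro ballI)
  fix i x assume i: "i \<in> A" "x \<in> space Q"
  have "cexp i (cexp j \<phi>) x = cexp j (cexp i \<phi>) x" using assms i by (simp add: cexp_commute)
  also have "\<dots> = (\<integral>y. 0 \<partial>Q)"
    using assms i unfolding cexp_def[of j] by (intro Bochner_Integration.integral_cong) (auto simp: centered_on_def mix_in_space)
  finally show "cexp i (cexp j \<phi>) x = 0" by simp
qed

text \<open>Peel off one coordinate \<open>d\<close> at a time, writing \<open>\<phi> = (\<phi> - E\<^sub>d \<phi>) + E\<^sub>d \<phi>\<close>.\<close>

lemma hoeffding_aux:
  assumes "finite D" "C \<inter> D = {}" "bmeas \<phi>" "dep (C \<union> D) \<phi>" "centered_on C \<phi>"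
  shows "\<exists>\<Phi>. (\<forall>A\<in>Pow D. pure (C \<union> A) (\<Phi> A)) \<and> (\<forall>x\<in>space Q. \<phi> x = (\<Sum>A\<in>Pow D. \<Phi> A x))"
  using assms
proof (induction D arbitrary: C \<phi> rule: finite_induct)
  case empty
  then show ?case by (intro exI[of _ "\<lambda>_. \<phi>"]) (auto simp: pure_def)
next
  case (insert d D)
  \<comment> \<open>\<open>C\<close> holds the coordinates already centred, \<open>D\<close> those
    still to be treated. The remainder \<open>?r\<close> is centred in \<open>d\<close> as well, so
    \<open>d\<close> joins \<open>C\<close>; the average \<open>?e\<close> no longer depends on
    \<open>d\<close>, so \<open>d\<close> is dropped. The induction hypothesis is applied to
    both.\<close>
  let ?e = "cexp d \<phi>"
  let ?r = "\<lambda>x. \<phi> x - cexp d \<phi> x"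
  have be: "bmeas ?e" using insert by (intro bmeas_cexp)
  have de: "dep (C \<union> D) ?e"
    using dep_cexp[OF insert.prems(3), of d] by (rule dep_mono) auto
  have ce: "centered_on C ?e" using insert by (intro centered_on_cexp)
  obtain \<Phi>1 where 1: "\<forall>A\<in>Pow D. pure (C \<union> A) (\<Phi>1 A)" "\<forall>x\<in>space Q. ?e x = (\<Sum>A\<in>Pow D. \<Phi>1 A x)"
    using insert.IH[OF _ be de ce] insert.prems by auto
  have br: "bmeas ?r" using insert be by (intro bmeas_diff)
  have dr: "dep (insert d C \<union> D) ?r"
    unfolding Un_insert_left Un_insert_right[symmetric]
    using insert.prems(3) dep_mono[OF de, of "C \<union> insert d D"] by (intro dep_diff) auto
  have cr: "centered_on (insert d C) ?r"
    unfolding centered_on_def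
  proof (intro ballI)
    fix i x assume i: "i \<in> insert d C" "x \<in> space Q"
    have "cexp i ?r x = cexp i \<phi> x - cexp i ?e x"
      using insert.prems be i by (intro cexp_diff)
    also have "\<dots> = 0"
    proof (cases "i = d")
      case True
      then show ?thesis using cexp_cexp_same[OF insert.prems(2) i(2)] by simp
    next
      case False
      then show ?thesis using i insert.prems(4) ce by (auto simp: centered_on_def)
    qed
    finally show "cexp i ?r x = 0" .
  qed
  obtain \<Phi>2 where 2: "\<forall>A\<in>Pow D. pure (insert d C \<union> A) (\<Phi>2 A)" "\<forall>x\<in>space Q. ?r x = (\<Sum>A\<in>Pow D. \<Phi>2 A x)"
    using insert.IH[OF _ br dr cr] insert by auto
  define \<Phi> where "\<Phi> A = (if d \<in> A then \<Phi>2 (A - {d}) else \<Phi>1 A)" for A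
  have "pure (C \<union> A) (\<Phi> A)" if "A \<in> Pow (insert d D)" for A
  proof (cases "d \<in> A")
    case True
    then have "C \<union> A = insert d C \<union> (A - {d})" by auto
    with True 2(1) that show ?thesis by (auto simp: \<Phi>_def)
  next
    case False
    with 1(1) that show ?thesis by (auto simp: \<Phi>_def)
  qed
  moreover have "\<phi> x = (\<Sum>A\<in>Pow (insert d D). \<Phi> A x)" if "x \<in> space Q" for x
  proof -
    have "(\<Sum>A\<in>Pow (insert d D). \<Phi> A x) = (\<Sum>A\<in>Pow D. \<Phi> A x) + (\<Sum>A\<in>insert d ` Pow D. \<Phi> A x)"
      unfolding Pow_insert using insert.hyps by (subst sum.union_disjoint) auto
    also have "(\<Sum>A\<in>insert d ` Pow D. \<Phi> A x) = (\<Sum>A\<in>Pow D. \<Phi> (insert d A) x)"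
      using insert.hyps by (subst sum.reindex) (auto simp: inj_on_def)
    also have "\<dots> = (\<Sum>A\<in>Pow D. \<Phi>2 A x)"
      using insert.hyps by (intro sum.cong refl) (auto simp: \<Phi>_def subset_iff intro!: arg_cong[where f="\<lambda>A. \<Phi>2 A x"])
    also have "(\<Sum>A\<in>Pow D. \<Phi> A x) = (\<Sum>A\<in>Pow D. \<Phi>1 A x)"
      using insert.hyps by (intro sum.cong refl) (auto simp: \<Phi>_def)
    finally show ?thesis using 1(2) 2(2) that by force
  qed
  ultimately show ?case by blast
qed

lemma hoeffding:
  assumes "finite D" "bmeas \<phi>" "dep D \<phi>"
  obtains \<Phi> where "\<And>A. A \<subseteq> D \<Longrightarrow> pure A (\<Phi> A)" "\<And>x. x \<in> space Q \<Longrightarrow> \<phi> x = (\<Sum>A\<in>Pow D. \<Phi> A x)"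
  using hoeffding_aux[of D "{}" \<phi>] assms by (auto simp: centered_on_def)

text \<open>The coordinate \<open>j\<close> enters the product through \<open>\<phi>\<close> alone.
  Resampling it first leaves \<open>g\<close> untouched and turns \<open>\<phi>\<close> into
  \<open>cexp j \<phi>\<close>, which is zero.\<close>

lemma pure_orthogonal:
  assumes p: "pure A \<phi>" and j: "j \<in> A" "j \<notin> B" and g: "dep B g" "integrable Q g"
  shows "(\<integral>x. g x * \<phi> x \<partial>Q) = 0"
proof -
  have "(\<integral>x. g x * \<phi> x \<partial>Q) = (\<integral>x. (\<integral>y. g (mix {j} x y) * \<phi> (mix {j} x y) \<partial>Q) \<partial>Q)"
    using p g by (intro integral_mix(1) bmeas_integrable_mult) (auto simp: pure_def)
  also have "\<dots> = (\<integral>x. (\<integral>y. g x * \<phi> (mix {j} x y) \<partial>Q) \<partial>Q)"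
    using g j by (intro Bochner_Integration.integral_cong refl) (simp add: dep_mix)
  also have "\<dots> = (\<integral>x. g x * cexp j \<phi> x \<partial>Q)"
    by (simp add: cexp_def)
  also have "\<dots> = (\<integral>x. 0 \<partial>Q)"
    using p j by (intro Bochner_Integration.integral_cong refl) (auto simp: pure_def centered_on_def)
  finally show ?thesis by simp
qed

text \<open>Two different index sets differ in some coordinate, and \<open>pure_orthogonal\<close>
  applies there; only the diagonal of the squared sum survives.\<close>

lemma pure_parseval:
  assumes D: "finite D" and P: "\<And>A. A \<subseteq> D \<Longrightarrow> pure A (\<Phi> A)"
    and eq: "\<And>x. x \<in> space Q \<Longrightarrow> \<phi> x = (\<Sum>A\<in>Pow D. \<Phi> A x)"
  shows "(\<integral>x. (\<phi> x)\<^sup>2 \<partial>Q) = (\<Sum>A\<in>Pow D. \<integral>x. (\<Phi> A x)\<^sup>2 \<partial>Q)"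
proof -
  have b: "A \<subseteq> D \<Longrightarrow> bmeas (\<Phi> A)" for A using P by (auto simp: pure_def)
  have "(\<integral>x. (\<phi> x)\<^sup>2 \<partial>Q) = (\<integral>x. (\<Sum>A\<in>Pow D. \<Sum>B\<in>Pow D. \<Phi> A x * \<Phi> B x) \<partial>Q)"
    by (intro Bochner_Integration.integral_cong refl) (simp add: eq power2_eq_square sum_product)
  also have "\<dots> = (\<Sum>A\<in>Pow D. \<Sum>B\<in>Pow D. \<integral>x. \<Phi> A x * \<Phi> B x \<partial>Q)"
  proof -
    have "integrable Q (\<lambda>x. \<Phi> A x * \<Phi> B x)" if "A \<in> Pow D" "B \<in> Pow D" for A B
      using b that by (intro bmeas_integrable bmeas_mult) auto
    then show ?thesis by (subst Bochner_Integration.integral_sum; force intro!: Bochner_Integration.integrable_sum sum.cong Bochner_Integration.integral_sum)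
  qed
  also have "\<dots> = (\<Sum>A\<in>Pow D. \<Sum>B\<in>Pow D. if B = A then \<integral>x. (\<Phi> A x)\<^sup>2 \<partial>Q else 0)"
  proof (intro sum.cong refl)
    fix A B assume AB: "A \<in> Pow D" "B \<in> Pow D"
    show "(\<integral>x. \<Phi> A x * \<Phi> B x \<partial>Q) = (if B = A then \<integral>x. (\<Phi> A x)\<^sup>2 \<partial>Q else 0)"
    proof (cases "A = B")
      case False
      then consider j where "j \<in> A" "j \<notin> B" | j where "j \<in> B" "j \<notin> A" by blast
      then have "(\<integral>x. \<Phi> A x * \<Phi> B x \<partial>Q) = 0"
      proof cases
        case 1
        then have "(\<integral>x. \<Phi> B x * \<Phi> A x \<partial>Q) = 0"
          using AB P b by (intro pure_orthogonal[of A "\<Phi> A" _ B]) (auto simp: pure_def bmeas_integrable)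
        then show ?thesis by (simp add: mult.commute)
      next
        case 2
        then show ?thesis
          using AB P b by (intro pure_orthogonal[of B "\<Phi> B" _ A]) (auto simp: pure_def bmeas_integrable)
      qed
      with False show ?thesis by simp
    qed (simp add: power2_eq_square)
  qed
  also have "\<dots> = (\<Sum>A\<in>Pow D. \<integral>x. (\<Phi> A x)\<^sup>2 \<partial>Q)"
    using D by (simp add: sum.delta')
  finally show ?thesis .
qed

text \<open>The sign of \<open>G\<close> is bounded and depends on the same coordinates as
  \<open>G\<close>. Decomposing it into pure parts shows that the integral of
  \<open>\<bar>G x\<bar>\<close> is a sum of vanishing pairings.\<close>

lemma weak_unique:
  assumes D: "finite D" and G: "integrable Q G" "dep D G"
    and z: "\<And>A \<phi>. A \<subseteq> D \<Longrightarrow> pure A \<phi> \<Longrightarrow> (\<integral>x. G x * \<phi> x \<partial>Q) = 0"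
  shows "AE x in Q. G x = 0"
proof -
  have [measurable]: "G \<in> borel_measurable Q" using G by simp
  have b: "bmeas (\<lambda>x. sgn (G x))"
    unfolding bmeas_def by (auto intro!: exI[of _ 1] simp: sgn_real_def)
  have "dep D (\<lambda>x. sgn (G x))"
    by (intro dep_def[THEN iffD2] ballI impI arg_cong[where f=sgn]) (erule (1) depD[OF G(2)], blast)
  from hoeffding[OF D b this] obtain \<Phi> where \<Phi>: "\<And>A. A \<subseteq> D \<Longrightarrow> pure A (\<Phi> A)"
     "\<And>x. x \<in> space Q \<Longrightarrow> sgn (G x) = (\<Sum>A\<in>Pow D. \<Phi> A x)" by blast
  have "(\<integral>x. \<bar>G x\<bar> \<partial>Q) = (\<integral>x. (\<Sum>A\<in>Pow D. G x * \<Phi> A x) \<partial>Q)"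
  proof (intro Bochner_Integration.integral_cong refl)
    fix x assume "x \<in> space Q"
    have "\<bar>G x\<bar> = G x * sgn (G x)" by (simp add: abs_sgn)
    with \<Phi>(2)[OF \<open>x \<in> space Q\<close>] show "\<bar>G x\<bar> = (\<Sum>A\<in>Pow D. G x * \<Phi> A x)"
      by (simp add: sum_distrib_left)
  qed
  also have "\<dots> = (\<Sum>A\<in>Pow D. \<integral>x. G x * \<Phi> A x \<partial>Q)"
    using \<Phi>(1) G by (intro Bochner_Integration.integral_sum bmeas_integrable_mult) (auto simp: pure_def)
  also have "\<dots> = 0" using z \<Phi>(1) by (intro sum.neutral) auto
  finally have "AE x in Q. \<bar>G x\<bar> = 0"
    using G by (subst integral_nonneg_eq_0_iff_AE[symmetric]) auto
  then show ?thesis by simp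
qed

section \<open>Sums over tuples of distinct cells\<close>

lemma tcat_pick: "tcat r (\<lambda>j. x (k j)) q y = tcat r (pick r k x) q y"
  by (auto simp: tcat_def pick_def)

lemma blk_tcat: "tcat r u q y \<in> blk r k \<longleftrightarrow> u \<in> blk r k"
  by (auto simp: blk_def tcat_def)

lemma blk_iff: "v \<in> space (Rp p) \<Longrightarrow> r \<le> p \<Longrightarrow> v \<in> blk r k \<longleftrightarrow> (\<forall>j<r. k j = nat \<lfloor>v j / 2\<rfloor>)"
  unfolding blk_def using in_cell_iff[of "v _"] by (auto simp: space_Rp PiE_iff)

lemma blk_unique: "v \<in> blk p k \<Longrightarrow> v \<in> blk q l \<Longrightarrow> j < p \<Longrightarrow> j < q \<Longrightarrow> k j = l j"
  unfolding blk_def using cell_unique by blast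

text \<open>Bochner integrals against a density need a weight that is the \<open>ennreal\<close> of
  a real function.\<close>

lemma density_weight: "density M (\<lambda>v. ennreal (1/2^p) * indicator S v) = density M (\<lambda>v. ennreal (1/2^p * indicator S v))"
  by (intro arg_cong[where f="density M"] ext) (simp add: ennreal_mult' ennreal_indicator split: split_indicator)

lemma nn_integral_pick:
  assumes k: "inj_on k {..<p}" and [measurable]: "F \<in> borel_measurable (Rp p)"
  shows "(\<integral>\<^sup>+x. F (pick p k x) \<partial>Q) = ennreal (1/2^p) * (\<integral>\<^sup>+v. indicator (blk p k) v * F v \<partial>Rp p)"
proof -
  have "(\<integral>\<^sup>+x. F (pick p k x) \<partial>Q) = (\<integral>\<^sup>+v. F v \<partial>distr Q (Rp p) (pick p k))"
    by (subst nn_integral_distr) auto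
  also have "\<dots> = (\<integral>\<^sup>+v. ennreal (1/2^p) * (indicator (blk p k) v * F v) \<partial>Rp p)"
    unfolding law_pick[OF k] by (subst nn_integral_density) (auto simp: mult_ac)
  finally show ?thesis by (simp add: nn_integral_cmult)
qed

lemma AE_pick:
  assumes k: "inj_on k {..<p}" and P: "AE v in Rp p. P v"
  shows "AE x in Q. P (pick p k x)"
proof -
  have "AE v in density (Rp p) (\<lambda>v. ennreal (1/2^p) * indicator (blk p k) v). P v"
    using P by (subst AE_density) auto
  then have "AE v in distr Q (Rp p) (pick p k). P v"
    unfolding law_pick[OF k] .
  from AE_distrD[OF pick_measurable this] show ?thesis .
qed

text \<open>The terms of the defining formula evaluate the first \<open>r\<close> arguments at
  random points and integrate the other \<open>q\<close> against Lebesgue measure. Jointly this is,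
  up to the factor \<open>1/2^r\<close>, Lebesgue measure in \<open>r + q\<close> variables
  restricted to the block of the first \<open>r\<close>.\<close>

lemma law_slice:
  assumes k: "inj_on k {..<r}"
  shows "distr (Q \<Otimes>\<^sub>M Rp q) (Rp (r + q)) (\<lambda>(x,y). tcat r (pick r k x) q y) =
    density (Rp (r + q)) (\<lambda>v. ennreal (1/2^r) * indicator (blk r k) v)"
proof (rule measure_eqI)
  fix A assume "A \<in> sets (distr (Q \<Otimes>\<^sub>M Rp q) (Rp (r + q)) (\<lambda>(x,y). tcat r (pick r k x) q y))"
  then have A[measurable]: "A \<in> sets (Rp (r + q))" by simp
  have "emeasure (distr (Q \<Otimes>\<^sub>M Rp q) (Rp (r + q)) (\<lambda>(x,y). tcat r (pick r k x) q y)) A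
    = (\<integral>\<^sup>+v. indicator A v \<partial>distr (Q \<Otimes>\<^sub>M Rp q) (Rp (r + q)) (\<lambda>(x,y). tcat r (pick r k x) q y))"
    by simp
  also have "\<dots> = (\<integral>\<^sup>+z. indicator A (tcat r (pick r k (fst z)) q (snd z)) \<partial>(Q \<Otimes>\<^sub>M Rp q))"
    by (subst nn_integral_distr) (auto simp: case_prod_beta')
  also have "\<dots> = (\<integral>\<^sup>+x. \<integral>\<^sup>+y. indicator A (tcat r (pick r k x) q y) \<partial>Rp q \<partial>Q)"
    by (subst Rp.nn_integral_fst[symmetric]) auto
  also have "\<dots> = ennreal (1/2^r) * (\<integral>\<^sup>+u. indicator (blk r k) u * (\<integral>\<^sup>+y. indicator A (tcat r u q y) \<partial>Rp q) \<partial>Rp r)"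
    by (rule nn_integral_pick[OF k]) measurable
  also have "\<dots> = (\<integral>\<^sup>+u. \<integral>\<^sup>+y. ennreal (1/2^r) * indicator (blk r k) (tcat r u q y) * indicator A (tcat r u q y) \<partial>Rp q \<partial>Rp r)"
  proof (subst nn_integral_cmult[symmetric], measurable, intro nn_integral_cong)
    fix u assume [measurable]: "u \<in> space (Rp r)"
    have "(indicator (blk r k) (tcat r u q y) :: ennreal) = indicator (blk r k) u" for y
      by (simp add: indicator_def blk_tcat)
    then show "ennreal (1/2^r) * (indicator (blk r k) u * (\<integral>\<^sup>+y. indicator A (tcat r u q y) \<partial>Rp q)) =
       (\<integral>\<^sup>+y. ennreal (1/2^r) * indicator (blk r k) (tcat r u q y) * indicator A (tcat r u q y) \<partial>Rp q)"
      by (subst nn_integral_cmult[symmetric], measurable)+ (simp add: mult.assoc)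
  qed
  also have "\<dots> = (\<integral>\<^sup>+z. (\<lambda>v. ennreal (1/2^r) * indicator (blk r k) v * indicator A v) (tcat r (fst z) q (snd z)) \<partial>(Rp r \<Otimes>\<^sub>M Rp q))"
  proof (subst Rp.nn_integral_fst[symmetric])
    have "(\<lambda>v. ennreal (1/2^r) * indicator (blk r k) v * indicator A v) \<in> borel_measurable (Rp (r + q))"
      by measurable
    from measurable_compose[OF tcat_measurable this]
    show "(\<lambda>z. ennreal (1/2^r) * indicator (blk r k) (tcat r (fst z) q (snd z)) * indicator A (tcat r (fst z) q (snd z)))
       \<in> borel_measurable (Rp r \<Otimes>\<^sub>M Rp q)"
      by (simp add: case_prod_beta')
  qed simp
  also have "\<dots> = (\<integral>\<^sup>+v. ennreal (1/2^r) * indicator (blk r k) v * indicator A v \<partial>distr (Rp r \<Otimes>\<^sub>M Rp q) (Rp (r + q)) (\<lambda>(u,y). tcat r u q y))"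
    by (subst nn_integral_distr) (auto simp: case_prod_beta')
  also have "\<dots> = emeasure (density (Rp (r + q)) (\<lambda>v. ennreal (1/2^r) * indicator (blk r k) v)) A"
    unfolding law_tcat by (subst emeasure_density) auto
  finally show "emeasure (distr (Q \<Otimes>\<^sub>M Rp q) (Rp (r + q)) (\<lambda>(x,y). tcat r (pick r k x) q y)) A =
     emeasure (density (Rp (r + q)) (\<lambda>v. ennreal (1/2^r) * indicator (blk r k) v)) A" .
qed simp

lemma slice_measurable [measurable]:
  "(\<lambda>(x,y). tcat r (pick r k x) q y) \<in> measurable (Q \<Otimes>\<^sub>M Rp q) (Rp (r + q))"
  by measurable

lemma nn_integral_slice:
  assumes k: "inj_on k {..<r}" and [measurable]: "F \<in> borel_measurable (Rp (r + q))"
  shows "(\<integral>\<^sup>+x. \<integral>\<^sup>+y. F (tcat r (pick r k x) q y) \<partial>Rp q \<partial>Q) =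
    ennreal (1/2^r) * (\<integral>\<^sup>+v. indicator (blk r k) v * F v \<partial>Rp (r + q))"
proof -
  have "(\<integral>\<^sup>+x. \<integral>\<^sup>+y. F (tcat r (pick r k x) q y) \<partial>Rp q \<partial>Q) = (\<integral>\<^sup>+z. F (tcat r (pick r k (fst z)) q (snd z)) \<partial>(Q \<Otimes>\<^sub>M Rp q))"
    by (subst Rp.nn_integral_fst[symmetric]) auto
  also have "\<dots> = (\<integral>\<^sup>+v. F v \<partial>distr (Q \<Otimes>\<^sub>M Rp q) (Rp (r + q)) (\<lambda>(x,y). tcat r (pick r k x) q y))"
    by (subst nn_integral_distr) (auto simp: case_prod_beta')
  also have "\<dots> = (\<integral>\<^sup>+v. ennreal (1/2^r) * (indicator (blk r k) v * F v) \<partial>Rp (r + q))"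
    unfolding law_slice[OF k] by (subst nn_integral_density) (auto simp: mult_ac)
  finally show ?thesis by (simp add: nn_integral_cmult)
qed

lemma integrable_pick_iff:
  fixes F :: "(nat \<Rightarrow> real) \<Rightarrow> real"
  assumes k: "inj_on k {..<p}" and [measurable]: "F \<in> borel_measurable (Rp p)"
  shows "integrable Q (\<lambda>x. F (pick p k x)) \<longleftrightarrow> integrable (Rp p) (\<lambda>v. indicator (blk p k) v * F v)"
proof -
  have "integrable Q (\<lambda>x. F (pick p k x)) \<longleftrightarrow> integrable (density (Rp p) (\<lambda>v. ennreal (1/2^p * indicator (blk p k) v))) F"
    using integrable_distr_eq[of "pick p k" Q "Rp p" F]
    unfolding law_pick[OF k] density_weight by simp
  also have "\<dots> \<longleftrightarrow> integrable (Rp p) (\<lambda>v. (1/2^p) * (indicator (blk p k) v * F v))"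
    by (subst integrable_density) (auto simp: mult.assoc)
  also have "\<dots> \<longleftrightarrow> integrable (Rp p) (\<lambda>v. indicator (blk p k) v * F v)"
    by (subst integrable_mult_left_iff) auto
  finally show ?thesis .
qed

lemma integral_pick:
  fixes F :: "(nat \<Rightarrow> real) \<Rightarrow> real"
  assumes k: "inj_on k {..<p}" and [measurable]: "F \<in> borel_measurable (Rp p)"
  shows "(\<integral>x. F (pick p k x) \<partial>Q) = (1/2^p) * (\<integral>v. indicator (blk p k) v * F v \<partial>Rp p)"
proof -
  have "(\<integral>x. F (pick p k x) \<partial>Q) = (\<integral>v. F v \<partial>density (Rp p) (\<lambda>v. ennreal (1/2^p * indicator (blk p k) v)))"
    using integral_distr[of "pick p k" Q "Rp p" F]
    unfolding law_pick[OF k] density_weight by simp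
  also have "\<dots> = (\<integral>v. (1/2^p) * (indicator (blk p k) v * F v) \<partial>Rp p)"
    by (subst integral_density) (auto simp: mult.assoc)
  finally show ?thesis by simp
qed

lemma integrable_slice_iff:
  fixes F :: "(nat \<Rightarrow> real) \<Rightarrow> real"
  assumes k: "inj_on k {..<r}" and [measurable]: "F \<in> borel_measurable (Rp (r + q))"
  shows "integrable (Q \<Otimes>\<^sub>M Rp q) (\<lambda>(x,y). F (tcat r (pick r k x) q y)) \<longleftrightarrow>
    integrable (Rp (r + q)) (\<lambda>v. indicator (blk r k) v * F v)"
proof -
  have "integrable (Q \<Otimes>\<^sub>M Rp q) (\<lambda>(x,y). F (tcat r (pick r k x) q y)) \<longleftrightarrow>
     integrable (density (Rp (r + q)) (\<lambda>v. ennreal (1/2^r * indicator (blk r k) v))) F"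
    using integrable_distr_eq[OF slice_measurable[of r k q], of F]
    unfolding law_slice[OF k] density_weight by (simp add: case_prod_beta')
  also have "\<dots> \<longleftrightarrow> integrable (Rp (r + q)) (\<lambda>v. (1/2^r) * (indicator (blk r k) v * F v))"
    by (subst integrable_density) (auto simp: mult.assoc)
  also have "\<dots> \<longleftrightarrow> integrable (Rp (r + q)) (\<lambda>v. indicator (blk r k) v * F v)"
    by (subst integrable_mult_left_iff) auto
  finally show ?thesis .
qed

interpretation QR: pair_sigma_finite Q "Rp q" for q ..

lemma integral_slice:
  fixes F :: "(nat \<Rightarrow> real) \<Rightarrow> real"
  assumes k: "inj_on k {..<r}" and [measurable]: "F \<in> borel_measurable (Rp (r + q))"
    and i: "integrable (Rp (r + q)) (\<lambda>v. indicator (blk r k) v * F v)"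
  shows "(\<integral>x. \<integral>y. F (tcat r (pick r k x) q y) \<partial>Rp q \<partial>Q) = (1/2^r) * (\<integral>v. indicator (blk r k) v * F v \<partial>Rp (r + q))"
proof -
  have I: "integrable (Q \<Otimes>\<^sub>M Rp q) (\<lambda>(x,y). F (tcat r (pick r k x) q y))"
    using i integrable_slice_iff[OF k] by simp
  have "(\<integral>x. \<integral>y. F (tcat r (pick r k x) q y) \<partial>Rp q \<partial>Q) = (\<integral>z. F (tcat r (pick r k (fst z)) q (snd z)) \<partial>(Q \<Otimes>\<^sub>M Rp q))"
    using QR.integral_fst'[OF I] by (simp add: case_prod_beta')
  also have "\<dots> = (\<integral>v. F v \<partial>density (Rp (r + q)) (\<lambda>v. ennreal (1/2^r * indicator (blk r k) v)))"
    using integral_distr[OF slice_measurable[of r k q], of F]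
    unfolding law_slice[OF k] density_weight by (simp add: case_prod_beta')
  also have "\<dots> = (\<integral>v. (1/2^r) * (indicator (blk r k) v * F v) \<partial>Rp (r + q))"
    by (subst integral_density) (auto simp: mult.assoc)
  finally show ?thesis by simp
qed

section \<open>Finite sums over tuples and the partition into blocks\<close>

definition DN :: "nat \<Rightarrow> nat \<Rightarrow> (nat \<Rightarrow> nat) set" where
  "DN N p = {k \<in> {..<p} \<rightarrow>\<^sub>E {..<N}. inj_on k {..<p}}"

lemma finite_DN [simp]: "finite (DN N p)"
  unfolding DN_def by (rule finite_subset[OF _ finite_PiE[of "{..<p}" "\<lambda>_. {..<N}"]]) auto

lemma DN_inj: "k \<in> DN N p \<Longrightarrow> inj_on k {..<p}"
  by (simp add: DN_def)

lemma DN_lt: "k \<in> DN N p \<Longrightarrow> j < p \<Longrightarrow> k j < N"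
  by (auto simp: DN_def PiE_iff)

lemma DN_eqI: "k \<in> DN N p \<Longrightarrow> l \<in> DN M p \<Longrightarrow> (\<And>j. j < p \<Longrightarrow> k j = l j) \<Longrightarrow> k = l"
  by (rule extensionalityI[of _ "{..<p}"]) (auto simp: DN_def PiE_iff)

lemma blk_DN_unique: "v \<in> blk p k \<Longrightarrow> v \<in> blk p l \<Longrightarrow> k \<in> DN N p \<Longrightarrow> l \<in> DN N p \<Longrightarrow> k = l"
  by (rule DN_eqI) (auto intro: blk_unique)

text \<open>A value lies in only one cell, so blocks of different tuples are disjoint.\<close>

lemma sum_indicator_blk_le:
  "(\<Sum>k\<in>DN N p. indicator (blk p k) v) \<le> (1 :: ennreal)"
proof (cases "\<exists>k\<in>DN N p. v \<in> blk p k")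
  case True
  then obtain k where k: "k \<in> DN N p" "v \<in> blk p k" by blast
  have "(\<Sum>l\<in>DN N p. indicator (blk p l) v) = (\<Sum>l\<in>{k}. indicator (blk p l) v :: ennreal)"
    using k by (intro sum.mono_neutral_right) (auto split: split_indicator intro: DN_eqI blk_unique)
  then show ?thesis using k by simp
next
  case False
  then have "(\<Sum>k\<in>DN N p. indicator (blk p k) v) = (0 :: ennreal)"
    by (intro sum.neutral) auto
  then show ?thesis by simp
qed

text \<open>Disjointness of the blocks turns a sum of expectations over tuples into a single
  Lebesgue integral.\<close>

lemma sum_nn_integral_pick_le:
  assumes [measurable]: "F \<in> borel_measurable (Rp p)"
  shows "(\<Sum>k\<in>DN N p. \<integral>\<^sup>+x. F (pick p k x) \<partial>Q) \<le> ennreal (1/2^p) * (\<integral>\<^sup>+v. F v \<partial>Rp p)"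
proof -
  have "(\<Sum>k\<in>DN N p. \<integral>\<^sup>+x. F (pick p k x) \<partial>Q) = (\<Sum>k\<in>DN N p. ennreal (1/2^p) * (\<integral>\<^sup>+v. indicator (blk p k) v * F v \<partial>Rp p))"
    by (intro sum.cong refl nn_integral_pick) (auto simp: DN_inj)
  also have "\<dots> = ennreal (1/2^p) * (\<integral>\<^sup>+v. (\<Sum>k\<in>DN N p. indicator (blk p k) v) * F v \<partial>Rp p)"
    unfolding sum_distrib_right by (subst nn_integral_sum) (auto simp: sum_distrib_left)
  also have "\<dots> \<le> ennreal (1/2^p) * (\<integral>\<^sup>+v. 1 * F v \<partial>Rp p)"
    by (intro mult_left_mono nn_integral_mono mult_right_mono sum_indicator_blk_le) auto
  finally show ?thesis by simp
qed

text \<open>By \<open>van\<close> the block of \<open>\<kappa>\<close> splits, up to a null set and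
  points where \<open>B\<close> vanishes, into the blocks of the tuples \<open>\<rho>\<close>
  extending \<open>\<kappa>\<close>. An expectation over \<open>\<rho>\<close> carries
  \<open>1/2^(r + q)\<close>, the slice only \<open>1/2^r\<close>; the quotient is
  \<open>2^q\<close>.\<close>

lemma slice_sum:
  fixes B :: "(nat \<Rightarrow> real) \<Rightarrow> real"
  assumes k: "\<kappa> \<in> DN N r" and [measurable]: "B \<in> borel_measurable (Rp (r + q))"
    and i: "integrable (Rp (r + q)) (\<lambda>v. indicator (blk r \<kappa>) v * B v)"
    and van: "AE v in Rp (r + q). v \<in> blk r \<kappa> \<longrightarrow> B v \<noteq> 0 \<longrightarrow> (\<exists>\<rho>\<in>DN N (r + q). v \<in> blk (r + q) \<rho>)"
  shows "(\<integral>x. \<integral>y. B (tcat r (pick r \<kappa> x) q y) \<partial>Rp q \<partial>Q) =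
    2^q * (\<Sum>\<rho> | \<rho> \<in> DN N (r + q) \<and> (\<forall>j<r. \<rho> j = \<kappa> j). \<integral>x. B (pick (r + q) \<rho> x) \<partial>Q)"
proof -
  let ?S = "{\<rho> \<in> DN N (r + q). \<forall>j<r. \<rho> j = \<kappa> j}"
  have fS: "finite ?S" by simp
  have sub: "indicator (blk (r + q) \<rho>) v * B v = indicator (blk (r + q) \<rho>) v * (indicator (blk r \<kappa>) v * B v)" if "\<rho> \<in> ?S" for \<rho> v
  proof -
    have "v \<in> blk (r + q) \<rho> \<Longrightarrow> v \<in> blk r \<kappa>"
    proof -
      assume v: "v \<in> blk (r + q) \<rho>"
      have "v j \<in> cell (\<kappa> j)" if "j < r" for j
      proof -
        have "v j \<in> cell (\<rho> j)" using v that by (simp add: blk_def)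
        then show ?thesis using \<open>\<rho> \<in> ?S\<close> that by simp
      qed
      then show ?thesis by (simp add: blk_def)
    qed
    then show ?thesis by (auto split: split_indicator)
  qed
  have int: "integrable (Rp (r + q)) (\<lambda>v. indicator (blk (r + q) \<rho>) v * B v)" if "\<rho> \<in> ?S" for \<rho>
    unfolding sub[OF that]
    by (rule Bochner_Integration.integrable_bound[OF i]) (auto split: split_indicator)
  have "(\<integral>v. indicator (blk r \<kappa>) v * B v \<partial>Rp (r + q)) = (\<integral>v. (\<Sum>\<rho>\<in>?S. indicator (blk (r + q) \<rho>) v * B v) \<partial>Rp (r + q))"
  proof (rule integral_cong_AE)
    show "AE v in Rp (r + q). indicator (blk r \<kappa>) v * B v = (\<Sum>\<rho>\<in>?S. indicator (blk (r + q) \<rho>) v * B v)"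
      using van
    proof eventually_elim
      fix v assume van: "v \<in> blk r \<kappa> \<longrightarrow> B v \<noteq> 0 \<longrightarrow> (\<exists>\<rho>\<in>DN N (r + q). v \<in> blk (r + q) \<rho>)"
      show "indicator (blk r \<kappa>) v * B v = (\<Sum>\<rho>\<in>?S. indicator (blk (r + q) \<rho>) v * B v)"
      proof (cases "v \<in> blk r \<kappa> \<and> B v \<noteq> 0")
        case True
        then obtain \<rho> where \<rho>: "\<rho> \<in> DN N (r + q)" "v \<in> blk (r + q) \<rho>" using van by blast
        have "\<rho> \<in> ?S" using \<rho> True blk_unique[of v "r + q" \<rho> r \<kappa>] by auto
        have "(\<Sum>\<rho>\<in>?S. indicator (blk (r + q) \<rho>) v * B v) = (\<Sum>\<rho>\<in>{\<rho>}. indicator (blk (r + q) \<rho>) v * B v)"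
        proof (intro sum.mono_neutral_right ballI)
          fix l assume l: "l \<in> ?S - {\<rho>}"
          then have "v \<notin> blk (r + q) l" using blk_DN_unique[OF \<rho>(2) _ \<rho>(1)] by blast
          then show "indicator (blk (r + q) l) v * B v = 0" by simp
        qed (use \<open>\<rho> \<in> ?S\<close> in auto)
        then show ?thesis using True \<rho> by simp
      next
        case False
        then have "(\<Sum>\<rho>\<in>?S. indicator (blk (r + q) \<rho>) v * B v) = 0"
        proof (intro sum.neutral ballI)
          fix l assume "l \<in> ?S"
          from sub[OF this, of v] False show "indicator (blk (r + q) l) v * B v = 0" by (cases "v \<in> blk r \<kappa>") auto
        qed
        then show ?thesis using False by (cases "v \<in> blk r \<kappa>") auto
      qed
    qed
  next
    have m: "(\<lambda>v. indicator (blk (r + q) \<rho>) v * B v) \<in> borel_measurable (Rp (r + q))" for \<rho>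
      by measurable
    show "(\<lambda>v. \<Sum>\<rho>\<in>?S. indicator (blk (r + q) \<rho>) v * B v) \<in> borel_measurable (Rp (r + q))"
      by (rule borel_measurable_sum) (rule m)
  qed measurable
  also have "\<dots> = (\<Sum>\<rho>\<in>?S. \<integral>v. indicator (blk (r + q) \<rho>) v * B v \<partial>Rp (r + q))"
    using int by (intro Bochner_Integration.integral_sum) auto
  also have "\<dots> = (\<Sum>\<rho>\<in>?S. 2^(r + q) * (\<integral>x. B (pick (r + q) \<rho> x) \<partial>Q))"
  proof (intro sum.cong refl)
    fix \<rho> assume "\<rho> \<in> ?S"
    then show "(\<integral>v. indicator (blk (r + q) \<rho>) v * B v \<partial>Rp (r + q)) = 2^(r + q) * (\<integral>x. B (pick (r + q) \<rho> x) \<partial>Q)"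
      by (subst integral_pick) (auto simp: DN_inj)
  qed
  also have "\<dots> = 2^(r + q) * (\<Sum>\<rho>\<in>?S. (\<integral>x. B (pick (r + q) \<rho> x) \<partial>Q))"
    by (simp add: sum_distrib_left)
  finally show ?thesis
    by (subst integral_slice[OF DN_inj[OF k] _ i]) (auto simp: power_add)
qed

text \<open>Cell boundaries are null sets, so up to null sets membership in \<open>\<Delta>\<close> means lying in
  pairwise distinct half-open cells.\<close>

definition idx :: "nat \<Rightarrow> (nat \<Rightarrow> real) \<Rightarrow> nat \<Rightarrow> nat" where
  "idx p v = (\<lambda>j\<in>{..<p}. nat \<lfloor>v j / 2\<rfloor>)"

lemma blk_idx: "v \<in> space (Rp p) \<Longrightarrow> v \<in> blk p (idx p v)"
  using blk_iff[of v p p "idx p v"] by (simp add: idx_def)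

lemma AE_component_neq:
  assumes j: "j < p" shows "AE v in Rp p. v j \<noteq> c"
proof -
  let ?A = "\<lambda>i. if i = j then {c} \<inter> {0..} else {0..}"
  have m: "?A i \<in> sets Rpos" for i
    by (auto simp: sets_restrict_space_iff)
  have z: "emeasure Rpos (?A j) = 0"
  proof -
    have "emeasure Rpos (?A j) = emeasure lborel ({c} \<inter> {0..})"
      by (subst emeasure_restrict_space) auto
    also have "\<dots> \<le> emeasure lborel {c}" by (intro emeasure_mono) auto
    finally show ?thesis by simp
  qed
  have "emeasure (Rp p) (Pi\<^sub>E {..<p} ?A) = (\<Prod>i<p. emeasure Rpos (?A i))"
    unfolding Rp_def using m by (intro PR.emeasure_PiM) auto
  also have "\<dots> = 0"
    by (rule prod_zero[OF finite_lessThan], rule bexI[of _ j]) (use j z in auto)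
  finally have "Pi\<^sub>E {..<p} ?A \<in> null_sets (Rp p)"
    using box_sets_Rp[OF m] by auto
  then show ?thesis
    by (rule AE_I') (auto simp: space_Rp PiE_iff extensional_def)
qed

lemma AE_Delta: "AE v in Rp p. v \<in> Delta p \<longrightarrow> inj_on (idx p v) {..<p}"
proof -
  have "AE v in Rp p. \<forall>c::nat. \<forall>j\<in>{..<p}. v j \<noteq> 2 * real c"
    by (subst AE_all_countable, intro allI, subst AE_finite_all) (auto intro: AE_component_neq)
  then show ?thesis
  proof eventually_elim
    fix v assume v: "\<forall>c::nat. \<forall>j\<in>{..<p}. v j \<noteq> 2 * real c"
    show "v \<in> Delta p \<longrightarrow> inj_on (idx p v) {..<p}"
    proof
      assume "v \<in> Delta p"
      then obtain k where k: "inj_on k {..<p}" "\<And>j. j < p \<Longrightarrow> v j \<in> {2 * real (k j)..2 * real (k j) + 2}" "v \<in> space (Rp p)"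
        by (auto simp: Delta_def)
      have "v \<in> blk p k"
        unfolding blk_def
      proof (intro CollectI allI impI)
        \<comment> \<open>\<open>Delta\<close> uses closed cells. The only point of such a cell
          outside the half-open one is the right end \<open>2 * real (Suc (k j))\<close>, which is
          excluded by assumption.\<close>
        fix j assume "j < p"
        then show "v j \<in> cell (k j)"
          using k(2)[of j] v[rule_format, of j "Suc (k j)"] by (auto simp: cell_def)
      qed
      then have "idx p v j = k j" if "j < p" for j
        using blk_iff[OF k(3) order_refl, of k] that by (simp add: idx_def)
      then show "inj_on (idx p v) {..<p}" using k(1) by (auto simp: inj_on_def)
    qed
  qed
qed

section \<open>Selecting and permuting coordinates\<close>

lemma permutes_extend:
  fixes e :: "nat \<Rightarrow> nat" and n p :: nat
  assumes e: "inj_on e {..<n}" "e ` {..<n} \<subseteq> {..<p}"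
  obtains \<sigma> where "\<sigma> permutes {..<p}" "\<And>j. j < n \<Longrightarrow> \<sigma> j = e j" "n \<le> p"
proof -
  have np: "n \<le> p" using card_inj_on_le[OF e finite_lessThan] by simp
  have "card ({..<p} - {..<n}) = card ({..<p} - e ` {..<n})"
    using np e by (simp add: card_Diff_subset card_image)
  from finite_same_card_bij[OF _ _ this] obtain g where g: "bij_betw g ({..<p} - {..<n}) ({..<p} - e ` {..<n})"
    by auto
  define \<sigma> where "\<sigma> = (\<lambda>j. if j \<in> {..<n} then e j else if j < p then g j else j)"
  have 1: "bij_betw \<sigma> {..<n} (e ` {..<n})"
    using inj_on_imp_bij_betw[OF e(1)] by (subst bij_betw_cong[of _ _ e]) (auto simp: \<sigma>_def)
  have 2: "bij_betw \<sigma> ({..<p} - {..<n}) ({..<p} - e ` {..<n})"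
    using g by (subst bij_betw_cong[of _ _ g]) (auto simp: \<sigma>_def)
  have "bij_betw \<sigma> ({..<n} \<union> ({..<p} - {..<n})) (e ` {..<n} \<union> ({..<p} - e ` {..<n}))"
    using 1 2 by (rule bij_betw_combine) auto
  moreover have "{..<n} \<union> ({..<p} - {..<n}) = {..<p}" "e ` {..<n} \<union> ({..<p} - e ` {..<n}) = {..<p}"
    using np e by auto
  ultimately have "bij_betw \<sigma> {..<p} {..<p}" by simp
  then have "\<sigma> permutes {..<p}"
    by (rule bij_imp_permutes) (use np in \<open>auto simp: \<sigma>_def\<close>)
  then show thesis by (rule that) (auto simp: \<sigma>_def np)
qed

lemma select_measurable:
  assumes "e ` {..<n} \<subseteq> {..<p}"
  shows "(\<lambda>v. \<lambda>j\<in>{..<n}. v (e j)) \<in> measurable (Rp p) (Rp n)"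
  using assms by (intro measurable_Rp Rp_component) auto

text \<open>By \<open>permutes_extend\<close> the selection is a permutation followed by the
  projection to the first \<open>n\<close> coordinates, and preimages of null sets under both are
  null.\<close>

lemma AE_select:
  assumes e: "inj_on e {..<n}" "e ` {..<n} \<subseteq> {..<p}" and P: "AE w in Rp n. P w"
  shows "AE v in Rp p. P (\<lambda>j\<in>{..<n}. v (e j))"
proof -
  obtain \<sigma> where \<sigma>: "\<sigma> permutes {..<p}" "\<And>j. j < n \<Longrightarrow> \<sigma> j = e j" and np: "n \<le> p"
    using permutes_extend[OF e] by blast
  obtain N where N: "{w\<in>space (Rp n). \<not> P w} \<subseteq> N" "N \<in> null_sets (Rp n)"
    using AE_E[OF P] by (metis null_setsI)
  have [measurable]: "N \<in> sets (Rp n)" using N by auto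
  have [measurable]: "(\<lambda>v. \<lambda>j\<in>{..<n}. v j) \<in> measurable (Rp p) (Rp n)"
    using select_measurable[of "\<lambda>j. j" n p] np by auto
  have [measurable]: "(\<lambda>v. \<lambda>j\<in>{..<n}. v (e j)) \<in> measurable (Rp p) (Rp n)"
    using select_measurable[OF e(2)] .
  have pe: "p = n + (p - n)" using np by simp
  have "(\<integral>\<^sup>+v. indicator N (\<lambda>j\<in>{..<n}. v (e j)) \<partial>Rp p) = (\<integral>\<^sup>+v. indicator N (\<lambda>j\<in>{..<n}. (v \<circ> \<sigma>) j) \<partial>Rp p)"
    by (intro nn_integral_cong arg_cong[where f="indicator N"]) (auto simp: \<sigma>(2))
  also have "\<dots> = (\<integral>\<^sup>+v. indicator N (\<lambda>j\<in>{..<n}. v j) \<partial>distr (Rp p) (Rp p) (\<lambda>v. v \<circ> \<sigma>))"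
    by (subst nn_integral_distr) (auto intro: permute_measurable \<sigma>)
  also have "\<dots> = (\<integral>\<^sup>+v. indicator N (\<lambda>j\<in>{..<n}. v j) \<partial>Rp (n + (p - n)))"
    unfolding law_permute[OF \<sigma>(1)] using np by simp
  also have "\<dots> = (\<integral>\<^sup>+v. indicator N (\<lambda>j\<in>{..<n}. v j) \<partial>distr (Rp n \<Otimes>\<^sub>M Rp (p - n)) (Rp (n + (p - n))) (\<lambda>(u,y). tcat n u (p - n) y))"
    by (simp only: law_tcat)
  also have "\<dots> = (\<integral>\<^sup>+z. indicator N (\<lambda>j\<in>{..<n}. tcat n (fst z) (p - n) (snd z) j) \<partial>(Rp n \<Otimes>\<^sub>M Rp (p - n)))"
    using select_measurable[of "\<lambda>j. j" n "n + (p - n)"] by (subst nn_integral_distr) (auto simp: case_prod_beta' image_subset_iff)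
  also have "\<dots> = (\<integral>\<^sup>+z. indicator N (fst z) \<partial>(Rp n \<Otimes>\<^sub>M Rp (p - n)))"
    by (intro nn_integral_cong arg_cong[where f="indicator N"])
      (auto simp: tcat_def space_pair_measure space_Rp fun_eq_iff PiE_iff extensional_def)
  also have "\<dots> = (\<integral>\<^sup>+u. \<integral>\<^sup>+y. indicator N u \<partial>Rp (p - n) \<partial>Rp n)"
    by (subst Rp.nn_integral_fst[symmetric]) auto
  \<comment> \<open>The discarded variables may have infinite total mass;
    \<open>0 * \<infinity> = 0\<close> in \<open>ennreal\<close> still gives zero off
    \<open>N\<close>.\<close>
  also have "\<dots> = (\<integral>\<^sup>+u. indicator N u * emeasure (Rp (p - n)) (space (Rp (p - n))) \<partial>Rp n)"
    by simp
  also have "\<dots> = 0"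
    using N by (subst nn_integral_0_iff_AE) (auto dest!: AE_not_in split: split_indicator)
  finally have "AE v in Rp p. indicator N (\<lambda>j\<in>{..<n}. v (e j)) = (0::ennreal)"
    by (subst (asm) nn_integral_0_iff_AE) auto
  then show ?thesis
  proof (rule AE_mp, intro AE_I2 impI)
    fix v assume v: "v \<in> space (Rp p)" "indicator N (\<lambda>j\<in>{..<n}. v (e j)) = (0::ennreal)"
    have "(\<lambda>j\<in>{..<n}. v (e j)) \<in> space (Rp n)"
      using measurable_space[OF select_measurable[OF e(2)] v(1)] .
    with N v(2) show "P (\<lambda>j\<in>{..<n}. v (e j))" by (auto split: split_indicator_asm)
  qed
qed

section \<open>Alternating sums and symmetric sums over tuples\<close>

lemma sum_Pow_alternating:
  assumes "finite A"
  shows "(\<Sum>D\<in>Pow A. (-1) ^ card D) = (if A = {} then 1 else 0 :: real)"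
  using assms
proof (induction A rule: finite_induct)
  case (insert a A)
  have "(\<Sum>D\<in>Pow (insert a A). (-1) ^ card D :: real) = (\<Sum>D\<in>Pow A. (-1) ^ card D) + (\<Sum>D\<in>insert a ` Pow A. (-1) ^ card D)"
    unfolding Pow_insert using insert.hyps by (subst sum.union_disjoint) auto
  also have "(\<Sum>D\<in>insert a ` Pow A. (-1) ^ card D :: real) = (\<Sum>D\<in>Pow A. (-1) ^ card (insert a D))"
    using insert.hyps by (subst sum.reindex) (auto simp: inj_on_def)
  also have "\<dots> = (\<Sum>D\<in>Pow A. - ((-1) ^ card D))"
  proof (intro sum.cong refl)
    fix D assume "D \<in> Pow A"
    then have "finite D" "a \<notin> D" using insert.hyps finite_subset by auto
    then show "(-1) ^ card (insert a D) = (- ((-1) ^ card D) :: real)" by simp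
  qed
  finally show ?case by (simp add: sum_negf)
qed simp

text \<open>With \<open>D = T - R\<close> this is the expansion of
  \<open>(1 - 1) ^ card (T - S)\<close>.\<close>

lemma sum_between_alternating:
  assumes "finite T" "S \<subseteq> T"
  shows "(\<Sum>R | S \<subseteq> R \<and> R \<subseteq> T. (-1) ^ (card T - card R)) = (if S = T then 1 else 0 :: real)"
proof -
  have "(\<Sum>R | S \<subseteq> R \<and> R \<subseteq> T. (-1) ^ (card T - card R) :: real) = (\<Sum>D\<in>Pow (T - S). (-1) ^ card D)"
  proof (rule sum.reindex_bij_witness[where i="\<lambda>D. T - D" and j="\<lambda>R. T - R"])
    fix R assume R: "R \<in> {R. S \<subseteq> R \<and> R \<subseteq> T}"
    then have "finite R" using assms(1) finite_subset by blast
    then show "(-1) ^ card (T - R) = ((-1) ^ (card T - card R) :: real)"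
      using R by (simp add: card_Diff_subset)
  qed (use assms in auto)
  also have "\<dots> = (if S = T then 1 else 0)"
    using assms by (subst sum_Pow_alternating) auto
  finally show ?thesis .
qed

text \<open>With this convention
  \<open>pick p (act p \<sigma> k) x = pick p k x \<circ> \<sigma>\<close>, so symmetry of an
  integrand becomes invariance of tuple sums. Restricting to \<open>{..<p}\<close> keeps the result
  in \<open>DN N p\<close>.\<close>

definition act :: "nat \<Rightarrow> (nat \<Rightarrow> nat) \<Rightarrow> (nat \<Rightarrow> nat) \<Rightarrow> nat \<Rightarrow> nat" where
  "act p \<sigma> \<rho> = (\<lambda>j\<in>{..<p}. \<rho> (\<sigma> j))"

lemma act_DN:
  assumes s: "\<sigma> permutes {..<p}" and r: "\<rho> \<in> DN N p"
  shows "act p \<sigma> \<rho> \<in> DN N p"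
proof -
  have lt: "\<sigma> j < p" if "j < p" for j
    using permutes_in_image[OF s, of j] that by simp
  have "inj_on (act p \<sigma> \<rho>) {..<p}"
  proof (rule inj_onI)
    fix i j assume ij: "i \<in> {..<p}" "j \<in> {..<p}" "act p \<sigma> \<rho> i = act p \<sigma> \<rho> j"
    then have "\<rho> (\<sigma> i) = \<rho> (\<sigma> j)" by (simp add: act_def)
    then have "\<sigma> i = \<sigma> j" using inj_onD[OF DN_inj[OF r], of "\<sigma> i" "\<sigma> j"] ij lt by simp
    then show "i = j" using permutes_inj[OF s] by (simp add: inj_eq)
  qed
  then show ?thesis
    using DN_lt[OF r] lt unfolding DN_def act_def by auto
qed

lemma act_image:
  assumes s: "\<sigma> permutes {..<p}" and R: "R \<subseteq> {..<p}"
  shows "act p \<sigma> \<rho> ` R = \<rho> ` \<sigma> ` R"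
  using R by (auto simp: act_def image_iff intro!: bexI)

lemma act_inv:
  assumes s: "\<sigma> permutes {..<p}" and r: "\<rho> \<in> DN N p"
  shows "act p (inv \<sigma>) (act p \<sigma> \<rho>) = \<rho>" "act p \<sigma> (act p (inv \<sigma>) \<rho>) = \<rho>"
proof -
  have lt: "\<sigma> j < p" "inv \<sigma> j < p" if "j < p" for j
    using permutes_in_image[OF s, of j] permutes_in_image[OF permutes_inv[OF s], of j] that by simp_all
  have e: "\<rho> \<in> extensional {..<p}" using r by (simp add: DN_def PiE_iff)
  show "act p (inv \<sigma>) (act p \<sigma> \<rho>) = \<rho>" "act p \<sigma> (act p (inv \<sigma>) \<rho>) = \<rho>"
    using e lt by (auto intro!: extensionalityI[of _ "{..<p}"] simp: act_def permutes_inverses[OF s])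
qed

lemma act_reindex:
  assumes s: "\<sigma> permutes {..<p}"
  shows "(\<Sum>\<rho> | \<rho> \<in> DN N p \<and> P (act p \<sigma> \<rho>). F (act p \<sigma> \<rho>)) = (\<Sum>\<rho> | \<rho> \<in> DN N p \<and> P \<rho>. F \<rho> :: real)"
  by (rule sum.reindex_bij_witness[where j="act p \<sigma>" and i="act p (inv \<sigma>)"])
     (auto simp: act_DN[OF s] act_DN[OF permutes_inv[OF s]] act_inv[OF s])

lemma permutes_initial_segment:
  assumes "R \<subseteq> {..<p}"
  obtains \<sigma> where "\<sigma> permutes {..<p}" "\<sigma> ` {..<card R} = R"
proof -
  have fR: "finite R" using assms finite_subset by auto
  then obtain e where e: "bij_betw e {..<card R} R"
    using ex_bij_betw_nat_finite[of R] by (auto simp: lessThan_atLeast0)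
  then have "inj_on e {..<card R}" "e ` {..<card R} \<subseteq> {..<p}"
    using assms by (auto simp: bij_betw_def)
  from permutes_extend[OF this] obtain \<sigma> where "\<sigma> permutes {..<p}" "\<And>j. j < card R \<Longrightarrow> \<sigma> j = e j"
    by blast
  moreover from this have "\<sigma> ` {..<card R} = e ` {..<card R}" by (intro image_cong) auto
  ultimately show thesis using that e by (simp add: bij_betw_def)
qed

text \<open>Inclusion-exclusion: by symmetry the binomial coefficient becomes a sum over subsets \<open>R\<close> of
  \<open>{..<p}\<close>, and the alternating sum over \<open>R\<close> keeps the tuples with image exactly \<open>A\<close>.\<close>

lemma alternating_tuple_sum:
  fixes \<eta> :: "(nat \<Rightarrow> nat) \<Rightarrow> real"
  assumes sym: "\<And>\<sigma> \<rho>. \<sigma> permutes {..<p} \<Longrightarrow> \<rho> \<in> DN N p \<Longrightarrow> \<eta> (act p \<sigma> \<rho>) = \<eta> \<rho>"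
  shows "(\<Sum>r\<le>p. (-1) ^ (p - r) * real (p choose r) * (\<Sum>\<rho> | \<rho> \<in> DN N p \<and> A \<subseteq> \<rho> ` {..<r}. \<eta> \<rho>)) =
    (\<Sum>\<rho> | \<rho> \<in> DN N p \<and> \<rho> ` {..<p} = A. \<eta> \<rho>)"
proof -
  define C where "C R = (\<Sum>\<rho> | \<rho> \<in> DN N p \<and> A \<subseteq> \<rho> ` R. \<eta> \<rho>)" for R
  \<comment> \<open>Permuting positions carries any \<open>R\<close> to an initial segment, and
    \<open>\<eta>\<close> does not notice, so \<open>C R\<close> depends on \<open>card R\<close>
    only.\<close>
  have C: "C R = C {..<card R}" if R: "R \<subseteq> {..<p}" for R
  proof -
    obtain \<sigma> where s: "\<sigma> permutes {..<p}" "\<sigma> ` {..<card R} = R"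
      by (rule permutes_initial_segment[OF R])
    have le: "{..<card R} \<subseteq> {..<p}" using card_mono[OF finite_lessThan R] by auto
    have "C R = (\<Sum>\<rho> | \<rho> \<in> DN N p \<and> A \<subseteq> act p \<sigma> \<rho> ` {..<card R}. \<eta> (act p \<sigma> \<rho>))"
      unfolding C_def act_image[OF s(1) le] s(2) by (intro sum.cong refl) (simp add: sym s(1))
    also have "\<dots> = C {..<card R}"
      unfolding C_def by (rule act_reindex[OF s(1)])
    finally show ?thesis .
  qed
  have "(\<Sum>r\<le>p. (-1) ^ (p - r) * real (p choose r) * C {..<r}) = (\<Sum>r\<le>p. \<Sum>R | R \<subseteq> {..<p} \<and> card R = r. (-1) ^ (p - card R) * C R)"
  proof (intro sum.cong refl)
    fix r assume "r \<in> {..p}"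
    have "(\<Sum>R | R \<subseteq> {..<p} \<and> card R = r. (-1) ^ (p - card R) * C R) = (\<Sum>R | R \<subseteq> {..<p} \<and> card R = r. (-1) ^ (p - r) * C {..<r})"
      by (intro sum.cong refl) (use C in auto)
    also have "\<dots> = (-1) ^ (p - r) * real (p choose r) * C {..<r}"
      using n_subsets[of "{..<p}" r] by simp
    finally show "(-1) ^ (p - r) * real (p choose r) * C {..<r} = (\<Sum>R | R \<subseteq> {..<p} \<and> card R = r. (-1) ^ (p - card R) * C R)" by simp
  qed
  also have "\<dots> = (\<Sum>r\<le>p. \<Sum>R | R \<in> Pow {..<p} \<and> card R = r. (-1) ^ (p - card R) * C R)"
    by simp
  also have "\<dots> = (\<Sum>R\<in>Pow {..<p}. (-1) ^ (p - card R) * C R)"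
    using card_mono[OF finite_lessThan, of _ p] by (intro sum.group) auto
  also have "\<dots> = (\<Sum>R\<in>Pow {..<p}. \<Sum>\<rho>\<in>DN N p. (-1) ^ (p - card R) * (if A \<subseteq> \<rho> ` R then \<eta> \<rho> else 0))"
  proof (intro sum.cong refl)
    fix R
    have "C R = (\<Sum>\<rho>\<in>DN N p. if A \<subseteq> \<rho> ` R then \<eta> \<rho> else 0)"
      unfolding C_def by (rule sum.inter_filter) simp
    then show "(-1) ^ (p - card R) * C R = (\<Sum>\<rho>\<in>DN N p. (-1) ^ (p - card R) * (if A \<subseteq> \<rho> ` R then \<eta> \<rho> else 0))"
      by (simp only: sum_distrib_left)
  qed
  also have "\<dots> = (\<Sum>\<rho>\<in>DN N p. \<Sum>R\<in>Pow {..<p}. (-1) ^ (p - card R) * (if A \<subseteq> \<rho> ` R then \<eta> \<rho> else 0))"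
    by (rule sum.swap)
  also have "\<dots> = (\<Sum>\<rho>\<in>DN N p. if \<rho> ` {..<p} = A then \<eta> \<rho> else 0)"
  proof (intro sum.cong refl)
    fix \<rho> assume \<rho>: "\<rho> \<in> DN N p"
    have "(\<Sum>R\<in>Pow {..<p}. (-1) ^ (p - card R) * (if A \<subseteq> \<rho> ` R then \<eta> \<rho> else 0)) =
        (\<Sum>R\<in>Pow {..<p}. if A \<subseteq> \<rho> ` R then (-1) ^ (p - card R) * \<eta> \<rho> else 0)"
      by (intro sum.cong refl) simp
    also have "\<dots> = (\<Sum>R | R \<in> Pow {..<p} \<and> A \<subseteq> \<rho> ` R. (-1) ^ (p - card R) * \<eta> \<rho>)"
      by (subst sum.inter_filter[symmetric]) auto
    also have "\<dots> = (if \<rho> ` {..<p} = A then \<eta> \<rho> else 0)"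
    proof (cases "A \<subseteq> \<rho> ` {..<p}")
      case False
      then have e: "{R. R \<in> Pow {..<p} \<and> A \<subseteq> \<rho> ` R} = {}" by blast
      have "\<rho> ` {..<p} \<noteq> A" using False by blast
      then show ?thesis unfolding e by simp
    next
      case True
      \<comment> \<open>The positions that hold elements of \<open>A\<close>. Since
        \<open>\<rho>\<close> is injective, its values on \<open>R\<close> cover \<open>A\<close>
        exactly when \<open>R\<close> contains \<open>?S\<close>; the alternating sum then forces
        \<open>?S\<close> to be everything.\<close>
      let ?S = "{j\<in>{..<p}. \<rho> j \<in> A}"
      have inj: "inj_on \<rho> {..<p}" by (rule DN_inj[OF \<rho>])
      have eq: "{R. R \<in> Pow {..<p} \<and> A \<subseteq> \<rho> ` R} = {R. ?S \<subseteq> R \<and> R \<subseteq> {..<p}}"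
      proof (intro set_eqI iffI)
        fix R assume R: "R \<in> {R. R \<in> Pow {..<p} \<and> A \<subseteq> \<rho> ` R}"
        have "j \<in> R" if "j \<in> ?S" for j
        proof -
          from that R obtain i where "i \<in> R" "\<rho> i = \<rho> j" by auto
          with inj_onD[OF inj, of i j] that R show ?thesis by auto
        qed
        with R show "R \<in> {R. ?S \<subseteq> R \<and> R \<subseteq> {..<p}}" by auto
      next
        fix R assume R: "R \<in> {R. ?S \<subseteq> R \<and> R \<subseteq> {..<p}}"
        have "a \<in> \<rho> ` R" if "a \<in> A" for a
        proof -
          from that True obtain j where "j \<in> {..<p}" "a = \<rho> j" by auto
          with R that show ?thesis by auto
        qed
        with R show "R \<in> {R. R \<in> Pow {..<p} \<and> A \<subseteq> \<rho> ` R}" by auto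
      qed
      have "(\<Sum>R | R \<in> Pow {..<p} \<and> A \<subseteq> \<rho> ` R. (-1) ^ (p - card R) * \<eta> \<rho>) =
         (\<Sum>R | ?S \<subseteq> R \<and> R \<subseteq> {..<p}. (-1) ^ (card {..<p} - card R)) * \<eta> \<rho>"
        unfolding eq by (simp add: sum_distrib_right)
      also have "\<dots> = (if ?S = {..<p} then 1 else 0) * \<eta> \<rho>"
        by (subst sum_between_alternating) auto
      also have "?S = {..<p} \<longleftrightarrow> \<rho> ` {..<p} = A" using True by auto
      finally show ?thesis by simp
    qed
    finally show "(\<Sum>R\<in>Pow {..<p}. (-1) ^ (p - card R) * (if A \<subseteq> \<rho> ` R then \<eta> \<rho> else 0)) = (if \<rho> ` {..<p} = A then \<eta> \<rho> else 0)" .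
  qed
  also have "\<dots> = (\<Sum>\<rho> | \<rho> \<in> DN N p \<and> \<rho> ` {..<p} = A. \<eta> \<rho>)"
    by (subst sum.inter_filter[symmetric]) auto
  finally show ?thesis by (simp add: C_def)
qed

text \<open>Once a bijection \<open>e\<close> is fixed, every other one is a permutation of
  \<open>A\<close> after \<open>e\<close>.\<close>

lemma card_bij_extensional:
  assumes I: "finite I" and A: "finite A" and c: "card I = card A"
  shows "card {k \<in> extensional I. bij_betw k I A} = fact (card A)"
proof -
  obtain e where e: "bij_betw e I A" using finite_same_card_bij[OF I A c] by auto
  let ?f = "\<lambda>\<sigma>. restrict (\<sigma> \<circ> e) I"
  have eI: "e i \<in> A" if "i \<in> I" for i using e that by (auto simp: bij_betw_def)
  have surj: "\<exists>i\<in>I. a = e i" if "a \<in> A" for a using e that by (auto simp: bij_betw_def)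
  have "bij_betw ?f {\<sigma>. \<sigma> permutes A} {k \<in> extensional I. bij_betw k I A}"
  proof (rule bij_betwI')
    fix \<sigma> \<tau> assume st: "\<sigma> \<in> {\<sigma>. \<sigma> permutes A}" "\<tau> \<in> {\<sigma>. \<sigma> permutes A}"
    show "(?f \<sigma> = ?f \<tau>) = (\<sigma> = \<tau>)"
    proof
      assume eq: "?f \<sigma> = ?f \<tau>"
      show "\<sigma> = \<tau>"
      proof
        fix a
        show "\<sigma> a = \<tau> a"
        proof (cases "a \<in> A")
          case True
          then obtain i where i: "i \<in> I" "a = e i" using surj by blast
          with fun_cong[OF eq, of i] show ?thesis by simp
        next
          case False
          with st show ?thesis by (simp add: permutes_not_in)
        qed
      qed
    qed simp
  next
    fix \<sigma> assume "\<sigma> \<in> {\<sigma>. \<sigma> permutes A}"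
    then have "bij_betw (\<sigma> \<circ> e) I A"
      by (intro bij_betw_trans[OF e]) (simp add: permutes_imp_bij)
    then show "?f \<sigma> \<in> {k \<in> extensional I. bij_betw k I A}"
      by (subst (asm) bij_betw_cong[of I _ "?f \<sigma>"]) auto
  next
    fix k assume k: "k \<in> {k \<in> extensional I. bij_betw k I A}"
    define \<sigma> where "\<sigma> a = (if a \<in> A then k (inv_into I e a) else a)" for a
    have "bij_betw (k \<circ> inv_into I e) A A"
      using k by (intro bij_betw_trans[OF bij_betw_inv_into[OF e]]) simp
    then have "bij_betw \<sigma> A A"
      by (subst (asm) bij_betw_cong[of A _ \<sigma>]) (auto simp: \<sigma>_def)
    then have "\<sigma> permutes A" by (rule bij_imp_permutes) (simp add: \<sigma>_def)
    moreover have "k = ?f \<sigma>"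
      using k e by (intro extensionalityI[of _ I]) (auto simp: \<sigma>_def eI bij_betw_def)
    ultimately show "\<exists>\<sigma>\<in>{\<sigma>. \<sigma> permutes A}. k = ?f \<sigma>" by blast
  qed
  then have "card {k \<in> extensional I. bij_betw k I A} = card {\<sigma>. \<sigma> permutes A}"
    by (rule bij_betw_same_card[symmetric])
  also have "\<dots> = fact (card A)" using A by (simp add: card_permutations)
  finally show ?thesis .
qed

lemma DN_image_eq:
  assumes "A \<subseteq> {..<N}"
  shows "{k \<in> DN N p. k ` {..<p} = A} = {k \<in> extensional {..<p}. bij_betw k {..<p} A}"
  using assms by (auto simp: DN_def PiE_iff bij_betw_def)

lemma card_DN_image:
  assumes "A \<subseteq> {..<N}"
  shows "card {k \<in> DN N p. k ` {..<p} = A} = (if card A = p then fact p else 0)"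
proof (cases "card A = p")
  case True
  then show ?thesis
    unfolding DN_image_eq[OF assms] using assms finite_subset[OF assms]
    by (subst card_bij_extensional) auto
next
  case False
  then have "{k \<in> DN N p. k ` {..<p} = A} = {}"
    using card_image[OF DN_inj, of _ N p] by auto
  with False show ?thesis by simp
qed

text \<open>As \<open>\<phi>\<close> depends only on the coordinates listed by
  \<open>\<kappa>\<close>, it is a function of the first \<open>r\<close> arguments and can be
  absorbed into \<open>B\<close>; then \<open>slice_sum\<close> applies.\<close>

lemma slice_weight_sum:
  fixes B \<phi> :: "(nat \<Rightarrow> real) \<Rightarrow> real"
  assumes k: "\<kappa> \<in> DN N r" and [measurable]: "B \<in> borel_measurable (Rp (r + q))"
    and i: "integrable (Rp (r + q)) (\<lambda>v. indicator (blk r \<kappa>) v * B v)"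
    and van: "AE v in Rp (r + q). v \<in> blk r \<kappa> \<longrightarrow> B v \<noteq> 0 \<longrightarrow> (\<exists>\<rho>\<in>DN N (r + q). v \<in> blk (r + q) \<rho>)"
    and \<phi>: "bmeas \<phi>" "dep (\<kappa> ` {..<r}) \<phi>"
  shows "(\<integral>x. (\<integral>y. B (tcat r (pick r \<kappa> x) q y) \<partial>Rp q) * \<phi> x \<partial>Q) =
    2^q * (\<Sum>\<rho> | \<rho> \<in> DN N (r + q) \<and> (\<forall>j<r. \<rho> j = \<kappa> j). \<integral>x. B (pick (r + q) \<rho> x) * \<phi> x \<partial>Q)"
proof -
  \<comment> \<open>Recovers from the arguments a point of \<open>space Q\<close> with the right
    coordinates at the indices of \<open>\<kappa>\<close>. The left end \<open>2 * real i\<close> is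
    a default: it keeps \<open>lift v\<close> in \<open>space Q\<close> at all other indices and
    when an argument is outside its cell.\<close>
  define lift :: "(nat \<Rightarrow> real) \<Rightarrow> nat \<Rightarrow> real" where
    "lift v = (\<lambda>i. if i \<in> \<kappa> ` {..<r} \<and> v (the_inv_into {..<r} \<kappa> i) \<in> cell i then v (the_inv_into {..<r} \<kappa> i) else 2 * real i)" for v
  have inv: "the_inv_into {..<r} \<kappa> (\<kappa> j) = j" if "j < r" for j
    using DN_inj[OF k] that by (intro the_inv_into_f_f) auto
  have lift_space: "lift v \<in> space Q" for v
    by (auto simp: lift_def space_Q cell_def)
  have lift_m: "lift \<in> measurable (Rp (r + q)) Q"
    unfolding Q_def
  proof (rule measurable_PiM_single')
    fix i :: nat
    show "(\<lambda>v. lift v i) \<in> measurable (Rp (r + q)) (Qc i)"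
    proof (subst measurable_cong_sets[OF refl sets_Qc], rule measurable_restrict_space2)
      show "(\<lambda>v. lift v i) \<in> space (Rp (r + q)) \<rightarrow> cell i"
        using lift_space by (auto simp: space_Q)
      show "(\<lambda>v. lift v i) \<in> borel_measurable (Rp (r + q))"
      proof (cases "i \<in> \<kappa> ` {..<r}")
        case True
        then obtain j where "j < r" "i = \<kappa> j" by auto
        then have e: "(\<lambda>v. lift v i) = (\<lambda>v. if v j \<in> cell i then v j else 2 * real i)"
          by (auto simp: lift_def inv)
        have [measurable]: "(\<lambda>v. v j) \<in> borel_measurable (Rp (r + q))"
          using \<open>j < r\<close> by simp
        show ?thesis unfolding e by measurable
      qed (simp add: lift_def)
    qed
  qed (use lift_space in \<open>auto simp: space_Q PiE_iff\<close>)
  have \<phi>_lift: "\<phi> (lift v) = \<phi> x" if x: "x \<in> space Q" and v: "\<And>j. j < r \<Longrightarrow> v j = x (\<kappa> j)" for x v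
  proof (rule depD[OF \<phi>(2) lift_space x])
    fix i assume "i \<in> \<kappa> ` {..<r}"
    then obtain j where "j < r" "i = \<kappa> j" by auto
    then show "lift v i = x i" using x v[of j] by (auto simp: lift_def inv space_Q)
  qed
  have [measurable]: "\<phi> \<in> borel_measurable Q" using \<phi>(1) by (rule bmeas_measurable)
  have m: "(\<lambda>v. B v * \<phi> (lift v)) \<in> borel_measurable (Rp (r + q))"
    by (intro borel_measurable_times measurable_compose[OF lift_m]) auto
  obtain c where c: "\<And>x. x \<in> space Q \<Longrightarrow> \<bar>\<phi> x\<bar> \<le> c"
    using bmeasE[OF \<phi>(1)] by blast
  have int: "integrable (Rp (r + q)) (\<lambda>v. indicator (blk r \<kappa>) v * (B v * \<phi> (lift v)))"
  proof (rule Bochner_Integration.integrable_bound)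
    show "integrable (Rp (r + q)) (\<lambda>v. c * (indicator (blk r \<kappa>) v * B v))" using i by simp
    have "norm (indicator (blk r \<kappa>) v * (B v * \<phi> (lift v))) \<le> norm (c * (indicator (blk r \<kappa>) v * B v))" for v
    proof -
      have "\<bar>\<phi> (lift v)\<bar> \<le> \<bar>c\<bar>" using c[OF lift_space, of v] by linarith
      then have "\<bar>indicator (blk r \<kappa>) v * B v\<bar> * \<bar>\<phi> (lift v)\<bar> \<le> \<bar>indicator (blk r \<kappa>) v * B v\<bar> * \<bar>c\<bar>"
        by (intro mult_left_mono) auto
      then show ?thesis by (simp add: abs_mult mult_ac)
    qed
    then show "AE v in Rp (r + q). norm (indicator (blk r \<kappa>) v * (B v * \<phi> (lift v))) \<le> norm (c * (indicator (blk r \<kappa>) v * B v))"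
      by simp
  qed (use m in measurable)
  have "(\<integral>x. (\<integral>y. B (tcat r (pick r \<kappa> x) q y) \<partial>Rp q) * \<phi> x \<partial>Q) =
     (\<integral>x. \<integral>y. B (tcat r (pick r \<kappa> x) q y) * \<phi> (lift (tcat r (pick r \<kappa> x) q y)) \<partial>Rp q \<partial>Q)"
  proof (intro Bochner_Integration.integral_cong refl)
    fix x assume x: "x \<in> space Q"
    have "\<phi> (lift (tcat r (pick r \<kappa> x) q y)) = \<phi> x" for y
      by (rule \<phi>_lift[OF x]) (simp add: tcat_def pick_def)
    then show "(\<integral>y. B (tcat r (pick r \<kappa> x) q y) \<partial>Rp q) * \<phi> x =
        (\<integral>y. B (tcat r (pick r \<kappa> x) q y) * \<phi> (lift (tcat r (pick r \<kappa> x) q y)) \<partial>Rp q)"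
      by simp
  qed
  also have "\<dots> = 2^q * (\<Sum>\<rho> | \<rho> \<in> DN N (r + q) \<and> (\<forall>j<r. \<rho> j = \<kappa> j). \<integral>x. B (pick (r + q) \<rho> x) * \<phi> (lift (pick (r + q) \<rho> x)) \<partial>Q)"
    by (rule slice_sum[OF k m int]) (use van in auto)
  also have "\<dots> = 2^q * (\<Sum>\<rho> | \<rho> \<in> DN N (r + q) \<and> (\<forall>j<r. \<rho> j = \<kappa> j). \<integral>x. B (pick (r + q) \<rho> x) * \<phi> x \<partial>Q)"
  proof (intro arg_cong2[where f="(*)"] sum.cong refl Bochner_Integration.integral_cong)
    fix \<rho> x assume "\<rho> \<in> {\<rho> \<in> DN N (r + q). \<forall>j<r. \<rho> j = \<kappa> j}" and x: "x \<in> space Q"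
    then show "\<phi> (lift (pick (r + q) \<rho> x)) = \<phi> x"
      by (intro \<phi>_lift x) (auto simp: pick_def)
  qed
  finally show ?thesis .
qed

section \<open>Truncated multiple integrals\<close>

text \<open>\<open>2 * real N\<close> is the right end of the last of the first \<open>N\<close>
  cells.\<close>

definition trunc :: "nat \<Rightarrow> nat \<Rightarrow> ((nat \<Rightarrow> real) \<Rightarrow> real) \<Rightarrow> (nat \<Rightarrow> real) \<Rightarrow> real" where
  "trunc N p h v = (if \<forall>j<p. v j < 2 * real N then h v else 0)"

text \<open>The defining formula applied to \<open>trunc N p h\<close>: tuples with an index
  \<open>N\<close> or larger contribute nothing, so the sums over \<open>k\<close> are finite.
  \<open>J_trunc\<close> confirms the agreement.\<close>

definition JN :: "nat \<Rightarrow> nat \<Rightarrow> ((nat \<Rightarrow> real) \<Rightarrow> real) \<Rightarrow> (nat \<Rightarrow> real) \<Rightarrow> real" where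
  "JN N p h x = (\<Sum>r\<le>p. (-1) ^ (p - r) / 2 ^ (p - r) * real (p choose r) *
     (\<Sum>k\<in>DN N r. \<integral>y. trunc N p h (tcat r (pick r k x) (p - r) y) \<partial>Rp (p - r)))"

lemma box_pred: "Measurable.pred (Rp p) (\<lambda>v. \<forall>j<p. v j < c)"
proof -
  have "Measurable.pred (Rp p) (\<lambda>v. \<forall>j\<in>{..<p}. v j < c)"
    by (intro pred_intros_finite borel_measurable_less Rp_component_borel) auto
  then show ?thesis by (simp add: Ball_def)
qed

lemma trunc_measurable [measurable (raw)]:
  "h \<in> borel_measurable (Rp p) \<Longrightarrow> trunc N p h \<in> borel_measurable (Rp p)"
  unfolding trunc_def[abs_def] by (rule measurable_If[OF _ _ box_pred[unfolded pred_def]]) simp_all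

lemma box_blk:
  assumes v: "v \<in> space (Rp p)" and inj: "inj_on (idx p v) {..<p}" and lt: "\<forall>j<p. v j < 2 * real N"
  shows "idx p v \<in> DN N p"
proof -
  have "idx p v j < N" if j: "j < p" for j
  proof -
    have "v j < 2 * real N" "0 \<le> v j" using lt v j by (auto simp: space_Rp PiE_iff)
    then have "\<lfloor>v j / 2\<rfloor> < int N" by (simp add: floor_less_iff)
    then show ?thesis using j \<open>0 \<le> v j\<close> by (simp add: idx_def nat_less_iff)
  qed
  with inj show ?thesis by (auto simp: DN_def idx_def PiE_iff)
qed

lemma trunc_pick:
  assumes "k \<in> DN N p" "x \<in> space Q" shows "trunc N p h (pick p k x) = h (pick p k x)"
proof -
  have "x (k j) < 2 * real N" if "j < p" for j
  proof -
    have "real (k j) + 1 \<le> real N" using DN_lt[OF assms(1) that] by simp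
    moreover have "x (k j) < 2 * real (k j) + 2" using assms(2) by (simp add: space_Q cell_def)
    ultimately show ?thesis by linarith
  qed
  then show ?thesis by (simp add: trunc_def pick_def)
qed

lemma L2_hat_measurable: "f \<in> L2_hat p \<Longrightarrow> f \<in> borel_measurable (Rp p)"
  by (simp add: L2_hat_def sq_integrable_def)

lemma L2_hat_square: "f \<in> L2_hat p \<Longrightarrow> integrable (Rp p) (\<lambda>v. (f v)\<^sup>2)"
  by (simp add: L2_hat_def sq_integrable_def)

lemma L2_hat_inj:
  assumes "f \<in> L2_hat p" shows "AE v in Rp p. f v \<noteq> 0 \<longrightarrow> inj_on (idx p v) {..<p}"
proof -
  have "AE v in Rp p. v \<notin> Delta p \<longrightarrow> f v = 0" using assms by (simp add: L2_hat_def)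
  with AE_Delta show ?thesis by eventually_elim blast
qed

lemma L2_hat_sym:
  assumes "f \<in> L2_hat p" "\<sigma> permutes {..<p}" shows "AE x in Rp p. f (x \<circ> \<sigma>) = f x"
  using assms by (simp add: L2_hat_def)

lemma integrable_box: "integrable (Rp p) (\<lambda>v. if \<forall>j<p. v j < c then 1 else 0 :: real)"
proof -
  have s: "{v\<in>space (Rp p). \<forall>j<p. v j < c} \<in> sets (Rp p)"
    using box_pred[of p c] unfolding pred_def .
  have e: "{v\<in>space (Rp p). \<forall>j<p. v j < c} = Pi\<^sub>E {..<p} (\<lambda>_. {0..<c})"
    by (intro set_eqI) (force simp: space_Rp PiE_iff)
  have m: "{0..<c} \<in> sets Rpos" by (auto simp: sets_restrict_space_iff)
  have "emeasure Rpos {0..<c} = ennreal (max 0 c)"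
    by (subst emeasure_restrict_space) (auto simp: max_def)
  then have "(\<Prod>i<p. emeasure Rpos {0..<c}) < \<infinity>"
    by (simp add: power_less_top_ennreal)
  moreover have "emeasure (Rp p) {v\<in>space (Rp p). \<forall>j<p. v j < c} = (\<Prod>i<p. emeasure Rpos {0..<c})"
    unfolding e unfolding Rp_def using m by (intro PR.emeasure_PiM) auto
  ultimately have "integrable (Rp p) (indicator {v\<in>space (Rp p). \<forall>j<p. v j < c} :: _ \<Rightarrow> real)"
    using s by (intro integrable_real_indicator) auto
  then show ?thesis
    by (rule Bochner_Integration.integrable_cong[THEN iffD1, rotated 2]) (auto split: split_indicator)
qed

lemma trunc_L2_hat:
  assumes f: "f \<in> L2_hat p"
  shows "trunc N p f \<in> L2_hat p" "integrable (Rp p) (trunc N p f)"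
proof -
  note [measurable] = L2_hat_measurable[OF f]
  show "integrable (Rp p) (trunc N p f)"
  proof (rule Bochner_Integration.integrable_bound)
    show "integrable (Rp p) (\<lambda>v. (if \<forall>j<p. v j < 2 * real N then 1 else 0 :: real) + (f v)\<^sup>2)"
      using L2_hat_square[OF f] integrable_box by (rule Bochner_Integration.integrable_add[rotated])
    \<comment> \<open>On a box of finite measure square integrability implies integrability, by this
      bound with \<open>1\<close> replaced by the indicator of the box.\<close>
    have "\<bar>t\<bar> \<le> 1 + t\<^sup>2" for t :: real
      using sum_squares_ge_zero[of "\<bar>t\<bar> - 1" 0] zero_le_power2[of "\<bar>t\<bar> - 1"] by (simp add: power2_eq_square algebra_simps)
    then show "AE v in Rp p. norm (trunc N p f v) \<le> norm ((if \<forall>j<p. v j < 2 * real N then 1 else 0 :: real) + (f v)\<^sup>2)"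
      by (auto simp: trunc_def)
  qed measurable
  have "integrable (Rp p) (\<lambda>v. (trunc N p f v)\<^sup>2)"
    by (rule Bochner_Integration.integrable_bound[OF L2_hat_square[OF f]]) (auto simp: trunc_def)
  moreover have "AE x in Rp p. trunc N p f (x \<circ> \<sigma>) = trunc N p f x" if s: "\<sigma> permutes {..<p}" for \<sigma>
    using L2_hat_sym[OF f s]
  proof eventually_elim
    fix x assume "f (x \<circ> \<sigma>) = f x"
    moreover have "(\<forall>j<p. (x \<circ> \<sigma>) j < 2 * real N) = (\<forall>j<p. x j < 2 * real N)"
    proof (intro iffI allI impI)
      fix j assume a: "\<forall>j<p. (x \<circ> \<sigma>) j < 2 * real N" "j < p"
      have "inv \<sigma> j < p" using permutes_in_image[OF permutes_inv[OF s], of j] a(2) by simp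
      with a(1) show "x j < 2 * real N" by (auto simp: permutes_inverses[OF s] dest!: spec[of _ "inv \<sigma> j"])
    next
      fix j assume a: "\<forall>j<p. x j < 2 * real N" "j < p"
      then show "(x \<circ> \<sigma>) j < 2 * real N" using permutes_in_image[OF s, of j] by simp
    qed
    ultimately show "trunc N p f (x \<circ> \<sigma>) = trunc N p f x" unfolding trunc_def by (simp only:)
  qed
  moreover have "AE v in Rp p. v \<notin> Delta p \<longrightarrow> trunc N p f v = 0"
    using f by (auto simp: L2_hat_def trunc_def elim!: eventually_mono)
  ultimately show "trunc N p f \<in> L2_hat p"
    by (simp add: L2_hat_def sq_integrable_def)
qed

lemma pick_square_integrable:
  assumes f: "f \<in> L2_hat p" and k: "inj_on k {..<p}"
  shows "integrable Q (\<lambda>x. (f (pick p k x))\<^sup>2)" "integrable Q (\<lambda>x. f (pick p k x))"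
proof -
  note [measurable] = L2_hat_measurable[OF f]
  have "integrable (Rp p) (\<lambda>v. indicator (blk p k) v * (f v)\<^sup>2)"
    by (rule Bochner_Integration.integrable_bound[OF L2_hat_square[OF f]]) (auto split: split_indicator)
  then show "integrable Q (\<lambda>x. (f (pick p k x))\<^sup>2)"
    using integrable_pick_iff[OF k, of "\<lambda>v. (f v)\<^sup>2"] by simp
  then show "integrable Q (\<lambda>x. f (pick p k x))"
    by (rule Q.square_integrable_imp_integrable[rotated]) measurable
qed

lemma pick_act:
  assumes "\<sigma> permutes {..<p}"
  shows "pick p (act p \<sigma> k) x = pick p k x \<circ> \<sigma>"
proof
  fix j
  show "pick p (act p \<sigma> k) x j = (pick p k x \<circ> \<sigma>) j"
    using permutes_in_image[OF assms, of j] by (auto simp: pick_def act_def)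
qed

lemma AE_pick_sym:
  assumes f: "f \<in> L2_hat p" and s: "\<sigma> permutes {..<p}" and k: "inj_on k {..<p}"
  shows "AE x in Q. f (pick p (act p \<sigma> k) x) = f (pick p k x)"
  unfolding pick_act[OF s] by (rule AE_pick[OF k L2_hat_sym[OF f s]])

lemma trunc_slice:
  assumes f: "f \<in> L2_hat (r + q)" and k: "k \<in> DN N r"
  shows "integrable (Q \<Otimes>\<^sub>M Rp q) (\<lambda>(x,y). trunc N (r + q) f (tcat r (pick r k x) q y))"
    and "integrable (Rp (r + q)) (\<lambda>v. indicator (blk r k) v * trunc N (r + q) f v)"
proof -
  note [measurable] = L2_hat_measurable[OF f]
  show "integrable (Rp (r + q)) (\<lambda>v. indicator (blk r k) v * trunc N (r + q) f v)"
    by (rule Bochner_Integration.integrable_bound[OF trunc_L2_hat(2)[OF f, of N]]) (auto split: split_indicator)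
  then show "integrable (Q \<Otimes>\<^sub>M Rp q) (\<lambda>(x,y). trunc N (r + q) f (tcat r (pick r k x) q y))"
    using integrable_slice_iff[OF DN_inj[OF k], of "trunc N (r + q) f" q] by simp
qed

lemma trunc_slice_integrable:
  assumes f: "f \<in> L2_hat p" and k: "k \<in> DN N r" and r: "r \<le> p"
  shows "integrable Q (\<lambda>x. \<integral>y. trunc N p f (tcat r (pick r k x) (p - r) y) \<partial>Rp (p - r))"
  using QR.integrable_fst'[OF trunc_slice(1)[of f r "p - r" k N]] f k r by simp

lemma trunc_slice_dep:
  "dep (k ` {..<r}) (\<lambda>x. \<integral>y. trunc N p f (tcat r (pick r k x) q y) \<partial>Rp q)"
  unfolding dep_def
proof (intro ballI impI)
  fix x y :: "nat \<Rightarrow> real" assume "\<forall>j\<in>k ` {..<r}. x j = y j"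
  then have "pick r k x = pick r k y" by (auto simp: pick_def)
  then show "(\<integral>z. trunc N p f (tcat r (pick r k x) q z) \<partial>Rp q) = (\<integral>z. trunc N p f (tcat r (pick r k y) q z) \<partial>Rp q)"
    by simp
qed

lemma JN_integrable: "f \<in> L2_hat p \<Longrightarrow> integrable Q (JN N p f)"
  unfolding JN_def[abs_def]
  by (intro Bochner_Integration.integrable_sum Bochner_Integration.integrable_mult_right trunc_slice_integrable) auto

lemma JN_dep: "dep {..<N} (JN N p f)"
  unfolding dep_def
proof (intro ballI impI)
  fix x y :: "nat \<Rightarrow> real" assume xy: "\<forall>j\<in>{..<N}. x j = y j"
  have "pick r k x = pick r k y" if "k \<in> DN N r" for r k
    using xy DN_lt[OF that] by (auto simp: pick_def)
  then show "JN N p f x = JN N p f y" by (simp add: JN_def)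
qed

text \<open>If \<open>A\<close> has an index outside the image of \<open>k\<close>, only
  \<open>\<phi>\<close> sees it and the pairing vanishes. Otherwise \<open>\<phi>\<close> is a
  function of the listed coordinates and \<open>slice_weight_sum\<close> expands the integral over
  \<open>y\<close> into a sum over further cells.\<close>

lemma slice_pure:
  assumes f: "f \<in> L2_hat p" and A: "pure A \<phi>" and k: "k \<in> DN N r" and r: "r \<le> p"
  shows "(\<integral>x. (\<integral>y. trunc N p f (tcat r (pick r k x) (p - r) y) \<partial>Rp (p - r)) * \<phi> x \<partial>Q) =
    (if A \<subseteq> k ` {..<r} then 2 ^ (p - r) * (\<Sum>\<rho> | \<rho> \<in> DN N p \<and> restrict \<rho> {..<r} = k. \<integral>x. f (pick p \<rho> x) * \<phi> x \<partial>Q) else 0)"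
proof (cases "A \<subseteq> k ` {..<r}")
  case False
  then obtain j where "j \<in> A" "j \<notin> k ` {..<r}" by blast
  then have "(\<integral>x. (\<integral>y. trunc N p f (tcat r (pick r k x) (p - r) y) \<partial>Rp (p - r)) * \<phi> x \<partial>Q) = 0"
    by (rule pure_orthogonal[OF A _ _ trunc_slice_dep trunc_slice_integrable[OF f k r]])
  with False show ?thesis by simp
next
  case True
  obtain q where p: "p = r + q" using r by (auto simp: le_iff_add)
  note [measurable] = L2_hat_measurable[OF f]
  have van: "AE v in Rp (r + q). v \<in> blk r k \<longrightarrow> trunc N (r + q) f v \<noteq> 0 \<longrightarrow> (\<exists>\<rho>\<in>DN N (r + q). v \<in> blk (r + q) \<rho>)"
    using L2_hat_inj[OF f[unfolded p]]
  proof (rule AE_mp, intro AE_I2 impI)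
    fix v assume v: "v \<in> space (Rp (r + q))" "f v \<noteq> 0 \<longrightarrow> inj_on (idx (r + q) v) {..<r + q}" "trunc N (r + q) f v \<noteq> 0"
    then have "idx (r + q) v \<in> DN N (r + q)"
      by (intro box_blk) (auto simp: trunc_def split: if_split_asm)
    with blk_idx[OF v(1)] show "\<exists>\<rho>\<in>DN N (r + q). v \<in> blk (r + q) \<rho>" by blast
  qed
  have eq: "{\<rho>. \<rho> \<in> DN N (r + q) \<and> (\<forall>j<r. \<rho> j = k j)} = {\<rho>. \<rho> \<in> DN N (r + q) \<and> restrict \<rho> {..<r} = k}"
    using k by (auto simp: DN_def PiE_iff extensional_def fun_eq_iff restrict_def)
  have "(\<integral>x. (\<integral>y. trunc N (r + q) f (tcat r (pick r k x) q y) \<partial>Rp q) * \<phi> x \<partial>Q) =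
    2^q * (\<Sum>\<rho> | \<rho> \<in> DN N (r + q) \<and> (\<forall>j<r. \<rho> j = k j). \<integral>x. trunc N (r + q) f (pick (r + q) \<rho> x) * \<phi> x \<partial>Q)"
    using A True trunc_slice(2)[of f r q k N] f k p
    by (intro slice_weight_sum van trunc_measurable L2_hat_measurable) (auto simp: pure_def elim: dep_mono)
  also have "\<dots> = 2^q * (\<Sum>\<rho> | \<rho> \<in> DN N (r + q) \<and> (\<forall>j<r. \<rho> j = k j). \<integral>x. f (pick (r + q) \<rho> x) * \<phi> x \<partial>Q)"
    by (intro arg_cong2[where f="(*)"] sum.cong refl Bochner_Integration.integral_cong) (auto simp: trunc_pick)
  finally show ?thesis using True unfolding eq p by simp
qed

text \<open>The factor \<open>2 ^ (p - r)\<close> of \<open>slice_pure\<close> cancels the power of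
  two in the definition, which leaves the sum of \<open>alternating_tuple_sum\<close>. Thus the
  Lebesgue terms of the definition serve to project onto the components of order exactly
  \<open>p\<close>.\<close>

lemma JN_pure:
  assumes f: "f \<in> L2_hat p" and A: "pure A \<phi>"
  shows "(\<integral>x. JN N p f x * \<phi> x \<partial>Q) = (\<Sum>k | k \<in> DN N p \<and> k ` {..<p} = A. \<integral>x. f (pick p k x) * \<phi> x \<partial>Q)"
proof -
  define \<eta> where "\<eta> k = (\<integral>x. f (pick p k x) * \<phi> x \<partial>Q)" for k
  note [measurable] = L2_hat_measurable[OF f]
  have b: "bmeas \<phi>" using A by (simp add: pure_def)
  have [measurable]: "\<phi> \<in> borel_measurable Q" using b by (rule bmeas_measurable)
  let ?G = "\<lambda>r k x. \<integral>y. trunc N p f (tcat r (pick r k x) (p - r) y) \<partial>Rp (p - r)"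
  have iG: "integrable Q (\<lambda>x. ?G r k x * \<phi> x)" if "r \<le> p" "k \<in> DN N r" for r k
    using trunc_slice_integrable[OF f that(2,1)] by (rule bmeas_integrable_mult[OF b])
  have "(\<integral>x. JN N p f x * \<phi> x \<partial>Q) = (\<integral>x. (\<Sum>r\<le>p. \<Sum>k\<in>DN N r. (-1) ^ (p - r) / 2 ^ (p - r) * real (p choose r) * (?G r k x * \<phi> x)) \<partial>Q)"
    by (intro Bochner_Integration.integral_cong refl) (simp add: JN_def sum_distrib_left sum_distrib_right mult_ac)
  also have "\<dots> = (\<Sum>r\<le>p. \<Sum>k\<in>DN N r. (-1) ^ (p - r) / 2 ^ (p - r) * real (p choose r) * (\<integral>x. ?G r k x * \<phi> x \<partial>Q))"
    using iG by (subst Bochner_Integration.integral_sum; (intro Bochner_Integration.integrable_sum sum.cong refl)?; (subst Bochner_Integration.integral_sum)?)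
       (auto intro!: integrable_mult_right)
  also have "\<dots> = (\<Sum>r\<le>p. (-1) ^ (p - r) * real (p choose r) * (\<Sum>k\<in>DN N r. if A \<subseteq> k ` {..<r} then (\<Sum>\<rho> | \<rho> \<in> DN N p \<and> restrict \<rho> {..<r} = k. \<eta> \<rho>) else 0))"
    unfolding sum_distrib_left
    by (intro sum.cong refl) (simp add: slice_pure[OF f A] \<eta>_def)
  also have "\<dots> = (\<Sum>r\<le>p. (-1) ^ (p - r) * real (p choose r) * (\<Sum>\<rho> | \<rho> \<in> DN N p \<and> A \<subseteq> \<rho> ` {..<r}. \<eta> \<rho>))"
  proof (rule sum.cong[OF refl], rule arg_cong2[where f="(*)", OF refl])
    fix r assume r: "r \<in> {..p}"
    have im: "restrict \<rho> {..<r} ` {..<r} = \<rho> ` {..<r}" for \<rho> :: "nat \<Rightarrow> nat"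
      by auto
    have sub: "(\<lambda>\<rho>. restrict \<rho> {..<r}) ` {\<rho> \<in> DN N p. A \<subseteq> \<rho> ` {..<r}} \<subseteq> {k \<in> DN N r. A \<subseteq> k ` {..<r}}"
    proof (intro image_subsetI)
      fix \<rho> assume \<rho>: "\<rho> \<in> {\<rho> \<in> DN N p. A \<subseteq> \<rho> ` {..<r}}"
      have "inj_on \<rho> {..<r}" using inj_on_subset[OF DN_inj[of \<rho> N p], of "{..<r}"] \<rho> r by auto
      moreover have "\<rho> j < N" if "j < r" for j using DN_lt[of \<rho> N p j] \<rho> r that by auto
      ultimately show "restrict \<rho> {..<r} \<in> {k \<in> DN N r. A \<subseteq> k ` {..<r}}"
        using \<rho> by (auto simp: DN_def im)
    qed
    have "(\<Sum>k\<in>DN N r. if A \<subseteq> k ` {..<r} then (\<Sum>\<rho> | \<rho> \<in> DN N p \<and> restrict \<rho> {..<r} = k. \<eta> \<rho>) else 0) =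
      (\<Sum>k | k \<in> DN N r \<and> A \<subseteq> k ` {..<r}. \<Sum>\<rho> | \<rho> \<in> DN N p \<and> restrict \<rho> {..<r} = k. \<eta> \<rho>)"
      by (rule sum.inter_filter[symmetric]) simp
    also have "\<dots> = (\<Sum>k | k \<in> DN N r \<and> A \<subseteq> k ` {..<r}. \<Sum>\<rho> | \<rho> \<in> {\<rho> \<in> DN N p. A \<subseteq> \<rho> ` {..<r}} \<and> restrict \<rho> {..<r} = k. \<eta> \<rho>)"
      by (intro sum.cong refl Collect_cong) auto
    also have "\<dots> = (\<Sum>\<rho> | \<rho> \<in> DN N p \<and> A \<subseteq> \<rho> ` {..<r}. \<eta> \<rho>)"
      using sub by (intro sum.group) auto
    finally show "(\<Sum>k\<in>DN N r. if A \<subseteq> k ` {..<r} then (\<Sum>\<rho> | \<rho> \<in> DN N p \<and> restrict \<rho> {..<r} = k. \<eta> \<rho>) else 0) =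
       (\<Sum>\<rho> | \<rho> \<in> DN N p \<and> A \<subseteq> \<rho> ` {..<r}. \<eta> \<rho>)" .
  qed
  also have "\<dots> = (\<Sum>k | k \<in> DN N p \<and> k ` {..<p} = A. \<eta> k)"
  proof (rule alternating_tuple_sum)
    fix \<sigma> \<rho> assume s: "\<sigma> permutes {..<p}" "\<rho> \<in> DN N p"
    show "\<eta> (act p \<sigma> \<rho>) = \<eta> \<rho>"
      unfolding \<eta>_def using AE_pick_sym[OF f s(1) DN_inj[OF s(2)]]
      by (intro integral_cong_AE) auto
  qed
  finally show ?thesis by (simp add: \<eta>_def)
qed

text \<open>Young's inequality. The weight is kept free because \<open>JN_clamped_bound\<close>
  needs \<open>a = fact p\<close>.\<close>

lemma am_gm_weighted:
  fixes a u v :: real assumes "0 < a"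
  shows "u * v \<le> a / 2 * u\<^sup>2 + 1 / (2 * a) * v\<^sup>2"
proof -
  have "0 \<le> (a * u - v)\<^sup>2 / (2 * a)" using assms by simp
  also have "\<dots> = a / 2 * u\<^sup>2 + 1 / (2 * a) * v\<^sup>2 - u * v"
    using assms by (simp add: power2_eq_square field_simps)
  finally show ?thesis by simp
qed

lemma sum_pick_square_le:
  assumes f: "f \<in> L2_hat p"
  shows "(\<Sum>k\<in>DN N p. \<integral>x. (f (pick p k x))\<^sup>2 \<partial>Q) \<le> (1/2^p) * (\<integral>v. (f v)\<^sup>2 \<partial>Rp p)"
proof -
  note [measurable] = L2_hat_measurable[OF f]
  have "ennreal (\<Sum>k\<in>DN N p. \<integral>x. (f (pick p k x))\<^sup>2 \<partial>Q) = (\<Sum>k\<in>DN N p. ennreal (\<integral>x. (f (pick p k x))\<^sup>2 \<partial>Q))"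
    by (rule sum_ennreal[symmetric]) simp
  also have "\<dots> = (\<Sum>k\<in>DN N p. \<integral>\<^sup>+x. ennreal ((f (pick p k x))\<^sup>2) \<partial>Q)"
    by (intro sum.cong refl nn_integral_eq_integral[symmetric] pick_square_integrable(1)[OF f] DN_inj) auto
  also have "\<dots> \<le> ennreal (1/2^p) * (\<integral>\<^sup>+v. ennreal ((f v)\<^sup>2) \<partial>Rp p)"
    by (rule sum_nn_integral_pick_le) measurable
  also have "(\<integral>\<^sup>+v. ennreal ((f v)\<^sup>2) \<partial>Rp p) = ennreal (\<integral>v. (f v)\<^sup>2 \<partial>Rp p)"
    by (rule nn_integral_eq_integral[OF L2_hat_square[OF f]]) simp
  also have "ennreal (1/2^p) * ennreal (\<integral>v. (f v)\<^sup>2 \<partial>Rp p) = ennreal ((1/2^p) * (\<integral>v. (f v)\<^sup>2 \<partial>Rp p))"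
    by (rule ennreal_mult'[symmetric]) simp
  finally show ?thesis by (subst (asm) ennreal_le_iff) auto
qed

text \<open>Testing \<open>JN\<close> against a bounded truncation of itself gives the \<open>L\<^sup>2\<close> bound without
  ever computing the second moment.\<close>

lemma JN_clamped_bound:
  assumes f: "f \<in> L2_hat p" and c: "0 \<le> c"
  shows "(\<integral>x. (max (- c) (min c (JN N p f x)))\<^sup>2 \<partial>Q) \<le> fact p / 2^p * (\<integral>v. (f v)\<^sup>2 \<partial>Rp p)"
proof -
  note [measurable] = L2_hat_measurable[OF f]
  have mJ[measurable]: "JN N p f \<in> borel_measurable Q"
    using JN_integrable[OF f] by (rule borel_measurable_integrable)
  define \<phi> where "\<phi> x = max (- c) (min c (JN N p f x))" for x
  have b: "bmeas \<phi>"
  proof (rule bmeasI)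
    show "\<bar>\<phi> x\<bar> \<le> c" for x using c by (auto simp: \<phi>_def abs_le_iff)
  qed (simp add: \<phi>_def[abs_def])
  have d: "dep {..<N} \<phi>"
    unfolding dep_def \<phi>_def
    by (intro ballI impI arg_cong[where f="\<lambda>t. max (- c) (min c t)"]) (rule depD[OF JN_dep]; auto)
  obtain \<Phi> where \<Phi>: "\<And>A. A \<subseteq> {..<N} \<Longrightarrow> pure A (\<Phi> A)" "\<And>x. x \<in> space Q \<Longrightarrow> \<phi> x = (\<Sum>A\<in>Pow {..<N}. \<Phi> A x)"
    using hoeffding[OF _ b d] by blast
  have b\<Phi>: "bmeas (\<Phi> A)" if "A \<subseteq> {..<N}" for A using \<Phi>(1)[OF that] by (simp add: pure_def)
  have i\<Phi>: "integrable Q (\<lambda>x. (\<Phi> A x)\<^sup>2)" if "A \<subseteq> {..<N}" for A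
    using bmeas_integrable[OF bmeas_mult[OF b\<Phi>[OF that] b\<Phi>[OF that]]] by (simp add: power2_eq_square)
  have n\<Phi>: "0 \<le> (\<integral>x. (\<Phi> A x)\<^sup>2 \<partial>Q)" for A by (rule Bochner_Integration.integral_nonneg) simp
  let ?F = "\<lambda>k. \<integral>x. (f (pick p k x))\<^sup>2 \<partial>Q"
  \<comment> \<open>A set \<open>A\<close> is the image of at most \<open>fact p\<close> tuples.
    With this weight the \<open>\<Phi>\<close> parts add up to at most half of the second moment of
    \<open>\<phi>\<close>, which is then absorbed on the left.\<close>
  let ?a = "fact p :: real"
  have a: "0 < ?a" by simp
  \<comment> \<open>Clamping keeps the sign and never increases the modulus.\<close>
  have "(\<integral>x. (\<phi> x)\<^sup>2 \<partial>Q) \<le> (\<integral>x. JN N p f x * \<phi> x \<partial>Q)"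
  proof (rule integral_mono)
    show "integrable Q (\<lambda>x. (\<phi> x)\<^sup>2)"
      using bmeas_integrable[OF bmeas_mult[OF b b]] by (simp add: power2_eq_square)
    show "integrable Q (\<lambda>x. JN N p f x * \<phi> x)"
      by (rule bmeas_integrable_mult[OF b JN_integrable[OF f]])
    fix x
    consider "JN N p f x < - c" | "- c \<le> JN N p f x" "JN N p f x \<le> c" | "c < JN N p f x" by linarith
    then show "(\<phi> x)\<^sup>2 \<le> JN N p f x * \<phi> x"
    proof cases
      case 1
      then have "\<phi> x = - c" using c by (simp add: \<phi>_def)
      then show ?thesis using 1 c mult_right_mono[of c "- JN N p f x" c] by (simp add: power2_eq_square)
    next
      case 2
      then have "\<phi> x = JN N p f x" by (simp add: \<phi>_def)
      then show ?thesis by (simp add: power2_eq_square)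
    next
      case 3
      then have "\<phi> x = c" using c by (simp add: \<phi>_def)
      then show ?thesis using 3 c mult_right_mono[of c "JN N p f x" c] by (simp add: power2_eq_square)
    qed
  qed
  also have "\<dots> = (\<integral>x. (\<Sum>A\<in>Pow {..<N}. JN N p f x * \<Phi> A x) \<partial>Q)"
    by (intro Bochner_Integration.integral_cong refl) (simp add: \<Phi>(2) sum_distrib_left)
  also have "\<dots> = (\<Sum>A\<in>Pow {..<N}. \<integral>x. JN N p f x * \<Phi> A x \<partial>Q)"
    using b\<Phi> by (intro Bochner_Integration.integral_sum bmeas_integrable_mult JN_integrable f) auto
  also have "\<dots> = (\<Sum>A\<in>Pow {..<N}. \<Sum>k | k \<in> DN N p \<and> k ` {..<p} = A. \<integral>x. f (pick p k x) * \<Phi> A x \<partial>Q)"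
    using \<Phi>(1) by (intro sum.cong refl JN_pure[OF f]) auto
  also have "\<dots> \<le> (\<Sum>A\<in>Pow {..<N}. \<Sum>k | k \<in> DN N p \<and> k ` {..<p} = A. ?a / 2 * ?F k + 1 / (2 * ?a) * (\<integral>x. (\<Phi> A x)\<^sup>2 \<partial>Q))"
  proof (intro sum_mono)
    fix A k assume A: "A \<in> Pow {..<N}" and k: "k \<in> {k. k \<in> DN N p \<and> k ` {..<p} = A}"
    have i1: "integrable Q (\<lambda>x. (f (pick p k x))\<^sup>2)" and i2: "integrable Q (\<lambda>x. f (pick p k x))"
      using pick_square_integrable[OF f DN_inj] k by auto
    have "(\<integral>x. f (pick p k x) * \<Phi> A x \<partial>Q) \<le> (\<integral>x. ?a / 2 * (f (pick p k x))\<^sup>2 + 1 / (2 * ?a) * (\<Phi> A x)\<^sup>2 \<partial>Q)"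
      using A by (intro integral_mono bmeas_integrable_mult b\<Phi> i2 Bochner_Integration.integrable_add Bochner_Integration.integrable_mult_right i1 i\<Phi> am_gm_weighted a) auto
    also have "\<dots> = ?a / 2 * ?F k + 1 / (2 * ?a) * (\<integral>x. (\<Phi> A x)\<^sup>2 \<partial>Q)"
      using A by (subst Bochner_Integration.integral_add) (auto intro!: i1 i\<Phi>)
    finally show "(\<integral>x. f (pick p k x) * \<Phi> A x \<partial>Q) \<le> ?a / 2 * ?F k + 1 / (2 * ?a) * (\<integral>x. (\<Phi> A x)\<^sup>2 \<partial>Q)" .
  qed
  also have "\<dots> = (\<Sum>A\<in>Pow {..<N}. \<Sum>k | k \<in> DN N p \<and> k ` {..<p} = A. ?a / 2 * ?F k) +
      (\<Sum>A\<in>Pow {..<N}. \<Sum>k | k \<in> DN N p \<and> k ` {..<p} = A. 1 / (2 * ?a) * (\<integral>x. (\<Phi> A x)\<^sup>2 \<partial>Q))"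
    by (simp only: sum.distrib)
  also have "(\<Sum>A\<in>Pow {..<N}. \<Sum>k | k \<in> DN N p \<and> k ` {..<p} = A. ?a / 2 * ?F k) = (\<Sum>k\<in>DN N p. ?a / 2 * ?F k)"
    using DN_lt by (intro sum.group) auto
  also have "(\<Sum>k\<in>DN N p. ?a / 2 * ?F k) = ?a / 2 * (\<Sum>k\<in>DN N p. ?F k)"
    by (simp add: sum_distrib_left)
  also have "(\<Sum>A\<in>Pow {..<N}. \<Sum>k | k \<in> DN N p \<and> k ` {..<p} = A. 1 / (2 * ?a) * (\<integral>x. (\<Phi> A x)\<^sup>2 \<partial>Q)) \<le>
      (\<Sum>A\<in>Pow {..<N}. 1 / 2 * (\<integral>x. (\<Phi> A x)\<^sup>2 \<partial>Q))"
  proof (intro sum_mono)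
    fix A assume "A \<in> Pow {..<N}"
    then have "real (card {k \<in> DN N p. k ` {..<p} = A}) \<le> ?a"
      by (subst card_DN_image) auto
    then have "real (card {k \<in> DN N p. k ` {..<p} = A}) * (1 / (2 * ?a) * (\<integral>x. (\<Phi> A x)\<^sup>2 \<partial>Q)) \<le> ?a * (1 / (2 * ?a) * (\<integral>x. (\<Phi> A x)\<^sup>2 \<partial>Q))"
      by (rule mult_right_mono) (use n\<Phi>[of A] in simp)
    also have "\<dots> = 1 / 2 * (\<integral>x. (\<Phi> A x)\<^sup>2 \<partial>Q)" by simp
    finally show "(\<Sum>k | k \<in> DN N p \<and> k ` {..<p} = A. 1 / (2 * ?a) * (\<integral>x. (\<Phi> A x)\<^sup>2 \<partial>Q)) \<le> 1 / 2 * (\<integral>x. (\<Phi> A x)\<^sup>2 \<partial>Q)"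
      by simp
  qed
  also have "(\<Sum>A\<in>Pow {..<N}. 1 / 2 * (\<integral>x. (\<Phi> A x)\<^sup>2 \<partial>Q)) = 1 / 2 * (\<integral>x. (\<phi> x)\<^sup>2 \<partial>Q)"
    by (subst pure_parseval[OF finite_lessThan \<Phi>]) (simp_all add: sum_distrib_left)
  finally have "(\<integral>x. (\<phi> x)\<^sup>2 \<partial>Q) \<le> ?a * (\<Sum>k\<in>DN N p. ?F k)" by simp
  also have "\<dots> \<le> ?a * ((1/2^p) * (\<integral>v. (f v)\<^sup>2 \<partial>Rp p))"
    by (intro mult_left_mono sum_pick_square_le f) simp
  finally show ?thesis by (simp add: \<phi>_def)
qed

text \<open>\<open>JN\<close> is so far only known to be integrable. The clamped bound is uniform in
  the clamping level, and Fatou's lemma removes the clamp.\<close>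

lemma JN_L2_bound:
  assumes f: "f \<in> L2_hat p"
  shows "(\<integral>\<^sup>+x. ennreal ((JN N p f x)\<^sup>2) \<partial>Q) \<le> ennreal (fact p / 2^p * (\<integral>v. (f v)\<^sup>2 \<partial>Rp p))"
proof -
  have mJ[measurable]: "JN N p f \<in> borel_measurable Q"
    using JN_integrable[OF f] by (rule borel_measurable_integrable)
  define \<phi> where "\<phi> n x = max (- real n) (min (real n) (JN N p f x))" for n :: nat and x
  have m[measurable]: "\<phi> n \<in> borel_measurable Q" for n by (simp add: \<phi>_def[abs_def])
  have lim: "(\<lambda>n. ennreal ((\<phi> n x)\<^sup>2)) \<longlonglongrightarrow> ennreal ((JN N p f x)\<^sup>2)" for x
  proof (rule tendsto_eventually)
    obtain n0 :: nat where n0: "\<bar>JN N p f x\<bar> \<le> real n0" using real_arch_simple by blast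
    show "eventually (\<lambda>n. ennreal ((\<phi> n x)\<^sup>2) = ennreal ((JN N p f x)\<^sup>2)) sequentially"
      using eventually_ge_at_top[of n0]
    proof eventually_elim
      fix n assume "n0 \<le> n"
      then have "\<bar>JN N p f x\<bar> \<le> real n" using n0 by linarith
      then have "\<phi> n x = JN N p f x" by (simp add: \<phi>_def abs_le_iff)
      then show "ennreal ((\<phi> n x)\<^sup>2) = ennreal ((JN N p f x)\<^sup>2)" by simp
    qed
  qed
  have "(\<integral>\<^sup>+x. ennreal ((JN N p f x)\<^sup>2) \<partial>Q) = (\<integral>\<^sup>+x. liminf (\<lambda>n. ennreal ((\<phi> n x)\<^sup>2)) \<partial>Q)"
    by (intro nn_integral_cong lim_imp_Liminf[symmetric] lim) simp
  also have "\<dots> \<le> liminf (\<lambda>n. \<integral>\<^sup>+x. ennreal ((\<phi> n x)\<^sup>2) \<partial>Q)"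
    by (rule nn_integral_liminf) measurable
  also have "\<dots> \<le> ennreal (fact p / 2^p * (\<integral>v. (f v)\<^sup>2 \<partial>Rp p))"
  proof (rule Liminf_le)
    show "\<forall>\<^sub>F n in sequentially. (\<integral>\<^sup>+x. ennreal ((\<phi> n x)\<^sup>2) \<partial>Q) \<le> ennreal (fact p / 2^p * (\<integral>v. (f v)\<^sup>2 \<partial>Rp p))"
    proof (rule always_eventually, rule allI)
    fix n
    have b: "bmeas (\<phi> n)"
      by (rule bmeasI[of _ "real n"]) (auto simp: \<phi>_def[abs_def] abs_le_iff)
    have "(\<integral>\<^sup>+x. ennreal ((\<phi> n x)\<^sup>2) \<partial>Q) = ennreal (\<integral>x. (\<phi> n x)\<^sup>2 \<partial>Q)"
      using bmeas_integrable[OF bmeas_mult[OF b b]] by (intro nn_integral_eq_integral) (auto simp: power2_eq_square)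
    also have "\<dots> \<le> ennreal (fact p / 2^p * (\<integral>v. (f v)\<^sup>2 \<partial>Rp p))"
      unfolding \<phi>_def by (intro ennreal_leI JN_clamped_bound f) simp
    finally show "(\<integral>\<^sup>+x. ennreal ((\<phi> n x)\<^sup>2) \<partial>Q) \<le> ennreal (fact p / 2^p * (\<integral>v. (f v)\<^sup>2 \<partial>Rp p))" .
    qed
  qed simp
  finally show ?thesis .
qed

section \<open>Convergence of the truncated integrals\<close>

text \<open>The Riesz-Fischer theorem, phrased with \<open>nn_integral\<close> of squared
  differences to match the form of \<open>is_stoch_int\<close>.\<close>

lemma L2_complete:
  fixes a :: "nat \<Rightarrow> 'a \<Rightarrow> real"
  assumes [measurable]: "\<And>n. a n \<in> borel_measurable M"
    and cau: "\<And>e. 0 < e \<Longrightarrow> \<exists>N. \<forall>m\<ge>N. \<forall>n\<ge>N. (\<integral>\<^sup>+x. ennreal ((a m x - a n x)\<^sup>2) \<partial>M) \<le> ennreal e"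
  obtains X where "X \<in> borel_measurable M" "(\<lambda>n. \<integral>\<^sup>+x. ennreal ((a n x - X x)\<^sup>2) \<partial>M) \<longlonglongrightarrow> 0"
proof -
  \<comment> \<open>The rate \<open>1/8^i\<close> leaves the summable \<open>(1/2)^n\<close> after
    multiplication by the weight \<open>4^n\<close> below.\<close>
  have "\<exists>K. \<forall>i::nat. \<forall>m\<ge>K i. \<forall>n\<ge>K i. (\<integral>\<^sup>+x. ennreal ((a m x - a n x)\<^sup>2) \<partial>M) \<le> ennreal (1/8^i)"
    by (intro choice allI cau) simp
  then obtain K :: "nat \<Rightarrow> nat" where K: "\<And>i m n. m \<ge> K i \<Longrightarrow> n \<ge> K i \<Longrightarrow> (\<integral>\<^sup>+x. ennreal ((a m x - a n x)\<^sup>2) \<partial>M) \<le> ennreal (1/8^i)"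
    by blast
  \<comment> \<open>Summing all \<open>K i\<close> with \<open>i \<le> n\<close> makes
    \<open>r n\<close> and \<open>r (Suc n)\<close> both at least \<open>K n\<close>; the summand
    \<open>n\<close> makes \<open>r\<close> tend to infinity.\<close>
  define r where "r n = n + (\<Sum>i\<le>n. K i)" for n
  have rK: "K n \<le> r n" "K n \<le> r (Suc n)" "n \<le> r n" for n
    using member_le_sum[of n "{..n}" K] by (auto simp: r_def)
  define d where "d n x = a (r (Suc n)) x - a (r n) x" for n x
  have [measurable]: "d n \<in> borel_measurable M" for n by (simp add: d_def[abs_def])
  define X where "X x = lim (\<lambda>n. a (r n) x)" for x
  have mX[measurable]: "X \<in> borel_measurable M" unfolding X_def[abs_def] by measurable
  have "(\<integral>\<^sup>+x. (\<Sum>n. ennreal (4^n * (d n x)\<^sup>2)) \<partial>M) = (\<Sum>n. \<integral>\<^sup>+x. ennreal (4^n * (d n x)\<^sup>2) \<partial>M)"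
    by (rule nn_integral_suminf) measurable
  also have "\<dots> \<le> (\<Sum>n. ennreal ((1/2)^n))"
  proof (rule suminf_le)
    fix n
    have "(\<integral>\<^sup>+x. ennreal (4^n * (d n x)\<^sup>2) \<partial>M) = ennreal (4^n) * (\<integral>\<^sup>+x. ennreal ((d n x)\<^sup>2) \<partial>M)"
      by (subst nn_integral_cmult[symmetric]) (auto simp: ennreal_mult)
    also have "\<dots> \<le> ennreal (4^n) * ennreal (1/8^n)"
      unfolding d_def by (intro mult_left_mono K rK) simp
    also have "\<dots> = ennreal ((1/2)^n)"
      by (subst ennreal_mult[symmetric]) (auto simp: power_divide[symmetric] power_mult_distrib[symmetric] simp flip: power_one_over)
    finally show "(\<integral>\<^sup>+x. ennreal (4^n * (d n x)\<^sup>2) \<partial>M) \<le> ennreal ((1/2)^n)" .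
  qed auto
  also have "\<dots> < \<infinity>"
    by (subst suminf_ennreal2) (auto simp: summable_geometric)
  finally have fin: "AE x in M. (\<Sum>n. ennreal (4^n * (d n x)\<^sup>2)) \<noteq> \<infinity>"
    by (intro nn_integral_PInf_AE) auto
  have conv: "AE x in M. (\<lambda>n. a (r n) x) \<longlonglongrightarrow> X x"
    using fin
  proof eventually_elim
    fix x assume f: "(\<Sum>n. ennreal (4^n * (d n x)\<^sup>2)) \<noteq> \<infinity>"
    have "summable (\<lambda>n. 4^n * (d n x)\<^sup>2)"
      by (rule summable_suminf_not_top) (use f in \<open>auto simp: infinity_ennreal_def\<close>)
    then have "(\<lambda>n. 4^n * (d n x)\<^sup>2) \<longlonglongrightarrow> 0" by (rule summable_LIMSEQ_zero)
    then have "Bseq (\<lambda>n. 4^n * (d n x)\<^sup>2)" by (intro convergent_imp_Bseq convergentI)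
    then obtain C where C: "C > 0" "\<And>n. norm (4^n * (d n x)\<^sup>2) \<le> C" by (rule BseqE) blast
    \<comment> \<open>Terms of a convergent series are bounded; taking roots gives geometric decay
      of the increments.\<close>
    have "norm (d n x) \<le> sqrt C * (1/2)^n" for n
    proof -
      have "(2^n * \<bar>d n x\<bar>)\<^sup>2 = 4^n * (d n x)\<^sup>2"
      proof -
        have "(4 :: real) ^ n = (2\<^sup>2) ^ n" by simp
        also have "\<dots> = (2 ^ n)\<^sup>2" by (simp only: power_mult[symmetric] mult.commute)
        finally show ?thesis by (simp only: power_mult_distrib power2_abs)
      qed
      also have "\<dots> \<le> C" using C(2)[of n] by simp
      finally have "2^n * \<bar>d n x\<bar> \<le> sqrt C" by (rule real_le_rsqrt)
      then show ?thesis by (simp add: field_simps)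
    qed
    then have "summable (\<lambda>n. d n x)"
      by (intro summable_comparison_test'[OF summable_mult[OF summable_geometric, of "1/2" "sqrt C"], of 0]) auto
    then have "(\<lambda>n. a (r 0) x + (\<Sum>i<n. d i x)) \<longlonglongrightarrow> a (r 0) x + (\<Sum>i. d i x)"
      by (intro tendsto_add tendsto_const summable_LIMSEQ)
    moreover have "a (r 0) x + (\<Sum>i<n. d i x) = a (r n) x" for n
      by (induction n) (auto simp: d_def)
    ultimately have "convergent (\<lambda>n. a (r n) x)" by (auto simp: convergent_def)
    then show "(\<lambda>n. a (r n) x) \<longlonglongrightarrow> X x" unfolding X_def by (simp add: convergent_LIMSEQ_iff)
  qed
  have "(\<lambda>m. \<integral>\<^sup>+x. ennreal ((a m x - X x)\<^sup>2) \<partial>M) \<longlonglongrightarrow> 0"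
  proof (rule tendsto_zero_ennreal)
    fix e :: real assume e: "0 < e"
    obtain N where N: "\<And>m n. m \<ge> N \<Longrightarrow> n \<ge> N \<Longrightarrow> (\<integral>\<^sup>+x. ennreal ((a m x - a n x)\<^sup>2) \<partial>M) \<le> ennreal (e/2)"
      using cau[of "e/2"] e by auto
    show "eventually (\<lambda>m. (\<integral>\<^sup>+x. ennreal ((a m x - X x)\<^sup>2) \<partial>M) < ennreal e) sequentially"
      using eventually_ge_at_top[of N]
    proof eventually_elim
      fix m assume m: "N \<le> m"
      \<comment> \<open>Fatou's lemma along the subsequence that converges almost everywhere, with
        \<open>m\<close> fixed.\<close>
      have "(\<integral>\<^sup>+x. ennreal ((a m x - X x)\<^sup>2) \<partial>M) = (\<integral>\<^sup>+x. liminf (\<lambda>n. ennreal ((a m x - a (r n) x)\<^sup>2)) \<partial>M)"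
      proof (rule nn_integral_cong_AE)
        show "AE x in M. ennreal ((a m x - X x)\<^sup>2) = liminf (\<lambda>n. ennreal ((a m x - a (r n) x)\<^sup>2))"
          using conv
        proof eventually_elim
          fix x assume "(\<lambda>n. a (r n) x) \<longlonglongrightarrow> X x"
          then have "(\<lambda>n. ennreal ((a m x - a (r n) x)\<^sup>2)) \<longlonglongrightarrow> ennreal ((a m x - X x)\<^sup>2)"
            by (intro tendsto_ennrealI tendsto_power tendsto_diff tendsto_const)
          then show "ennreal ((a m x - X x)\<^sup>2) = liminf (\<lambda>n. ennreal ((a m x - a (r n) x)\<^sup>2))"
            by (intro lim_imp_Liminf[symmetric]) simp
        qed
      qed
      also have "\<dots> \<le> liminf (\<lambda>n. \<integral>\<^sup>+x. ennreal ((a m x - a (r n) x)\<^sup>2) \<partial>M)"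
        by (rule nn_integral_liminf) measurable
      also have "\<dots> \<le> ennreal (e/2)"
      proof (rule Liminf_le)
        show "eventually (\<lambda>n. (\<integral>\<^sup>+x. ennreal ((a m x - a (r n) x)\<^sup>2) \<partial>M) \<le> ennreal (e/2)) sequentially"
          using eventually_ge_at_top[of N]
        proof eventually_elim
          fix n assume "N \<le> n"
          then have "N \<le> r n" using rK(3)[of n] by linarith
          then show "(\<integral>\<^sup>+x. ennreal ((a m x - a (r n) x)\<^sup>2) \<partial>M) \<le> ennreal (e/2)" by (rule N[OF m])
        qed
      qed simp
      also have "\<dots> < ennreal e" using e by (simp add: ennreal_less_iff)
      finally show "(\<integral>\<^sup>+x. ennreal ((a m x - X x)\<^sup>2) \<partial>M) < ennreal e" .
    qed
  qed
  with mX show thesis by (rule that)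
qed

section \<open>Absolute convergence and removal of the truncation\<close>

definition J :: "nat \<Rightarrow> ((nat \<Rightarrow> real) \<Rightarrow> real) \<Rightarrow> (nat \<Rightarrow> real) \<Rightarrow> real" where
  "J p h x = (\<Sum>r\<le>p. (-1) ^ (p - r) / 2 ^ (p - r) * real (p choose r) *
     (\<Sum>\<^sub>\<infinity>k\<in>distinct_tuples r. \<integral>y. h (tcat r (pick r k x) (p - r) y) \<partial>Rp (p - r)))"

text \<open>Where this fails, \<open>J\<close> may be made of default values: \<open>infsum\<close>
  and the Bochner integral return 0 when there is no absolute convergence. Limits and linearity are
  therefore claimed only at these points.\<close>

definition summable_slices :: "nat \<Rightarrow> ((nat \<Rightarrow> real) \<Rightarrow> real) \<Rightarrow> (nat \<Rightarrow> real) \<Rightarrow> bool" where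
  "summable_slices p h x \<longleftrightarrow> (\<forall>r\<le>p.
     (\<forall>k\<in>distinct_tuples r. integrable (Rp (p - r)) (\<lambda>y. h (tcat r (pick r k x) (p - r) y))) \<and>
     integrable (count_space (distinct_tuples r)) (\<lambda>k. \<integral>y. \<bar>h (tcat r (pick r k x) (p - r) y)\<bar> \<partial>Rp (p - r)))"

lemma DN_subset: "DN N r \<subseteq> distinct_tuples r"
  by (auto simp: DN_def distinct_tuples_def PiE_iff)

lemma DN_mono: "N \<le> M \<Longrightarrow> DN N r \<subseteq> DN M r"
proof
  fix k assume "N \<le> M" and k: "k \<in> DN N r"
  then have "k j < M" if "j < r" for j using DN_lt[OF k that] by linarith
  with k show "k \<in> DN M r" by (auto simp: DN_def PiE_iff)
qed

lemma finite_subset_DN: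
  assumes "finite F" "F \<subseteq> distinct_tuples r" obtains N where "F \<subseteq> DN N r"
proof -
  have "finite (\<Union>k\<in>F. k ` {..<r})" using assms by auto
  then obtain N where N: "\<And>i. i \<in> (\<Union>k\<in>F. k ` {..<r}) \<Longrightarrow> i < N"
    using finite_nat_set_iff_bounded[of "\<Union>k\<in>F. k ` {..<r}"] by blast
  have "F \<subseteq> DN N r"
  proof
    fix k assume k: "k \<in> F"
    have "k j < N" if "j < r" for j using N[of "k j"] k that by blast
    then show "k \<in> DN N r" using assms(2) k by (auto simp: DN_def distinct_tuples_def PiE_iff)
  qed
  then show thesis by (rule that)
qed

lemma pick_space: "x \<in> space Q \<Longrightarrow> pick r k x \<in> space (Rp r)"
  by (rule measurable_space[OF pick_measurable])

lemma slice_measurable_snd: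
  assumes "h \<in> borel_measurable (Rp (r + q))" "x \<in> space Q"
  shows "(\<lambda>y. h (tcat r (pick r k x) q y)) \<in> borel_measurable (Rp q)"
  using pick_space[OF assms(2), of r k]
  by (intro measurable_compose[OF tcat_measurable' assms(1)]) auto

lemma sum_nn_integral_slice_le:
  assumes [measurable]: "F \<in> borel_measurable (Rp (r + q))"
  shows "(\<Sum>k\<in>DN N r. \<integral>\<^sup>+x. \<integral>\<^sup>+y. F (tcat r (pick r k x) q y) \<partial>Rp q \<partial>Q) \<le> (\<integral>\<^sup>+v. F v \<partial>Rp (r + q))"
proof -
  have "(\<Sum>k\<in>DN N r. \<integral>\<^sup>+x. \<integral>\<^sup>+y. F (tcat r (pick r k x) q y) \<partial>Rp q \<partial>Q) =
      (\<Sum>k\<in>DN N r. ennreal (1/2^r) * (\<integral>\<^sup>+v. indicator (blk r k) v * F v \<partial>Rp (r + q)))"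
    by (intro sum.cong refl nn_integral_slice) (auto simp: DN_inj)
  also have "\<dots> = ennreal (1/2^r) * (\<integral>\<^sup>+v. (\<Sum>k\<in>DN N r. indicator (blk r k) v) * F v \<partial>Rp (r + q))"
    unfolding sum_distrib_right by (subst nn_integral_sum) (auto simp: sum_distrib_left)
  also have "\<dots> \<le> 1 * (\<integral>\<^sup>+v. 1 * F v \<partial>Rp (r + q))"
    by (intro mult_mono nn_integral_mono mult_right_mono sum_indicator_blk_le) auto
  finally show ?thesis by simp
qed

text \<open>Since the blocks are disjoint, the expectation of the sum of all absolute slices is at
  most the integral of \<open>\<bar>h v\<bar>\<close>; so that sum is finite almost surely.\<close>

lemma AE_summable_slices:
  assumes i: "integrable (Rp p) h"
  shows "AE x in Q. summable_slices p h x"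
proof -
  have m: "h \<in> borel_measurable (Rp p)" using i by auto
  have "AE x in Q.
     (\<forall>k\<in>distinct_tuples r. integrable (Rp (p - r)) (\<lambda>y. h (tcat r (pick r k x) (p - r) y))) \<and>
     integrable (count_space (distinct_tuples r)) (\<lambda>k. \<integral>y. \<bar>h (tcat r (pick r k x) (p - r) y)\<bar> \<partial>Rp (p - r))"
    if r: "r \<le> p" for r
  proof -
    obtain q where p: "p = r + q" using r by (auto simp: le_iff_add)
    have [measurable]: "h \<in> borel_measurable (Rp (r + q))" using m p by simp
    define S where "S k x = (\<integral>\<^sup>+y. ennreal \<bar>h (tcat r (pick r k x) q y)\<bar> \<partial>Rp q)" for k x
    have [measurable]: "S k \<in> borel_measurable Q" for k unfolding S_def[abs_def] by measurable
    define T where "T N x = (\<Sum>k\<in>DN N r. S k x)" for N x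
    have [measurable]: "T N \<in> borel_measurable Q" for N unfolding T_def[abs_def] by measurable
    have "incseq T"
      unfolding T_def by (intro monoI le_funI sum_mono2 DN_mono) auto
    then have "(\<integral>\<^sup>+x. (SUP N. T N x) \<partial>Q) = (SUP N. \<integral>\<^sup>+x. T N x \<partial>Q)"
      by (rule nn_integral_monotone_convergence_SUP) measurable
    also have "\<dots> \<le> (\<integral>\<^sup>+v. ennreal \<bar>h v\<bar> \<partial>Rp (r + q))"
    proof (rule SUP_least)
      fix N
      have "(\<integral>\<^sup>+x. T N x \<partial>Q) = (\<Sum>k\<in>DN N r. \<integral>\<^sup>+x. S k x \<partial>Q)"
        unfolding T_def by (rule nn_integral_sum) measurable
      also have "\<dots> \<le> (\<integral>\<^sup>+v. ennreal \<bar>h v\<bar> \<partial>Rp (r + q))"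
        unfolding S_def by (rule sum_nn_integral_slice_le) measurable
      finally show "(\<integral>\<^sup>+x. T N x \<partial>Q) \<le> (\<integral>\<^sup>+v. ennreal \<bar>h v\<bar> \<partial>Rp (r + q))" .
    qed
    also have "\<dots> < \<infinity>" using i p by (simp add: integrable_iff_bounded)
    finally have "AE x in Q. (SUP N. T N x) \<noteq> \<infinity>"
      by (intro nn_integral_PInf_AE) auto
    then show ?thesis
    proof (rule AE_mp, intro AE_I2 impI)
      fix x assume x: "x \<in> space Q" and fin: "(SUP N. T N x) \<noteq> \<infinity>"
      have le: "(\<Sum>k\<in>F. S k x) \<le> (SUP N. T N x)" if F: "finite F" "F \<subseteq> distinct_tuples r" for F
      proof -
        obtain N where "F \<subseteq> DN N r" using finite_subset_DN[OF F] .
        then have "(\<Sum>k\<in>F. S k x) \<le> T N x" unfolding T_def by (intro sum_mono2) auto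
        also have "\<dots> \<le> (SUP N. T N x)" by (rule SUP_upper) simp
        finally show ?thesis .
      qed
      have Sfin: "S k x < \<infinity>" if "k \<in> distinct_tuples r" for k
      proof -
        have "S k x \<le> (SUP N. T N x)" using le[of "{k}"] that by simp
        also have "\<dots> < \<infinity>" using fin by (simp only: less_top infinity_ennreal_def)
        finally show ?thesis .
      qed
      have int: "integrable (Rp q) (\<lambda>y. h (tcat r (pick r k x) q y))" if "k \<in> distinct_tuples r" for k
        using Sfin[OF that] slice_measurable_snd[of h r q x k] x by (simp add: integrable_iff_bounded S_def)
      have eqS: "ennreal (norm (\<integral>y. \<bar>h (tcat r (pick r k x) q y)\<bar> \<partial>Rp q)) = S k x" if "k \<in> distinct_tuples r" for k
        unfolding S_def using nn_integral_eq_integral[OF integrable_abs[OF int[OF that]]] by simp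
      have "(\<integral>\<^sup>+k. ennreal (norm (\<integral>y. \<bar>h (tcat r (pick r k x) q y)\<bar> \<partial>Rp q)) \<partial>count_space (distinct_tuples r)) \<le> (SUP N. T N x)"
      proof -
        \<comment> \<open>Rewrites the integral over all tuples as the supremum of the finite sums
          over \<open>DN N r\<close>, which exhaust \<open>distinct_tuples r\<close>.\<close>
        define G where "G N k = (if k \<in> DN N r then S k x else 0)" for N k
        have "incseq G"
        proof (intro monoI le_funI)
          fix N N' :: nat and k assume "N \<le> N'"
          then show "G N k \<le> G N' k" using DN_mono[of N N' r] by (auto simp: G_def)
        qed
        have "(\<integral>\<^sup>+k. ennreal (norm (\<integral>y. \<bar>h (tcat r (pick r k x) q y)\<bar> \<partial>Rp q)) \<partial>count_space (distinct_tuples r)) \<le>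
            (\<integral>\<^sup>+k. (SUP N. G N k) \<partial>count_space (distinct_tuples r))"
        proof (rule nn_integral_mono)
          fix k assume "k \<in> space (count_space (distinct_tuples r))"
          then have k: "k \<in> distinct_tuples r" by simp
          from finite_subset_DN[of "{k}" r] k obtain N where "k \<in> DN N r" by auto
          then have "S k x \<le> G N k" by (simp add: G_def)
          also have "\<dots> \<le> (SUP N. G N k)" by (rule SUP_upper) simp
          finally show "ennreal (norm (\<integral>y. \<bar>h (tcat r (pick r k x) q y)\<bar> \<partial>Rp q)) \<le> (SUP N. G N k)"
            by (simp only: eqS[OF k])
        qed
        also have "\<dots> = (SUP N. \<integral>\<^sup>+k. G N k \<partial>count_space (distinct_tuples r))"
          by (rule nn_integral_monotone_convergence_SUP[OF \<open>incseq G\<close>]) simp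
        also have "\<dots> = (SUP N. T N x)"
        proof (rule SUP_cong[OF refl])
          fix N
          have "(\<integral>\<^sup>+k. G N k \<partial>count_space (distinct_tuples r)) = (\<Sum>k\<in>DN N r. G N k)"
            by (rule nn_integral_count_space') (auto simp: G_def DN_subset[THEN subsetD])
          then show "(\<integral>\<^sup>+k. G N k \<partial>count_space (distinct_tuples r)) = T N x"
            by (simp add: T_def G_def)
        qed
        finally show ?thesis .
      qed
      then have "integrable (count_space (distinct_tuples r)) (\<lambda>k. \<integral>y. \<bar>h (tcat r (pick r k x) q y)\<bar> \<partial>Rp q)"
        using fin by (intro integrableI_bounded) (auto simp only: less_top infinity_ennreal_def intro: le_less_trans borel_measurable_count_space)
      with int show "(\<forall>k\<in>distinct_tuples r. integrable (Rp (p - r)) (\<lambda>y. h (tcat r (pick r k x) (p - r) y))) \<and>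
     integrable (count_space (distinct_tuples r)) (\<lambda>k. \<integral>y. \<bar>h (tcat r (pick r k x) (p - r) y)\<bar> \<partial>Rp (p - r))"
        by (simp add: p)
    qed
  qed
  then have "AE x in Q. \<forall>r\<in>{..p}.
     (\<forall>k\<in>distinct_tuples r. integrable (Rp (p - r)) (\<lambda>y. h (tcat r (pick r k x) (p - r) y))) \<and>
     integrable (count_space (distinct_tuples r)) (\<lambda>k. \<integral>y. \<bar>h (tcat r (pick r k x) (p - r) y)\<bar> \<partial>Rp (p - r))"
    by (intro AE_finite_allI) auto
  then show ?thesis
    unfolding summable_slices_def by (rule eventually_mono) simp
qed

text \<open>Lets dominated convergence act on the unordered sum over tuples.\<close>

lemma infsum_eq_integral_count_space:
  fixes F :: "'b \<Rightarrow> real"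
  assumes "integrable (count_space A) F"
  shows "infsum F A = (\<integral>k. F k \<partial>count_space A)"
proof -
  have "Infinite_Set_Sum.abs_summable_on F A"
    using assms by (simp add: Infinite_Set_Sum.abs_summable_on_def)
  then show ?thesis
    using infsetsum_infsum[of F A] by (simp add: infsetsum_def)
qed

text \<open>An index \<open>N\<close> or larger forces an argument of at least
  \<open>2 * real N\<close>, beyond the truncation.\<close>

lemma trunc_slice_eq_zero:
  assumes x: "x \<in> space Q" and k: "k \<in> distinct_tuples r" "k \<notin> DN N r"
  shows "trunc N (r + q) h (tcat r (pick r k x) q y) = 0"
proof -
  obtain j where j: "j < r" "N \<le> k j"
    using k by (auto simp: DN_def distinct_tuples_def PiE_iff not_less)
  have "2 * real N \<le> x (k j)" using x j(2) by (auto simp: space_Q cell_def intro: order_trans[of _ "2 * real (k j)"])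
  then have "\<not> tcat r (pick r k x) q y j < 2 * real N" using j by (simp add: tcat_def pick_def)
  then show ?thesis using j(1) by (auto simp: trunc_def)
qed

lemma trunc_tendsto: "(\<lambda>N. trunc N p h v) \<longlonglongrightarrow> h v"
proof (rule tendsto_eventually)
  obtain N0 where N0: "\<And>j. j < p \<Longrightarrow> v j < real N0"
  proof -
    obtain N0 :: nat where "(\<Sum>j<p. \<bar>v j\<bar>) < real N0" using reals_Archimedean2 by blast
    moreover have "v j \<le> (\<Sum>j<p. \<bar>v j\<bar>)" if "j < p" for j
      using member_le_sum[of j "{..<p}" "\<lambda>j. \<bar>v j\<bar>"] that by auto
    ultimately show thesis by (intro that[of N0]) fastforce
  qed
  show "eventually (\<lambda>N. trunc N p h v = h v) sequentially"
    using eventually_ge_at_top[of N0]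
  proof eventually_elim
    fix N assume "N0 \<le> N"
    then have "v j < 2 * real N" if "j < p" for j using N0[OF that] by linarith
    then show "trunc N p h v = h v" by (simp add: trunc_def)
  qed
qed

lemma trunc_abs_le: "\<bar>trunc N p h v\<bar> \<le> \<bar>h v\<bar>"
  by (simp add: trunc_def)

lemma summable_slices_trunc:
  assumes g: "summable_slices (r + q) h x" and x: "x \<in> space Q" and m: "h \<in> borel_measurable (Rp (r + q))" and k: "k \<in> distinct_tuples r"
  shows "integrable (Rp q) (\<lambda>y. h (tcat r (pick r k x) q y))"
    and "integrable (Rp q) (\<lambda>y. trunc N (r + q) h (tcat r (pick r k x) q y))"
proof -
  show i: "integrable (Rp q) (\<lambda>y. h (tcat r (pick r k x) q y))"
    using g k unfolding summable_slices_def by (auto dest!: spec[of _ r])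
  show "integrable (Rp q) (\<lambda>y. trunc N (r + q) h (tcat r (pick r k x) q y))"
    by (rule Bochner_Integration.integrable_bound[OF i slice_measurable_snd[OF trunc_measurable[OF m] x]])
       (simp add: trunc_abs_le)
qed

text \<open>Dominated convergence twice, in \<open>y\<close> and over the tuples with counting
  measure; the absolute slices in \<open>summable_slices\<close> dominate both times.\<close>

lemma JN_tendsto_J:
  assumes g: "summable_slices p h x" and x: "x \<in> space Q" and m: "h \<in> borel_measurable (Rp p)"
  shows "(\<lambda>N. JN N p h x) \<longlonglongrightarrow> J p h x"
  unfolding JN_def J_def
proof (intro tendsto_sum tendsto_mult tendsto_const)
  fix r assume "r \<in> {..p}"
  then obtain q where p: "p = r + q" by (auto simp: le_iff_add)
  note m' = m[unfolded p] and g' = g[unfolded p]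
  let ?D = "distinct_tuples r"
  let ?t = "\<lambda>N k. \<integral>y. trunc N (r + q) h (tcat r (pick r k x) q y) \<partial>Rp q"
  let ?a = "\<lambda>k. \<integral>y. h (tcat r (pick r k x) q y) \<partial>Rp q"
  let ?b = "\<lambda>k. \<integral>y. \<bar>h (tcat r (pick r k x) q y)\<bar> \<partial>Rp q"
  have ib: "integrable (count_space ?D) ?b"
    using g' unfolding summable_slices_def by (auto dest!: spec[of _ r])
  have bnd: "norm (?t N k) \<le> ?b k" if "k \<in> ?D" for N k
  proof -
    have "norm (?t N k) \<le> (\<integral>y. norm (trunc N (r + q) h (tcat r (pick r k x) q y)) \<partial>Rp q)"
      by (rule integral_norm_bound)
    also have "\<dots> \<le> ?b k"
      using summable_slices_trunc[OF g' x m' that]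
      by (intro integral_mono integrable_abs integrable_norm) (simp_all add: trunc_abs_le)
    finally show ?thesis .
  qed
  have lim: "(\<lambda>N. ?t N k) \<longlonglongrightarrow> ?a k" if k: "k \<in> ?D" for k
  proof (rule integral_dominated_convergence)
    show "integrable (Rp q) (\<lambda>y. \<bar>h (tcat r (pick r k x) q y)\<bar>)"
      using summable_slices_trunc(1)[OF g' x m' k] by (rule integrable_abs)
  qed (auto intro!: slice_measurable_snd m' x trunc_measurable trunc_tendsto simp: trunc_abs_le)
  have ia: "integrable (count_space ?D) ?a"
    by (rule Bochner_Integration.integrable_bound[OF ib]) (auto simp: AE_count_space intro!: integral_abs_bound)
  have "(\<lambda>N. \<integral>k. ?t N k \<partial>count_space ?D) \<longlonglongrightarrow> (\<integral>k. ?a k \<partial>count_space ?D)"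
    by (rule integral_dominated_convergence[OF _ _ ib]) (auto simp: AE_count_space lim bnd[simplified])
  moreover have "(\<integral>k. ?t N k \<partial>count_space ?D) = (\<Sum>k\<in>DN N r. ?t N k)" for N
  proof -
    have z: "?t N k = 0" if "k \<in> ?D" "k \<notin> DN N r" for k
      using trunc_slice_eq_zero[OF x that] by simp
    have "{k \<in> ?D. ?t N k \<noteq> 0} \<subseteq> DN N r" using z by blast
    then have "(\<integral>k. ?t N k \<partial>count_space ?D) = (\<Sum>k | k \<in> ?D \<and> ?t N k \<noteq> 0. ?t N k)"
      by (intro lebesgue_integral_count_space_finite_support finite_subset[OF _ finite_DN])
    also have "\<dots> = (\<Sum>k\<in>DN N r. ?t N k)"
      using z DN_subset[of N r] by (intro sum.mono_neutral_left) auto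
    finally show ?thesis .
  qed
  moreover have "(\<integral>k. ?a k \<partial>count_space ?D) = infsum ?a ?D"
    by (rule infsum_eq_integral_count_space[OF ia, symmetric])
  ultimately have "(\<lambda>N. \<Sum>k\<in>DN N r. ?t N k) \<longlonglongrightarrow> infsum ?a ?D" by simp
  then show "(\<lambda>N. \<Sum>k\<in>DN N r. \<integral>y. trunc N p h (tcat r (pick r k x) (p - r) y) \<partial>Rp (p - r)) \<longlonglongrightarrow>
     (\<Sum>\<^sub>\<infinity>k\<in>?D. \<integral>y. h (tcat r (pick r k x) (p - r) y) \<partial>Rp (p - r))"
    by (simp add: p)
qed

lemma J_trunc:
  assumes x: "x \<in> space Q"
  shows "J p (trunc N p h) x = JN N p h x"
  unfolding JN_def J_def
proof (intro sum.cong refl arg_cong2[where f="(*)"])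
  fix r assume "r \<in> {..p}"
  then obtain q where p: "p = r + q" by (auto simp: le_iff_add)
  have "(\<Sum>\<^sub>\<infinity>k\<in>distinct_tuples r. \<integral>y. trunc N (r + q) h (tcat r (pick r k x) q y) \<partial>Rp q) =
     (\<Sum>\<^sub>\<infinity>k\<in>DN N r. \<integral>y. trunc N (r + q) h (tcat r (pick r k x) q y) \<partial>Rp q)"
    using DN_subset[of N r] trunc_slice_eq_zero[OF x] by (intro infsum_cong_neutral) auto
  then show "(\<Sum>\<^sub>\<infinity>k\<in>distinct_tuples r. \<integral>y. trunc N p h (tcat r (pick r k x) (p - r) y) \<partial>Rp (p - r)) =
     (\<Sum>k\<in>DN N r. \<integral>y. trunc N p h (tcat r (pick r k x) (p - r) y) \<partial>Rp (p - r))"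
    by (simp add: p)
qed

lemma if_diff_zero: "(if c then a - b else 0) = (if c then a else 0) - (if c then b else (0 :: real))"
  by simp

lemma JN_diff:
  assumes g: "summable_slices p h x" "summable_slices p h' x" and x: "x \<in> space Q"
    and m: "h \<in> borel_measurable (Rp p)" "h' \<in> borel_measurable (Rp p)"
  shows "JN N p (\<lambda>v. h v - h' v) x = JN N p h x - JN N p h' x"
proof -
  have "(\<integral>y. trunc N p (\<lambda>v. h v - h' v) (tcat r (pick r k x) (p - r) y) \<partial>Rp (p - r)) =
     (\<integral>y. trunc N p h (tcat r (pick r k x) (p - r) y) \<partial>Rp (p - r)) - (\<integral>y. trunc N p h' (tcat r (pick r k x) (p - r) y) \<partial>Rp (p - r))"
    if r: "r \<le> p" and k: "k \<in> DN N r" for r k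
  proof -
    obtain q where p: "p = r + q" using r by (auto simp: le_iff_add)
    have k': "k \<in> distinct_tuples r" using k DN_subset by blast
    have "integrable (Rp q) (\<lambda>y. trunc N (r + q) h (tcat r (pick r k x) q y))"
      by (rule summable_slices_trunc(2)[OF g(1)[unfolded p] x m(1)[unfolded p] k'])
    moreover have "integrable (Rp q) (\<lambda>y. trunc N (r + q) h' (tcat r (pick r k x) q y))"
      by (rule summable_slices_trunc(2)[OF g(2)[unfolded p] x m(2)[unfolded p] k'])
    ultimately have "(\<integral>y. trunc N (r + q) h (tcat r (pick r k x) q y) - trunc N (r + q) h' (tcat r (pick r k x) q y) \<partial>Rp q) =
       (\<integral>y. trunc N (r + q) h (tcat r (pick r k x) q y) \<partial>Rp q) - (\<integral>y. trunc N (r + q) h' (tcat r (pick r k x) q y) \<partial>Rp q)"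
      by (rule Bochner_Integration.integral_diff)
    moreover have "trunc N (r + q) (\<lambda>v. h v - h' v) w = trunc N (r + q) h w - trunc N (r + q) h' w" for w
      unfolding trunc_def by (rule if_diff_zero)
    ultimately show ?thesis by (simp add: p)
  qed
  then have "(\<Sum>k\<in>DN N r. \<integral>y. trunc N p (\<lambda>v. h v - h' v) (tcat r (pick r k x) (p - r) y) \<partial>Rp (p - r)) =
     (\<Sum>k\<in>DN N r. \<integral>y. trunc N p h (tcat r (pick r k x) (p - r) y) \<partial>Rp (p - r)) - (\<Sum>k\<in>DN N r. \<integral>y. trunc N p h' (tcat r (pick r k x) (p - r) y) \<partial>Rp (p - r))"
    if "r \<le> p" for r using that by (simp add: sum_subtractf)
  note eq = this
  have "JN N p (\<lambda>v. h v - h' v) x = (\<Sum>r\<le>p. (-1) ^ (p - r) / 2 ^ (p - r) * real (p choose r) *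
     ((\<Sum>k\<in>DN N r. \<integral>y. trunc N p h (tcat r (pick r k x) (p - r) y) \<partial>Rp (p - r)) - (\<Sum>k\<in>DN N r. \<integral>y. trunc N p h' (tcat r (pick r k x) (p - r) y) \<partial>Rp (p - r))))"
    unfolding JN_def by (rule sum.cong[OF refl], rule arg_cong2[where f="(*)", OF refl], rule eq) simp
  then show ?thesis
    by (simp only: JN_def sum_subtractf right_diff_distrib)
qed

text \<open>At points of absolute convergence each \<open>JN\<close> is additive, and additivity
  passes to the limit. Three null sets are discarded, those of \<open>h\<close>, of
  \<open>h'\<close> and of their difference.\<close>

lemma AE_J_diff:
  assumes i: "integrable (Rp p) h" "integrable (Rp p) h'"
  shows "AE x in Q. J p (\<lambda>v. h v - h' v) x = J p h x - J p h' x"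
  using AE_summable_slices[OF i(1)] AE_summable_slices[OF i(2)]
    AE_summable_slices[OF Bochner_Integration.integrable_diff[OF i]] AE_space
proof eventually_elim
  fix x assume g: "summable_slices p h x" "summable_slices p h' x" "summable_slices p (\<lambda>v. h v - h' v) x" and x: "x \<in> space Q"
  have m: "h \<in> borel_measurable (Rp p)" "h' \<in> borel_measurable (Rp p)" using i by auto
  have "(\<lambda>N. JN N p (\<lambda>v. h v - h' v) x) \<longlonglongrightarrow> J p (\<lambda>v. h v - h' v) x"
    using m by (intro JN_tendsto_J[OF g(3) x]) simp
  moreover have "(\<lambda>N. JN N p (\<lambda>v. h v - h' v) x) \<longlonglongrightarrow> J p h x - J p h' x"
    unfolding JN_diff[OF g(1,2) x m] by (intro tendsto_diff JN_tendsto_J g x m)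
  ultimately show "J p (\<lambda>v. h v - h' v) x = J p h x - J p h' x" by (rule LIMSEQ_unique)
qed

text \<open>The continuity estimate behind the extension to all of \<open>L2_hat p\<close>;
  \<open>fact p / 2^p\<close> is the factorial times the normalisation of \<open>dx/2\<close>. It
  follows from the truncated bound by Fatou's lemma.\<close>

lemma J_L2_bound:
  assumes f: "f \<in> L2_hat p" and i: "integrable (Rp p) f"
  shows "(\<integral>\<^sup>+x. ennreal ((J p f x)\<^sup>2) \<partial>Q) \<le> ennreal (fact p / 2^p * (\<integral>v. (f v)\<^sup>2 \<partial>Rp p))"
proof -
  have [measurable]: "JN N p f \<in> borel_measurable Q" for N
    using JN_integrable[OF f] by (rule borel_measurable_integrable)
  have "(\<integral>\<^sup>+x. ennreal ((J p f x)\<^sup>2) \<partial>Q) = (\<integral>\<^sup>+x. liminf (\<lambda>N. ennreal ((JN N p f x)\<^sup>2)) \<partial>Q)"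
  proof (rule nn_integral_cong_AE)
    show "AE x in Q. ennreal ((J p f x)\<^sup>2) = liminf (\<lambda>N. ennreal ((JN N p f x)\<^sup>2))"
      using AE_summable_slices[OF i] AE_space
    proof eventually_elim
      fix x assume "summable_slices p f x" "x \<in> space Q"
      then have "(\<lambda>N. ennreal ((JN N p f x)\<^sup>2)) \<longlonglongrightarrow> ennreal ((J p f x)\<^sup>2)"
        by (intro tendsto_ennrealI tendsto_power JN_tendsto_J L2_hat_measurable f)
      then show "ennreal ((J p f x)\<^sup>2) = liminf (\<lambda>N. ennreal ((JN N p f x)\<^sup>2))"
        by (intro lim_imp_Liminf[symmetric]) simp
    qed
  qed
  also have "\<dots> \<le> liminf (\<lambda>N. \<integral>\<^sup>+x. ennreal ((JN N p f x)\<^sup>2) \<partial>Q)"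
    by (rule nn_integral_liminf) measurable
  also have "\<dots> \<le> ennreal (fact p / 2^p * (\<integral>v. (f v)\<^sup>2 \<partial>Rp p))"
  proof (rule Liminf_le)
    show "\<forall>\<^sub>F N in sequentially. (\<integral>\<^sup>+x. ennreal ((JN N p f x)\<^sup>2) \<partial>Q) \<le> ennreal (fact p / 2^p * (\<integral>v. (f v)\<^sup>2 \<partial>Rp p))"
      by (intro always_eventually allI JN_L2_bound f)
  qed simp
  finally show ?thesis .
qed

lemma L2_hat_diff:
  assumes f: "f \<in> L2_hat p" "g \<in> L2_hat p"
  shows "(\<lambda>v. f v - g v) \<in> L2_hat p"
proof -
  note [measurable] = L2_hat_measurable[OF f(1)] L2_hat_measurable[OF f(2)]
  have "integrable (Rp p) (\<lambda>v. (f v - g v)\<^sup>2)"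
  proof (rule Bochner_Integration.integrable_bound)
    show "integrable (Rp p) (\<lambda>v. 2 * (f v)\<^sup>2 + 2 * (g v)\<^sup>2)"
      using L2_hat_square[OF f(1)] L2_hat_square[OF f(2)] by simp
    have "(a - b)\<^sup>2 \<le> 2 * a\<^sup>2 + 2 * b\<^sup>2" for a b :: real
      using zero_le_power2[of "a + b"] by (simp add: power2_eq_square algebra_simps)
    then show "AE v in Rp p. norm ((f v - g v)\<^sup>2) \<le> norm (2 * (f v)\<^sup>2 + 2 * (g v)\<^sup>2)" by simp
  qed measurable
  moreover have "AE x in Rp p. f (x \<circ> \<sigma>) - g (x \<circ> \<sigma>) = f x - g x" if "\<sigma> permutes {..<p}" for \<sigma>
    using L2_hat_sym[OF f(1) that] L2_hat_sym[OF f(2) that] by eventually_elim simp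
  moreover have "AE v in Rp p. v \<notin> Delta p \<longrightarrow> f v - g v = 0"
    using f by (auto simp: L2_hat_def)
  ultimately show ?thesis by (simp add: L2_hat_def sq_integrable_def)
qed

lemma nn_integral_square_triangle:
  fixes a b c :: "'a \<Rightarrow> real"
  assumes [measurable]: "a \<in> borel_measurable M" "b \<in> borel_measurable M" "c \<in> borel_measurable M"
  shows "(\<integral>\<^sup>+x. ennreal ((a x - c x)\<^sup>2) \<partial>M) \<le>
    2 * (\<integral>\<^sup>+x. ennreal ((a x - b x)\<^sup>2) \<partial>M) + 2 * (\<integral>\<^sup>+x. ennreal ((b x - c x)\<^sup>2) \<partial>M)"
proof -
  have "(u - w)\<^sup>2 \<le> 2 * (u - v)\<^sup>2 + 2 * (v - w)\<^sup>2" for u v w :: real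
    using zero_le_power2[of "u - 2 * v + w"] by (simp add: power2_eq_square algebra_simps)
  then have "(\<integral>\<^sup>+x. ennreal ((a x - c x)\<^sup>2) \<partial>M) \<le> (\<integral>\<^sup>+x. ennreal (2 * (a x - b x)\<^sup>2 + 2 * (b x - c x)\<^sup>2) \<partial>M)"
    by (intro nn_integral_mono ennreal_leI)
  also have "\<dots> = (\<integral>\<^sup>+x. 2 * ennreal ((a x - b x)\<^sup>2) + 2 * ennreal ((b x - c x)\<^sup>2) \<partial>M)"
    by (intro nn_integral_cong) (simp add: ennreal_plus ennreal_mult)
  also have "\<dots> = 2 * (\<integral>\<^sup>+x. ennreal ((a x - b x)\<^sup>2) \<partial>M) + 2 * (\<integral>\<^sup>+x. ennreal ((b x - c x)\<^sup>2) \<partial>M)"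
    by (subst nn_integral_add) (auto simp: nn_integral_cmult)
  finally show ?thesis .
qed

lemma trunc_tendsto_L2:
  assumes f: "f \<in> L2_hat p"
  shows "(\<lambda>N. \<integral>\<^sup>+v. ennreal ((trunc N p f v - f v)\<^sup>2) \<partial>Rp p) \<longlonglongrightarrow> 0"
proof -
  note [measurable] = L2_hat_measurable[OF f]
  have "(\<lambda>N. \<integral>\<^sup>+v. ennreal ((trunc N p f v - f v)\<^sup>2) \<partial>Rp p) \<longlonglongrightarrow> (\<integral>\<^sup>+v. 0 \<partial>Rp p)"
  proof (rule nn_integral_dominated_convergence)
    show "(\<integral>\<^sup>+v. ennreal ((f v)\<^sup>2) \<partial>Rp p) < \<infinity>"
      using L2_hat_square[OF f] by (simp add: integrable_iff_bounded)
    show "AE v in Rp p. ennreal ((trunc N p f v - f v)\<^sup>2) \<le> ennreal ((f v)\<^sup>2)" for N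
      by (simp add: trunc_def)
    show "AE v in Rp p. (\<lambda>N. ennreal ((trunc N p f v - f v)\<^sup>2)) \<longlonglongrightarrow> 0"
    proof (intro AE_I2)
      fix v
      have "(\<lambda>N. ennreal ((trunc N p f v - f v)\<^sup>2)) \<longlonglongrightarrow> ennreal ((f v - f v)\<^sup>2)"
        by (intro tendsto_ennrealI tendsto_power tendsto_diff tendsto_const trunc_tendsto)
      then show "(\<lambda>N. ennreal ((trunc N p f v - f v)\<^sup>2)) \<longlonglongrightarrow> 0" by simp
    qed
  qed measurable
  then show ?thesis by simp
qed

text \<open>A measurable version of \<open>J\<close>; on the null set where \<open>JN\<close> diverges its value is arbitrary.\<close>

definition Jlim :: "nat \<Rightarrow> ((nat \<Rightarrow> real) \<Rightarrow> real) \<Rightarrow> (nat \<Rightarrow> real) \<Rightarrow> real" where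
  "Jlim p f x = lim (\<lambda>N. JN N p f x)"

lemma JN_measurable: "f \<in> L2_hat p \<Longrightarrow> JN N p f \<in> borel_measurable Q"
  using JN_integrable by (rule borel_measurable_integrable)

lemma Jlim_measurable: "f \<in> L2_hat p \<Longrightarrow> Jlim p f \<in> borel_measurable Q"
  unfolding Jlim_def[abs_def] by (intro borel_measurable_lim_metric JN_measurable)

lemma AE_J_eq_Jlim:
  assumes f: "f \<in> L2_hat p" and i: "integrable (Rp p) f"
  shows "AE x in Q. J p f x = Jlim p f x"
  using AE_summable_slices[OF i] AE_space
proof eventually_elim
  fix x assume "summable_slices p f x" "x \<in> space Q"
  from JN_tendsto_J[OF this L2_hat_measurable[OF f]] show "J p f x = Jlim p f x"
    unfolding Jlim_def by (rule limI[symmetric])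
qed

text \<open>By linearity almost everywhere, the bound applies to the difference of the
  integrands.\<close>

lemma Jlim_diff_bound:
  assumes f: "f \<in> L2_hat p" "integrable (Rp p) f" and g: "g \<in> L2_hat p" "integrable (Rp p) g"
  shows "(\<integral>\<^sup>+x. ennreal ((Jlim p f x - Jlim p g x)\<^sup>2) \<partial>Q) \<le> ennreal (fact p / 2^p) * (\<integral>\<^sup>+v. ennreal ((f v - g v)\<^sup>2) \<partial>Rp p)"
proof -
  let ?d = "\<lambda>v. f v - g v"
  have d: "?d \<in> L2_hat p" "integrable (Rp p) ?d"
    using f g by (auto intro: L2_hat_diff)
  have "(\<integral>\<^sup>+x. ennreal ((Jlim p f x - Jlim p g x)\<^sup>2) \<partial>Q) = (\<integral>\<^sup>+x. ennreal ((J p ?d x)\<^sup>2) \<partial>Q)"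
  proof (rule nn_integral_cong_AE)
    show "AE x in Q. ennreal ((Jlim p f x - Jlim p g x)\<^sup>2) = ennreal ((J p ?d x)\<^sup>2)"
      using AE_J_eq_Jlim[OF f] AE_J_eq_Jlim[OF g] AE_J_diff[OF f(2) g(2)] by eventually_elim simp
  qed
  also have "\<dots> \<le> ennreal (fact p / 2^p * (\<integral>v. (?d v)\<^sup>2 \<partial>Rp p))"
    by (rule J_L2_bound[OF d])
  also have "\<dots> = ennreal (fact p / 2^p) * ennreal (\<integral>v. (?d v)\<^sup>2 \<partial>Rp p)"
    by (rule ennreal_mult') simp
  also have "ennreal (\<integral>v. (?d v)\<^sup>2 \<partial>Rp p) = (\<integral>\<^sup>+v. ennreal ((f v - g v)\<^sup>2) \<partial>Rp p)"
    by (rule nn_integral_eq_integral[OF L2_hat_square[OF d(1)], symmetric]) simp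
  finally show ?thesis .
qed

section \<open>The stochastic integral as a limit\<close>

text \<open>Modifying \<open>2k + 1 + U\<^sub>k\<close> on the null event \<open>U\<^sub>k \<notin> [-1, 1)\<close> makes \<open>Xs U\<close> take values in the space of
  \<open>Q\<close> everywhere.\<close>

definition snap :: "nat \<Rightarrow> real \<Rightarrow> real" where
  "snap k t = (if 2 * real k + 1 + t \<in> cell k then 2 * real k + 1 + t else 2 * real k)"

definition Xs :: "(nat \<Rightarrow> 'a \<Rightarrow> real) \<Rightarrow> 'a \<Rightarrow> nat \<Rightarrow> real" where
  "Xs U \<omega> k = snap k (U k \<omega>)"

lemma snap_in_cell: "snap k t \<in> cell k"
  by (simp add: snap_def cell_def)

lemma snap_measurable: "snap k \<in> measurable borel (Qc k)"
proof -
  have "snap k \<in> measurable borel (restrict_space borel (cell k))"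
  proof (rule measurable_restrict_space2)
    show "snap k \<in> space borel \<rightarrow> cell k" using snap_in_cell by blast
    show "snap k \<in> borel_measurable borel" unfolding snap_def[abs_def] by measurable
  qed
  then show ?thesis by (simp add: measurable_cong_sets[OF refl sets_Qc])
qed

lemma uniform_almost_interior: "AE t in uniform_measure lborel {-1..1}. -1 \<le> t \<and> t < (1::real)"
proof (rule AE_uniform_measureI)
  show "AE t in lborel. t \<in> {-1..1} \<longrightarrow> -1 \<le> t \<and> t < (1::real)"
    using AE_lborel_singleton[of "1::real"] by eventually_elim auto
qed simp

lemma snap_eq: "-1 \<le> t \<Longrightarrow> t < 1 \<Longrightarrow> snap k t = 2 * real k + 1 + t"
  by (simp add: snap_def cell_def)

text \<open>On \<open>{-1..1}\<close>, apart from the null point \<open>t = 1\<close>,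
  \<open>snap k\<close> is translation by \<open>2 * real k + 1\<close>, which carries one uniform
  law to the other.\<close>

lemma distr_snap: "distr (uniform_measure lborel {-1..1}) (Qc k) (snap k) = Qc k"
proof (rule measure_eqI)
  fix A assume "A \<in> sets (distr (uniform_measure lborel {-1..1}) (Qc k) (snap k))"
  then have A: "A \<in> sets (Qc k)" by simp
  then have Ab: "A \<in> sets borel" "A \<subseteq> cell k"
    by (auto simp: sets_Qc sets_restrict_space_iff)
  have m: "snap k \<in> measurable (uniform_measure lborel {-1..1}) (Qc k)"
    using snap_measurable by (simp add: measurable_cong_sets[OF sets_uniform_measure refl])
  have pre: "snap k -` A \<in> sets borel"
    using measurable_sets[OF snap_measurable A] by simp
  have tr: "(\<lambda>t. 2 * real k + 1 + t) -` A \<in> sets borel"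
    using measurable_sets[of "\<lambda>t. 2 * real k + 1 + t" borel borel A] Ab by simp
  have "emeasure (distr (uniform_measure lborel {-1..1}) (Qc k) (snap k)) A = emeasure (uniform_measure lborel {-1..1}) (snap k -` A)"
    using A m by (subst emeasure_distr) auto
  also have "\<dots> = emeasure lborel ({-1..1} \<inter> snap k -` A) / emeasure lborel {-1..1::real}"
    by (rule emeasure_uniform_measure) (use pre in auto)
  also have "emeasure lborel ({-1..1} \<inter> snap k -` A) = emeasure lborel ((\<lambda>t. 2 * real k + 1 + t) -` A)"
  proof (rule emeasure_eq_AE)
    show "AE t in lborel. t \<in> {-1..1} \<inter> snap k -` A \<longleftrightarrow> t \<in> (\<lambda>t. 2 * real k + 1 + t) -` A"
      using AE_lborel_singleton[of "1::real"]
    proof eventually_elim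
      fix t :: real assume "t \<noteq> 1"
      show "t \<in> {-1..1} \<inter> snap k -` A \<longleftrightarrow> t \<in> (\<lambda>t. 2 * real k + 1 + t) -` A"
      proof (cases "-1 \<le> t \<and> t < 1")
        case True
        then show ?thesis by (simp add: snap_eq)
      next
        case False
        then have "2 * real k + 1 + t \<notin> cell k" by (auto simp: cell_def)
        then show ?thesis using False \<open>t \<noteq> 1\<close> Ab(2) by auto
      qed
    qed
  qed (use pre tr in auto)
  also have "emeasure lborel ((\<lambda>t. 2 * real k + 1 + t) -` A) = emeasure (distr lborel borel ((+) (2 * real k + 1))) A"
    using Ab by (subst emeasure_distr) auto
  also have "\<dots> = emeasure lborel A" by (simp add: lborel_distr_plus)
  also have "emeasure lborel A / emeasure lborel {-1..1::real} = ennreal (1/2) * emeasure lborel A"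
    by (simp add: divide_ennreal_def mult.commute flip: ennreal_numeral)
  also have "\<dots> = emeasure (Qc k) A"
    using emeasure_Qc[OF Ab(1), of k] Ab(2) by (simp add: Int_absorb2 Int_commute Int_absorb1)
  finally show "emeasure (distr (uniform_measure lborel {-1..1}) (Qc k) (snap k)) A = emeasure (Qc k) A" .
qed simp

context
  fixes M :: "'a measure" and U :: "nat \<Rightarrow> 'a \<Rightarrow> real"
  assumes pM: "prob_space M"
    and ind: "prob_space.indep_vars M (\<lambda>_. borel) U UNIV"
    and dU: "\<And>k. distr M borel (U k) = uniform_measure lborel {-1..1}"
begin

lemma U_measurable: "U k \<in> borel_measurable M"
  using ind prob_space.indep_vars_def[OF pM, of "\<lambda>_. borel" U UNIV] by simp

text \<open>Independence passes to the coordinatewise images of \<open>U\<close>, whose joint law is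
  then the product measure. Statements about \<open>M\<close> are pulled back from \<open>Q\<close>
  from here on.\<close>

lemma Xs_law: "distr M Q (Xs U) = Q" and Xs_measurable: "Xs U \<in> measurable M Q"
proof -
  interpret prob_space M by (rule pM)
  have c: "(\<lambda>\<omega>. snap k (U k \<omega>)) \<in> measurable M (Qc k)" for k
    by (rule measurable_compose[OF U_measurable snap_measurable])
  have "indep_vars Qc (\<lambda>k \<omega>. snap k (U k \<omega>)) UNIV"
    by (rule indep_vars_compose2[OF ind snap_measurable])
  then have "distr M (PiM UNIV Qc) (\<lambda>\<omega>. \<lambda>k\<in>UNIV. snap k (U k \<omega>)) = PiM UNIV (\<lambda>k. distr M (Qc k) (\<lambda>\<omega>. snap k (U k \<omega>)))"
    by (subst (asm) indep_vars_iff_distr_eq_PiM) (use c in auto)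
  moreover have "distr M (Qc k) (\<lambda>\<omega>. snap k (U k \<omega>)) = Qc k" for k
    using distr_distr[OF snap_measurable U_measurable, of k k] distr_snap[of k] by (simp add: comp_def dU)
  moreover have eq: "(\<lambda>\<omega>. \<lambda>k\<in>UNIV. snap k (U k \<omega>)) = Xs U" by (auto simp: Xs_def fun_eq_iff)
  ultimately show "distr M Q (Xs U) = Q" by (simp add: Q_def)
  have "(\<lambda>\<omega>. \<lambda>k\<in>UNIV. snap k (U k \<omega>)) \<in> measurable M (PiM UNIV Qc)"
    by (rule measurable_restrict) (rule c)
  then show "Xs U \<in> measurable M Q" unfolding eq Q_def .
qed

lemma AE_Xs:
  assumes "AE x in Q. P x" shows "AE \<omega> in M. P (Xs U \<omega>)"
  using assms by (rule AE_distrD[OF Xs_measurable, unfolded Xs_law])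

lemma nn_integral_Xs: "F \<in> borel_measurable Q \<Longrightarrow> (\<integral>\<^sup>+\<omega>. F (Xs U \<omega>) \<partial>M) = (\<integral>\<^sup>+x. F x \<partial>Q)"
  using nn_integral_distr[OF Xs_measurable, of F] by (simp add: Xs_law)

lemma AE_Xs_eq: "AE \<omega> in M. \<forall>k. Xs U \<omega> k = 2 * real k + 1 + U k \<omega>"
proof (subst AE_all_countable, rule allI)
  fix k
  have "AE t in distr M borel (U k). -1 \<le> t \<and> t < (1::real)"
    unfolding dU by (rule uniform_almost_interior)
  from AE_distrD[OF U_measurable this] show "AE \<omega> in M. Xs U \<omega> k = 2 * real k + 1 + U k \<omega>"
    by eventually_elim (simp add: Xs_def snap_eq)
qed

lemma AE_stoch_int_L1: "AE \<omega> in M. stoch_int_L1 U p h \<omega> = J p h (Xs U \<omega>)"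
  using AE_Xs_eq
proof eventually_elim
  fix \<omega> assume "\<forall>k. Xs U \<omega> k = 2 * real k + 1 + U k \<omega>"
  then have "tcat r (\<lambda>j. 2 * real (k j) + 1 + U (k j) \<omega>) q y = tcat r (pick r k (Xs U \<omega>)) q y" for r k q y
    using tcat_pick[of r "Xs U \<omega>" k q y] by simp
  then show "stoch_int_L1 U p h \<omega> = J p h (Xs U \<omega>)"
    by (simp add: stoch_int_L1_def J_def)
qed

lemma AE_stoch_int_L1_Jlim:
  assumes f: "f \<in> L2_hat p" "integrable (Rp p) f"
  shows "AE \<omega> in M. stoch_int_L1 U p f \<omega> = Jlim p f (Xs U \<omega>)"
  using AE_stoch_int_L1[of p f] AE_Xs[OF AE_J_eq_Jlim[OF f]] by eventually_elim simp

lemma AE_stoch_int_L1_JN: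
  "AE \<omega> in M. stoch_int_L1 U p (trunc N p f) \<omega> = JN N p f (Xs U \<omega>)"
  using AE_stoch_int_L1[of p "trunc N p f"] AE_space
  by eventually_elim (simp add: J_trunc measurable_space[OF Xs_measurable])

lemma Jlim_Xs_measurable: "f \<in> L2_hat p \<Longrightarrow> (\<lambda>\<omega>. Jlim p f (Xs U \<omega>)) \<in> borel_measurable M"
  by (rule measurable_compose[OF Xs_measurable Jlim_measurable])

lemma JN_Xs_measurable: "f \<in> L2_hat p \<Longrightarrow> (\<lambda>\<omega>. JN N p f (Xs U \<omega>)) \<in> borel_measurable M"
  by (rule measurable_compose[OF Xs_measurable JN_measurable])

text \<open>Compares two integrable approximations through their common target \<open>h\<close>,
  which may itself fail to be integrable.\<close>

lemma Jlim_Xs_bound: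
  assumes f: "f \<in> L2_hat p" "integrable (Rp p) f" and g: "g \<in> L2_hat p" "integrable (Rp p) g" and h: "h \<in> borel_measurable (Rp p)"
  shows "(\<integral>\<^sup>+\<omega>. ennreal ((Jlim p f (Xs U \<omega>) - Jlim p g (Xs U \<omega>))\<^sup>2) \<partial>M) \<le>
    ennreal (fact p / 2^p) * (2 * (\<integral>\<^sup>+v. ennreal ((f v - h v)\<^sup>2) \<partial>Rp p) + 2 * (\<integral>\<^sup>+v. ennreal ((g v - h v)\<^sup>2) \<partial>Rp p))"
proof -
  have [measurable]: "Jlim p f \<in> borel_measurable Q" "Jlim p g \<in> borel_measurable Q"
    using f g by (auto intro: Jlim_measurable)
  have "(\<integral>\<^sup>+\<omega>. ennreal ((Jlim p f (Xs U \<omega>) - Jlim p g (Xs U \<omega>))\<^sup>2) \<partial>M) = (\<integral>\<^sup>+x. ennreal ((Jlim p f x - Jlim p g x)\<^sup>2) \<partial>Q)"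
    by (rule nn_integral_Xs) measurable
  also have "\<dots> \<le> ennreal (fact p / 2^p) * (\<integral>\<^sup>+v. ennreal ((f v - g v)\<^sup>2) \<partial>Rp p)"
    by (rule Jlim_diff_bound[OF f g])
  also have "\<dots> \<le> ennreal (fact p / 2^p) * (2 * (\<integral>\<^sup>+v. ennreal ((f v - h v)\<^sup>2) \<partial>Rp p) + 2 * (\<integral>\<^sup>+v. ennreal ((h v - g v)\<^sup>2) \<partial>Rp p))"
    using L2_hat_measurable[OF f(1)] L2_hat_measurable[OF g(1)] h by (intro mult_left_mono nn_integral_square_triangle) auto
  also have "(\<integral>\<^sup>+v. ennreal ((h v - g v)\<^sup>2) \<partial>Rp p) = (\<integral>\<^sup>+v. ennreal ((g v - h v)\<^sup>2) \<partial>Rp p)"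
    by (simp add: power2_commute)
  finally show ?thesis .
qed

text \<open>The truncations of \<open>f\<close> are integrable and converge to it in L2, so their
  integrals are Cauchy with a limit \<open>X\<close>. The same estimate shows that any other
  approximating sequence leads to this limit.\<close>

lemma is_stoch_int_exists:
  assumes f: "f \<in> L2_hat p"
  shows "\<exists>X. is_stoch_int M U p f X"
proof -
  interpret prob_space M by (rule pM)
  let ?C = "ennreal (fact p / 2^p)"
  note fm = L2_hat_measurable[OF f]
  define e where "e N = (\<integral>\<^sup>+v. ennreal ((trunc N p f v - f v)\<^sup>2) \<partial>Rp p)" for N
  have e: "e \<longlonglongrightarrow> 0" unfolding e_def[abs_def] by (rule trunc_tendsto_L2[OF f])
  define a where "a N \<omega> = Jlim p (trunc N p f) (Xs U \<omega>)" for N \<omega>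
  have am[measurable]: "a N \<in> borel_measurable M" for N
    unfolding a_def[abs_def] by (intro Jlim_Xs_measurable trunc_L2_hat f)
  have ab: "(\<integral>\<^sup>+\<omega>. ennreal ((Jlim p h (Xs U \<omega>) - a N \<omega>)\<^sup>2) \<partial>M) \<le> ?C * (2 * (\<integral>\<^sup>+v. ennreal ((h v - f v)\<^sup>2) \<partial>Rp p) + 2 * e N)"
    if "h \<in> L2_hat p" "integrable (Rp p) h" for h N
    unfolding a_def e_def by (rule Jlim_Xs_bound[OF that trunc_L2_hat[OF f] fm])
  have aa: "(\<integral>\<^sup>+\<omega>. ennreal ((a m \<omega> - a n \<omega>)\<^sup>2) \<partial>M) \<le> ?C * (2 * e m + 2 * e n)" for m n
    using ab[OF trunc_L2_hat[OF f, of m], of n] by (simp add: a_def e_def)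
  have C0: "(\<lambda>n. ?C * (2 * u n + 2 * w n)) \<longlonglongrightarrow> 0" if "u \<longlonglongrightarrow> 0" "w \<longlonglongrightarrow> 0" for u w :: "nat \<Rightarrow> ennreal"
  proof -
    have "(\<lambda>n. ?C * (2 * u n + 2 * w n)) \<longlonglongrightarrow> ?C * (2 * 0 + 2 * 0)"
      by (intro ennreal_tendsto_cmult tendsto_add that) (auto simp: ennreal_numeral[symmetric] simp del: ennreal_numeral)
    then show ?thesis by simp
  qed
  obtain X where X: "X \<in> borel_measurable M" "(\<lambda>n. \<integral>\<^sup>+\<omega>. ennreal ((a n \<omega> - X \<omega>)\<^sup>2) \<partial>M) \<longlonglongrightarrow> 0"
  proof (rule L2_complete[of a M])
    fix d :: real assume d: "0 < d"
    have "eventually (\<lambda>n. ?C * (2 * e n + 2 * e n) < ennreal d) sequentially"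
      by (rule order_tendstoD(2)[OF C0[OF e e]]) (use d in simp)
    then obtain N where N: "\<And>n. n \<ge> N \<Longrightarrow> ?C * (2 * e n + 2 * e n) < ennreal d"
      by (auto simp: eventually_sequentially)
    have "(\<integral>\<^sup>+\<omega>. ennreal ((a m \<omega> - a n \<omega>)\<^sup>2) \<partial>M) \<le> ennreal d" if mn: "N \<le> m" "N \<le> n" for m n
    proof (cases "e m \<le> e n")
      case True
      have "?C * (2 * e m + 2 * e n) \<le> ?C * (2 * e n + 2 * e n)"
        by (intro mult_left_mono add_right_mono True) auto
      then show ?thesis using aa[of m n] N[OF mn(2)] by (meson less_imp_le order_trans)
    next
      case False
      then have "?C * (2 * e m + 2 * e n) \<le> ?C * (2 * e m + 2 * e m)"
        by (intro mult_left_mono add_left_mono) auto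
      then show ?thesis using aa[of m n] N[OF mn(1)] by (meson less_imp_le order_trans)
    qed
    then show "\<exists>N. \<forall>m\<ge>N. \<forall>n\<ge>N. (\<integral>\<^sup>+\<omega>. ennreal ((a m \<omega> - a n \<omega>)\<^sup>2) \<partial>M) \<le> ennreal d" by blast
  qed (use am in auto)
  note [measurable] = X(1)
  have "is_stoch_int M U p f X"
    unfolding is_stoch_int_def
  proof (intro conjI allI impI X(1))
    have "eventually (\<lambda>n. (\<integral>\<^sup>+\<omega>. ennreal ((a n \<omega> - X \<omega>)\<^sup>2) \<partial>M) < 1) sequentially"
      by (rule order_tendstoD(2)[OF X(2)]) simp
    then obtain n where n: "(\<integral>\<^sup>+\<omega>. ennreal ((a n \<omega> - X \<omega>)\<^sup>2) \<partial>M) < 1"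
      by (auto simp: eventually_sequentially)
    \<comment> \<open>Comparison with the zero integrand turns the bound for differences into a
      bound for \<open>a n\<close> itself.\<close>
    have zero: "(\<lambda>_. 0) \<in> L2_hat p" by (simp add: L2_hat_def sq_integrable_def)
    have z: "AE x in Q. Jlim p (\<lambda>_. 0) x = 0"
      using AE_J_eq_Jlim[OF zero] by (simp add: J_def)
    have "(\<integral>\<^sup>+\<omega>. ennreal ((a n \<omega>)\<^sup>2) \<partial>M) = (\<integral>\<^sup>+\<omega>. ennreal ((Jlim p (\<lambda>_. 0) (Xs U \<omega>) - a n \<omega>)\<^sup>2) \<partial>M)"
      using AE_Xs[OF z] by (intro nn_integral_cong_AE) (auto elim!: eventually_mono)
    also have "\<dots> \<le> ?C * (2 * (\<integral>\<^sup>+v. ennreal ((0 - f v)\<^sup>2) \<partial>Rp p) + 2 * e n)"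
      by (rule ab[OF zero]) simp
    also have "\<dots> < \<infinity>"
    proof -
      have 1: "(\<integral>\<^sup>+v. ennreal ((0 - f v)\<^sup>2) \<partial>Rp p) < \<infinity>"
        using L2_hat_square[OF f] by (simp add: integrable_iff_bounded)
      have "e n \<le> (\<integral>\<^sup>+v. ennreal ((0 - f v)\<^sup>2) \<partial>Rp p)"
        unfolding e_def by (intro nn_integral_mono ennreal_leI) (simp add: trunc_def)
      then have 2: "e n < \<infinity>" using 1 by (rule le_less_trans)
      show ?thesis using 1 2 by (simp add: ennreal_mult_less_top)
    qed
    finally have an: "(\<integral>\<^sup>+\<omega>. ennreal ((a n \<omega>)\<^sup>2) \<partial>M) < \<infinity>" .
    have "(\<integral>\<^sup>+\<omega>. ennreal ((X \<omega> - 0)\<^sup>2) \<partial>M) \<le> 2 * (\<integral>\<^sup>+\<omega>. ennreal ((X \<omega> - a n \<omega>)\<^sup>2) \<partial>M) + 2 * (\<integral>\<^sup>+\<omega>. ennreal ((a n \<omega> - 0)\<^sup>2) \<partial>M)"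
      by (rule nn_integral_square_triangle) measurable
    also have "\<dots> < \<infinity>"
      using n an by (simp add: power2_commute[of "X _"] ennreal_mult_less_top less_trans[OF n ennreal_one_less_top])
    finally show "integrable M (\<lambda>\<omega>. (X \<omega>)\<^sup>2)"
      by (intro integrableI_bounded) auto
  next
    fix h :: "nat \<Rightarrow> (nat \<Rightarrow> real) \<Rightarrow> real"
    assume h: "\<forall>j. h j \<in> L2_hat p \<and> integrable (Rp p) (h j)"
      and hf: "(\<lambda>j. \<integral>\<^sup>+v. ennreal ((h j v - f v)\<^sup>2) \<partial>Rp p) \<longlonglongrightarrow> 0"
    have hm: "(\<lambda>\<omega>. Jlim p (h j) (Xs U \<omega>)) \<in> borel_measurable M" for j
      using h by (intro Jlim_Xs_measurable) auto
    have b: "(\<integral>\<^sup>+\<omega>. ennreal ((stoch_int_L1 U p (h j) \<omega> - X \<omega>)\<^sup>2) \<partial>M) \<le>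
       2 * (?C * (2 * (\<integral>\<^sup>+v. ennreal ((h j v - f v)\<^sup>2) \<partial>Rp p) + 2 * e j)) + 2 * (\<integral>\<^sup>+\<omega>. ennreal ((a j \<omega> - X \<omega>)\<^sup>2) \<partial>M)" for j
    proof -
      have "(\<integral>\<^sup>+\<omega>. ennreal ((stoch_int_L1 U p (h j) \<omega> - X \<omega>)\<^sup>2) \<partial>M) = (\<integral>\<^sup>+\<omega>. ennreal ((Jlim p (h j) (Xs U \<omega>) - X \<omega>)\<^sup>2) \<partial>M)"
        using AE_stoch_int_L1_Jlim[of "h j" p] h by (intro nn_integral_cong_AE) (auto elim!: eventually_mono)
      also have "\<dots> \<le> 2 * (\<integral>\<^sup>+\<omega>. ennreal ((Jlim p (h j) (Xs U \<omega>) - a j \<omega>)\<^sup>2) \<partial>M) + 2 * (\<integral>\<^sup>+\<omega>. ennreal ((a j \<omega> - X \<omega>)\<^sup>2) \<partial>M)"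
        by (rule nn_integral_square_triangle[OF hm am X(1)])
      also have "\<dots> \<le> 2 * (?C * (2 * (\<integral>\<^sup>+v. ennreal ((h j v - f v)\<^sup>2) \<partial>Rp p) + 2 * e j)) + 2 * (\<integral>\<^sup>+\<omega>. ennreal ((a j \<omega> - X \<omega>)\<^sup>2) \<partial>M)"
        using h by (intro add_right_mono mult_left_mono ab) auto
      finally show ?thesis .
    qed
    have "(\<lambda>j. 2 * (?C * (2 * (\<integral>\<^sup>+v. ennreal ((h j v - f v)\<^sup>2) \<partial>Rp p) + 2 * e j)) + 2 * (\<integral>\<^sup>+\<omega>. ennreal ((a j \<omega> - X \<omega>)\<^sup>2) \<partial>M)) \<longlonglongrightarrow> 2 * 0 + 2 * 0"
      by (intro tendsto_add ennreal_tendsto_cmult C0 hf e X(2)) (auto simp: ennreal_numeral[symmetric] simp del: ennreal_numeral)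
    then have l: "(\<lambda>j. 2 * (?C * (2 * (\<integral>\<^sup>+v. ennreal ((h j v - f v)\<^sup>2) \<partial>Rp p) + 2 * e j)) + 2 * (\<integral>\<^sup>+\<omega>. ennreal ((a j \<omega> - X \<omega>)\<^sup>2) \<partial>M)) \<longlonglongrightarrow> 0" by simp
    show "(\<lambda>j. \<integral>\<^sup>+\<omega>. ennreal ((stoch_int_L1 U p (h j) \<omega> - X \<omega>)\<^sup>2) \<partial>M) \<longlonglongrightarrow> 0"
      by (rule tendsto_sandwich[OF _ _ tendsto_const l]) (auto intro!: always_eventually allI b)
  qed
  then show ?thesis by blast
qed

text \<open>The choice made by \<open>SOME\<close> does not matter, since the predicate pins down
  the limit along the truncations. The product formula uses \<open>stoch_int\<close> only through
  these three facts.\<close>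

lemma stoch_int_limit:
  assumes f: "f \<in> L2_hat p"
  shows "stoch_int M U p f \<in> borel_measurable M"
    and "integrable M (\<lambda>\<omega>. (stoch_int M U p f \<omega>)\<^sup>2)"
    and "(\<lambda>N. \<integral>\<^sup>+\<omega>. ennreal ((JN N p f (Xs U \<omega>) - stoch_int M U p f \<omega>)\<^sup>2) \<partial>M) \<longlonglongrightarrow> 0"
proof -
  have s: "is_stoch_int M U p f (stoch_int M U p f)"
    unfolding stoch_int_def by (rule someI_ex[OF is_stoch_int_exists[OF f]])
  then show "stoch_int M U p f \<in> borel_measurable M" "integrable M (\<lambda>\<omega>. (stoch_int M U p f \<omega>)\<^sup>2)"
    by (simp_all add: is_stoch_int_def)
  have "(\<lambda>N. \<integral>\<^sup>+\<omega>. ennreal ((stoch_int_L1 U p (trunc N p f) \<omega> - stoch_int M U p f \<omega>)\<^sup>2) \<partial>M) \<longlonglongrightarrow> 0"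
    using s trunc_L2_hat[OF f] trunc_tendsto_L2[OF f] unfolding is_stoch_int_def
    by (elim conjE allE[of _ "\<lambda>N. trunc N p f"]) blast
  moreover have "(\<integral>\<^sup>+\<omega>. ennreal ((stoch_int_L1 U p (trunc N p f) \<omega> - stoch_int M U p f \<omega>)\<^sup>2) \<partial>M) =
     (\<integral>\<^sup>+\<omega>. ennreal ((JN N p f (Xs U \<omega>) - stoch_int M U p f \<omega>)\<^sup>2) \<partial>M)" for N
    using AE_stoch_int_L1_JN[of p N f] by (intro nn_integral_cong_AE) (auto elim!: eventually_mono)
  ultimately show "(\<lambda>N. \<integral>\<^sup>+\<omega>. ennreal ((JN N p f (Xs U \<omega>) - stoch_int M U p f \<omega>)\<^sup>2) \<partial>M) \<longlonglongrightarrow> 0" by simp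
qed

end

section \<open>Centred integrands\<close>

lemma tcat_one_measurable:
  assumes f: "f \<in> borel_measurable (Rp (1 + q))" and w: "w \<in> space (Rp q)"
  shows "(\<lambda>t. f (tcat 1 (\<lambda>_. t) q w)) \<in> borel_measurable (restrict_space borel {0..})"
proof -
  have 1: "(\<lambda>t. \<lambda>j\<in>{..<1::nat}. t) \<in> measurable (restrict_space borel {0..}) (Rp 1)"
    by (rule measurable_Rp) (simp add: measurable_cong_sets[OF refl sets_Rpos])
  have 2: "tcat 1 (\<lambda>_. t) q w = tcat 1 (\<lambda>j\<in>{..<1::nat}. t) q w" for t :: real
    by (auto simp: tcat_def)
  show ?thesis
    unfolding 2 using w by (intro measurable_compose[OF tcat_measurable'[OF 1] f]) simp
qed

text \<open>\<open>Qc\<close> lives on half-open cells with density 1/2,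
  \<open>cell_centered\<close> on closed cells with Lebesgue measure; the end point is a null
  set.\<close>

lemma integral_component:
  fixes G :: "real \<Rightarrow> real"
  assumes G: "G \<in> borel_measurable (restrict_space borel {0..})"
  shows "(\<integral>y. G (y j) \<partial>Q) = (1/2) * (LBINT t:{2 * real j .. 2 * real j + 2}. G t)"
proof -
  have Gs: "G \<in> borel_measurable (restrict_space borel S)" if "S \<subseteq> {0..}" for S
    using measurable_restrict_mono[OF G, of S] that by simp
  have Gc: "G \<in> borel_measurable (restrict_space borel (cell j))"
    by (rule Gs) (auto simp: cell_def)
  have GI: "G \<in> borel_measurable (restrict_space borel {2 * real j .. 2 * real j + 2})"
    by (rule Gs) auto
  have m: "(\<lambda>x. x j) \<in> measurable Q (Qc j)" unfolding Q_def by simp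
  have GQ: "G \<in> borel_measurable (Qc j)"
    using Gc by (simp add: measurable_cong_sets[OF sets_Qc refl])
  have "(\<integral>y. G (y j) \<partial>Q) = (\<integral>t. G t \<partial>distr Q (Qc j) (\<lambda>x. x j))"
    by (rule integral_distr[OF m GQ, symmetric])
  also have "distr Q (Qc j) (\<lambda>x. x j) = Qc j"
    unfolding Q_def by (rule PQ.PiM_component) simp
  also have "(\<integral>t. G t \<partial>Qc j) = (\<integral>t. (1/2) *\<^sub>R G t \<partial>restrict_space lborel (cell j))"
    unfolding Qc_def using Gc
    by (intro integral_density) (simp_all add: measurable_cong_sets[OF sets_restrict_space_cong[OF sets_lborel] refl])
  also have "\<dots> = (1/2) * (\<integral>t. indicator (cell j) t *\<^sub>R G t \<partial>lborel)"
    by (subst integral_restrict_space) auto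
  also have "(\<integral>t. indicator (cell j) t *\<^sub>R G t \<partial>lborel) = (\<integral>t. indicator {2 * real j .. 2 * real j + 2} t *\<^sub>R G t \<partial>lborel)"
  proof (rule integral_cong_AE)
    show "(\<lambda>t. indicator (cell j) t *\<^sub>R G t) \<in> borel_measurable lborel"
      using Gc by (subst (asm) borel_measurable_restrict_space_iff) auto
    show "(\<lambda>t. indicator {2 * real j .. 2 * real j + 2} t *\<^sub>R G t) \<in> borel_measurable lborel"
      using GI by (subst (asm) borel_measurable_restrict_space_iff) auto
    show "AE t in lborel. indicator (cell j) t *\<^sub>R G t = indicator {2 * real j .. 2 * real j + 2} t *\<^sub>R G t"
      using AE_lborel_singleton[of "2 * real j + 2"] by eventually_elim (auto simp: cell_def split: split_indicator)
  qed
  finally show ?thesis by (simp add: set_lebesgue_integral_def)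
qed

text \<open>The coordinate \<open>j\<close> occurs in \<open>f\<close> and nowhere else in the
  product, so averaging over it first produces an integral of \<open>f\<close> over one cell, which
  vanishes.\<close>

lemma centered_orthogonal:
  assumes f: "f \<in> L2_hat n" and c: "cell_centered n f" and k: "k \<in> DN N n" and j: "j \<in> k ` {..<n}"
    and \<psi>: "dep B \<psi>" "j \<notin> B" "\<psi> \<in> borel_measurable Q" and int: "integrable Q (\<lambda>x. f (pick n k x) * \<psi> x)"
  shows "(\<integral>x. f (pick n k x) * \<psi> x \<partial>Q) = 0"
proof -
  note [measurable] = L2_hat_measurable[OF f] \<psi>(3)
  obtain i where i: "i < n" "k i = j" using j by auto
  then obtain q where n: "n = 1 + q" by (auto simp: less_eq_Suc_le le_iff_add)
  \<comment> \<open>\<open>cell_centered\<close> speaks of the first argument only; by symmetry of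
    \<open>f\<close> the index \<open>j\<close> may be moved there.\<close>
  define \<sigma> where "\<sigma> = Transposition.transpose 0 i"
  have s: "\<sigma> permutes {..<n}" unfolding \<sigma>_def using i by (intro permutes_swap_id) auto
  define k' where "k' = act n \<sigma> k"
  have k': "k' \<in> DN N n" unfolding k'_def by (rule act_DN[OF s k])
  have k0: "k' 0 = j" using i by (simp add: k'_def act_def \<sigma>_def)
  have sym: "AE x in Q. f (pick n k x) = f (pick n k' x)"
    using AE_pick_sym[OF f s DN_inj[OF k]] by (simp add: k'_def eq_commute)
  define l where "l = (\<lambda>i\<in>{..<q}. k' (Suc i))"
  have linj: "inj_on l {..<q}"
    using DN_inj[OF k'] by (auto simp: inj_on_def l_def n)
  have lj: "l i \<noteq> j" if "i < q" for i
    using inj_onD[OF DN_inj[OF k'], of "Suc i" 0] that k0 by (auto simp: l_def n)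
  have pk: "pick n k' x = tcat 1 (\<lambda>_. x j) q (pick q l x)" for x
  proof
    fix a show "pick n k' x a = tcat 1 (\<lambda>_. x j) q (pick q l x) a"
      by (cases a) (auto simp: pick_def tcat_def n l_def k0)
  qed
  have int': "integrable Q (\<lambda>x. f (pick n k' x) * \<psi> x)"
    using int by (rule integrable_cong_AE_imp) (use sym in \<open>auto elim!: eventually_mono\<close>)
  have "(\<integral>x. f (pick n k x) * \<psi> x \<partial>Q) = (\<integral>x. f (pick n k' x) * \<psi> x \<partial>Q)"
    using sym by (intro integral_cong_AE) (auto elim!: eventually_mono)
  also have "\<dots> = (\<integral>x. \<integral>y. f (pick n k' (mix {j} x y)) * \<psi> (mix {j} x y) \<partial>Q \<partial>Q)"
    by (rule integral_mix(1)[OF int'])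
  also have "\<dots> = (\<integral>x. (\<integral>y. f (tcat 1 (\<lambda>_. y j) q (pick q l x)) \<partial>Q) * \<psi> x \<partial>Q)"
  proof (intro Bochner_Integration.integral_cong refl)
    fix x assume x: "x \<in> space Q"
    have "pick n k' (mix {j} x y) = tcat 1 (\<lambda>_. y j) q (pick q l x)" for y
    proof -
      have "pick q l (mix {j} x y) = pick q l x" using lj by (auto simp: pick_def mix_def)
      then show ?thesis unfolding pk by (simp add: mix_def)
    qed
    then have "(\<integral>y. f (pick n k' (mix {j} x y)) * \<psi> (mix {j} x y) \<partial>Q) = (\<integral>y. f (tcat 1 (\<lambda>_. y j) q (pick q l x)) * \<psi> x \<partial>Q)"
      using x by (intro Bochner_Integration.integral_cong refl) (simp add: dep_mix[OF \<psi>(1,2)])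
    then show "(\<integral>y. f (pick n k' (mix {j} x y)) * \<psi> (mix {j} x y) \<partial>Q) = (\<integral>y. f (tcat 1 (\<lambda>_. y j) q (pick q l x)) \<partial>Q) * \<psi> x"
      by simp
  qed
  also have "\<dots> = (\<integral>x. (1/2) * (LBINT t:{2 * real j .. 2 * real j + 2}. f (tcat 1 (\<lambda>_. t) q (pick q l x))) * \<psi> x \<partial>Q)"
  proof (intro Bochner_Integration.integral_cong refl arg_cong2[where f="(*)"])
    fix x assume x: "x \<in> space Q"
    have "f \<in> borel_measurable (Rp (1 + q))" using L2_hat_measurable[OF f] unfolding n .
    from integral_component[OF tcat_one_measurable[OF this pick_space[OF x]], of j l]
    show "(\<integral>y. f (tcat 1 (\<lambda>_. y j) q (pick q l x)) \<partial>Q) = (1/2) * (LBINT t:{2 * real j .. 2 * real j + 2}. f (tcat 1 (\<lambda>_. t) q (pick q l x)))" .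
  qed
  also have "\<dots> = 0"
  proof -
    have "AE w in Rp q. (LBINT t:{2 * real j .. 2 * real j + 2}. f (tcat 1 (\<lambda>_. t) q w)) = 0"
    proof -
      have "1 \<le> n" "n - 1 = q" using n by simp_all
      moreover from c this(1) have "\<forall>k :: nat. AE y in Rp (n - 1).
        (LBINT t:{2 * real k .. 2 * real k + 2}. f (tcat 1 (\<lambda>_. t) (n - 1) y)) = 0"
        unfolding cell_centered_def by (rule mp)
      ultimately show ?thesis by (simp only:)
    qed
    from AE_pick[OF linj this]
    have "AE x in Q. (1/2) * (LBINT t:{2 * real j .. 2 * real j + 2}. f (tcat 1 (\<lambda>_. t) q (pick q l x))) * \<psi> x = 0"
      by eventually_elim simp
    then show ?thesis by (rule integral_eq_zero_AE)
  qed
  finally show ?thesis .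
qed

lemma pick_dep: "dep (k ` {..<n}) (\<lambda>x. f (pick n k x))"
  unfolding dep_def
proof (intro ballI impI)
  fix x y :: "nat \<Rightarrow> real" assume "\<forall>j\<in>k ` {..<n}. x j = y j"
  then have "pick n k x = pick n k y" by (auto simp: pick_def)
  then show "f (pick n k x) = f (pick n k y)" by simp
qed

lemma dep_sum: "(\<And>k. k \<in> S \<Longrightarrow> dep D (F k)) \<Longrightarrow> dep D (\<lambda>x. \<Sum>k\<in>S. F k x)"
  unfolding dep_def by (intro ballI impI sum.cong refl) blast

lemma pick_measurable_L2: "f \<in> L2_hat n \<Longrightarrow> (\<lambda>x. f (pick n k x)) \<in> borel_measurable Q"
  by (rule measurable_compose[OF pick_measurable L2_hat_measurable])

text \<open>Both sides pair equally with every pure function: by \<open>JN_pure\<close> the left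
  side keeps the tuples with image \<open>A\<close>, and on the right orthogonality and centring
  remove all others. So for a centred integrand the definition reduces to its term
  \<open>r = n\<close>.\<close>

lemma JN_centered:
  assumes f: "f \<in> L2_hat n" and c: "cell_centered n f"
  shows "AE x in Q. JN N n f x = (\<Sum>k\<in>DN N n. f (pick n k x))"
proof -
  let ?S = "\<lambda>x. \<Sum>k\<in>DN N n. f (pick n k x)"
  have ik: "integrable Q (\<lambda>x. f (pick n k x))" if "k \<in> DN N n" for k
    by (rule pick_square_integrable(2)[OF f DN_inj[OF that]])
  have iS: "integrable Q ?S" using ik by (rule Bochner_Integration.integrable_sum)
  have dS: "dep {..<N} ?S"
  proof (rule dep_sum)
    fix k assume k: "k \<in> DN N n"
    show "dep {..<N} (\<lambda>x. f (pick n k x))"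
      by (rule dep_mono[OF pick_dep]) (use DN_lt[OF k] in auto)
  qed
  have "AE x in Q. JN N n f x - ?S x = 0"
  proof (rule weak_unique[of "{..<N}"])
    fix A \<phi> assume A: "A \<subseteq> {..<N}" "pure A \<phi>"
    then have b: "bmeas \<phi>" "dep A \<phi>" by (simp_all add: pure_def)
    have z: "(\<integral>x. f (pick n k x) * \<phi> x \<partial>Q) = 0" if k: "k \<in> DN N n" "k ` {..<n} \<noteq> A" for k
    proof -
      consider j where "j \<in> A" "j \<notin> k ` {..<n}" | j where "j \<in> k ` {..<n}" "j \<notin> A" using k(2) by blast
      then show ?thesis
      proof cases
        case 1
        then show ?thesis by (rule pure_orthogonal[OF A(2) _ _ pick_dep ik[OF k(1)]])
      next
        case 2
        show ?thesis
          by (rule centered_orthogonal[OF f c k(1) 2(1) b(2) 2(2) bmeas_measurable[OF b(1)] bmeas_integrable_mult[OF b(1) ik[OF k(1)]]])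
      qed
    qed
    have "(\<integral>x. (JN N n f x - ?S x) * \<phi> x \<partial>Q) = (\<integral>x. JN N n f x * \<phi> x - (\<Sum>k\<in>DN N n. f (pick n k x) * \<phi> x) \<partial>Q)"
      by (simp add: left_diff_distrib sum_distrib_right)
    also have "\<dots> = (\<integral>x. JN N n f x * \<phi> x \<partial>Q) - (\<Sum>k\<in>DN N n. \<integral>x. f (pick n k x) * \<phi> x \<partial>Q)"
      using bmeas_integrable_mult[OF b(1) JN_integrable[OF f]] bmeas_integrable_mult[OF b(1) ik]
      by (subst Bochner_Integration.integral_diff) (auto intro!: Bochner_Integration.integrable_sum Bochner_Integration.integral_sum)
    also have "(\<Sum>k\<in>DN N n. \<integral>x. f (pick n k x) * \<phi> x \<partial>Q) = (\<Sum>k | k \<in> DN N n \<and> k ` {..<n} = A. \<integral>x. f (pick n k x) * \<phi> x \<partial>Q)"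
      by (rule sum.mono_neutral_right) (use z in auto)
    also have "(\<integral>x. JN N n f x * \<phi> x \<partial>Q) = (\<Sum>k | k \<in> DN N n \<and> k ` {..<n} = A. \<integral>x. f (pick n k x) * \<phi> x \<partial>Q)"
      by (rule JN_pure[OF f A(2)])
    finally show "(\<integral>x. (JN N n f x - ?S x) * \<phi> x \<partial>Q) = 0" by simp
  next
    show "integrable Q (\<lambda>x. JN N n f x - ?S x)" using JN_integrable[OF f] iS by (rule Bochner_Integration.integrable_diff)
    show "dep {..<N} (\<lambda>x. JN N n f x - ?S x)" by (rule dep_diff[OF JN_dep dS])
  qed simp
  then show ?thesis by simp
qed

section \<open>Pairing two centred integrands with a test function\<close>

definition pairing :: "nat \<Rightarrow> nat \<Rightarrow> ((nat \<Rightarrow> real) \<Rightarrow> real) \<Rightarrow> ((nat \<Rightarrow> real) \<Rightarrow> real) \<Rightarrow>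
    ((nat \<Rightarrow> real) \<Rightarrow> real) \<Rightarrow> (nat \<Rightarrow> nat) \<Rightarrow> (nat \<Rightarrow> nat) \<Rightarrow> real" where
  "pairing n m f g \<phi> k l = (\<integral>x. f (pick n k x) * g (pick m l x) * \<phi> x \<partial>Q)"

lemma abs_mult_le_sum_squares: "\<bar>a * b\<bar> \<le> a\<^sup>2 + b\<^sup>2" for a b :: real
proof -
  have "2 * \<bar>a\<bar> * \<bar>b\<bar> \<le> a\<^sup>2 + b\<^sup>2"
    using zero_le_power2[of "\<bar>a\<bar> - \<bar>b\<bar>"] by (simp add: power2_diff)
  moreover have "0 \<le> \<bar>a\<bar> * \<bar>b\<bar>" by simp
  ultimately show ?thesis unfolding abs_mult by linarith
qed

lemma integrable_mult_of_squares:
  fixes F G :: "'a \<Rightarrow> real"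
  assumes "F \<in> borel_measurable M" "G \<in> borel_measurable M"
    and "integrable M (\<lambda>x. (F x)\<^sup>2)" "integrable M (\<lambda>x. (G x)\<^sup>2)"
  shows "integrable M (\<lambda>x. F x * G x)"
proof (rule Bochner_Integration.integrable_bound)
  show "integrable M (\<lambda>x. (F x)\<^sup>2 + (G x)\<^sup>2)"
    using assms(3,4) by (rule Bochner_Integration.integrable_add)
  show "AE x in M. norm (F x * G x) \<le> norm ((F x)\<^sup>2 + (G x)\<^sup>2)"
    using abs_mult_le_sum_squares by simp
qed (intro borel_measurable_times assms)

lemma pick_mult_integrable:
  assumes f: "f \<in> L2_hat n" and g: "g \<in> L2_hat m" and k: "k \<in> DN N n" and l: "l \<in> DN N m"
  shows "integrable Q (\<lambda>x. f (pick n k x) * g (pick m l x))"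
  by (intro integrable_mult_of_squares pick_measurable_L2 f g pick_square_integrable(1) DN_inj[OF k] DN_inj[OF l])

text \<open>An index present in only one of \<open>k\<close>, \<open>l\<close>, \<open>A\<close>
  belongs to a single factor of the integrand, and every factor is centred in its own
  coordinates.\<close>

lemma pairing_zero:
  assumes f: "f \<in> L2_hat n" "cell_centered n f" and g: "g \<in> L2_hat m" "cell_centered m g"
    and A: "pure A \<phi>" and k: "k \<in> DN N n" and l: "l \<in> DN N m"
    and nz: "pairing n m f g \<phi> k l \<noteq> 0"
  shows "k ` {..<n} - l ` {..<m} \<subseteq> A" "l ` {..<m} - k ` {..<n} \<subseteq> A" "A \<subseteq> k ` {..<n} \<union> l ` {..<m}"
proof -
  have b: "bmeas \<phi>" "dep A \<phi>" using A by (simp_all add: pure_def)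
  note i = pick_mult_integrable[OF f(1) g(1) k l]
  note i\<phi> = bmeas_integrable_mult[OF b(1) i]
  have m: "(\<lambda>x. f (pick n k x) * \<phi> x) \<in> borel_measurable Q" "(\<lambda>x. g (pick m l x) * \<phi> x) \<in> borel_measurable Q"
    by (intro borel_measurable_times pick_measurable_L2 f g bmeas_measurable b)+
  show "k ` {..<n} - l ` {..<m} \<subseteq> A"
  proof (rule ccontr)
    assume "\<not> ?thesis"
    then obtain j where j: "j \<in> k ` {..<n}" "j \<notin> l ` {..<m} \<union> A" by blast
    have "(\<integral>x. f (pick n k x) * (g (pick m l x) * \<phi> x) \<partial>Q) = 0"
      by (rule centered_orthogonal[OF f k j(1) dep_mult[OF pick_dep b(2)] j(2) m(2)]) (use i\<phi> in \<open>simp add: mult.assoc\<close>)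
    with nz show False by (simp add: pairing_def mult.assoc)
  qed
  show "l ` {..<m} - k ` {..<n} \<subseteq> A"
  proof (rule ccontr)
    assume "\<not> ?thesis"
    then obtain j where j: "j \<in> l ` {..<m}" "j \<notin> k ` {..<n} \<union> A" by blast
    have "(\<integral>x. g (pick m l x) * (f (pick n k x) * \<phi> x) \<partial>Q) = 0"
      by (rule centered_orthogonal[OF g l j(1) dep_mult[OF pick_dep b(2)] j(2) m(1)]) (use i\<phi> in \<open>simp add: mult_ac\<close>)
    with nz show False by (simp add: pairing_def mult_ac)
  qed
  show "A \<subseteq> k ` {..<n} \<union> l ` {..<m}"
  proof (rule ccontr)
    assume "\<not> ?thesis"
    then obtain j where j: "j \<in> A" "j \<notin> k ` {..<n} \<union> l ` {..<m}" by blast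
    have "(\<integral>x. (f (pick n k x) * g (pick m l x)) * \<phi> x \<partial>Q) = 0"
      by (rule pure_orthogonal[OF A j dep_mult[OF pick_dep pick_dep] i])
    with nz show False by (simp add: pairing_def)
  qed
qed

lemma same_image_act:
  assumes k: "k \<in> DN N p" and k': "k' \<in> DN N' p" and eq: "k ` {..<p} = k' ` {..<p}"
  obtains \<sigma> where "\<sigma> permutes {..<p}" "k' = act p \<sigma> k"
proof -
  define \<sigma> where "\<sigma> j = (if j < p then inv_into {..<p} k (k' j) else j)" for j
  have in_k: "k' j \<in> k ` {..<p}" if "j < p" for j using eq that by auto
  have s: "\<sigma> j < p" "k (\<sigma> j) = k' j" if "j < p" for j
    using inv_into_into[OF in_k[OF that]] f_inv_into_f[OF in_k[OF that]] that by (auto simp: \<sigma>_def)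
  have "inj_on \<sigma> {..<p}"
    by (rule inj_onI) (metis s(2) DN_inj[OF k'] inj_onD lessThan_iff)
  moreover have "\<sigma> ` {..<p} \<subseteq> {..<p}" using s(1) by auto
  ultimately have "bij_betw \<sigma> {..<p} {..<p}"
    by (intro bij_betw_imageI) (simp_all add: endo_inj_surj)
  then have p: "\<sigma> permutes {..<p}" by (rule bij_imp_permutes) (simp add: \<sigma>_def)
  moreover have "k' = act p \<sigma> k"
    using k' s(2) by (intro extensionalityI[of _ "{..<p}"]) (auto simp: act_def DN_def PiE_iff)
  ultimately show thesis by (rule that)
qed

text \<open>Tuples with the same image differ by a permutation, which symmetric integrands do not
  see up to null sets.\<close>

lemma pairing_image:
  assumes f: "f \<in> L2_hat n" and g: "g \<in> L2_hat m" and b: "bmeas \<phi>"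
    and k: "k \<in> DN N n" "k' \<in> DN N' n" "k ` {..<n} = k' ` {..<n}"
    and l: "l \<in> DN N m" "l' \<in> DN N' m" "l ` {..<m} = l' ` {..<m}"
  shows "pairing n m f g \<phi> k l = pairing n m f g \<phi> k' l'"
proof -
  obtain \<sigma> where s: "\<sigma> permutes {..<n}" "k' = act n \<sigma> k" by (rule same_image_act[OF k])
  obtain \<tau> where t: "\<tau> permutes {..<m}" "l' = act m \<tau> l" by (rule same_image_act[OF l])
  have "AE x in Q. f (pick n k x) * g (pick m l x) * \<phi> x = f (pick n k' x) * g (pick m l' x) * \<phi> x"
    using AE_pick_sym[OF f s(1) DN_inj[OF k(1)]] AE_pick_sym[OF g t(1) DN_inj[OF l(1)]]
    unfolding s(2) t(2) by eventually_elim simp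
  then show ?thesis
    unfolding pairing_def
    by (intro integral_cong_AE borel_measurable_times pick_measurable_L2 f g bmeas_measurable b)
qed

lemma JN_product_pure:
  assumes f: "f \<in> L2_hat n" "cell_centered n f" and g: "g \<in> L2_hat m" "cell_centered m g" and b: "bmeas \<phi>"
  shows "(\<integral>x. JN N n f x * JN N m g x * \<phi> x \<partial>Q) = (\<Sum>k\<in>DN N n. \<Sum>l\<in>DN N m. pairing n m f g \<phi> k l)"
proof -
  have i: "integrable Q (\<lambda>x. f (pick n k x) * g (pick m l x) * \<phi> x)" if "k \<in> DN N n" "l \<in> DN N m" for k l
    by (rule bmeas_integrable_mult[OF b pick_mult_integrable[OF f(1) g(1) that]])
  have "(\<integral>x. JN N n f x * JN N m g x * \<phi> x \<partial>Q) = (\<integral>x. (\<Sum>k\<in>DN N n. \<Sum>l\<in>DN N m. f (pick n k x) * g (pick m l x) * \<phi> x) \<partial>Q)"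
  proof (rule integral_cong_AE)
    show "AE x in Q. JN N n f x * JN N m g x * \<phi> x = (\<Sum>k\<in>DN N n. \<Sum>l\<in>DN N m. f (pick n k x) * g (pick m l x) * \<phi> x)"
      using JN_centered[OF f, of N] JN_centered[OF g, of N]
      by eventually_elim (simp only: sum_product, simp only: sum_distrib_right)
  qed (intro borel_measurable_times borel_measurable_sum JN_measurable pick_measurable_L2 f g bmeas_measurable b)+
  also have "\<dots> = (\<Sum>k\<in>DN N n. \<integral>x. (\<Sum>l\<in>DN N m. f (pick n k x) * g (pick m l x) * \<phi> x) \<partial>Q)"
    by (intro Bochner_Integration.integral_sum Bochner_Integration.integrable_sum i)
  also have "\<dots> = (\<Sum>k\<in>DN N n. \<Sum>l\<in>DN N m. pairing n m f g \<phi> k l)"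
    unfolding pairing_def by (intro sum.cong refl Bochner_Integration.integral_sum i)
  finally show ?thesis .
qed

section \<open>Counting tuples\<close>

text \<open>Both sides of the product formula, tested against a function centred on \<open>A\<close>, are
  multiples of one sum over pairs of finite sets \<open>K\<close>, \<open>L\<close>; only the multiplicities remain to be
  compared.\<close>

lemma card_split_extensional:
  assumes I: "I \<inter> I' = {}"
  shows "card {\<rho> \<in> extensional (I \<union> I'). P (restrict \<rho> I) \<and> P' (restrict \<rho> I')} =
    card {\<rho> \<in> extensional I. P \<rho>} * card {\<rho> \<in> extensional I'. P' \<rho>}"
proof -
  have "bij_betw (\<lambda>\<rho>. (restrict \<rho> I, restrict \<rho> I')) {\<rho> \<in> extensional (I \<union> I'). P (restrict \<rho> I) \<and> P' (restrict \<rho> I')}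
     ({\<rho> \<in> extensional I. P \<rho>} \<times> {\<rho> \<in> extensional I'. P' \<rho>})"
  proof (rule bij_betwI[where g="\<lambda>(u, w). \<lambda>i\<in>I \<union> I'. if i \<in> I then u i else w i"])
    show "(\<lambda>\<rho>. (restrict \<rho> I, restrict \<rho> I')) \<in> {\<rho> \<in> extensional (I \<union> I'). P (restrict \<rho> I) \<and> P' (restrict \<rho> I')} \<rightarrow>
      ({\<rho> \<in> extensional I. P \<rho>} \<times> {\<rho> \<in> extensional I'. P' \<rho>})" by auto
    have r: "restrict (\<lambda>i\<in>I \<union> I'. if i \<in> I then u i else w i) I = u" "restrict (\<lambda>i\<in>I \<union> I'. if i \<in> I then u i else w i) I' = w"
      if "u \<in> extensional I" "w \<in> extensional I'" for u w :: "'a \<Rightarrow> 'b"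
      using that I by (auto simp: fun_eq_iff restrict_def extensional_def)
    show "(\<lambda>(u, w). \<lambda>i\<in>I \<union> I'. if i \<in> I then u i else w i) \<in> {\<rho> \<in> extensional I. P \<rho>} \<times> {\<rho> \<in> extensional I'. P' \<rho>} \<rightarrow>
       {\<rho> \<in> extensional (I \<union> I'). P (restrict \<rho> I) \<and> P' (restrict \<rho> I')}"
      using r by auto
    show "(restrict (case z of (u, w) \<Rightarrow> \<lambda>i\<in>I \<union> I'. if i \<in> I then u i else w i) I,
        restrict (case z of (u, w) \<Rightarrow> \<lambda>i\<in>I \<union> I'. if i \<in> I then u i else w i) I') = z"
      if "z \<in> {\<rho> \<in> extensional I. P \<rho>} \<times> {\<rho> \<in> extensional I'. P' \<rho>}" for z
      using that r by auto
    show "(case (restrict \<rho> I, restrict \<rho> I') of (u, w) \<Rightarrow> \<lambda>i\<in>I \<union> I'. if i \<in> I then u i else w i) = \<rho>"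
      if "\<rho> \<in> {\<rho> \<in> extensional (I \<union> I'). P (restrict \<rho> I) \<and> P' (restrict \<rho> I')}" for \<rho>
      using that by (auto simp: fun_eq_iff extensional_def)
  qed
  then show ?thesis by (simp add: bij_betw_same_card card_cartesian_product)
qed

lemma card_bij_blocks:
  assumes I: "finite I" "finite I'" "I \<inter> I' = {}" and V: "finite V"
  shows "card {\<rho> \<in> extensional (I \<union> I'). bij_betw \<rho> I V \<and> P' (restrict \<rho> I')} =
    (if card V = card I then fact (card I) else 0) * card {\<rho> \<in> extensional I'. P' \<rho>}"
proof -
  have b: "bij_betw (restrict \<rho> I) I V \<longleftrightarrow> bij_betw \<rho> I V" for \<rho>
    by (rule bij_betw_cong) simp
  have "card {\<rho> \<in> extensional I. bij_betw \<rho> I V} = (if card V = card I then fact (card I) else 0)"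
  proof (cases "card V = card I")
    case True
    then show ?thesis using card_bij_extensional[OF I(1) V] by simp
  next
    case False
    then have e: "{\<rho> \<in> extensional I. bij_betw \<rho> I V} = {}" using bij_betw_same_card by fastforce
    show ?thesis unfolding e using False by simp
  qed
  then show ?thesis
    using card_split_extensional[OF I(3), of "\<lambda>\<rho>. bij_betw \<rho> I V" P'] unfolding b by simp
qed

text \<open>The blocks are the positions of \<gamma>, \<open>t\<close>, \<open>s\<close> and
  \<open>z\<close>; each is filled bijectively and independently of the others.\<close>

lemma card_four_blocks:
  fixes a b c d :: nat
  assumes V: "finite V1" "finite V2" "finite V3" "finite V4"
  shows "card {\<rho> \<in> extensional {..<a + b + c + d}. bij_betw \<rho> {..<a} V1 \<and> bij_betw \<rho> {a..<a + b} V2 \<and>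
      bij_betw \<rho> {a + b..<a + b + c} V3 \<and> bij_betw \<rho> {a + b + c..<a + b + c + d} V4} =
    (if card V1 = a \<and> card V2 = b \<and> card V3 = c \<and> card V4 = d then fact a * fact b * fact c * fact d else 0)"
proof -
  let ?I1 = "{..<a}" and ?I2 = "{a..<a + b}" and ?I3 = "{a + b..<a + b + c}" and ?I4 = "{a + b + c..<a + b + c + d}"
  have res: "bij_betw (restrict \<rho> J) I V \<longleftrightarrow> bij_betw \<rho> I V" if "I \<subseteq> J" for \<rho> :: "nat \<Rightarrow> 'a" and I J V
    by (rule bij_betw_cong) (use that in auto)
  have u: "{..<a + b + c + d} = ?I1 \<union> (?I2 \<union> (?I3 \<union> ?I4))" by auto
  have "card {\<rho> \<in> extensional {..<a + b + c + d}. bij_betw \<rho> ?I1 V1 \<and> bij_betw \<rho> ?I2 V2 \<and> bij_betw \<rho> ?I3 V3 \<and> bij_betw \<rho> ?I4 V4} =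
    card {\<rho> \<in> extensional (?I1 \<union> (?I2 \<union> (?I3 \<union> ?I4))). bij_betw \<rho> ?I1 V1 \<and>
      (\<lambda>\<rho>. bij_betw \<rho> ?I2 V2 \<and> bij_betw \<rho> ?I3 V3 \<and> bij_betw \<rho> ?I4 V4) (restrict \<rho> (?I2 \<union> (?I3 \<union> ?I4)))}"
    unfolding u by (intro arg_cong[where f=card] Collect_cong) (subst res, blast, subst res, blast, subst res, blast, simp)
  also have "\<dots> = (if card V1 = a then fact a else 0) * card {\<rho> \<in> extensional (?I2 \<union> (?I3 \<union> ?I4)). bij_betw \<rho> ?I2 V2 \<and> bij_betw \<rho> ?I3 V3 \<and> bij_betw \<rho> ?I4 V4}"
    by (subst card_bij_blocks) (auto simp: V)
  also have "card {\<rho> \<in> extensional (?I2 \<union> (?I3 \<union> ?I4)). bij_betw \<rho> ?I2 V2 \<and> bij_betw \<rho> ?I3 V3 \<and> bij_betw \<rho> ?I4 V4} =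
     card {\<rho> \<in> extensional (?I2 \<union> (?I3 \<union> ?I4)). bij_betw \<rho> ?I2 V2 \<and> (\<lambda>\<rho>. bij_betw \<rho> ?I3 V3 \<and> bij_betw \<rho> ?I4 V4) (restrict \<rho> (?I3 \<union> ?I4))}"
    by (intro arg_cong[where f=card] Collect_cong) (subst res, blast, subst res, blast, simp)
  also have "\<dots> = (if card V2 = b then fact b else 0) * card {\<rho> \<in> extensional (?I3 \<union> ?I4). bij_betw \<rho> ?I3 V3 \<and> bij_betw \<rho> ?I4 V4}"
    by (subst card_bij_blocks) (auto simp: V)
  also have "card {\<rho> \<in> extensional (?I3 \<union> ?I4). bij_betw \<rho> ?I3 V3 \<and> bij_betw \<rho> ?I4 V4} =
     card {\<rho> \<in> extensional (?I3 \<union> ?I4). bij_betw \<rho> ?I3 V3 \<and> (\<lambda>\<rho>. bij_betw \<rho> ?I4 V4) (restrict \<rho> ?I4)}"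
    by (intro arg_cong[where f=card] Collect_cong) (subst res, blast, simp)
  also have "\<dots> = (if card V3 = c then fact c else 0) * card {\<rho> \<in> extensional ?I4. bij_betw \<rho> ?I4 V4}"
    by (subst card_bij_blocks) (auto simp: V)
  also have "card {\<rho> \<in> extensional ?I4. bij_betw \<rho> ?I4 V4} = (if card V4 = d then fact d else 0)"
    using card_bij_blocks[of ?I4 "{}" V4 "\<lambda>_. True"] V by (simp add: extensional_empty)
  finally show ?thesis by (simp add: mult.assoc)
qed

text \<open>A set of size \<open>n\<close> is the image of \<open>fact n\<close> tuples, a set of
  any other size of none.\<close>

lemma sum_DN_image:
  fixes \<theta> :: "nat set \<Rightarrow> real"
  shows "(\<Sum>k\<in>DN N n. \<theta> (k ` {..<n})) = fact n * (\<Sum>K | K \<subseteq> {..<N} \<and> card K = n. \<theta> K)"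
proof -
  have "(\<Sum>k\<in>DN N n. \<theta> (k ` {..<n})) = (\<Sum>K\<in>Pow {..<N}. \<Sum>k | k \<in> DN N n \<and> k ` {..<n} = K. \<theta> (k ` {..<n}))"
    using DN_lt by (intro sum.group[symmetric]) auto
  also have "\<dots> = (\<Sum>K\<in>Pow {..<N}. if card K = n then fact n * \<theta> K else 0)"
  proof (intro sum.cong refl)
    fix K assume K: "K \<in> Pow {..<N}"
    have "(\<Sum>k | k \<in> DN N n \<and> k ` {..<n} = K. \<theta> (k ` {..<n})) = (\<Sum>k | k \<in> DN N n \<and> k ` {..<n} = K. \<theta> K)"
      by (intro sum.cong refl) auto
    also have "\<dots> = real (card {k \<in> DN N n. k ` {..<n} = K}) * \<theta> K" by simp
    also have "\<dots> = (if card K = n then fact n * \<theta> K else 0)"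
      using K by (subst card_DN_image) auto
    finally show "(\<Sum>k | k \<in> DN N n \<and> k ` {..<n} = K. \<theta> (k ` {..<n})) = (if card K = n then fact n * \<theta> K else 0)" .
  qed
  also have "\<dots> = (\<Sum>K | K \<in> Pow {..<N} \<and> card K = n. fact n * \<theta> K)"
    by (rule sum.inter_filter[symmetric]) simp
  finally show ?thesis by (simp add: sum_distrib_left)
qed

text \<open>With \<open>p = m + n - q - i\<close>, a tuple of length \<open>p + i\<close> lists \<open>\<gamma>\<close>, \<open>t\<close>, \<open>s\<close> as in \<open>contraction\<close>,
  followed by \<open>z\<close>; \<open>left_ix\<close> and \<open>right_ix\<close> extract the arguments of the two factors.\<close>

definition left_ix :: "nat \<Rightarrow> nat \<Rightarrow> nat \<Rightarrow> nat" where
  "left_ix p i j = (if j < i then p + j else j - i)"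

definition right_ix :: "nat \<Rightarrow> nat \<Rightarrow> nat \<Rightarrow> nat \<Rightarrow> nat \<Rightarrow> nat" where
  "right_ix n q p i j = (if j < i then p + j else if j < q then j - i else n - i + (j - q))"

lemma left_ix_image:
  assumes "i \<le> q" "q \<le> n" "q \<le> m" "p = m + n - q - i"
  shows "left_ix p i ` {..<n} = {..<q - i} \<union> {q - i..<n - i} \<union> {p..<p + i}" "inj_on (left_ix p i) {..<n}"
    "left_ix p i ` {..<n} \<subseteq> {..<p + i}"
proof -
  show 1: "left_ix p i ` {..<n} = {..<q - i} \<union> {q - i..<n - i} \<union> {p..<p + i}"
  proof (intro set_eqI iffI)
    fix a assume "a \<in> left_ix p i ` {..<n}"
    then show "a \<in> {..<q - i} \<union> {q - i..<n - i} \<union> {p..<p + i}"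
      using assms by (auto simp: left_ix_def split: if_splits)
  next
    fix a assume a: "a \<in> {..<q - i} \<union> {q - i..<n - i} \<union> {p..<p + i}"
    show "a \<in> left_ix p i ` {..<n}"
    proof (cases "a < n - i")
      case True
      then show ?thesis using assms by (intro image_eqI[of _ _ "a + i"]) (auto simp: left_ix_def)
    next
      case False
      then have "p \<le> a" "a < p + i" using a assms by auto
      then show ?thesis using assms by (intro image_eqI[of _ _ "a - p"]) (auto simp: left_ix_def)
    qed
  qed
  show "inj_on (left_ix p i) {..<n}" using assms by (auto simp: inj_on_def left_ix_def split: if_splits)
  show "left_ix p i ` {..<n} \<subseteq> {..<p + i}" unfolding 1 using assms by auto
qed

lemma right_ix_image:
  assumes "i \<le> q" "q \<le> n" "q \<le> m" "p = m + n - q - i"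
  shows "right_ix n q p i ` {..<m} = {..<q - i} \<union> {n - i..<p} \<union> {p..<p + i}" "inj_on (right_ix n q p i) {..<m}"
    "right_ix n q p i ` {..<m} \<subseteq> {..<p + i}"
proof -
  show 1: "right_ix n q p i ` {..<m} = {..<q - i} \<union> {n - i..<p} \<union> {p..<p + i}"
  proof (intro set_eqI iffI)
    fix a assume "a \<in> right_ix n q p i ` {..<m}"
    then show "a \<in> {..<q - i} \<union> {n - i..<p} \<union> {p..<p + i}"
      using assms by (auto simp: right_ix_def split: if_splits)
  next
    fix a assume a: "a \<in> {..<q - i} \<union> {n - i..<p} \<union> {p..<p + i}"
    consider "a < q - i" | "q - i \<le> a" "a < p" | "p \<le> a" by linarith
    then show "a \<in> right_ix n q p i ` {..<m}"
    proof cases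
      case 1
      then show ?thesis using assms by (intro image_eqI[of _ _ "a + i"]) (auto simp: right_ix_def)
    next
      case 2
      then have "n - i \<le> a" using a by auto
      then show ?thesis using 2 assms by (intro image_eqI[of _ _ "a - (n - i) + q"]) (auto simp: right_ix_def)
    next
      case 3
      then have "a < p + i" using a assms by auto
      then show ?thesis using 3 assms by (intro image_eqI[of _ _ "a - p"]) (auto simp: right_ix_def)
    qed
  qed
  show "inj_on (right_ix n q p i) {..<m}" using assms by (auto simp: inj_on_def right_ix_def split: if_splits)
  show "right_ix n q p i ` {..<m} \<subseteq> {..<p + i}" unfolding 1 using assms by auto
qed

lemma inj_on_disjoint_Un: "inj_on f A \<Longrightarrow> inj_on f B \<Longrightarrow> f ` A \<inter> f ` B = {} \<Longrightarrow> inj_on f (A \<union> B)"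
  by (auto simp: inj_on_Un)

lemma if_conj_zero: "(P \<longleftrightarrow> a \<and> b) \<Longrightarrow> (if P then X else 0) = (if a then (if b then X else 0) else 0)"
  by simp

text \<open>The sets force the content of every block: \<gamma> lists
  \<open>A \<inter> (K \<inter> L)\<close>, \<open>t\<close> lists \<open>K - L\<close>,
  \<open>s\<close> lists \<open>L - K\<close> and \<open>z\<close> lists
  \<open>K \<inter> L - A\<close>. The remaining freedom is the order inside each block, and the
  block lengths fit exactly when \<open>card (K \<inter> L) = q\<close> and
  \<open>card A = p\<close>.\<close>

lemma card_fiber:
  assumes iq: "i \<le> q" "q \<le> n" "q \<le> m" and p: "p = m + n - q - i"
    and K: "K \<subseteq> {..<N}" "card K = n" and L: "L \<subseteq> {..<N}" "card L = m"
    and A: "K - L \<subseteq> A" "L - K \<subseteq> A" "A \<subseteq> K \<union> L"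
  shows "card {\<rho> \<in> DN N (p + i). \<rho> ` {..<p} = A \<and> \<rho> ` left_ix p i ` {..<n} = K \<and> \<rho> ` right_ix n q p i ` {..<m} = L} =
    (if card (K \<inter> L) = q \<and> card A = p then fact (q - i) * fact (n - q) * fact (m - q) * fact i else 0)"
proof -
  \<comment> \<open>Block lengths as variables of their own, so that positions become sums instead
    of truncated differences.\<close>
  define a b c d where abcd: "a = q - i" "b = n - q" "c = m - q" "d = i"
  have e: "{..<q - i} = {..<a}" "{q - i..<n - i} = {a..<a + b}" "{n - i..<p} = {a + b..<a + b + c}" "{p..<p + i} = {a + b + c..<a + b + c + d}"
    "{..<p} = {..<a} \<union> {a..<a + b} \<union> {a + b..<a + b + c}" "p + i = a + b + c + d"
    "{p..<a + b + c + d} = {a + b + c..<a + b + c + d}"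
    using iq p by (auto simp: abcd)
  let ?I1 = "{..<a}" and ?I2 = "{a..<a + b}" and ?I3 = "{a + b..<a + b + c}" and ?I4 = "{a + b + c..<a + b + c + d}"
  have fin: "finite K" "finite L" using K L finite_subset by auto
  have iff: "\<rho> \<in> DN N (p + i) \<and> \<rho> ` {..<p} = A \<and> \<rho> ` left_ix p i ` {..<n} = K \<and> \<rho> ` right_ix n q p i ` {..<m} = L \<longleftrightarrow>
     \<rho> \<in> extensional {..<a + b + c + d} \<and> bij_betw \<rho> ?I1 (A \<inter> (K \<inter> L)) \<and> bij_betw \<rho> ?I2 (K - L) \<and> bij_betw \<rho> ?I3 (L - K) \<and> bij_betw \<rho> ?I4 (K \<inter> L - A)"
    (is "?lhs \<longleftrightarrow> ?rhs") for \<rho>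
  proof
    assume l: ?lhs
    then have inj: "inj_on \<rho> {..<a + b + c + d}" using DN_inj[of \<rho> N "p + i"] unfolding e by blast
    have ext: "\<rho> \<in> extensional {..<a + b + c + d}" using l unfolding DN_def e by (auto simp: PiE_iff)
    have im: "A = \<rho> ` (?I1 \<union> ?I2 \<union> ?I3)" "K = \<rho> ` (?I1 \<union> ?I2 \<union> ?I4)" "L = \<rho> ` (?I1 \<union> ?I3 \<union> ?I4)"
      using l unfolding left_ix_image(1)[OF iq p] right_ix_image(1)[OF iq p] e by simp_all
    have KL: "K \<inter> L = \<rho> ` (?I1 \<union> ?I4)"
      unfolding im by (subst inj_on_image_Int[OF inj, symmetric]) (auto intro!: arg_cong[where f="image \<rho>"])
    have "A \<inter> (K \<inter> L) = \<rho> ` ?I1"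
      unfolding KL unfolding im by (subst inj_on_image_Int[OF inj, symmetric]) (auto intro!: arg_cong[where f="image \<rho>"])
    moreover have "K - L = \<rho> ` ?I2"
      unfolding im by (subst inj_on_image_set_diff[OF inj, symmetric]) (auto intro!: arg_cong[where f="image \<rho>"])
    moreover have "L - K = \<rho> ` ?I3"
      unfolding im by (subst inj_on_image_set_diff[OF inj, symmetric]) (auto intro!: arg_cong[where f="image \<rho>"])
    moreover have "K \<inter> L - A = \<rho> ` ?I4"
      unfolding KL unfolding im by (subst inj_on_image_set_diff[OF inj, symmetric]) (auto intro!: arg_cong[where f="image \<rho>"])
    moreover have "inj_on \<rho> ?I1" "inj_on \<rho> ?I2" "inj_on \<rho> ?I3" "inj_on \<rho> ?I4"
      by (rule inj_on_subset[OF inj]; auto)+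
    ultimately show ?rhs using ext by (simp add: bij_betw_def)
  next
    assume r: ?rhs
    then have im: "\<rho> ` ?I1 = A \<inter> (K \<inter> L)" "\<rho> ` ?I2 = K - L" "\<rho> ` ?I3 = L - K" "\<rho> ` ?I4 = K \<inter> L - A"
      and inj: "inj_on \<rho> ?I1" "inj_on \<rho> ?I2" "inj_on \<rho> ?I3" "inj_on \<rho> ?I4"
      by (simp_all add: bij_betw_def)
    have u: "{..<a + b + c + d} = ?I1 \<union> (?I2 \<union> (?I3 \<union> ?I4))" by auto
    have "inj_on \<rho> {..<a + b + c + d}"
      unfolding u by (intro inj_on_disjoint_Un inj; unfold image_Un im; blast)
    moreover have "\<rho> ` {..<a + b + c + d} \<subseteq> {..<N}"
      unfolding u image_Un im using K L by auto
    ultimately have "\<rho> \<in> DN N (p + i)"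
      using r unfolding DN_def e by (auto simp: PiE_iff)
    moreover have "\<rho> ` {..<p} = A" unfolding e image_Un im using A by auto
    moreover have "\<rho> ` left_ix p i ` {..<n} = K"
      unfolding left_ix_image(1)[OF iq p] e image_Un im using A by auto
    moreover have "\<rho> ` right_ix n q p i ` {..<m} = L"
      unfolding right_ix_image(1)[OF iq p] e image_Un im using A by auto
    ultimately show ?lhs by simp
  qed
  have KL: "card (K - L) + card (K \<inter> L) = n" "card (L - K) + card (K \<inter> L) = m"
    using card_Diff_subset_Int[of K L] card_Diff_subset_Int[of L K] fin K L card_mono[OF fin(1), of "K \<inter> L"] card_mono[OF fin(2), of "K \<inter> L"]
    by (auto simp: Int_commute)
  have AA: "card A = card (A \<inter> (K \<inter> L)) + card (K - L) + card (L - K)"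
  proof -
    have "A = A \<inter> (K \<inter> L) \<union> (K - L) \<union> (L - K)" using A by auto
    also have "card \<dots> = card (A \<inter> (K \<inter> L) \<union> (K - L)) + card (L - K)"
      using fin by (intro card_Un_disjoint) auto
    also have "card (A \<inter> (K \<inter> L) \<union> (K - L)) = card (A \<inter> (K \<inter> L)) + card (K - L)"
      using fin by (intro card_Un_disjoint) auto
    finally show ?thesis .
  qed
  have KLA: "card (K \<inter> L) = card (A \<inter> (K \<inter> L)) + card (K \<inter> L - A)"
  proof -
    have "K \<inter> L = A \<inter> (K \<inter> L) \<union> (K \<inter> L - A)" by auto
    also have "card \<dots> = card (A \<inter> (K \<inter> L)) + card (K \<inter> L - A)"
      using fin by (intro card_Un_disjoint) auto
    finally show ?thesis .
  qed
  have cond: "card (A \<inter> (K \<inter> L)) = a \<and> card (K - L) = b \<and> card (L - K) = c \<and> card (K \<inter> L - A) = d \<longleftrightarrow> card (K \<inter> L) = q \<and> card A = p"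
    using KL AA KLA iq p by (auto simp: abcd)
  have "{\<rho> \<in> DN N (p + i). \<rho> ` {..<p} = A \<and> \<rho> ` left_ix p i ` {..<n} = K \<and> \<rho> ` right_ix n q p i ` {..<m} = L} =
     {\<rho> \<in> extensional {..<a + b + c + d}. bij_betw \<rho> ?I1 (A \<inter> (K \<inter> L)) \<and> bij_betw \<rho> ?I2 (K - L) \<and> bij_betw \<rho> ?I3 (L - K) \<and> bij_betw \<rho> ?I4 (K \<inter> L - A)}"
    by (intro Collect_cong iff)
  moreover have "finite (A \<inter> (K \<inter> L))" "finite (K - L)" "finite (L - K)" "finite (K \<inter> L - A)"
    using fin by simp_all
  note card_four_blocks[OF this, of a b c d, unfolded cond]
  ultimately show ?thesis by (simp only: abcd)
qed

text \<open>Groups the tuples by the pair of argument sets. Where \<open>\<theta>\<close> is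
  nonzero, \<open>van\<close> supplies the inclusions that \<open>card_fiber\<close> asks
  for.\<close>

lemma tuple_sum_sets:
  fixes \<theta> :: "nat set \<Rightarrow> nat set \<Rightarrow> real"
  assumes iq: "i \<le> q" "q \<le> n" "q \<le> m" and p: "p = m + n - q - i" and AN: "A \<subseteq> {..<N}"
    and van: "\<And>K L. \<theta> K L \<noteq> 0 \<Longrightarrow> K \<subseteq> {..<N} \<Longrightarrow> L \<subseteq> {..<N} \<Longrightarrow> card K = n \<Longrightarrow> card L = m \<Longrightarrow> K - L \<subseteq> A \<and> L - K \<subseteq> A \<and> A \<subseteq> K \<union> L"
  shows "(\<Sum>\<rho> | \<rho> \<in> DN N (p + i) \<and> \<rho> ` {..<p} = A. \<theta> (\<rho> ` left_ix p i ` {..<n}) (\<rho> ` right_ix n q p i ` {..<m})) =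
    (\<Sum>K | K \<subseteq> {..<N} \<and> card K = n. \<Sum>L | L \<subseteq> {..<N} \<and> card L = m.
      (if card (K \<inter> L) = q \<and> card A = p then fact (q - i) * fact (n - q) * fact (m - q) * fact i * \<theta> K L else 0))"
proof -
  let ?S = "{\<rho>. \<rho> \<in> DN N (p + i) \<and> \<rho> ` {..<p} = A}"
  let ?k = "\<lambda>\<rho>. \<rho> ` left_ix p i ` {..<n}" and ?l = "\<lambda>\<rho>. \<rho> ` right_ix n q p i ` {..<m}"
  let ?T = "{K. K \<subseteq> {..<N} \<and> card K = n} \<times> {L. L \<subseteq> {..<N} \<and> card L = m}"
  have maps: "(?k \<rho>, ?l \<rho>) \<in> ?T" if "\<rho> \<in> DN N (p + i)" for \<rho>
  proof -
    have lt: "\<rho> ` J \<subseteq> {..<N}" if "J \<subseteq> {..<p + i}" for J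
      using DN_lt[OF \<open>\<rho> \<in> DN N (p + i)\<close>] that by auto
    have inj: "inj_on \<rho> {..<p + i}" by (rule DN_inj[OF that])
    have "card (?k \<rho>) = n"
      using inj_on_subset[OF inj left_ix_image(3)[OF iq p]] left_ix_image(2)[OF iq p] by (simp add: card_image)
    moreover have "card (?l \<rho>) = m"
      using inj_on_subset[OF inj right_ix_image(3)[OF iq p]] right_ix_image(2)[OF iq p] by (simp add: card_image)
    ultimately show ?thesis using lt[OF left_ix_image(3)[OF iq p]] lt[OF right_ix_image(3)[OF iq p]] by simp
  qed
  have "(\<Sum>\<rho>\<in>?S. \<theta> (?k \<rho>) (?l \<rho>)) = (\<Sum>z\<in>?T. \<Sum>\<rho> | \<rho> \<in> ?S \<and> (?k \<rho>, ?l \<rho>) = z. \<theta> (?k \<rho>) (?l \<rho>))"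
  proof (rule sum.group[symmetric])
    show "(\<lambda>\<rho>. (?k \<rho>, ?l \<rho>)) ` ?S \<subseteq> ?T" using maps by blast
  qed simp_all
  also have "\<dots> = (\<Sum>z\<in>?T. (if card (fst z \<inter> snd z) = q \<and> card A = p then fact (q - i) * fact (n - q) * fact (m - q) * fact i * \<theta> (fst z) (snd z) else 0))"
  proof (intro sum.cong refl)
    fix z assume z: "z \<in> ?T"
    obtain K L where zKL: "z = (K, L)" by (cases z)
    have KL: "K \<subseteq> {..<N}" "card K = n" "L \<subseteq> {..<N}" "card L = m" using z by (simp_all add: zKL)
    have "(\<Sum>\<rho> | \<rho> \<in> ?S \<and> (?k \<rho>, ?l \<rho>) = z. \<theta> (?k \<rho>) (?l \<rho>)) = (\<Sum>\<rho> | \<rho> \<in> ?S \<and> (?k \<rho>, ?l \<rho>) = z. \<theta> K L)"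
      by (intro sum.cong refl) (simp add: zKL)
    also have "\<dots> = real (card {\<rho>. \<rho> \<in> ?S \<and> (?k \<rho>, ?l \<rho>) = z}) * \<theta> K L" by simp
    also have "{\<rho>. \<rho> \<in> ?S \<and> (?k \<rho>, ?l \<rho>) = z} = {\<rho> \<in> DN N (p + i). \<rho> ` {..<p} = A \<and> ?k \<rho> = K \<and> ?l \<rho> = L}"
      by (intro Collect_cong) (simp add: zKL)
    also have "real (card {\<rho> \<in> DN N (p + i). \<rho> ` {..<p} = A \<and> ?k \<rho> = K \<and> ?l \<rho> = L}) * \<theta> K L =
      (if card (K \<inter> L) = q \<and> card A = p then fact (q - i) * fact (n - q) * fact (m - q) * fact i * \<theta> K L else 0)"
    proof (cases "\<theta> K L = 0")
      case False
      from van[OF this KL(1,3,2,4)] have c: "K - L \<subseteq> A" "L - K \<subseteq> A" "A \<subseteq> K \<union> L" by simp_all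
      show ?thesis by (subst card_fiber[OF iq p KL c]) simp
    qed simp
    finally show "(\<Sum>\<rho> | \<rho> \<in> ?S \<and> (?k \<rho>, ?l \<rho>) = z. \<theta> (?k \<rho>) (?l \<rho>)) =
       (if card (fst z \<inter> snd z) = q \<and> card A = p then fact (q - i) * fact (n - q) * fact (m - q) * fact i * \<theta> (fst z) (snd z) else 0)"
      by (simp add: zKL)
  qed
  also have "\<dots> = (\<Sum>K | K \<subseteq> {..<N} \<and> card K = n. \<Sum>L | L \<subseteq> {..<N} \<and> card L = m.
      (if card (K \<inter> L) = q \<and> card A = p then fact (q - i) * fact (n - q) * fact (m - q) * fact i * \<theta> K L else 0))"
    by (simp add: sum.cartesian_product case_prod_beta')
  finally show ?thesis .
qed

text \<open>The coefficient of the theorem times the number of tuples over \<open>(K, L)\<close>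
  equals the number \<open>fact n * fact m\<close> of pairs of tuples with these images.\<close>

lemma coefficient_identity:
  fixes i q n m :: nat
  assumes "i \<le> q" "q \<le> n" "q \<le> m"
  shows "fact q * real (m choose q) * real (n choose q) * (real (q choose i) * (fact (q - i) * fact (n - q) * fact (m - q) * fact i)) = fact n * fact m"
proof -
  have "fact q * fact (n - q) * real (n choose q) = fact n" "fact q * fact (m - q) * real (m choose q) = fact m" "fact i * fact (q - i) * real (q choose i) = fact q"
    using binomial_fact_lemma[OF assms(1)] binomial_fact_lemma[OF assms(2)] binomial_fact_lemma[OF assms(3)]
    by (metis of_nat_fact of_nat_mult)+
  \<comment> \<open>The product of the three binomial identities carries one factor
    \<open>fact q\<close> too many, which cancels at the end.\<close>
  then have "fact n * fact m * fact q = (fact q * fact (n - q) * real (n choose q)) * (fact q * fact (m - q) * real (m choose q)) * (fact i * fact (q - i) * real (q choose i))"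
    by simp
  also have "\<dots> = (fact q * real (m choose q) * real (n choose q) * (real (q choose i) * (fact (q - i) * fact (n - q) * fact (m - q) * fact i))) * fact q"
    by (simp add: mult_ac)
  finally show ?thesis by simp
qed

text \<open>For fixed \<open>A\<close>, every \<open>(K, L)\<close> with
  \<open>\<theta> K L \<noteq> 0\<close> is met by exactly one \<open>(q, i)\<close>, and its total
  weight there is \<open>fact n * fact m\<close>, as on the left.\<close>

lemma combinatorial_identity:
  fixes \<theta> :: "nat set \<Rightarrow> nat set \<Rightarrow> real"
  assumes AN: "A \<subseteq> {..<N}"
    and van: "\<And>K L. \<theta> K L \<noteq> 0 \<Longrightarrow> K \<subseteq> {..<N} \<Longrightarrow> L \<subseteq> {..<N} \<Longrightarrow> card K = n \<Longrightarrow> card L = m \<Longrightarrow> K - L \<subseteq> A \<and> L - K \<subseteq> A \<and> A \<subseteq> K \<union> L"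
  shows "(\<Sum>k\<in>DN N n. \<Sum>l\<in>DN N m. \<theta> (k ` {..<n}) (l ` {..<m})) =
    (\<Sum>q\<le>min m n. fact q * real (m choose q) * real (n choose q) * (\<Sum>i\<le>q. real (q choose i) *
      (\<Sum>\<rho> | \<rho> \<in> DN N (m + n - q - i + i) \<and> \<rho> ` {..<m + n - q - i} = A.
        \<theta> (\<rho> ` left_ix (m + n - q - i) i ` {..<n}) (\<rho> ` right_ix n q (m + n - q - i) i ` {..<m}))))" (is "?L = ?R")
proof -
  let ?Ks = "{K. K \<subseteq> {..<N} \<and> card K = n}" and ?Ls = "{L. L \<subseteq> {..<N} \<and> card L = m}"
  have "?L = (\<Sum>k\<in>DN N n. fact m * (\<Sum>L\<in>?Ls. \<theta> (k ` {..<n}) L))"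
    by (intro sum.cong refl sum_DN_image)
  also have "\<dots> = fact n * (\<Sum>K\<in>?Ks. fact m * (\<Sum>L\<in>?Ls. \<theta> K L))"
    by (rule sum_DN_image)
  also have "\<dots> = (\<Sum>K\<in>?Ks. \<Sum>L\<in>?Ls. fact n * fact m * \<theta> K L)"
    by (simp add: sum_distrib_left mult.assoc)
  finally have L: "?L = (\<Sum>K\<in>?Ks. \<Sum>L\<in>?Ls. fact n * fact m * \<theta> K L)" .
  have "?R = (\<Sum>q\<le>min m n. \<Sum>i\<le>q. \<Sum>K\<in>?Ks. \<Sum>L\<in>?Ls. (if card (K \<inter> L) = q \<and> card A = m + n - q - i then fact n * fact m * \<theta> K L else 0))"
  proof (rule sum.cong[OF refl])
    fix q assume q: "q \<in> {..min m n}"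
    let ?c = "fact q * real (m choose q) * real (n choose q)"
    have "?c * (\<Sum>i\<le>q. real (q choose i) * (\<Sum>\<rho> | \<rho> \<in> DN N (m + n - q - i + i) \<and> \<rho> ` {..<m + n - q - i} = A.
        \<theta> (\<rho> ` left_ix (m + n - q - i) i ` {..<n}) (\<rho> ` right_ix n q (m + n - q - i) i ` {..<m}))) =
      (\<Sum>i\<le>q. ?c * (real (q choose i) * (\<Sum>K\<in>?Ks. \<Sum>L\<in>?Ls. (if card (K \<inter> L) = q \<and> card A = m + n - q - i then fact (q - i) * fact (n - q) * fact (m - q) * fact i * \<theta> K L else 0))))"
    proof (subst sum_distrib_left, rule sum.cong[OF refl], rule arg_cong2[where f="(*)", OF refl], rule arg_cong2[where f="(*)", OF refl])
      fix i assume "i \<in> {..q}"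
      then show "(\<Sum>\<rho> | \<rho> \<in> DN N (m + n - q - i + i) \<and> \<rho> ` {..<m + n - q - i} = A.
        \<theta> (\<rho> ` left_ix (m + n - q - i) i ` {..<n}) (\<rho> ` right_ix n q (m + n - q - i) i ` {..<m})) =
        (\<Sum>K\<in>?Ks. \<Sum>L\<in>?Ls. (if card (K \<inter> L) = q \<and> card A = m + n - q - i then fact (q - i) * fact (n - q) * fact (m - q) * fact i * \<theta> K L else 0))"
        using q by (intro tuple_sum_sets[OF _ _ _ refl AN van]) auto
    qed
    also have "\<dots> = (\<Sum>i\<le>q. \<Sum>K\<in>?Ks. \<Sum>L\<in>?Ls. (if card (K \<inter> L) = q \<and> card A = m + n - q - i then fact n * fact m * \<theta> K L else 0))"
    proof (rule sum.cong[OF refl])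
      fix i assume i: "i \<in> {..q}"
      have "?c * (real (q choose i) * (if P then fact (q - i) * fact (n - q) * fact (m - q) * fact i * t else 0)) = (if P then fact n * fact m * t else 0)" for P and t :: real
      proof (cases P)
        case True
        have "?c * (real (q choose i) * (fact (q - i) * fact (n - q) * fact (m - q) * fact i * t)) =
            (?c * (real (q choose i) * (fact (q - i) * fact (n - q) * fact (m - q) * fact i))) * t" by (simp only: mult.assoc)
        also have "\<dots> = fact n * fact m * t" using coefficient_identity[of i q n m] i q by simp
        finally show ?thesis using True by simp
      qed simp
      then show "?c * (real (q choose i) * (\<Sum>K\<in>?Ks. \<Sum>L\<in>?Ls. (if card (K \<inter> L) = q \<and> card A = m + n - q - i then fact (q - i) * fact (n - q) * fact (m - q) * fact i * \<theta> K L else 0))) =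
         (\<Sum>K\<in>?Ks. \<Sum>L\<in>?Ls. (if card (K \<inter> L) = q \<and> card A = m + n - q - i then fact n * fact m * \<theta> K L else 0))"
        by (simp only: sum_distrib_left)
    qed
    finally show "?c * (\<Sum>i\<le>q. real (q choose i) * (\<Sum>\<rho> | \<rho> \<in> DN N (m + n - q - i + i) \<and> \<rho> ` {..<m + n - q - i} = A.
        \<theta> (\<rho> ` left_ix (m + n - q - i) i ` {..<n}) (\<rho> ` right_ix n q (m + n - q - i) i ` {..<m}))) =
      (\<Sum>i\<le>q. \<Sum>K\<in>?Ks. \<Sum>L\<in>?Ls. (if card (K \<inter> L) = q \<and> card A = m + n - q - i then fact n * fact m * \<theta> K L else 0))" .
  qed
  also have "\<dots> = (\<Sum>q\<le>min m n. \<Sum>K\<in>?Ks. \<Sum>L\<in>?Ls. \<Sum>i\<le>q. (if card (K \<inter> L) = q \<and> card A = m + n - q - i then fact n * fact m * \<theta> K L else 0))"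
    by (rule sum.cong[OF refl]) (subst sum.swap, rule sum.cong[OF refl], rule sum.swap)
  also have "\<dots> = (\<Sum>K\<in>?Ks. \<Sum>L\<in>?Ls. \<Sum>q\<le>min m n. \<Sum>i\<le>q. (if card (K \<inter> L) = q \<and> card A = m + n - q - i then fact n * fact m * \<theta> K L else 0))"
    by (subst sum.swap, rule sum.cong[OF refl], rule sum.swap)
  also have "\<dots> = (\<Sum>K\<in>?Ks. \<Sum>L\<in>?Ls. fact n * fact m * \<theta> K L)"
  proof (intro sum.cong refl)
    fix K L assume KL: "K \<in> ?Ks" "L \<in> ?Ls"
    show "(\<Sum>q\<le>min m n. \<Sum>i\<le>q. (if card (K \<inter> L) = q \<and> card A = m + n - q - i then fact n * fact m * \<theta> K L else 0)) = fact n * fact m * \<theta> K L"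
    proof (cases "\<theta> K L = 0")
      case False
      with van[of K L] KL have c: "K - L \<subseteq> A" "L - K \<subseteq> A" "A \<subseteq> K \<union> L" by auto
      have fin: "finite K" "finite L" "finite A" using KL finite_subset AN by auto
      define q0 where "q0 = card (K \<inter> L)"
      \<comment> \<open>\<open>card (K \<union> L) = m + n - q0\<close>, so \<open>i0\<close> is the
        number of elements of the union missing from \<open>A\<close>; all of them lie in the
        intersection.\<close>
      define i0 where "i0 = m + n - q0 - card A"
      have q0: "q0 \<le> m" "q0 \<le> n" using card_mono[OF fin(1), of "K \<inter> L"] card_mono[OF fin(2), of "K \<inter> L"] KL by (auto simp: q0_def)
      have U: "card (K \<union> L) + q0 = m + n" using card_Un_Int[OF fin(1,2)] KL by (simp add: q0_def)
      have A1: "card A \<le> card (K \<union> L)" using fin c by (intro card_mono) auto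
      \<comment> \<open>The symmetric difference has \<open>m + n - 2 * q0\<close> elements and lies
        in \<open>A\<close>; hence \<open>i0 \<le> q0\<close>, so the term is within the range of
        summation.\<close>
      have "card ((K - L) \<union> (L - K)) = card (K - L) + card (L - K)" using fin by (intro card_Un_disjoint) auto
      moreover have "card (K - L) + q0 = n" "card (L - K) + q0 = m"
        using card_Diff_subset_Int[of K L] card_Diff_subset_Int[of L K] fin KL q0 by (auto simp: q0_def Int_commute)
      moreover have "card ((K - L) \<union> (L - K)) \<le> card A" using fin c by (intro card_mono) auto
      ultimately have A2: "m + n \<le> card A + 2 * q0" by linarith
      have i0: "i0 \<le> q0" using A2 by (simp add: i0_def)
      have eqv: "card (K \<inter> L) = q \<and> card A = m + n - q - i \<longleftrightarrow> q = q0 \<and> i = i0" if "q \<le> min m n" "i \<le> q" for q i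
        using that U A1 A2 unfolding q0_def[symmetric] by (auto simp: i0_def)
      have "(\<Sum>q\<le>min m n. \<Sum>i\<le>q. (if card (K \<inter> L) = q \<and> card A = m + n - q - i then fact n * fact m * \<theta> K L else 0)) =
         (\<Sum>q\<le>min m n. \<Sum>i\<le>q. (if q = q0 then (if i = i0 then fact n * fact m * \<theta> K L else 0) else 0))"
      proof (intro sum.cong refl)
        fix q i assume "q \<in> {..min m n}" "i \<in> {..q}"
        then have "q \<le> min m n" "i \<le> q" by simp_all
        from eqv[OF this] show "(if card (K \<inter> L) = q \<and> card A = m + n - q - i then fact n * fact m * \<theta> K L else 0) =
            (if q = q0 then (if i = i0 then fact n * fact m * \<theta> K L else 0) else 0)"
          by (rule if_conj_zero)
      qed
      also have "\<dots> = (\<Sum>q\<le>min m n. if q = q0 then fact n * fact m * \<theta> K L else 0)"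
        using i0 by (intro sum.cong refl) (auto simp: sum.delta)
      also have "\<dots> = fact n * fact m * \<theta> K L"
        using q0 by (simp add: sum.delta)
      finally show ?thesis .
    next
      case True
      show ?thesis unfolding True mult_zero_right if_cancel by simp
    qed
  qed
  finally show ?thesis unfolding L by simp
qed

section \<open>Contractions\<close>

lemma sq_integrable_pick:
  assumes f: "sq_integrable p f" and k: "inj_on k {..<p}"
  shows "integrable Q (\<lambda>x. f (pick p k x))"
proof -
  have [measurable]: "f \<in> borel_measurable (Rp p)" and i: "integrable (Rp p) (\<lambda>v. (f v)\<^sup>2)"
    using f by (simp_all add: sq_integrable_def)
  have "integrable (Rp p) (\<lambda>v. indicator (blk p k) v * (f v)\<^sup>2)"
    by (rule Bochner_Integration.integrable_bound[OF i]) (auto split: split_indicator)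
  then have "integrable Q (\<lambda>x. (f (pick p k x))\<^sup>2)"
    using integrable_pick_iff[OF k, of "\<lambda>v. (f v)\<^sup>2"] by simp
  then show ?thesis
    by (rule Q.square_integrable_imp_integrable[rotated]) measurable
qed

section \<open>Restriction to \<open>Delta\<close> and symmetrization\<close>

lemma Delta_measurable: "Delta p \<in> sets (Rp p)"
proof -
  have D: "distinct_tuples p = (\<Union>N. DN N p)"
  proof (intro set_eqI iffI)
    fix k assume "k \<in> distinct_tuples p"
    with finite_subset_DN[of "{k}" p] obtain N where "k \<in> DN N p" by auto
    then show "k \<in> (\<Union>N. DN N p)" by auto
  qed (use DN_subset in blast)
  have c: "countable (distinct_tuples p)"
    unfolding D by (intro countable_UN) (auto intro: countable_finite)
  have "Delta p = (\<Union>k\<in>distinct_tuples p. {x \<in> space (Rp p). \<forall>j\<in>{..<p}. x j \<in> {2 * real (k j) .. 2 * real (k j) + 2}})"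
  proof (intro set_eqI iffI)
    fix x assume "x \<in> Delta p"
    then obtain k where k: "inj_on k {..<p}" "\<forall>j<p. x j \<in> {2 * real (k j) .. 2 * real (k j) + 2}" "x \<in> space (Rp p)"
      by (auto simp: Delta_def)
    have "restrict k {..<p} \<in> distinct_tuples p" using k(1) by (auto simp: distinct_tuples_def inj_on_def)
    moreover have "\<forall>j\<in>{..<p}. x j \<in> {2 * real (restrict k {..<p} j) .. 2 * real (restrict k {..<p} j) + 2}" using k(2) by simp
    ultimately show "x \<in> (\<Union>k\<in>distinct_tuples p. {x \<in> space (Rp p). \<forall>j\<in>{..<p}. x j \<in> {2 * real (k j) .. 2 * real (k j) + 2}})"
      using k(3) by blast
  next
    fix x assume "x \<in> (\<Union>k\<in>distinct_tuples p. {x \<in> space (Rp p). \<forall>j\<in>{..<p}. x j \<in> {2 * real (k j) .. 2 * real (k j) + 2}})"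
    then obtain k where "k \<in> distinct_tuples p" "x \<in> space (Rp p)" "\<forall>j\<in>{..<p}. x j \<in> {2 * real (k j) .. 2 * real (k j) + 2}"
      by blast
    then show "x \<in> Delta p" unfolding Delta_def distinct_tuples_def by (intro CollectI conjI exI[of _ k]) auto
  qed
  moreover have "{x \<in> space (Rp p). \<forall>j\<in>{..<p}. x j \<in> {2 * real (k j) .. 2 * real (k j) + 2}} \<in> sets (Rp p)" for k
  proof -
    have "Measurable.pred (Rp p) (\<lambda>x. \<forall>j\<in>{..<p}. x j \<in> {2 * real (k j) .. 2 * real (k j) + 2})"
      by (intro pred_intros_finite) (auto intro!: pred_sets1[OF _ Rp_component_borel] simp: pred_def)
    then show ?thesis by (simp add: pred_def)
  qed
  ultimately show ?thesis by (simp only:) (intro sets.countable_UN'[OF c], blast)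
qed

lemma Delta_permute:
  assumes s: "\<sigma> permutes {..<p}" and x: "x \<in> Delta p"
  shows "x \<circ> \<sigma> \<in> Delta p"
proof -
  obtain k where k: "inj_on k {..<p}" "\<forall>j<p. x j \<in> {2 * real (k j) .. 2 * real (k j) + 2}" "x \<in> space (Rp p)"
    using x by (auto simp: Delta_def)
  have lt: "\<sigma> j < p" if "j < p" for j using permutes_in_image[OF s, of j] that by simp
  have "inj_on (k \<circ> \<sigma>) {..<p}"
    using k(1) permutes_inj_on[OF s] permutes_image[OF s] by (intro comp_inj_on) auto
  moreover have "\<forall>j<p. (x \<circ> \<sigma>) j \<in> {2 * real ((k \<circ> \<sigma>) j) .. 2 * real ((k \<circ> \<sigma>) j) + 2}"
    using k(2) lt by simp
  moreover have "x \<circ> \<sigma> \<in> space (Rp p)" by (rule measurable_space[OF permute_measurable[OF s] k(3)])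
  ultimately show ?thesis unfolding Delta_def by blast
qed

lemma Delta_permute_iff:
  assumes s: "\<sigma> permutes {..<p}"
  shows "x \<circ> \<sigma> \<in> Delta p \<longleftrightarrow> x \<in> Delta p"
proof
  assume "x \<circ> \<sigma> \<in> Delta p"
  then have "x \<circ> \<sigma> \<circ> inv \<sigma> \<in> Delta p" by (rule Delta_permute[OF permutes_inv[OF s]])
  then show "x \<in> Delta p" by (simp add: o_assoc[symmetric] permutes_inv_o[OF s])
qed (rule Delta_permute[OF s])

text \<open>The integrand that the theorem passes to \<open>stoch_int\<close>. The factor
  \<open>indicator (Delta p) x\<close> realises the convention for integrands that do not vanish off
  \<open>Delta p\<close>.\<close>

definition symm_Delta :: "nat \<Rightarrow> ((nat \<Rightarrow> real) \<Rightarrow> real) \<Rightarrow> (nat \<Rightarrow> real) \<Rightarrow> real" where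
  "symm_Delta p h x = indicator (Delta p) x * symmetrization p h x"

lemma symmetrization_permute:
  assumes "\<tau> permutes {..<p}"
  shows "symmetrization p h (x \<circ> \<tau>) = symmetrization p h x"
  unfolding symmetrization_def o_assoc[symmetric]
  by (subst setum_permutations_compose_left[OF assms, of "\<lambda>\<sigma>. h (x \<circ> \<sigma>)"]) simp

lemma symm_Delta_L2_hat:
  assumes h: "sq_integrable p h"
  shows "symm_Delta p h \<in> L2_hat p"
proof -
  have m[measurable]: "h \<in> borel_measurable (Rp p)" and i: "integrable (Rp p) (\<lambda>v. (h v)\<^sup>2)"
    using h by (simp_all add: sq_integrable_def)
  have ms: "(\<lambda>x. h (x \<circ> \<sigma>)) \<in> borel_measurable (Rp p)" if "\<sigma> permutes {..<p}" for \<sigma>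
    by (rule measurable_compose[OF permute_measurable[OF that] m])
  have isq: "integrable (Rp p) (\<lambda>x. (h (x \<circ> \<sigma>))\<^sup>2)" if "\<sigma> permutes {..<p}" for \<sigma>
    using integrable_distr_eq[OF permute_measurable[OF that], of "\<lambda>v. (h v)\<^sup>2"] i law_permute[OF that] by simp
  note [measurable] = Delta_measurable[of p]
  have msym: "symmetrization p h \<in> borel_measurable (Rp p)"
    unfolding symmetrization_def[abs_def]
    by (intro borel_measurable_divide borel_measurable_sum borel_measurable_const ms) simp
  have mS[measurable]: "symm_Delta p h \<in> borel_measurable (Rp p)"
    unfolding symm_Delta_def[abs_def] using msym by measurable
  have "integrable (Rp p) (\<lambda>x. (symm_Delta p h x)\<^sup>2)"
  proof (rule Bochner_Integration.integrable_bound)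
    show "integrable (Rp p) (\<lambda>x. \<Sum>\<sigma> | \<sigma> permutes {..<p}. (h (x \<circ> \<sigma>))\<^sup>2)"
      by (rule Bochner_Integration.integrable_sum) (simp add: isq)
    have "(symm_Delta p h x)\<^sup>2 \<le> (\<Sum>\<sigma> | \<sigma> permutes {..<p}. (h (x \<circ> \<sigma>))\<^sup>2)" for x
    proof -
      let ?s = "\<Sum>\<sigma> | \<sigma> permutes {..<p}. h (x \<circ> \<sigma>)"
      let ?t = "\<Sum>\<sigma> | \<sigma> permutes {..<p}. (h (x \<circ> \<sigma>))\<^sup>2"
      have t: "0 \<le> ?t" by (intro sum_nonneg) simp
      have f1: "(1 :: real) \<le> fact p" by (rule fact_ge_1)
      \<comment> \<open>Cauchy-Schwarz over \<open>fact p\<close> permutations; the square of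
        \<open>fact p\<close> in the denominator more than compensates.\<close>
      have "?s\<^sup>2 \<le> ?t * real (card {\<sigma>. \<sigma> permutes {..<p}})"
        by (rule sum_squared_le_sum_of_squares)
      also have "real (card {\<sigma>. \<sigma> permutes {..<p}}) = fact p" by (subst card_permutations[OF refl]) simp_all
      also have "?t * fact p \<le> ?t * (fact p)\<^sup>2"
        using t f1 by (intro mult_left_mono) (simp_all add: power2_eq_square)
      finally have "?s\<^sup>2 / (fact p)\<^sup>2 \<le> ?t" by (rule mult_imp_div_pos_le[rotated]) simp
      then have "(symmetrization p h x)\<^sup>2 \<le> ?t" by (simp add: symmetrization_def power_divide)
      moreover have "(symm_Delta p h x)\<^sup>2 \<le> (symmetrization p h x)\<^sup>2"
        by (simp add: symm_Delta_def split: split_indicator)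
      ultimately show ?thesis by linarith
    qed
    then show "AE x in Rp p. norm ((symm_Delta p h x)\<^sup>2) \<le> norm (\<Sum>\<sigma> | \<sigma> permutes {..<p}. (h (x \<circ> \<sigma>))\<^sup>2)"
      by (intro AE_I2) (simp add: sum_nonneg)
  qed measurable
  moreover have "symm_Delta p h (x \<circ> \<sigma>) = symm_Delta p h x" if s: "\<sigma> permutes {..<p}" for \<sigma> x
    using Delta_permute_iff[OF s, of x] symmetrization_permute[OF s, of h x]
    by (simp add: symm_Delta_def split: split_indicator)
  moreover have "x \<notin> Delta p \<longrightarrow> symm_Delta p h x = 0" for x by (simp add: symm_Delta_def)
  ultimately show ?thesis using mS by (simp add: L2_hat_def sq_integrable_def)
qed

lemma pick_in_Delta:
  assumes k: "inj_on k {..<p}" and x: "x \<in> space Q"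
  shows "pick p k x \<in> Delta p"
proof -
  have "pick p k x j \<in> {2 * real (k j)..2 * real (k j) + 2}" if "j < p" for j
    using x that by (auto simp: pick_def space_Q cell_def intro: less_imp_le)
  then show ?thesis unfolding Delta_def using k pick_space[OF x] by blast
qed

text \<open>Neither operation is visible here: evaluation at a tuple of distinct indices always
  lands in \<open>Delta p\<close>, and permuting the arguments only permutes the tuples with image
  \<open>A\<close> among themselves.\<close>

lemma JN_symm_pure:
  assumes h: "sq_integrable p h" and A: "pure A \<phi>"
  shows "(\<integral>x. JN N p (symm_Delta p h) x * \<phi> x \<partial>Q) = (\<Sum>\<kappa> | \<kappa> \<in> DN N p \<and> \<kappa> ` {..<p} = A. \<integral>x. h (pick p \<kappa> x) * \<phi> x \<partial>Q)"
proof -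
  have b: "bmeas \<phi>" using A by (simp add: pure_def)
  let ?D = "{\<kappa>. \<kappa> \<in> DN N p \<and> \<kappa> ` {..<p} = A}" and ?P = "{\<sigma>. \<sigma> permutes {..<p}}"
  have i: "integrable Q (\<lambda>x. h (pick p \<kappa> x) * \<phi> x)" if "\<kappa> \<in> DN N p" for \<kappa>
    by (rule bmeas_integrable_mult[OF b sq_integrable_pick[OF h DN_inj[OF that]]])
  have "(\<integral>x. JN N p (symm_Delta p h) x * \<phi> x \<partial>Q) = (\<Sum>\<kappa>\<in>?D. \<integral>x. symm_Delta p h (pick p \<kappa> x) * \<phi> x \<partial>Q)"
    by (rule JN_pure[OF symm_Delta_L2_hat[OF h] A])
  also have "\<dots> = (\<Sum>\<kappa>\<in>?D. (\<Sum>\<sigma>\<in>?P. \<integral>x. h (pick p (act p \<sigma> \<kappa>) x) * \<phi> x \<partial>Q) / fact p)"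
  proof (intro sum.cong refl)
    fix \<kappa> assume \<kappa>: "\<kappa> \<in> ?D"
    have "(\<integral>x. symm_Delta p h (pick p \<kappa> x) * \<phi> x \<partial>Q) = (\<integral>x. (\<Sum>\<sigma>\<in>?P. h (pick p (act p \<sigma> \<kappa>) x) * \<phi> x) / fact p \<partial>Q)"
    proof (intro Bochner_Integration.integral_cong refl)
      fix x assume x: "x \<in> space Q"
      have "pick p \<kappa> x \<in> Delta p" using \<kappa> by (intro pick_in_Delta[OF DN_inj x]) auto
      then have "symm_Delta p h (pick p \<kappa> x) = (\<Sum>\<sigma>\<in>?P. h (pick p (act p \<sigma> \<kappa>) x)) / fact p"
        by (simp add: symm_Delta_def symmetrization_def pick_act)
      then show "symm_Delta p h (pick p \<kappa> x) * \<phi> x = (\<Sum>\<sigma>\<in>?P. h (pick p (act p \<sigma> \<kappa>) x) * \<phi> x) / fact p"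
        by (simp add: sum_distrib_right)
    qed
    also have "\<dots> = (\<Sum>\<sigma>\<in>?P. \<integral>x. h (pick p (act p \<sigma> \<kappa>) x) * \<phi> x \<partial>Q) / fact p"
      using i[OF act_DN] \<kappa> by (subst integral_divide_zero, subst Bochner_Integration.integral_sum) auto
    finally show "(\<integral>x. symm_Delta p h (pick p \<kappa> x) * \<phi> x \<partial>Q) = (\<Sum>\<sigma>\<in>?P. \<integral>x. h (pick p (act p \<sigma> \<kappa>) x) * \<phi> x \<partial>Q) / fact p" .
  qed
  also have "\<dots> = (\<Sum>\<sigma>\<in>?P. \<Sum>\<kappa>\<in>?D. \<integral>x. h (pick p (act p \<sigma> \<kappa>) x) * \<phi> x \<partial>Q) / fact p"
    unfolding sum_divide_distrib[symmetric] by (subst sum.swap) (rule refl)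
  also have "\<dots> = (\<Sum>\<sigma>\<in>?P. \<Sum>\<kappa>\<in>?D. \<integral>x. h (pick p \<kappa> x) * \<phi> x \<partial>Q) / fact p"
  proof (rule arg_cong[where f="\<lambda>t. t / fact p"], rule sum.cong[OF refl])
    fix \<sigma> assume "\<sigma> \<in> ?P"
    then have s: "\<sigma> permutes {..<p}" by simp
    have im: "act p \<sigma> \<kappa> ` {..<p} = \<kappa> ` {..<p}" for \<kappa>
      using act_image[OF s order_refl, of \<kappa>] permutes_image[OF s] by simp
    show "(\<Sum>\<kappa>\<in>?D. \<integral>x. h (pick p (act p \<sigma> \<kappa>) x) * \<phi> x \<partial>Q) = (\<Sum>\<kappa>\<in>?D. \<integral>x. h (pick p \<kappa> x) * \<phi> x \<partial>Q)"
      using act_reindex[OF s, where N=N and P="\<lambda>\<kappa>. \<kappa> ` {..<p} = A" and F="\<lambda>\<kappa>. \<integral>x. h (pick p \<kappa> x) * \<phi> x \<partial>Q"]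
      unfolding im .
  qed
  also have "\<dots> = (\<Sum>\<kappa>\<in>?D. \<integral>x. h (pick p \<kappa> x) * \<phi> x \<partial>Q)"
    by (simp add: card_permutations[OF refl])
  finally show ?thesis .
qed

section \<open>Kernels of contractions on blocks of cells\<close>

definition select :: "nat \<Rightarrow> (nat \<Rightarrow> nat) \<Rightarrow> (nat \<Rightarrow> 'a) \<Rightarrow> nat \<Rightarrow> 'a" where
  "select n e v = (\<lambda>j\<in>{..<n}. v (e j))"

text \<open>The integrand of \<open>contraction\<close> as a function of all its variables, \<open>z\<close> coming last.\<close>

definition kernel :: "nat \<Rightarrow> nat \<Rightarrow> nat \<Rightarrow> nat \<Rightarrow> ((nat \<Rightarrow> real) \<Rightarrow> real) \<Rightarrow> ((nat \<Rightarrow> real) \<Rightarrow> real) \<Rightarrow> (nat \<Rightarrow> real) \<Rightarrow> real" where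
  "kernel n m i q f g v = f (select n (left_ix (m + n - q - i) i) v) * g (select m (right_ix n q (m + n - q - i) i) v)"

text \<open>\<open>contraction\<close> puts \<open>z\<close> first. With \<open>z\<close> last the
  integral has the form of a slice: free arguments at random points, the others against Lebesgue
  measure.\<close>

lemma contraction_kernel:
  assumes iq: "i \<le> q" "q \<le> n" "q \<le> m"
  shows "contraction n m i q f g x = 1 / 2 ^ i * (\<integral>z. kernel n m i q f g (tcat (m + n - q - i) x i z) \<partial>Rp i)"
proof -
  let ?p = "m + n - q - i"
  have l: "tcat i z (n - i) (tcat (q - i) (tslice 0 (q - i) x) (n - q) (tslice (q - i) (n - q) x)) = select n (left_ix ?p i) (tcat ?p x i z)" for z
  proof
    fix j
    show "tcat i z (n - i) (tcat (q - i) (tslice 0 (q - i) x) (n - q) (tslice (q - i) (n - q) x)) j = select n (left_ix ?p i) (tcat ?p x i z) j"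
      using iq by (cases "j < n"; cases "j < i"; cases "j < q") (auto simp: tcat_def tslice_def select_def left_ix_def intro!: arg_cong[where f=x])
  qed
  have r: "tcat i z (m - i) (tcat (q - i) (tslice 0 (q - i) x) (m - q) (tslice (q - i + (n - q)) (m - q) x)) = select m (right_ix n q ?p i) (tcat ?p x i z)" for z
  proof
    fix j
    show "tcat i z (m - i) (tcat (q - i) (tslice 0 (q - i) x) (m - q) (tslice (q - i + (n - q)) (m - q) x)) j = select m (right_ix n q ?p i) (tcat ?p x i z) j"
      using iq by (cases "j < m"; cases "j < i"; cases "j < q") (auto simp: tcat_def tslice_def select_def right_ix_def add.commute[of i q] intro!: arg_cong[where f=x])
  qed
  show ?thesis by (simp add: contraction_def Let_def kernel_def l r)
qed

lemma select_DN:
  assumes r: "\<rho> \<in> DN N P" and e: "inj_on e {..<n}" "e ` {..<n} \<subseteq> {..<P}"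
  shows "select n e \<rho> \<in> DN N n" "select n e \<rho> ` {..<n} = \<rho> ` e ` {..<n}"
proof -
  have "inj_on (\<rho> \<circ> e) {..<n}" by (rule comp_inj_on[OF e(1) inj_on_subset[OF DN_inj[OF r] e(2)]])
  then have "inj_on (select n e \<rho>) {..<n}" by (simp add: inj_on_def select_def)
  moreover have "\<rho> (e j) < N" if "j < n" for j using DN_lt[OF r, of "e j"] e(2) that by auto
  ultimately show "select n e \<rho> \<in> DN N n" by (auto simp: DN_def select_def)
  show "select n e \<rho> ` {..<n} = \<rho> ` e ` {..<n}" by (auto simp: select_def)
qed

text \<open>Selecting arguments of a point and selecting indices of a tuple amount to the same; this
  is why \<open>select\<close> is polymorphic.\<close>

lemma select_pick:
  assumes "e ` {..<n} \<subseteq> {..<P}" shows "select n e (pick P \<rho> x) = pick n (select n e \<rho>) x"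
  using assms by (auto simp: select_def pick_def fun_eq_iff image_subset_iff)

lemma select_measurable':
  "e ` {..<n} \<subseteq> {..<P} \<Longrightarrow> select n e \<in> measurable (Rp P) (Rp n)"
  using select_measurable[of e n P] by (simp add: select_def[abs_def])

lemma idx_select:
  assumes "e ` {..<n} \<subseteq> {..<P}" "j < n" shows "idx n (select n e v) j = idx P v (e j)"
  using assms by (auto simp: idx_def select_def)

context
  fixes n m i q p P :: nat and f g :: "(nat \<Rightarrow> real) \<Rightarrow> real"
  assumes iq: "i \<le> q" "q \<le> n" "q \<le> m" and p: "p = m + n - q - i" and P: "P = p + i"
    and f: "f \<in> L2_hat n" and g: "g \<in> L2_hat m"
begin

abbreviation "el \<equiv> left_ix p i"
abbreviation "er \<equiv> right_ix n q p i"
abbreviation "B \<equiv> kernel n m i q f g"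

lemma B_eq: "B v = f (select n el v) * g (select m er v)"
  by (simp add: kernel_def p)

lemma el: "inj_on el {..<n}" "el ` {..<n} \<subseteq> {..<P}" and er: "inj_on er {..<m}" "er ` {..<m} \<subseteq> {..<P}"
  using left_ix_image(2,3)[OF iq p] right_ix_image(2,3)[OF iq p] by (simp_all add: P)

lemma B_measurable: "B \<in> borel_measurable (Rp P)"
proof -
  have "(\<lambda>v. f (select n el v) * g (select m er v)) \<in> borel_measurable (Rp P)"
    by (intro borel_measurable_times measurable_compose[OF select_measurable' L2_hat_measurable] el er f g)
  then show ?thesis by (simp add: B_eq[abs_def])
qed

lemma B_pick: "B (pick P \<rho> x) = f (pick n (select n el \<rho>) x) * g (pick m (select m er \<rho>) x)"
  unfolding B_eq select_pick[OF el(2)] select_pick[OF er(2)] ..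

text \<open>Any two positions lie together among the first \<open>p\<close>, or among the arguments
  of \<open>f\<close>, or among those of \<open>g\<close>. Injectivity is known in each case, from
  \<open>\<kappa>\<close> or from the vanishing of \<open>f\<close> and \<open>g\<close> off
  \<open>Delta\<close>, and so it holds on all of \<open>{..<P}\<close>.\<close>

lemma B_vanish:
  assumes \<kappa>: "inj_on \<kappa> {..<p}"
  shows "AE v in Rp P. v \<in> blk p \<kappa> \<longrightarrow> B v \<noteq> 0 \<longrightarrow> inj_on (idx P v) {..<P}"
  using AE_select[OF el L2_hat_inj[OF f]] AE_select[OF er L2_hat_inj[OF g]] AE_space
proof (eventually_elim, intro impI)
  fix v assume v: "v \<in> space (Rp P)" and fv: "f (\<lambda>j\<in>{..<n}. v (el j)) \<noteq> 0 \<longrightarrow> inj_on (idx n (\<lambda>j\<in>{..<n}. v (el j))) {..<n}"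
    and gv: "g (\<lambda>j\<in>{..<m}. v (er j)) \<noteq> 0 \<longrightarrow> inj_on (idx m (\<lambda>j\<in>{..<m}. v (er j))) {..<m}"
    and vb: "v \<in> blk p \<kappa>" and nz: "B v \<noteq> 0"
  have "inj_on (idx n (select n el v)) {..<n}" using fv nz by (simp add: B_eq select_def)
  then have il: "inj_on (idx P v) (el ` {..<n})"
    using idx_select[OF el(2), of _ v] by (auto simp: inj_on_def)
  have "inj_on (idx m (select m er v)) {..<m}" using gv nz by (simp add: B_eq select_def)
  then have ir: "inj_on (idx P v) (er ` {..<m})"
    using idx_select[OF er(2), of _ v] by (auto simp: inj_on_def)
  have "idx P v j = \<kappa> j" if "j < p" for j
    using blk_iff[OF v, of p \<kappa>] vb that by (simp add: P idx_def)
  then have ip: "inj_on (idx P v) {..<p}" using \<kappa> by (auto simp: inj_on_def)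
  have cover: "(a \<in> {..<p} \<and> b \<in> {..<p}) \<or> (a \<in> el ` {..<n} \<and> b \<in> el ` {..<n}) \<or> (a \<in> er ` {..<m} \<and> b \<in> er ` {..<m})" if "a < P" "b < P" for a b
    unfolding left_ix_image(1)[OF iq p] right_ix_image(1)[OF iq p] using that iq by (auto simp: P p)
  show "inj_on (idx P v) {..<P}"
  proof (rule inj_onI)
    fix a b assume ab: "a \<in> {..<P}" "b \<in> {..<P}" "idx P v a = idx P v b"
    from cover[of a b] ab(1,2) show "a = b"
      using inj_onD[OF ip ab(3)] inj_onD[OF il ab(3)] inj_onD[OF ir ab(3)] by auto
  qed
qed

text \<open>All ways to choose cells below \<open>N\<close> for the \<open>i\<close> integrated
  variables, distinct from each other and from the cells that \<open>\<kappa>\<close> fixes for the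
  free ones.\<close>

definition ext :: "nat \<Rightarrow> (nat \<Rightarrow> nat) \<Rightarrow> (nat \<Rightarrow> nat) set" where
  "ext N \<kappa> = {\<rho>. \<rho> \<in> DN N P \<and> (\<forall>j<p. \<rho> j = \<kappa> j)}"

lemma finite_ext: "finite (ext N \<kappa>)" by (simp add: ext_def)

text \<open>The free indices are given by \<open>\<kappa>\<close>, and the indices of
  \<open>z\<close> occur among the arguments of both factors, so either argument tuple determines
  the whole one.\<close>

lemma ext_inj: "inj_on (select n el) (ext N \<kappa>)" "inj_on (select m er) (ext N \<kappa>)"
proof -
  have *: "\<rho> = \<rho>'" if r: "\<rho> \<in> ext N \<kappa>" "\<rho>' \<in> ext N \<kappa>" and z: "\<And>j. j < i \<Longrightarrow> \<rho> (p + j) = \<rho>' (p + j)" for \<rho> \<rho>'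
  proof (rule DN_eqI[of \<rho> N P \<rho>' N])
    fix j assume j: "j < P"
    show "\<rho> j = \<rho>' j"
    proof (cases "j < p")
      case True
      then show ?thesis using r by (simp add: ext_def)
    next
      case False
      then show ?thesis using z[of "j - p"] j by (simp add: P)
    qed
  qed (use r in \<open>simp_all add: ext_def\<close>)
  show "inj_on (select n el) (ext N \<kappa>)"
  proof (rule inj_onI)
    fix \<rho> \<rho>' assume r: "\<rho> \<in> ext N \<kappa>" "\<rho>' \<in> ext N \<kappa>" and eq: "select n el \<rho> = select n el \<rho>'"
    show "\<rho> = \<rho>'"
    proof (rule *[OF r])
      fix j assume "j < i"
      then show "\<rho> (p + j) = \<rho>' (p + j)" using fun_cong[OF eq, of j] iq by (simp add: select_def left_ix_def)
    qed
  qed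
  show "inj_on (select m er) (ext N \<kappa>)"
  proof (rule inj_onI)
    fix \<rho> \<rho>' assume r: "\<rho> \<in> ext N \<kappa>" "\<rho>' \<in> ext N \<kappa>" and eq: "select m er \<rho> = select m er \<rho>'"
    show "\<rho> = \<rho>'"
    proof (rule *[OF r])
      fix j assume "j < i"
      then show "\<rho> (p + j) = \<rho>' (p + j)" using fun_cong[OF eq, of j] iq by (simp add: select_def right_ix_def)
    qed
  qed
qed

text \<open>By injectivity of the selection each argument tuple is met at most once, so the sum over
  extensions is part of the sum over all tuples, which the norm of \<open>h\<close> bounds whatever
  \<open>N\<close> is.\<close>

lemma ext_sum_le:
  assumes h: "h \<in> L2_hat r" and e: "inj_on e {..<r}" "e ` {..<r} \<subseteq> {..<P}" and inj: "inj_on (select r e) (ext N \<kappa>)"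
  shows "(\<Sum>\<rho>\<in>ext N \<kappa>. \<integral>\<^sup>+x. ennreal ((h (pick r (select r e \<rho>) x))\<^sup>2) \<partial>Q) \<le> (\<integral>\<^sup>+v. ennreal ((h v)\<^sup>2) \<partial>Rp r)"
proof -
  note [measurable] = L2_hat_measurable[OF h]
  have "(\<Sum>\<rho>\<in>ext N \<kappa>. \<integral>\<^sup>+x. ennreal ((h (pick r (select r e \<rho>) x))\<^sup>2) \<partial>Q) = (\<Sum>k\<in>select r e ` ext N \<kappa>. \<integral>\<^sup>+x. ennreal ((h (pick r k x))\<^sup>2) \<partial>Q)"
    by (simp add: sum.reindex[OF inj])
  also have "\<dots> \<le> (\<Sum>k\<in>DN N r. \<integral>\<^sup>+x. ennreal ((h (pick r k x))\<^sup>2) \<partial>Q)"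
    using select_DN(1)[OF _ e] by (intro sum_mono2) (auto simp: ext_def)
  also have "\<dots> \<le> ennreal (1/2^r) * (\<integral>\<^sup>+v. ennreal ((h v)\<^sup>2) \<partial>Rp r)"
    by (rule sum_nn_integral_pick_le) measurable
  also have "\<dots> \<le> 1 * (\<integral>\<^sup>+v. ennreal ((h v)\<^sup>2) \<partial>Rp r)"
    by (rule mult_right_mono) auto
  finally show ?thesis by simp
qed

text \<open>A product is at most the sum of the squares, and \<open>ext_sum_le\<close> bounds both
  sums over extensions uniformly in \<open>N\<close>. So over one block of the free variables the
  kernel is integrable with \<open>z\<close> ranging over all cells.\<close>

lemma B_integrable:
  assumes \<kappa>: "\<kappa> \<in> DN N0 p"
  shows "integrable (Rp P) (\<lambda>v. indicator (blk p \<kappa>) v * B v)"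
proof (rule integrableI_bounded)
  note [measurable] = B_measurable
  have pP: "p \<le> P" by (simp add: P)
  have [measurable]: "(indicator (blk p \<kappa>) :: _ \<Rightarrow> real) \<in> borel_measurable (Rp P)"
    by (rule blk_indicator_measurable(2)[OF pP])
  show "(\<lambda>v. indicator (blk p \<kappa>) v * B v) \<in> borel_measurable (Rp P)" by measurable
  \<comment> \<open>Partial sums over the blocks of extensions with indices below \<open>N\<close>.
    By \<open>B_vanish\<close> these blocks exhaust, as \<open>N\<close> grows, the part of
    \<open>blk p \<kappa>\<close> where \<open>B\<close> is nonzero, up to a null set.\<close>
  define G where "G N v = (\<Sum>\<rho>\<in>ext N \<kappa>. indicator (blk P \<rho>) v) * ennreal \<bar>B v\<bar>" for N v
  have [measurable]: "G N \<in> borel_measurable (Rp P)" for N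
    unfolding G_def[abs_def] by measurable
  have "incseq G"
    unfolding G_def ext_def
    by (intro monoI le_funI mult_right_mono sum_mono2) (use DN_mono in \<open>auto\<close>)
  have "(\<integral>\<^sup>+v. ennreal (norm (indicator (blk p \<kappa>) v * B v)) \<partial>Rp P) \<le> (\<integral>\<^sup>+v. (SUP N. G N v) \<partial>Rp P)"
  proof (rule nn_integral_mono_AE)
    show "AE v in Rp P. ennreal (norm (indicator (blk p \<kappa>) v * B v)) \<le> (SUP N. G N v)"
      using B_vanish[OF DN_inj[OF \<kappa>]]
    proof (rule AE_mp, intro AE_I2 impI)
      fix v assume v: "v \<in> space (Rp P)" "v \<in> blk p \<kappa> \<longrightarrow> B v \<noteq> 0 \<longrightarrow> inj_on (idx P v) {..<P}"
      show "ennreal (norm (indicator (blk p \<kappa>) v * B v)) \<le> (SUP N. G N v)"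
      proof (cases "v \<in> blk p \<kappa> \<and> B v \<noteq> 0")
        case True
        then have "inj_on (idx P v) {..<P}" using v(2) by blast
        then have "idx P v \<in> distinct_tuples P" by (auto simp: distinct_tuples_def idx_def)
        from finite_subset_DN[of "{idx P v}" P] this obtain N where N: "idx P v \<in> DN N P" by auto
        have "idx P v j = \<kappa> j" if "j < p" for j
          using blk_iff[OF v(1) pP, of \<kappa>] True that pP by (simp add: idx_def)
        then have "idx P v \<in> ext N \<kappa>" using N by (simp add: ext_def)
        then have "(1 :: ennreal) \<le> (\<Sum>\<rho>\<in>ext N \<kappa>. indicator (blk P \<rho>) v)"
          using member_le_sum[of "idx P v" "ext N \<kappa>" "\<lambda>\<rho>. indicator (blk P \<rho>) v :: ennreal"] blk_idx[OF v(1)] finite_ext by simp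
        then have "1 * ennreal \<bar>B v\<bar> \<le> G N v" unfolding G_def by (rule mult_right_mono) simp
        also have "\<dots> \<le> (SUP N. G N v)" by (rule SUP_upper) simp
        finally show ?thesis using True by simp
      next
        case False
        then have "indicator (blk p \<kappa>) v * B v = 0" by (cases "v \<in> blk p \<kappa>") auto
        then show ?thesis by (simp only: norm_zero ennreal_0 zero_le)
      qed
    qed
  qed
  also have "\<dots> = (SUP N. \<integral>\<^sup>+v. G N v \<partial>Rp P)"
    by (rule nn_integral_monotone_convergence_SUP[OF \<open>incseq G\<close>]) measurable
  also have "\<dots> \<le> ennreal (2^P) * ((\<integral>\<^sup>+v. ennreal ((f v)\<^sup>2) \<partial>Rp n) + (\<integral>\<^sup>+v. ennreal ((g v)\<^sup>2) \<partial>Rp m))"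
  proof (rule SUP_least)
    fix N
    have "(\<integral>\<^sup>+v. G N v \<partial>Rp P) = (\<Sum>\<rho>\<in>ext N \<kappa>. \<integral>\<^sup>+v. indicator (blk P \<rho>) v * ennreal \<bar>B v\<bar> \<partial>Rp P)"
      unfolding G_def sum_distrib_right by (rule nn_integral_sum) measurable
    also have "\<dots> = (\<Sum>\<rho>\<in>ext N \<kappa>. ennreal (2^P) * (\<integral>\<^sup>+x. ennreal \<bar>B (pick P \<rho> x)\<bar> \<partial>Q))"
    proof (rule sum.cong[OF refl])
      fix \<rho> assume "\<rho> \<in> ext N \<kappa>"
      then have inj: "inj_on \<rho> {..<P}" using DN_inj by (auto simp: ext_def)
      have "ennreal (2^P) * (\<integral>\<^sup>+x. ennreal \<bar>B (pick P \<rho> x)\<bar> \<partial>Q) =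
        (ennreal (2^P) * ennreal (1/2^P)) * (\<integral>\<^sup>+v. indicator (blk P \<rho>) v * ennreal \<bar>B v\<bar> \<partial>Rp P)"
        by (subst nn_integral_pick[OF inj]) (measurable, simp add: mult.assoc)
      also have "ennreal (2^P) * ennreal (1/2^P) = 1"
        by (subst ennreal_mult[symmetric]) auto
      finally show "(\<integral>\<^sup>+v. indicator (blk P \<rho>) v * ennreal \<bar>B v\<bar> \<partial>Rp P) = ennreal (2^P) * (\<integral>\<^sup>+x. ennreal \<bar>B (pick P \<rho> x)\<bar> \<partial>Q)" by simp
    qed
    also have "\<dots> = ennreal (2^P) * (\<Sum>\<rho>\<in>ext N \<kappa>. \<integral>\<^sup>+x. ennreal \<bar>B (pick P \<rho> x)\<bar> \<partial>Q)"
      by (rule sum_distrib_left[symmetric])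
    also have "\<dots> \<le> ennreal (2^P) * (\<Sum>\<rho>\<in>ext N \<kappa>. (\<integral>\<^sup>+x. ennreal ((f (pick n (select n el \<rho>) x))\<^sup>2) \<partial>Q) + (\<integral>\<^sup>+x. ennreal ((g (pick m (select m er \<rho>) x))\<^sup>2) \<partial>Q))"
    proof (intro mult_left_mono sum_mono)
      fix \<rho> assume "\<rho> \<in> ext N \<kappa>"
      note [measurable] = pick_measurable_L2[OF f] pick_measurable_L2[OF g]
      have "(\<integral>\<^sup>+x. ennreal \<bar>B (pick P \<rho> x)\<bar> \<partial>Q) \<le> (\<integral>\<^sup>+x. ennreal ((f (pick n (select n el \<rho>) x))\<^sup>2) + ennreal ((g (pick m (select m er \<rho>) x))\<^sup>2) \<partial>Q)"
        unfolding B_pick by (intro nn_integral_mono) (simp only: ennreal_plus[symmetric] zero_le_power2, intro ennreal_leI abs_mult_le_sum_squares)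
      also have "\<dots> = (\<integral>\<^sup>+x. ennreal ((f (pick n (select n el \<rho>) x))\<^sup>2) \<partial>Q) + (\<integral>\<^sup>+x. ennreal ((g (pick m (select m er \<rho>) x))\<^sup>2) \<partial>Q)"
        by (rule nn_integral_add) measurable
      finally show "(\<integral>\<^sup>+x. ennreal \<bar>B (pick P \<rho> x)\<bar> \<partial>Q) \<le> (\<integral>\<^sup>+x. ennreal ((f (pick n (select n el \<rho>) x))\<^sup>2) \<partial>Q) + (\<integral>\<^sup>+x. ennreal ((g (pick m (select m er \<rho>) x))\<^sup>2) \<partial>Q)" .
    qed simp
    also have "\<dots> \<le> ennreal (2^P) * ((\<integral>\<^sup>+v. ennreal ((f v)\<^sup>2) \<partial>Rp n) + (\<integral>\<^sup>+v. ennreal ((g v)\<^sup>2) \<partial>Rp m))"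
      unfolding sum.distrib by (intro mult_left_mono add_mono ext_sum_le f g el er ext_inj) simp
    finally show "(\<integral>\<^sup>+v. G N v \<partial>Rp P) \<le> ennreal (2^P) * ((\<integral>\<^sup>+v. ennreal ((f v)\<^sup>2) \<partial>Rp n) + (\<integral>\<^sup>+v. ennreal ((g v)\<^sup>2) \<partial>Rp m))" .
  qed
  also have "\<dots> < \<infinity>"
    using L2_hat_square[OF f] L2_hat_square[OF g] by (simp add: integrable_iff_bounded ennreal_mult_less_top)
  finally show "(\<integral>\<^sup>+v. ennreal (norm (indicator (blk p \<kappa>) v * B v)) \<partial>Rp P) < \<infinity>" .
qed

text \<open>Truncation confines \<open>z\<close> to the first \<open>N\<close> cells, where
  \<open>slice_weight_sum\<close> gives the finite sum; dominated convergence lets \<open>N\<close>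
  grow. The \<open>2^i\<close> of the slice cancels the \<open>1/2^i\<close> of
  \<open>contraction\<close>.\<close>

lemma contraction_limit:
  assumes \<kappa>: "\<kappa> \<in> DN N0 p" and \<phi>: "bmeas \<phi>" "dep (\<kappa> ` {..<p}) \<phi>"
  shows "(\<lambda>N. \<Sum>\<rho>\<in>ext N \<kappa>. pairing n m f g \<phi> (select n el \<rho>) (select m er \<rho>)) \<longlonglongrightarrow> (\<integral>x. contraction n m i q f g (pick p \<kappa> x) * \<phi> x \<partial>Q)"
proof -
  have inj: "inj_on \<kappa> {..<p}" by (rule DN_inj[OF \<kappa>])
  have [measurable]: "B \<in> borel_measurable (Rp (p + i))" using B_measurable by (simp add: P)
  have [measurable]: "\<phi> \<in> borel_measurable Q" by (rule bmeas_measurable[OF \<phi>(1)])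
  have [measurable]: "trunc N (p + i) B \<in> borel_measurable (Rp (p + i))" for N by measurable
  note int = B_integrable[OF \<kappa>, unfolded P]
  have intN: "integrable (Rp (p + i)) (\<lambda>v. indicator (blk p \<kappa>) v * trunc N (p + i) B v)" for N
    by (rule Bochner_Integration.integrable_bound[OF int]) (auto split: split_indicator simp: trunc_abs_le)
  have I: "integrable (Q \<Otimes>\<^sub>M Rp i) (\<lambda>(x,y). B (tcat p (pick p \<kappa> x) i y))"
    using integrable_slice_iff[OF inj, of B i] int by simp
  obtain c where c: "\<And>x. x \<in> space Q \<Longrightarrow> \<bar>\<phi> x\<bar> \<le> c" using bmeasE[OF \<phi>(1)] by blast
  let ?F = "\<lambda>z. B (tcat p (pick p \<kappa> (fst z)) i (snd z)) * \<phi> (fst z)"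
  let ?FN = "\<lambda>N z. trunc N (p + i) B (tcat p (pick p \<kappa> (fst z)) i (snd z)) * \<phi> (fst z)"
  have bd: "integrable (Q \<Otimes>\<^sub>M Rp i) (\<lambda>z. \<bar>B (tcat p (pick p \<kappa> (fst z)) i (snd z))\<bar> * c)"
    using integrable_abs[OF I] by (simp add: case_prod_beta')
  have le: "\<bar>b * \<phi> (fst z)\<bar> \<le> \<bar>b'\<bar> * c" if "\<bar>b\<bar> \<le> \<bar>b'\<bar>" "z \<in> space (Q \<Otimes>\<^sub>M Rp i)" for b b' :: real and z
    unfolding abs_mult using that c[of "fst z"] by (intro mult_mono) (auto simp: space_pair_measure)
  have iF: "integrable (Q \<Otimes>\<^sub>M Rp i) ?F"
    by (rule Bochner_Integration.integrable_bound[OF bd]) (auto intro!: AE_I2 order_trans[OF le[OF order_refl]])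
  have iFN: "integrable (Q \<Otimes>\<^sub>M Rp i) (?FN N)" for N
    by (rule Bochner_Integration.integrable_bound[OF bd]) (auto intro!: AE_I2 order_trans[OF le[OF trunc_abs_le]])
  have l1: "(\<lambda>N. \<integral>z. ?FN N z \<partial>(Q \<Otimes>\<^sub>M Rp i)) \<longlonglongrightarrow> (\<integral>z. ?F z \<partial>(Q \<Otimes>\<^sub>M Rp i))"
  proof (rule integral_dominated_convergence[OF _ _ bd])
    show "AE z in Q \<Otimes>\<^sub>M Rp i. (\<lambda>N. ?FN N z) \<longlonglongrightarrow> ?F z"
      by (intro AE_I2 tendsto_mult tendsto_const trunc_tendsto)
    show "AE z in Q \<Otimes>\<^sub>M Rp i. norm (?FN N z) \<le> \<bar>B (tcat p (pick p \<kappa> (fst z)) i (snd z))\<bar> * c" for N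
      by (intro AE_I2) (simp only: real_norm_def, intro le trunc_abs_le)
  qed (use iF iFN in auto)
  have l2: "(\<integral>z. ?F z \<partial>(Q \<Otimes>\<^sub>M Rp i)) = 2^i * (\<integral>x. contraction n m i q f g (pick p \<kappa> x) * \<phi> x \<partial>Q)"
  proof -
    have "(\<integral>z. ?F z \<partial>(Q \<Otimes>\<^sub>M Rp i)) = (\<integral>x. \<integral>y. B (tcat p (pick p \<kappa> x) i y) * \<phi> x \<partial>Rp i \<partial>Q)"
      using QR.integral_fst'[OF iF] by simp
    also have "\<dots> = (\<integral>x. 2^i * (contraction n m i q f g (pick p \<kappa> x) * \<phi> x) \<partial>Q)"
      by (intro Bochner_Integration.integral_cong refl) (simp add: contraction_kernel[OF iq] p)
    finally show ?thesis by simp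
  qed
  \<comment> \<open>\<open>N0 \<le> N\<close> ensures that all cells of \<open>\<kappa>\<close> lie
    inside the truncation.\<close>
  have l3: "eventually (\<lambda>N. (\<integral>z. ?FN N z \<partial>(Q \<Otimes>\<^sub>M Rp i)) = 2^i * (\<Sum>\<rho>\<in>ext N \<kappa>. pairing n m f g \<phi> (select n el \<rho>) (select m er \<rho>))) sequentially"
    using eventually_ge_at_top[of N0]
  proof eventually_elim
    fix N assume "N0 \<le> N"
    then have \<kappa>N: "\<kappa> \<in> DN N p" using \<kappa> DN_mono by blast
    have van: "AE v in Rp (p + i). v \<in> blk p \<kappa> \<longrightarrow> trunc N (p + i) B v \<noteq> 0 \<longrightarrow> (\<exists>\<rho>\<in>DN N (p + i). v \<in> blk (p + i) \<rho>)"
      using B_vanish[OF inj, unfolded P]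
    proof (rule AE_mp, intro AE_I2 impI)
      fix v assume v: "v \<in> space (Rp (p + i))" "v \<in> blk p \<kappa> \<longrightarrow> B v \<noteq> 0 \<longrightarrow> inj_on (idx (p + i) v) {..<p + i}"
        "v \<in> blk p \<kappa>" "trunc N (p + i) B v \<noteq> 0"
      then have "idx (p + i) v \<in> DN N (p + i)"
        by (intro box_blk) (auto simp: trunc_def split: if_split_asm)
      with blk_idx[OF v(1)] show "\<exists>\<rho>\<in>DN N (p + i). v \<in> blk (p + i) \<rho>" by blast
    qed
    have "(\<integral>z. ?FN N z \<partial>(Q \<Otimes>\<^sub>M Rp i)) = (\<integral>x. (\<integral>y. trunc N (p + i) B (tcat p (pick p \<kappa> x) i y) \<partial>Rp i) * \<phi> x \<partial>Q)"
      using QR.integral_fst'[OF iFN[of N]] by simp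
    also have "\<dots> = 2^i * (\<Sum>\<rho> | \<rho> \<in> DN N (p + i) \<and> (\<forall>j<p. \<rho> j = \<kappa> j). \<integral>x. trunc N (p + i) B (pick (p + i) \<rho> x) * \<phi> x \<partial>Q)"
      by (rule slice_weight_sum[OF \<kappa>N _ intN van \<phi>]) measurable
    also have "\<dots> = 2^i * (\<Sum>\<rho>\<in>ext N \<kappa>. pairing n m f g \<phi> (select n el \<rho>) (select m er \<rho>))"
    proof (rule arg_cong2[where f="(*)", OF refl], rule sum.cong)
      fix \<rho> assume "\<rho> \<in> ext N \<kappa>"
      then have "\<rho> \<in> DN N P" by (simp add: ext_def)
      then have \<rho>: "\<rho> \<in> DN N (p + i)" by (simp only: P)
      show "(\<integral>x. trunc N (p + i) B (pick (p + i) \<rho> x) * \<phi> x \<partial>Q) = pairing n m f g \<phi> (select n el \<rho>) (select m er \<rho>)"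
        unfolding pairing_def
      proof (intro Bochner_Integration.integral_cong refl arg_cong2[where f="(*)"])
        fix x assume "x \<in> space Q"
        from trunc_pick[OF \<rho> this, of B] show "trunc N (p + i) B (pick (p + i) \<rho> x) = f (pick n (select n el \<rho>) x) * g (pick m (select m er \<rho>) x)"
          using B_pick[of \<rho> x] by (simp add: P)
      qed
    next
      show "{\<rho>. \<rho> \<in> DN N (p + i) \<and> (\<forall>j<p. \<rho> j = \<kappa> j)} = ext N \<kappa>"
        unfolding ext_def by (simp only: P)
    qed
    finally show "(\<integral>z. ?FN N z \<partial>(Q \<Otimes>\<^sub>M Rp i)) = 2^i * (\<Sum>\<rho>\<in>ext N \<kappa>. pairing n m f g \<phi> (select n el \<rho>) (select m er \<rho>))" .
  qed
  have "(\<lambda>N. 2^i * (\<Sum>\<rho>\<in>ext N \<kappa>. pairing n m f g \<phi> (select n el \<rho>) (select m er \<rho>))) \<longlonglongrightarrow> 2^i * (\<integral>x. contraction n m i q f g (pick p \<kappa> x) * \<phi> x \<partial>Q)"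
    using Lim_transform_eventually[OF l1 l3] unfolding l2 .
  from tendsto_mult[OF tendsto_const[of "1/2^i"] this] show ?thesis by simp
qed

text \<open>This difference is the truncation error: the contraction integrates \<open>z\<close>
  over all cells, the sum uses the first \<open>N\<close>. Only the finitely many tuples with image
  \<open>A\<close> are tested, so \<open>contraction_limit\<close> may be summed over them.\<close>

lemma JN_contraction_limit:
  assumes h: "sq_integrable p (contraction n m i q f g)" and A: "pure A \<phi>" "A \<subseteq> {..<N0}"
  shows "(\<lambda>N. (\<integral>x. JN N p (symm_Delta p (contraction n m i q f g)) x * \<phi> x \<partial>Q) -
     (\<Sum>\<rho> | \<rho> \<in> DN N P \<and> \<rho> ` {..<p} = A. pairing n m f g \<phi> (select n el \<rho>) (select m er \<rho>))) \<longlonglongrightarrow> 0"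
proof -
  let ?D = "\<lambda>N. {\<kappa>. \<kappa> \<in> DN N p \<and> \<kappa> ` {..<p} = A}"
  let ?pr = "\<lambda>\<rho>. pairing n m f g \<phi> (select n el \<rho>) (select m er \<rho>)"
  have b: "bmeas \<phi>" "dep A \<phi>" using A(1) by (simp_all add: pure_def)
  \<comment> \<open>The tested tuples take their values in \<open>A\<close> and so are the same for
    all \<open>N\<close> from \<open>N0\<close> on.\<close>
  have D: "?D N = ?D N0" if "N0 \<le> N" for N
  proof -
    have "A \<subseteq> {..<N}" using A(2) that by auto
    then show ?thesis
      using DN_image_eq[OF A(2), of p] DN_image_eq[of A N p] by simp
  qed
  have "(\<lambda>N. \<Sum>\<kappa>\<in>?D N0. \<Sum>\<rho>\<in>ext N \<kappa>. ?pr \<rho>) \<longlonglongrightarrow> (\<Sum>\<kappa>\<in>?D N0. \<integral>x. contraction n m i q f g (pick p \<kappa> x) * \<phi> x \<partial>Q)"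
    using b by (intro tendsto_sum contraction_limit) auto
  from tendsto_diff[OF tendsto_const this, of "\<Sum>\<kappa>\<in>?D N0. \<integral>x. contraction n m i q f g (pick p \<kappa> x) * \<phi> x \<partial>Q"]
  have "(\<lambda>N. (\<Sum>\<kappa>\<in>?D N0. \<integral>x. contraction n m i q f g (pick p \<kappa> x) * \<phi> x \<partial>Q) - (\<Sum>\<kappa>\<in>?D N0. \<Sum>\<rho>\<in>ext N \<kappa>. ?pr \<rho>)) \<longlonglongrightarrow> 0"
    by simp
  moreover have "eventually (\<lambda>N. (\<Sum>\<kappa>\<in>?D N0. \<integral>x. contraction n m i q f g (pick p \<kappa> x) * \<phi> x \<partial>Q) - (\<Sum>\<kappa>\<in>?D N0. \<Sum>\<rho>\<in>ext N \<kappa>. ?pr \<rho>) =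
     (\<integral>x. JN N p (symm_Delta p (contraction n m i q f g)) x * \<phi> x \<partial>Q) - (\<Sum>\<rho> | \<rho> \<in> DN N P \<and> \<rho> ` {..<p} = A. ?pr \<rho>)) sequentially"
    using eventually_ge_at_top[of N0]
  proof eventually_elim
    fix N assume N: "N0 \<le> N"
    have "(\<Sum>\<kappa>\<in>?D N. \<Sum>\<rho>\<in>ext N \<kappa>. ?pr \<rho>) = (\<Sum>\<kappa>\<in>?D N. \<Sum>\<rho> | \<rho> \<in> {\<rho>. \<rho> \<in> DN N P \<and> \<rho> ` {..<p} = A} \<and> restrict \<rho> {..<p} = \<kappa>. ?pr \<rho>)"
    proof (rule sum.cong[OF refl], rule sum.cong[OF _ refl])
      fix \<kappa> assume \<kappa>: "\<kappa> \<in> ?D N"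
      have f1: "(\<forall>j<p. \<rho> j = \<kappa> j) \<longleftrightarrow> restrict \<rho> {..<p} = \<kappa>" for \<rho>
        using \<kappa> by (auto simp: DN_def PiE_iff extensional_def fun_eq_iff restrict_def)
      have f2: "\<rho> ` {..<p} = A" if "restrict \<rho> {..<p} = \<kappa>" for \<rho>
      proof -
        have "\<rho> ` {..<p} = restrict \<rho> {..<p} ` {..<p}" by auto
        then show ?thesis using \<kappa> that by simp
      qed
      show "ext N \<kappa> = {\<rho>. \<rho> \<in> {\<rho>. \<rho> \<in> DN N P \<and> \<rho> ` {..<p} = A} \<and> restrict \<rho> {..<p} = \<kappa>}"
        unfolding ext_def f1 using f2 by blast
    qed
    also have "\<dots> = (\<Sum>\<rho> | \<rho> \<in> DN N P \<and> \<rho> ` {..<p} = A. ?pr \<rho>)"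
    proof (rule sum.group)
      show "(\<lambda>\<rho>. restrict \<rho> {..<p}) ` {\<rho>. \<rho> \<in> DN N P \<and> \<rho> ` {..<p} = A} \<subseteq> ?D N"
      proof (intro image_subsetI)
        fix \<rho> assume \<rho>: "\<rho> \<in> {\<rho>. \<rho> \<in> DN N P \<and> \<rho> ` {..<p} = A}"
        have "inj_on \<rho> {..<p}" using inj_on_subset[OF DN_inj[of \<rho> N P], of "{..<p}"] \<rho> by (auto simp: P)
        moreover have "\<rho> j < N" if "j < p" for j using DN_lt[of \<rho> N P j] \<rho> that by (auto simp: P)
        moreover have "restrict \<rho> {..<p} ` {..<p} = \<rho> ` {..<p}" by auto
        ultimately show "restrict \<rho> {..<p} \<in> ?D N" using \<rho> by (auto simp: DN_def)
      qed
    qed auto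
    finally have "(\<Sum>\<kappa>\<in>?D N0. \<Sum>\<rho>\<in>ext N \<kappa>. ?pr \<rho>) = (\<Sum>\<rho> | \<rho> \<in> DN N P \<and> \<rho> ` {..<p} = A. ?pr \<rho>)"
      unfolding D[OF N] .
    then show "(\<Sum>\<kappa>\<in>?D N0. \<integral>x. contraction n m i q f g (pick p \<kappa> x) * \<phi> x \<partial>Q) - (\<Sum>\<kappa>\<in>?D N0. \<Sum>\<rho>\<in>ext N \<kappa>. ?pr \<rho>) =
     (\<integral>x. JN N p (symm_Delta p (contraction n m i q f g)) x * \<phi> x \<partial>Q) - (\<Sum>\<rho> | \<rho> \<in> DN N P \<and> \<rho> ` {..<p} = A. ?pr \<rho>)"
      unfolding JN_symm_pure[OF h A(1)] D[OF N] by simp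
  qed
  ultimately show ?thesis by (rule Lim_transform_eventually)
qed

end

section \<open>The product formula\<close>

definition L1_tendsto :: "'a measure \<Rightarrow> (nat \<Rightarrow> 'a \<Rightarrow> real) \<Rightarrow> ('a \<Rightarrow> real) \<Rightarrow> bool" where
  "L1_tendsto M F G \<longleftrightarrow> (\<forall>N. F N \<in> borel_measurable M) \<and> G \<in> borel_measurable M \<and>
     (\<lambda>N. \<integral>\<^sup>+x. ennreal \<bar>F N x - G x\<bar> \<partial>M) \<longlonglongrightarrow> 0"

lemma ennreal_power2_tendsto_zero:
  fixes u :: "nat \<Rightarrow> ennreal"
  assumes "(\<lambda>N. (u N)\<^sup>2) \<longlonglongrightarrow> 0" shows "u \<longlonglongrightarrow> 0"
proof (rule tendsto_zero_ennreal)
  fix e :: real assume e: "0 < e"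
  have "eventually (\<lambda>N. (u N)\<^sup>2 < ennreal (e\<^sup>2)) sequentially"
    by (rule order_tendstoD(2)[OF assms]) (use e in simp)
  then show "eventually (\<lambda>N. u N < ennreal e) sequentially"
  proof eventually_elim
    fix N assume "(u N)\<^sup>2 < ennreal (e\<^sup>2)"
    moreover have "ennreal (e\<^sup>2) = (ennreal e)\<^sup>2" using e by (simp add: ennreal_power)
    ultimately show "u N < ennreal e" by (metis not_le power_mono zero_le)
  qed
qed

text \<open>By Cauchy-Schwarz the squared integral is at most \<open>C\<close> times a quantity that
  tends to 0.\<close>

lemma mult_L1_tendsto_zero:
  fixes u v :: "nat \<Rightarrow> 'a \<Rightarrow> real"
  assumes [measurable]: "\<And>N. u N \<in> borel_measurable M" "\<And>N. v N \<in> borel_measurable M"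
    and u: "(\<lambda>N. \<integral>\<^sup>+x. ennreal ((u N x)\<^sup>2) \<partial>M) \<longlonglongrightarrow> 0" and v: "\<And>N. (\<integral>\<^sup>+x. ennreal ((v N x)\<^sup>2) \<partial>M) \<le> ennreal C"
  shows "(\<lambda>N. \<integral>\<^sup>+x. ennreal \<bar>u N x * v N x\<bar> \<partial>M) \<longlonglongrightarrow> 0"
proof (rule ennreal_power2_tendsto_zero)
  have le: "(\<integral>\<^sup>+x. ennreal \<bar>u N x * v N x\<bar> \<partial>M)\<^sup>2 \<le> ennreal C * (\<integral>\<^sup>+x. ennreal ((u N x)\<^sup>2) \<partial>M)" for N
  proof -
    have "(\<integral>\<^sup>+x. ennreal \<bar>u N x * v N x\<bar> \<partial>M) = (\<integral>\<^sup>+x. ennreal \<bar>u N x\<bar> * ennreal \<bar>v N x\<bar> \<partial>M)"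
      by (intro nn_integral_cong) (simp add: abs_mult ennreal_mult)
    moreover have "(\<integral>\<^sup>+x. ennreal \<bar>u N x\<bar> * ennreal \<bar>v N x\<bar> \<partial>M)\<^sup>2 \<le> (\<integral>\<^sup>+x. (ennreal \<bar>u N x\<bar>)\<^sup>2 \<partial>M) * (\<integral>\<^sup>+x. (ennreal \<bar>v N x\<bar>)\<^sup>2 \<partial>M)"
      by (rule Cauchy_Schwarz_nn_integral) measurable
    moreover have "(ennreal \<bar>t\<bar>)\<^sup>2 = ennreal (t\<^sup>2)" for t by (simp add: ennreal_power)
    ultimately have "(\<integral>\<^sup>+x. ennreal \<bar>u N x * v N x\<bar> \<partial>M)\<^sup>2 \<le> (\<integral>\<^sup>+x. ennreal ((u N x)\<^sup>2) \<partial>M) * (\<integral>\<^sup>+x. ennreal ((v N x)\<^sup>2) \<partial>M)" by simp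
    also have "\<dots> \<le> (\<integral>\<^sup>+x. ennreal ((u N x)\<^sup>2) \<partial>M) * ennreal C" by (rule mult_left_mono[OF v]) simp
    finally show ?thesis by (simp add: mult.commute)
  qed
  have "(\<lambda>N. ennreal C * (\<integral>\<^sup>+x. ennreal ((u N x)\<^sup>2) \<partial>M)) \<longlonglongrightarrow> ennreal C * 0"
    by (rule ennreal_tendsto_cmult[OF _ u]) simp
  then have l: "(\<lambda>N. ennreal C * (\<integral>\<^sup>+x. ennreal ((u N x)\<^sup>2) \<partial>M)) \<longlonglongrightarrow> 0" by simp
  show "(\<lambda>N. (\<integral>\<^sup>+x. ennreal \<bar>u N x * v N x\<bar> \<partial>M)\<^sup>2) \<longlonglongrightarrow> 0"
    by (rule tendsto_sandwich[OF _ _ tendsto_const l]) (auto intro!: always_eventually allI le)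
qed

lemma L1_tendsto_linear:
  assumes F: "L1_tendsto M F f" and G: "L1_tendsto M G g"
  shows "L1_tendsto M (\<lambda>N x. F N x + c * G N x) (\<lambda>x. f x + c * g x)"
proof -
  note [measurable] = F[unfolded L1_tendsto_def, THEN conjunct1, rule_format] F[unfolded L1_tendsto_def, THEN conjunct2, THEN conjunct1]
    G[unfolded L1_tendsto_def, THEN conjunct1, rule_format] G[unfolded L1_tendsto_def, THEN conjunct2, THEN conjunct1]
  have le: "(\<integral>\<^sup>+x. ennreal \<bar>F N x + c * G N x - (f x + c * g x)\<bar> \<partial>M) \<le>
     (\<integral>\<^sup>+x. ennreal \<bar>F N x - f x\<bar> \<partial>M) + ennreal \<bar>c\<bar> * (\<integral>\<^sup>+x. ennreal \<bar>G N x - g x\<bar> \<partial>M)" for N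
  proof -
    have "(\<integral>\<^sup>+x. ennreal \<bar>F N x + c * G N x - (f x + c * g x)\<bar> \<partial>M) \<le> (\<integral>\<^sup>+x. ennreal (\<bar>F N x - f x\<bar> + \<bar>c\<bar> * \<bar>G N x - g x\<bar>) \<partial>M)"
    proof (intro nn_integral_mono ennreal_leI)
      fix x
      have "F N x + c * G N x - (f x + c * g x) = (F N x - f x) + c * (G N x - g x)" by (simp add: algebra_simps)
      also have "\<bar>\<dots>\<bar> \<le> \<bar>F N x - f x\<bar> + \<bar>c * (G N x - g x)\<bar>" by (rule abs_triangle_ineq)
      finally show "\<bar>F N x + c * G N x - (f x + c * g x)\<bar> \<le> \<bar>F N x - f x\<bar> + \<bar>c\<bar> * \<bar>G N x - g x\<bar>" by (simp add: abs_mult)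
    qed
    also have "\<dots> = (\<integral>\<^sup>+x. ennreal \<bar>F N x - f x\<bar> + ennreal \<bar>c\<bar> * ennreal \<bar>G N x - g x\<bar> \<partial>M)"
      by (intro nn_integral_cong) (simp add: ennreal_mult)
    also have "\<dots> = (\<integral>\<^sup>+x. ennreal \<bar>F N x - f x\<bar> \<partial>M) + ennreal \<bar>c\<bar> * (\<integral>\<^sup>+x. ennreal \<bar>G N x - g x\<bar> \<partial>M)"
      by (subst nn_integral_add) (auto simp: nn_integral_cmult)
    finally show ?thesis .
  qed
  have "(\<lambda>N. (\<integral>\<^sup>+x. ennreal \<bar>F N x - f x\<bar> \<partial>M) + ennreal \<bar>c\<bar> * (\<integral>\<^sup>+x. ennreal \<bar>G N x - g x\<bar> \<partial>M)) \<longlonglongrightarrow> 0 + ennreal \<bar>c\<bar> * 0"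
    using F G unfolding L1_tendsto_def by (intro tendsto_add ennreal_tendsto_cmult) auto
  then have l: "(\<lambda>N. (\<integral>\<^sup>+x. ennreal \<bar>F N x - f x\<bar> \<partial>M) + ennreal \<bar>c\<bar> * (\<integral>\<^sup>+x. ennreal \<bar>G N x - g x\<bar> \<partial>M)) \<longlonglongrightarrow> 0" by simp
  have "(\<lambda>N. \<integral>\<^sup>+x. ennreal \<bar>F N x + c * G N x - (f x + c * g x)\<bar> \<partial>M) \<longlonglongrightarrow> 0"
    by (rule tendsto_sandwich[OF _ _ tendsto_const l]) (auto intro!: always_eventually allI le)
  then show ?thesis unfolding L1_tendsto_def by (intro conjI allI) measurable
qed

lemma L1_tendsto_zero: "L1_tendsto M (\<lambda>_ _. 0) (\<lambda>_. 0)"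
  by (simp add: L1_tendsto_def)

lemma L1_tendsto_sum:
  assumes "finite S" "\<And>s. s \<in> S \<Longrightarrow> L1_tendsto M (F s) (G s)"
  shows "L1_tendsto M (\<lambda>N x. \<Sum>s\<in>S. c s * F s N x) (\<lambda>x. \<Sum>s\<in>S. c s * G s x)"
  using assms
proof (induction S rule: finite_induct)
  case (insert s S)
  from L1_tendsto_linear[OF insert.IH insert.prems, of s "c s"] insert.hyps insert.prems show ?case
    by (simp add: add.commute)
qed (simp add: L1_tendsto_zero)

lemma JN_square:
  assumes f: "f \<in> L2_hat p"
  shows "integrable Q (\<lambda>x. (JN N p f x)\<^sup>2)"
proof (rule integrableI_bounded)
  show "(\<lambda>x. (JN N p f x)\<^sup>2) \<in> borel_measurable Q" using JN_measurable[OF f] by simp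
  have "(\<integral>\<^sup>+x. ennreal (norm ((JN N p f x)\<^sup>2)) \<partial>Q) = (\<integral>\<^sup>+x. ennreal ((JN N p f x)\<^sup>2) \<partial>Q)" by simp
  also have "\<dots> \<le> ennreal (fact p / 2^p * (\<integral>v. (f v)\<^sup>2 \<partial>Rp p))" by (rule JN_L2_bound[OF f])
  also have "\<dots> < \<infinity>" by simp
  finally show "(\<integral>\<^sup>+x. ennreal (norm ((JN N p f x)\<^sup>2)) \<partial>Q) < \<infinity>" .
qed

lemma JN_product_integrable:
  assumes f: "f \<in> L2_hat n" and g: "g \<in> L2_hat m"
  shows "integrable Q (\<lambda>x. JN N n f x * JN N m g x)"
  by (intro integrable_mult_of_squares JN_measurable JN_square f g)

text \<open>The truncated difference of both sides. It is written as a sum with factor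
  \<open>-1\<close> so that it matches \<open>L1_tendsto_linear\<close>.\<close>

definition defect :: "nat \<Rightarrow> nat \<Rightarrow> ((nat \<Rightarrow> real) \<Rightarrow> real) \<Rightarrow> ((nat \<Rightarrow> real) \<Rightarrow> real) \<Rightarrow> nat \<Rightarrow> (nat \<Rightarrow> real) \<Rightarrow> real" where
  "defect n m f g N x = JN N n f x * JN N m g x + (-1) * (\<Sum>q\<le>min m n. fact q * real (m choose q) * real (n choose q) *
      (\<Sum>i\<le>q. real (q choose i) * JN N (m + n - q - i) (symm_Delta (m + n - q - i) (contraction n m i q f g)) x))"

lemma exists_DN_image:
  assumes "K \<subseteq> {..<N}" "card K = n"
  shows "\<exists>k. k \<in> DN N n \<and> k ` {..<n} = K"
proof (rule ccontr)
  assume "\<not> ?thesis"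
  then have "{k \<in> DN N n. k ` {..<n} = K} = {}" by blast
  with card_DN_image[OF assms(1), of n] assms(2) show False by simp
qed

context
  fixes n m :: nat and f g :: "(nat \<Rightarrow> real) \<Rightarrow> real"
  assumes f: "f \<in> L2_hat n" "cell_centered n f" and g: "g \<in> L2_hat m" "cell_centered m g"
    and sq: "\<And>i k. i \<le> k \<Longrightarrow> k \<le> min m n \<Longrightarrow> sq_integrable (m + n - k - i) (contraction n m i k f g)"
begin

abbreviation "H q i \<equiv> symm_Delta (m + n - q - i) (contraction n m i q f g)"

lemma H_L2_hat: "i \<le> q \<Longrightarrow> q \<le> min m n \<Longrightarrow> H q i \<in> L2_hat (m + n - q - i)"
  by (rule symm_Delta_L2_hat[OF sq])

lemma sum_pairing:
  assumes A: "pure A \<phi>" "A \<subseteq> {..<N}"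
  shows "(\<Sum>k\<in>DN N n. \<Sum>l\<in>DN N m. pairing n m f g \<phi> k l) =
    (\<Sum>q\<le>min m n. fact q * real (m choose q) * real (n choose q) * (\<Sum>i\<le>q. real (q choose i) *
      (\<Sum>\<rho> | \<rho> \<in> DN N (m + n - q - i + i) \<and> \<rho> ` {..<m + n - q - i} = A.
        pairing n m f g \<phi> (select n (left_ix (m + n - q - i) i) \<rho>) (select m (right_ix n q (m + n - q - i) i) \<rho>))))"
proof -
  have b: "bmeas \<phi>" using A by (simp add: pure_def)
  \<comment> \<open>A representative tuple for every set. By \<open>pairing_image\<close> the
    pairing does not depend on the choice, so it becomes a function \<open>\<theta>\<close> of
    sets.\<close>
  define kK where "kK p K = (SOME k. k \<in> DN N p \<and> k ` {..<p} = K)" for p K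
  have kK: "kK p K \<in> DN N p" "kK p K ` {..<p} = K" if "K \<subseteq> {..<N}" "card K = p" for p K
    using someI_ex[OF exists_DN_image[OF that]] unfolding kK_def by blast+
  have kim: "k ` {..<p} \<subseteq> {..<N}" "card (k ` {..<p}) = p" if "k \<in> DN N p" for k p
    using DN_lt[OF that] card_image[OF DN_inj[OF that]] by auto
  define \<theta> where "\<theta> K L = pairing n m f g \<phi> (kK n K) (kK m L)" for K L
  have th: "pairing n m f g \<phi> k l = \<theta> (k ` {..<n}) (l ` {..<m})" if k: "k \<in> DN N n" and l: "l \<in> DN N m" for k l
    unfolding \<theta>_def
    by (rule pairing_image[OF f(1) g(1) b k kK(1)[OF kim[OF k]] kK(2)[OF kim[OF k], symmetric] l kK(1)[OF kim[OF l]] kK(2)[OF kim[OF l], symmetric]])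
  have van: "K - L \<subseteq> A \<and> L - K \<subseteq> A \<and> A \<subseteq> K \<union> L"
    if nz: "\<theta> K L \<noteq> 0" and K: "K \<subseteq> {..<N}" and L: "L \<subseteq> {..<N}" and c: "card K = n" "card L = m" for K L
    using pairing_zero[OF f g A(1) kK(1)[OF K c(1)] kK(1)[OF L c(2)] nz[unfolded \<theta>_def]] kK(2)[OF K c(1)] kK(2)[OF L c(2)] by simp
  have "(\<Sum>k\<in>DN N n. \<Sum>l\<in>DN N m. pairing n m f g \<phi> k l) = (\<Sum>k\<in>DN N n. \<Sum>l\<in>DN N m. \<theta> (k ` {..<n}) (l ` {..<m}))"
    by (intro sum.cong refl th)
  also have "\<dots> = (\<Sum>q\<le>min m n. fact q * real (m choose q) * real (n choose q) * (\<Sum>i\<le>q. real (q choose i) *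
      (\<Sum>\<rho> | \<rho> \<in> DN N (m + n - q - i + i) \<and> \<rho> ` {..<m + n - q - i} = A.
        \<theta> (\<rho> ` left_ix (m + n - q - i) i ` {..<n}) (\<rho> ` right_ix n q (m + n - q - i) i ` {..<m}))))"
    by (rule combinatorial_identity[OF A(2) van])
  also have "\<dots> = (\<Sum>q\<le>min m n. fact q * real (m choose q) * real (n choose q) * (\<Sum>i\<le>q. real (q choose i) *
      (\<Sum>\<rho> | \<rho> \<in> DN N (m + n - q - i + i) \<and> \<rho> ` {..<m + n - q - i} = A.
        pairing n m f g \<phi> (select n (left_ix (m + n - q - i) i) \<rho>) (select m (right_ix n q (m + n - q - i) i) \<rho>))))"
  proof (rule sum.cong[OF refl], rule arg_cong2[where f="(*)", OF refl], rule sum.cong[OF refl], rule arg_cong2[where f="(*)", OF refl], rule sum.cong[OF refl])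
    fix q i \<rho> assume q: "q \<in> {..min m n}" and i: "i \<in> {..q}" and r: "\<rho> \<in> {\<rho>. \<rho> \<in> DN N (m + n - q - i + i) \<and> \<rho> ` {..<m + n - q - i} = A}"
    have iq: "i \<le> q" "q \<le> n" "q \<le> m" using q i by auto
    have \<rho>: "\<rho> \<in> DN N (m + n - q - i + i)" using r by simp
    note L = select_DN[OF \<rho> left_ix_image(2,3)[OF iq refl]] and R = select_DN[OF \<rho> right_ix_image(2,3)[OF iq refl]]
    show "\<theta> (\<rho> ` left_ix (m + n - q - i) i ` {..<n}) (\<rho> ` right_ix n q (m + n - q - i) i ` {..<m}) =
       pairing n m f g \<phi> (select n (left_ix (m + n - q - i) i) \<rho>) (select m (right_ix n q (m + n - q - i) i) \<rho>)"
      unfolding th[OF L(1) R(1)] L(2) R(2) ..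
  qed
  finally show ?thesis .
qed

text \<open>Once \<open>A\<close> lies below \<open>N\<close>, \<open>sum_pairing\<close> writes the
  product term exactly as the weighted sum of the finite sums \<open>?R\<close>. What remains are
  the truncation errors of finitely many contractions.\<close>

lemma defect_pure_limit:
  assumes A: "pure A \<phi>" "A \<subseteq> {..<N0}"
  shows "(\<lambda>N. \<integral>x. defect n m f g N x * \<phi> x \<partial>Q) \<longlonglongrightarrow> 0"
proof -
  have b: "bmeas \<phi>" using A by (simp add: pure_def)
  let ?c = "\<lambda>q. fact q * real (m choose q) * real (n choose q)"
  let ?R = "\<lambda>N q i. \<Sum>\<rho> | \<rho> \<in> DN N (m + n - q - i + i) \<and> \<rho> ` {..<m + n - q - i} = A.
        pairing n m f g \<phi> (select n (left_ix (m + n - q - i) i) \<rho>) (select m (right_ix n q (m + n - q - i) i) \<rho>)"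
  let ?I = "\<lambda>N q i. \<integral>x. JN N (m + n - q - i) (H q i) x * \<phi> x \<partial>Q"
  have "(\<lambda>N. \<Sum>q\<le>min m n. ?c q * (\<Sum>i\<le>q. real (q choose i) * (?I N q i - ?R N q i))) \<longlonglongrightarrow> (\<Sum>q\<le>min m n. ?c q * (\<Sum>i\<le>q. real (q choose i) * 0))"
  proof (intro tendsto_sum tendsto_mult tendsto_const)
    fix q i assume "q \<in> {..min m n}" "i \<in> {..q}"
    then have iq: "i \<le> q" "q \<le> n" "q \<le> m" by auto
    show "(\<lambda>N. ?I N q i - ?R N q i) \<longlonglongrightarrow> 0"
      by (rule JN_contraction_limit[OF iq refl refl f(1) g(1) sq A]) (use iq in auto)
  qed
  then have "(\<lambda>N. - (\<Sum>q\<le>min m n. ?c q * (\<Sum>i\<le>q. real (q choose i) * (?I N q i - ?R N q i)))) \<longlonglongrightarrow> 0"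
    using tendsto_minus by fastforce
  moreover have "eventually (\<lambda>N. - (\<Sum>q\<le>min m n. ?c q * (\<Sum>i\<le>q. real (q choose i) * (?I N q i - ?R N q i))) = (\<integral>x. defect n m f g N x * \<phi> x \<partial>Q)) sequentially"
    using eventually_ge_at_top[of N0]
  proof eventually_elim
    fix N assume N: "N0 \<le> N"
    have iJ: "integrable Q (\<lambda>x. JN N (m + n - q - i) (H q i) x * \<phi> x)" if "i \<le> q" "q \<le> min m n" for q i
      by (rule bmeas_integrable_mult[OF b JN_integrable[OF H_L2_hat[OF that]]])
    have ip: "integrable Q (\<lambda>x. JN N n f x * JN N m g x * \<phi> x)"
      by (rule bmeas_integrable_mult[OF b JN_product_integrable[OF f(1) g(1)]])
    have "(\<integral>x. defect n m f g N x * \<phi> x \<partial>Q) = (\<integral>x. JN N n f x * JN N m g x * \<phi> x - (\<Sum>q\<le>min m n. ?c q * (\<Sum>i\<le>q. real (q choose i) * (JN N (m + n - q - i) (H q i) x * \<phi> x))) \<partial>Q)"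
    proof (intro Bochner_Integration.integral_cong refl)
      fix x
      let ?S = "\<Sum>q\<le>min m n. ?c q * (\<Sum>i\<le>q. real (q choose i) * JN N (m + n - q - i) (H q i) x)"
      have "?S * \<phi> x = (\<Sum>q\<le>min m n. ?c q * (\<Sum>i\<le>q. real (q choose i) * (JN N (m + n - q - i) (H q i) x * \<phi> x)))"
        by (simp only: sum_distrib_right mult.assoc)
      moreover have "defect n m f g N x * \<phi> x = JN N n f x * JN N m g x * \<phi> x - ?S * \<phi> x"
        unfolding defect_def by (simp only: distrib_right minus_mult_left mult_1 diff_conv_add_uminus)
      ultimately show "defect n m f g N x * \<phi> x = JN N n f x * JN N m g x * \<phi> x - (\<Sum>q\<le>min m n. ?c q * (\<Sum>i\<le>q. real (q choose i) * (JN N (m + n - q - i) (H q i) x * \<phi> x)))"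
        by (simp only:)
    qed
    also have "\<dots> = (\<integral>x. JN N n f x * JN N m g x * \<phi> x \<partial>Q) - (\<integral>x. (\<Sum>q\<le>min m n. ?c q * (\<Sum>i\<le>q. real (q choose i) * (JN N (m + n - q - i) (H q i) x * \<phi> x))) \<partial>Q)"
      by (intro Bochner_Integration.integral_diff ip Bochner_Integration.integrable_sum Bochner_Integration.integrable_mult_right iJ) auto
    also have "(\<integral>x. (\<Sum>q\<le>min m n. ?c q * (\<Sum>i\<le>q. real (q choose i) * (JN N (m + n - q - i) (H q i) x * \<phi> x))) \<partial>Q) =
        (\<Sum>q\<le>min m n. \<integral>x. ?c q * (\<Sum>i\<le>q. real (q choose i) * (JN N (m + n - q - i) (H q i) x * \<phi> x)) \<partial>Q)"
      by (intro Bochner_Integration.integral_sum Bochner_Integration.integrable_sum Bochner_Integration.integrable_mult_right iJ) auto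
    also have "\<dots> = (\<Sum>q\<le>min m n. ?c q * (\<Sum>i\<le>q. real (q choose i) * ?I N q i))"
    proof (rule sum.cong[OF refl])
      fix q assume q: "q \<in> {..min m n}"
      have "(\<integral>x. (\<Sum>i\<le>q. real (q choose i) * (JN N (m + n - q - i) (H q i) x * \<phi> x)) \<partial>Q) = (\<Sum>i\<le>q. \<integral>x. real (q choose i) * (JN N (m + n - q - i) (H q i) x * \<phi> x) \<partial>Q)"
        using q by (intro Bochner_Integration.integral_sum Bochner_Integration.integrable_mult_right iJ) auto
      then show "(\<integral>x. ?c q * (\<Sum>i\<le>q. real (q choose i) * (JN N (m + n - q - i) (H q i) x * \<phi> x)) \<partial>Q) = ?c q * (\<Sum>i\<le>q. real (q choose i) * ?I N q i)"
        by simp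
    qed
    also have "(\<integral>x. JN N n f x * JN N m g x * \<phi> x \<partial>Q) = (\<Sum>q\<le>min m n. ?c q * (\<Sum>i\<le>q. real (q choose i) * ?R N q i))"
    proof -
      have "A \<subseteq> {..<N}" using A(2) N by auto
      from sum_pairing[OF A(1) this] show ?thesis
        unfolding JN_product_pure[OF f g b] .
    qed
    finally show "- (\<Sum>q\<le>min m n. ?c q * (\<Sum>i\<le>q. real (q choose i) * (?I N q i - ?R N q i))) = (\<integral>x. defect n m f g N x * \<phi> x \<partial>Q)"
      by (simp add: right_diff_distrib sum_subtractf)
  qed
  ultimately show ?thesis by (rule Lim_transform_eventually)
qed

lemma defect_integrable: "integrable Q (defect n m f g N)"
  unfolding defect_def[abs_def]
  by (intro Bochner_Integration.integrable_add JN_product_integrable Bochner_Integration.integrable_mult_right Bochner_Integration.integrable_sum JN_integrable H_L2_hat f g) auto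

lemma defect_dep: "dep {..<N} (defect n m f g N)"
  unfolding dep_def
proof (intro ballI impI)
  fix x y assume "x \<in> space Q" "y \<in> space Q" "\<forall>j\<in>{..<N}. x j = y j"
  then have "JN N p h x = JN N p h y" for p h by (intro depD[OF JN_dep]) auto
  then show "defect n m f g N x = defect n m f g N y" unfolding defect_def by (simp only:)
qed

text \<open>A test function of finitely many coordinates has finitely many pure components.\<close>

lemma defect_weak_limit:
  assumes "finite D" "bmeas \<phi>" "dep D \<phi>"
  shows "(\<lambda>N. \<integral>x. defect n m f g N x * \<phi> x \<partial>Q) \<longlonglongrightarrow> 0"
proof -
  obtain \<Phi> where \<Phi>: "\<And>A. A \<subseteq> D \<Longrightarrow> pure A (\<Phi> A)" "\<And>x. x \<in> space Q \<Longrightarrow> \<phi> x = (\<Sum>A\<in>Pow D. \<Phi> A x)"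
    using hoeffding[OF assms] by blast
  have b: "bmeas (\<Phi> A)" if "A \<subseteq> D" for A using \<Phi>(1)[OF that] by (simp add: pure_def)
  obtain N0 where N0: "D \<subseteq> {..<N0}"
    using finite_nat_bounded[OF assms(1)] by blast
  have eq: "(\<integral>x. defect n m f g N x * \<phi> x \<partial>Q) = (\<Sum>A\<in>Pow D. \<integral>x. defect n m f g N x * \<Phi> A x \<partial>Q)" for N
  proof -
    have "(\<integral>x. defect n m f g N x * \<phi> x \<partial>Q) = (\<integral>x. (\<Sum>A\<in>Pow D. defect n m f g N x * \<Phi> A x) \<partial>Q)"
      by (intro Bochner_Integration.integral_cong refl) (simp add: \<Phi>(2) sum_distrib_left)
    also have "\<dots> = (\<Sum>A\<in>Pow D. \<integral>x. defect n m f g N x * \<Phi> A x \<partial>Q)"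
      using b by (intro Bochner_Integration.integral_sum bmeas_integrable_mult defect_integrable) auto
    finally show ?thesis .
  qed
  have "(\<lambda>N. \<Sum>A\<in>Pow D. \<integral>x. defect n m f g N x * \<Phi> A x \<partial>Q) \<longlonglongrightarrow> (\<Sum>A\<in>Pow D. 0)"
  proof (rule tendsto_sum)
    fix A assume A: "A \<in> Pow D"
    then have "A \<subseteq> {..<N0}" using N0 by auto
    then show "(\<lambda>N. \<integral>x. defect n m f g N x * \<Phi> A x \<partial>Q) \<longlonglongrightarrow> 0"
      using A by (intro defect_pure_limit[of A _ N0] \<Phi>(1)) auto
  qed
  then show ?thesis unfolding eq by simp
qed

end

text \<open>\<open>W\<close> is orthogonal to all bounded functions of finitely many coordinates; test it against the sign
  of \<open>F N\<close>, which is \<open>L\<^sup>1\<close>-close to \<open>W\<close>.\<close>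

lemma L1_limit_eq_zero:
  fixes W :: "'a \<Rightarrow> real" and F :: "nat \<Rightarrow> (nat \<Rightarrow> real) \<Rightarrow> real"
  assumes M: "prob_space M" and X: "X \<in> measurable M Q" "distr M Q X = Q"
    and F: "\<And>N. integrable Q (F N)" "\<And>N. dep {..<N} (F N)"
    and lim: "L1_tendsto M (\<lambda>N \<omega>. F N (X \<omega>)) W"
    and weak: "\<And>D \<phi>. finite D \<Longrightarrow> bmeas \<phi> \<Longrightarrow> dep D \<phi> \<Longrightarrow> (\<lambda>N. \<integral>x. F N x * \<phi> x \<partial>Q) \<longlonglongrightarrow> 0"
  shows "AE \<omega> in M. W \<omega> = 0"
proof -
  note [measurable] = X(1)
  have [measurable]: "F N \<in> borel_measurable Q" for N using F(1) by (rule borel_measurable_integrable)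
  have Wm[measurable]: "W \<in> borel_measurable M" using lim by (simp add: L1_tendsto_def)
  have Fm[measurable]: "(\<lambda>\<omega>. F N (X \<omega>)) \<in> borel_measurable M" for N by measurable
  have iF: "integrable M (\<lambda>\<omega>. F N (X \<omega>))" for N
    using integrable_distr_eq[OF X(1), of "F N"] F(1)[of N] X(2) by simp
  have nl: "(\<lambda>N. \<integral>\<^sup>+\<omega>. ennreal \<bar>F N (X \<omega>) - W \<omega>\<bar> \<partial>M) \<longlonglongrightarrow> 0" using lim by (simp add: L1_tendsto_def)
  \<comment> \<open>\<open>W\<close> is integrable because it has finite L1 distance from some
    integrable \<open>F N1\<close>; the bound \<open>1\<close> is arbitrary.\<close>
  have "eventually (\<lambda>N. (\<integral>\<^sup>+\<omega>. ennreal \<bar>F N (X \<omega>) - W \<omega>\<bar> \<partial>M) < 1) sequentially"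
    by (rule order_tendstoD(2)[OF nl]) simp
  then obtain N1 where N1: "(\<integral>\<^sup>+\<omega>. ennreal \<bar>F N1 (X \<omega>) - W \<omega>\<bar> \<partial>M) < 1" by (auto simp: eventually_sequentially)
  have "integrable M (\<lambda>\<omega>. F N1 (X \<omega>) - W \<omega>)"
  proof (rule integrableI_bounded)
    show "(\<integral>\<^sup>+\<omega>. ennreal (norm (F N1 (X \<omega>) - W \<omega>)) \<partial>M) < \<infinity>"
      using less_trans[OF N1 ennreal_one_less_top] by simp
  qed measurable
  from Bochner_Integration.integrable_diff[OF iF[of N1] this] have iW: "integrable M W" by simp
  define d where "d N = (\<integral>\<omega>. \<bar>F N (X \<omega>) - W \<omega>\<bar> \<partial>M)" for N
  have id: "integrable M (\<lambda>\<omega>. F N (X \<omega>) - W \<omega>)" for N using iF iW by (rule Bochner_Integration.integrable_diff)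
  have "(\<integral>\<^sup>+\<omega>. ennreal \<bar>F N (X \<omega>) - W \<omega>\<bar> \<partial>M) = ennreal (d N)" for N
    unfolding d_def by (rule nn_integral_eq_integral[OF integrable_abs[OF id]]) simp
  with nl have "(\<lambda>N. ennreal (d N)) \<longlonglongrightarrow> 0" by simp
  then have d0: "d \<longlonglongrightarrow> 0" by (subst (asm) ennreal_tendsto_0_iff) (auto simp: d_def)
  have ortho: "(\<integral>\<omega>. W \<omega> * \<phi> (X \<omega>) \<partial>M) = 0"
    if "finite D" "dep D \<phi>" and \<phi>m: "\<phi> \<in> borel_measurable Q" and bd: "\<And>x. \<bar>\<phi> x\<bar> \<le> 1" for D \<phi>
  proof -
    note [measurable] = \<phi>m
    have b: "bmeas \<phi>" by (rule bmeasI[OF \<phi>m bd])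
    have i\<phi>: "integrable M (\<lambda>\<omega>. G \<omega> * \<phi> (X \<omega>))" if "integrable M G" for G :: "'a \<Rightarrow> real"
    proof (rule Bochner_Integration.integrable_bound[OF that])
      show "AE \<omega> in M. norm (G \<omega> * \<phi> (X \<omega>)) \<le> norm (G \<omega>)"
        using bd by (intro AE_I2) (simp add: abs_mult mult_left_le)
    qed (use that in measurable)
    have eqQ: "(\<integral>\<omega>. F N (X \<omega>) * \<phi> (X \<omega>) \<partial>M) = (\<integral>x. F N x * \<phi> x \<partial>Q)" for N
      using integral_distr[OF X(1), of "\<lambda>x. F N x * \<phi> x"] X(2) by simp
    have le: "\<bar>(\<integral>x. F N x * \<phi> x \<partial>Q) - (\<integral>\<omega>. W \<omega> * \<phi> (X \<omega>) \<partial>M)\<bar> \<le> d N" for N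
    proof -
      have "(\<integral>x. F N x * \<phi> x \<partial>Q) - (\<integral>\<omega>. W \<omega> * \<phi> (X \<omega>) \<partial>M) = (\<integral>\<omega>. (F N (X \<omega>) - W \<omega>) * \<phi> (X \<omega>) \<partial>M)"
        unfolding eqQ[symmetric] left_diff_distrib by (rule Bochner_Integration.integral_diff[OF i\<phi>[OF iF] i\<phi>[OF iW], symmetric])
      also have "\<bar>\<dots>\<bar> \<le> (\<integral>\<omega>. \<bar>(F N (X \<omega>) - W \<omega>) * \<phi> (X \<omega>)\<bar> \<partial>M)" by (rule integral_abs_bound)
      also have "\<dots> \<le> d N"
        unfolding d_def using bd by (intro integral_mono integrable_abs i\<phi> id) (simp add: abs_mult mult_left_le)
      finally show ?thesis .
    qed
    have "(\<lambda>N. (\<integral>x. F N x * \<phi> x \<partial>Q) - (\<integral>\<omega>. W \<omega> * \<phi> (X \<omega>) \<partial>M)) \<longlonglongrightarrow> 0"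
      by (rule Lim_null_comparison[OF _ d0]) (auto intro!: always_eventually allI le)
    moreover have "(\<lambda>N. (\<integral>x. F N x * \<phi> x \<partial>Q) - (\<integral>\<omega>. W \<omega> * \<phi> (X \<omega>) \<partial>M)) \<longlonglongrightarrow> 0 - (\<integral>\<omega>. W \<omega> * \<phi> (X \<omega>) \<partial>M)"
      by (intro tendsto_diff tendsto_const weak[OF that(1) b that(2)])
    ultimately show ?thesis using LIMSEQ_unique by fastforce
  qed
  \<comment> \<open>The sign of \<open>F N\<close> changes with \<open>N\<close>, but
    \<open>ortho\<close> speaks only of \<open>W\<close>, so it applies to every \<open>N\<close>
    separately. The distance \<open>d N\<close> is spent twice: to bound the norm of
    \<open>F N\<close>, and to pass from \<open>F N\<close> to \<open>W\<close>.\<close>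
  have le2: "(\<integral>\<omega>. \<bar>W \<omega>\<bar> \<partial>M) \<le> 2 * d N" for N
  proof -
    define \<phi> where "\<phi> x = sgn (F N x)" for x
    have \<phi>m[measurable]: "\<phi> \<in> borel_measurable Q" by (simp add: \<phi>_def[abs_def])
    have bd: "\<bar>\<phi> x\<bar> \<le> 1" for x by (simp add: \<phi>_def sgn_real_def)
    have dep: "dep {..<N} \<phi>" unfolding dep_def \<phi>_def
      by (intro ballI impI arg_cong[where f=sgn]) (erule (1) depD[OF F(2)], blast)
    have i\<phi>: "integrable M (\<lambda>\<omega>. G \<omega> * \<phi> (X \<omega>))" if "integrable M G" for G :: "'a \<Rightarrow> real"
    proof (rule Bochner_Integration.integrable_bound[OF that])
      show "AE \<omega> in M. norm (G \<omega> * \<phi> (X \<omega>)) \<le> norm (G \<omega>)"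
        using bd by (intro AE_I2) (simp add: abs_mult mult_left_le)
    qed (use that in measurable)
    have "(\<integral>\<omega>. \<bar>F N (X \<omega>)\<bar> \<partial>M) = (\<integral>\<omega>. F N (X \<omega>) * \<phi> (X \<omega>) \<partial>M)"
      by (simp add: \<phi>_def abs_sgn)
    also have "\<dots> = (\<integral>\<omega>. (F N (X \<omega>) - W \<omega>) * \<phi> (X \<omega>) \<partial>M) + (\<integral>\<omega>. W \<omega> * \<phi> (X \<omega>) \<partial>M)"
      unfolding left_diff_distrib using i\<phi>[OF iF] i\<phi>[OF iW] by simp
    also have "\<dots> = (\<integral>\<omega>. (F N (X \<omega>) - W \<omega>) * \<phi> (X \<omega>) \<partial>M)"
      using ortho[OF _ dep \<phi>m bd] by simp
    also have "\<dots> \<le> d N"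
      unfolding d_def
    proof (intro integral_mono integrable_abs i\<phi> id)
      fix \<omega>
      have "(F N (X \<omega>) - W \<omega>) * \<phi> (X \<omega>) \<le> \<bar>F N (X \<omega>) - W \<omega>\<bar> * \<bar>\<phi> (X \<omega>)\<bar>"
        unfolding abs_mult[symmetric] by (rule abs_ge_self)
      also have "\<dots> \<le> \<bar>F N (X \<omega>) - W \<omega>\<bar>" using bd by (intro mult_left_le) auto
      finally show "(F N (X \<omega>) - W \<omega>) * \<phi> (X \<omega>) \<le> \<bar>F N (X \<omega>) - W \<omega>\<bar>" .
    qed
    finally have FN: "(\<integral>\<omega>. \<bar>F N (X \<omega>)\<bar> \<partial>M) \<le> d N" .
    have "(\<integral>\<omega>. \<bar>W \<omega>\<bar> \<partial>M) \<le> (\<integral>\<omega>. \<bar>F N (X \<omega>)\<bar> + \<bar>F N (X \<omega>) - W \<omega>\<bar> \<partial>M)"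
      by (intro integral_mono integrable_abs iW Bochner_Integration.integrable_add iF id) linarith
    also have "\<dots> = (\<integral>\<omega>. \<bar>F N (X \<omega>)\<bar> \<partial>M) + d N"
      unfolding d_def by (intro Bochner_Integration.integral_add integrable_abs iF id)
    finally show ?thesis using FN by simp
  qed
  have "(\<lambda>N. 2 * d N) \<longlonglongrightarrow> 2 * 0" by (intro tendsto_mult tendsto_const d0)
  then have "(\<integral>\<omega>. \<bar>W \<omega>\<bar> \<partial>M) \<le> 2 * 0"
    by (rule LIMSEQ_le_const) (use le2 in blast)
  moreover have "0 \<le> (\<integral>\<omega>. \<bar>W \<omega>\<bar> \<partial>M)" by (rule Bochner_Integration.integral_nonneg) simp
  ultimately have "(\<integral>\<omega>. \<bar>W \<omega>\<bar> \<partial>M) = 0" by simp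
  then have "AE \<omega> in M. \<bar>W \<omega>\<bar> = 0"
    using iW by (subst integral_nonneg_eq_0_iff_AE[symmetric]) auto
  then show ?thesis by simp
qed

theorem theorem7p1:
  fixes M :: "'a measure"
    and U :: "nat \<Rightarrow> 'a \<Rightarrow> real"
    and n m :: nat
    and f g :: "(nat \<Rightarrow> real) \<Rightarrow> real"
  assumes "prob_space M"
    and "prob_space.indep_vars M (\<lambda>_. borel) U UNIV"
    and "\<And>k. distr M borel (U k) = uniform_measure lborel {-1..1}"
    and "f \<in> L2_hat n"
    and "g \<in> L2_hat m"
    and "cell_centered n f"
    and "cell_centered m g"
    and "\<And>i k. i \<le> k \<Longrightarrow> k \<le> min m n \<Longrightarrow>
           sq_integrable (m + n - k - i) (contraction n m i k f g)"
  shows "AE \<omega> in M. stoch_int M U n f \<omega> * stoch_int M U m g \<omega> =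
           (\<Sum>k\<le>min m n. fact k * real (m choose k) * real (n choose k) *
              (\<Sum>i\<le>k. real (k choose i) *
                 stoch_int M U (m + n - k - i)
                   (\<lambda>x. indicator (Delta (m + n - k - i)) x *
                        symmetrization (m + n - k - i) (contraction n m i k f g) x) \<omega>))"
proof -
  interpret prob_space M by (rule assms(1))
  note MU = assms(1,2,3)
  note lim = stoch_int_limit[OF MU] and JM = JN_Xs_measurable[OF MU] and XM = Xs_measurable[OF MU] and XL = Xs_law[OF MU]
  let ?I = "stoch_int M U" and ?X = "Xs U"
  let ?H = "\<lambda>q i. symm_Delta (m + n - q - i) (contraction n m i q f g)"
  have H: "(\<lambda>x. indicator (Delta (m + n - k - i)) x * symmetrization (m + n - k - i) (contraction n m i k f g) x) = ?H k i" for k i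
    by (simp add: symm_Delta_def[abs_def])
  have HL: "?H q i \<in> L2_hat (m + n - q - i)" if "i \<le> q" "q \<le> min m n" for q i
    by (rule symm_Delta_L2_hat[OF assms(8)[OF that]])
  define W where "W \<omega> = ?I n f \<omega> * ?I m g \<omega> + (-1) * (\<Sum>q\<le>min m n. fact q * real (m choose q) * real (n choose q) *
      (\<Sum>i\<le>q. real (q choose i) * ?I (m + n - q - i) (?H q i) \<omega>))" for \<omega>
  have single: "L1_tendsto M (\<lambda>N \<omega>. JN N p h (?X \<omega>)) (?I p h)" if h: "h \<in> L2_hat p" for p h
  proof -
    note [measurable] = JM[OF h] lim(1)[OF h]
    \<comment> \<open>On a probability space L2 convergence gives L1 convergence: the second factor
      is the constant 1, with \<open>C = 1\<close>.\<close>
    have "(\<lambda>N. \<integral>\<^sup>+\<omega>. ennreal \<bar>(JN N p h (?X \<omega>) - ?I p h \<omega>) * 1\<bar> \<partial>M) \<longlonglongrightarrow> 0"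
      by (rule mult_L1_tendsto_zero[OF _ _ lim(3)[OF h], where C=1]) (measurable, simp add: emeasure_space_1)
    then show ?thesis unfolding L1_tendsto_def by (intro conjI allI JM[OF h] lim(1)[OF h]) simp
  qed
  \<comment> \<open>From \<open>u v - s t = (u - s) v + (v - t) s\<close>. The first product needs a
    bound on \<open>JN N m g\<close> uniform in \<open>N\<close>, given by
    \<open>JN_L2_bound\<close>; in the second product the other factor is fixed.\<close>
  have prod: "L1_tendsto M (\<lambda>N \<omega>. JN N n f (?X \<omega>) * JN N m g (?X \<omega>)) (\<lambda>\<omega>. ?I n f \<omega> * ?I m g \<omega>)"
  proof -
    note [measurable] = JM[OF assms(4)] lim(1)[OF assms(4)] JM[OF assms(5)] lim(1)[OF assms(5)]
    have JX: "(\<integral>\<^sup>+\<omega>. ennreal ((JN N m g (?X \<omega>))\<^sup>2) \<partial>M) \<le> ennreal (fact m / 2^m * (\<integral>v. (g v)\<^sup>2 \<partial>Rp m))" for N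
    proof -
      have "(\<integral>\<^sup>+\<omega>. ennreal ((JN N m g (?X \<omega>))\<^sup>2) \<partial>M) = (\<integral>\<^sup>+x. ennreal ((JN N m g x)\<^sup>2) \<partial>Q)"
        by (rule nn_integral_Xs[OF MU, of "\<lambda>x. ennreal ((JN N m g x)\<^sup>2)"])
           (intro measurable_compose[OF _ measurable_ennreal] borel_measurable_power JN_measurable assms(5))
      then show ?thesis using JN_L2_bound[OF assms(5), of N] by simp
    qed
    have a: "(\<lambda>N. \<integral>\<^sup>+\<omega>. ennreal \<bar>(JN N n f (?X \<omega>) - ?I n f \<omega>) * JN N m g (?X \<omega>)\<bar> \<partial>M) \<longlonglongrightarrow> 0"
      by (rule mult_L1_tendsto_zero[OF _ _ lim(3)[OF assms(4)] JX]) measurable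
    have b: "(\<lambda>N. \<integral>\<^sup>+\<omega>. ennreal \<bar>(JN N m g (?X \<omega>) - ?I m g \<omega>) * ?I n f \<omega>\<bar> \<partial>M) \<longlonglongrightarrow> 0"
    proof (rule mult_L1_tendsto_zero[OF _ _ lim(3)[OF assms(5)], where C="\<integral>\<omega>. (?I n f \<omega>)\<^sup>2 \<partial>M"])
      show "(\<integral>\<^sup>+\<omega>. ennreal ((?I n f \<omega>)\<^sup>2) \<partial>M) \<le> ennreal (\<integral>\<omega>. (?I n f \<omega>)\<^sup>2 \<partial>M)"
        using nn_integral_eq_integral[OF lim(2)[OF assms(4)]] by simp
    qed measurable
    have le: "(\<integral>\<^sup>+\<omega>. ennreal \<bar>JN N n f (?X \<omega>) * JN N m g (?X \<omega>) - ?I n f \<omega> * ?I m g \<omega>\<bar> \<partial>M) \<le>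
       (\<integral>\<^sup>+\<omega>. ennreal \<bar>(JN N n f (?X \<omega>) - ?I n f \<omega>) * JN N m g (?X \<omega>)\<bar> \<partial>M) + (\<integral>\<^sup>+\<omega>. ennreal \<bar>(JN N m g (?X \<omega>) - ?I m g \<omega>) * ?I n f \<omega>\<bar> \<partial>M)" for N
    proof -
      have "\<bar>u * v - s * t\<bar> \<le> \<bar>(u - s) * v\<bar> + \<bar>(v - t) * s\<bar>" for u v s t :: real
        using abs_triangle_ineq[of "(u - s) * v" "(v - t) * s"] by (simp add: algebra_simps)
      then have "(\<integral>\<^sup>+\<omega>. ennreal \<bar>JN N n f (?X \<omega>) * JN N m g (?X \<omega>) - ?I n f \<omega> * ?I m g \<omega>\<bar> \<partial>M) \<le>
        (\<integral>\<^sup>+\<omega>. ennreal (\<bar>(JN N n f (?X \<omega>) - ?I n f \<omega>) * JN N m g (?X \<omega>)\<bar> + \<bar>(JN N m g (?X \<omega>) - ?I m g \<omega>) * ?I n f \<omega>\<bar>) \<partial>M)"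
        by (intro nn_integral_mono ennreal_leI)
      also have "\<dots> = (\<integral>\<^sup>+\<omega>. ennreal \<bar>(JN N n f (?X \<omega>) - ?I n f \<omega>) * JN N m g (?X \<omega>)\<bar> + ennreal \<bar>(JN N m g (?X \<omega>) - ?I m g \<omega>) * ?I n f \<omega>\<bar> \<partial>M)"
        by (intro nn_integral_cong) simp
      also have "\<dots> = (\<integral>\<^sup>+\<omega>. ennreal \<bar>(JN N n f (?X \<omega>) - ?I n f \<omega>) * JN N m g (?X \<omega>)\<bar> \<partial>M) + (\<integral>\<^sup>+\<omega>. ennreal \<bar>(JN N m g (?X \<omega>) - ?I m g \<omega>) * ?I n f \<omega>\<bar> \<partial>M)"
        by (rule nn_integral_add) measurable
      finally show ?thesis .
    qed
    have "(\<lambda>N. \<integral>\<^sup>+\<omega>. ennreal \<bar>JN N n f (?X \<omega>) * JN N m g (?X \<omega>) - ?I n f \<omega> * ?I m g \<omega>\<bar> \<partial>M) \<longlonglongrightarrow> 0"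
    proof (rule tendsto_sandwich[OF _ _ tendsto_const])
      show "(\<lambda>N. (\<integral>\<^sup>+\<omega>. ennreal \<bar>(JN N n f (?X \<omega>) - ?I n f \<omega>) * JN N m g (?X \<omega>)\<bar> \<partial>M) +
          (\<integral>\<^sup>+\<omega>. ennreal \<bar>(JN N m g (?X \<omega>) - ?I m g \<omega>) * ?I n f \<omega>\<bar> \<partial>M)) \<longlonglongrightarrow> 0"
        using tendsto_add[OF a b] by (simp only: add_0_left)
    qed (rule always_eventually, rule allI, rule zero_le, rule always_eventually, rule allI, rule le)
    moreover have "(\<lambda>\<omega>. JN N n f (?X \<omega>) * JN N m g (?X \<omega>)) \<in> borel_measurable M" for N
      by (intro borel_measurable_times JM assms(4,5))
    moreover have "(\<lambda>\<omega>. ?I n f \<omega> * ?I m g \<omega>) \<in> borel_measurable M"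
      by (intro borel_measurable_times lim(1) assms(4,5))
    ultimately show ?thesis unfolding L1_tendsto_def by blast
  qed
  have W: "L1_tendsto M (\<lambda>N \<omega>. defect n m f g N (?X \<omega>)) W"
    unfolding defect_def W_def[abs_def]
    by (rule L1_tendsto_linear[OF prod], (rule L1_tendsto_sum, simp)+, rule single, rule HL) simp_all
  have "AE \<omega> in M. W \<omega> = 0"
  proof (rule L1_limit_eq_zero[OF assms(1) XM XL _ _ W])
    show "integrable Q (defect n m f g N)" for N
      by (rule defect_integrable[OF assms(4,6,5,7,8)])
    show "dep {..<N} (defect n m f g N)" for N
      by (rule defect_dep[OF assms(4,6,5,7,8)])
    show "(\<lambda>N. \<integral>x. defect n m f g N x * \<phi> x \<partial>Q) \<longlonglongrightarrow> 0"
      if "finite D" "bmeas \<phi>" "dep D \<phi>" for D \<phi>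
      by (rule defect_weak_limit[OF assms(4,6,5,7,8) that])
  qed
  then show ?thesis unfolding H W_def by simp
qed

end
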